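(* Let $p>1$, let $\Omega\subset\mathbb{R}^N$ be a (possibly unbounded) domain and $V\in L^\infty_{loc}(\Omega)$ with $\inf_\Omega V>-\infty$. For $\alpha>0$ let $\mathcal{L}_\alpha[\phi]=-\alpha\Delta_p\phi+V\phi^{p-1}$, $\phi\ge0$. Then: (i) the map $\alpha\mapsto\lambda(\mathcal{L}_\alpha,\Omega)$ is concave and nondecreasing on $(0,\infty)$, and $\lim_{\alpha\to0}\lambda(\mathcal{L}_\alpha,\Omega)=\inf_\Omega V$; (ii) if $\Omega$ is a smooth bounded domain, then $\lim_{\alpha\to+\infty}\lambda(\mathcal{L}_\alpha,\Omega)=+\infty$; (iii) if $\Omega=\mathbb{R}^N$, then $\limsup_{\alpha\to+\infty}\lambda(\mathcal{L}_\alpha,\mathbb{R}^N)\le\limsup_{|x|\to+\infty}V(x)$ and $\liminf_{\alpha\to+\infty}\lambda(\mathcal{L}_\alpha,\mathbb{R}^N)\ge\liminf_{|x|\to+\infty}V(x)$.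
   Context: $\Delta_p u=\mathrm{div}(|\nabla u|^{p-2}\nabla u)$. The generalized principal eigenvalue is $\lambda(\mathcal{L}_\alpha,\Omega)=\sup\{\lambda\in\mathbb{R}:\exists\psi\in W^{1,p}_{loc}(\Omega),\ \psi>0,\ \alpha\int_\Omega|\nabla\psi|^{p-2}\nabla\psi\cdot\nabla\phi\,dx+\int_\Omega V\psi^{p-1}\phi\,dx\ge\lambda\int_\Omega\psi^{p-1}\phi\,dx\ \text{for all nonnegative }\phi\in C_c^\infty(\Omega)\}$. *)

theory Defs
  imports "HOL-Analysis.Analysis"
begin

fun Ck :: "nat \<Rightarrow> ('a::euclidean_space \<Rightarrow> real) \<Rightarrow> bool" where
  "Ck 0 f = continuous_on UNIV f"
| "Ck (Suc k) f = ((\<forall>x. f differentiable (at x)) \<and> continuous_on UNIV f \<and>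
      (\<forall>v. Ck k (\<lambda>x. frechet_derivative f (at x) v)))"

definition smooth_fun :: "('a::euclidean_space \<Rightarrow> real) \<Rightarrow> bool" where
  "smooth_fun f \<longleftrightarrow> (\<forall>k. Ck k f)"

definition tsupp :: "('a::euclidean_space \<Rightarrow> real) \<Rightarrow> 'a set" where
  "tsupp f = closure {x. f x \<noteq> 0}"

definition test_fun :: "'a::euclidean_space set \<Rightarrow> ('a \<Rightarrow> real) \<Rightarrow> bool" where
  "test_fun \<Omega> \<phi> \<longleftrightarrow> smooth_fun \<phi> \<and> compact (tsupp \<phi>) \<and> tsupp \<phi> \<subseteq> \<Omega>"

definition grad :: "('a::euclidean_space \<Rightarrow> real) \<Rightarrow> 'a \<Rightarrow> 'a" where
  "grad f x = (\<Sum>i\<in>Basis. frechet_derivative f (at x) i *\<^sub>R i)"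

definition Lp_loc :: "real \<Rightarrow> 'a::euclidean_space set \<Rightarrow> ('a \<Rightarrow> real) \<Rightarrow> bool" where
  "Lp_loc p \<Omega> f \<longleftrightarrow> f \<in> borel_measurable (lebesgue_on \<Omega>) \<and>
     (\<forall>K. compact K \<and> K \<subseteq> \<Omega> \<longrightarrow> integrable (lebesgue_on K) (\<lambda>x. \<bar>f x\<bar> powr p))"

definition Linf_loc :: "'a::euclidean_space set \<Rightarrow> ('a \<Rightarrow> real) \<Rightarrow> bool" where
  "Linf_loc \<Omega> f \<longleftrightarrow> f \<in> borel_measurable (lebesgue_on \<Omega>) \<and>
     (\<forall>K. compact K \<and> K \<subseteq> \<Omega> \<longrightarrow> (\<exists>C. AE x in lebesgue_on K. \<bar>f x\<bar> \<le> C))"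

definition weak_grad :: "'a::euclidean_space set \<Rightarrow> ('a \<Rightarrow> real) \<Rightarrow> ('a \<Rightarrow> 'a) \<Rightarrow> bool" where
  "weak_grad \<Omega> \<psi> G \<longleftrightarrow> (\<forall>\<phi>. test_fun \<Omega> \<phi> \<longrightarrow> (\<forall>i\<in>Basis.
      integral\<^sup>L (lebesgue_on \<Omega>) (\<lambda>x. \<psi> x * frechet_derivative \<phi> (at x) i)
      = - integral\<^sup>L (lebesgue_on \<Omega>) (\<lambda>x. (G x \<bullet> i) * \<phi> x)))"

definition W1p_loc :: "real \<Rightarrow> 'a::euclidean_space set \<Rightarrow> ('a \<Rightarrow> real) \<Rightarrow> ('a \<Rightarrow> 'a) \<Rightarrow> bool" where
  "W1p_loc p \<Omega> \<psi> G \<longleftrightarrow> Lp_loc p \<Omega> \<psi> \<and> G \<in> borel_measurable (lebesgue_on \<Omega>) \<and>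
     Lp_loc p \<Omega> (\<lambda>x. norm (G x)) \<and> weak_grad \<Omega> \<psi> G"

definition gpe :: "real \<Rightarrow> real \<Rightarrow> ('a::euclidean_space \<Rightarrow> real) \<Rightarrow> 'a set \<Rightarrow> real" where
  "gpe p \<alpha> V \<Omega> = Sup {l. \<exists>\<psi> G. W1p_loc p \<Omega> \<psi> G \<and> (\<forall>x\<in>\<Omega>. \<psi> x > 0) \<and>
      (\<forall>\<phi>. test_fun \<Omega> \<phi> \<and> (\<forall>x. \<phi> x \<ge> 0) \<longrightarrow>
         \<alpha> * integral\<^sup>L (lebesgue_on \<Omega>) (\<lambda>x. norm (G x) powr (p - 2) * (G x \<bullet> grad \<phi> x))
         + integral\<^sup>L (lebesgue_on \<Omega>) (\<lambda>x. V x * \<psi> x powr (p - 1) * \<phi> x)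
         \<ge> l * integral\<^sup>L (lebesgue_on \<Omega>) (\<lambda>x. \<psi> x powr (p - 1) * \<phi> x))}"

definition ess_inf_on :: "'a::euclidean_space set \<Rightarrow> ('a \<Rightarrow> real) \<Rightarrow> ereal" where
  "ess_inf_on S f = Sup {ereal c | c. AE x in lebesgue. x \<in> S \<longrightarrow> c \<le> f x}"

definition ess_sup_on :: "'a::euclidean_space set \<Rightarrow> ('a \<Rightarrow> real) \<Rightarrow> ereal" where
  "ess_sup_on S f = Inf {ereal c | c. AE x in lebesgue. x \<in> S \<longrightarrow> f x \<le> c}"

definition ess_limsup_inf :: "('a::euclidean_space \<Rightarrow> real) \<Rightarrow> ereal" where
  "ess_limsup_inf f = (INF R::real. ess_sup_on {x. norm x > R} f)"

definition ess_liminf_inf :: "('a::euclidean_space \<Rightarrow> real) \<Rightarrow> ereal" where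
  "ess_liminf_inf f = (SUP R::real. ess_inf_on {x. norm x > R} f)"

definition domain :: "'a::euclidean_space set \<Rightarrow> bool" where
  "domain \<Omega> \<longleftrightarrow> open \<Omega> \<and> connected \<Omega> \<and> \<Omega> \<noteq> {}"

text \<open>smooth bounded domain: bounded domain with a smooth defining function rho,
  Omega = {rho < 0}, grad rho nonvanishing on {rho = 0} (= boundary)\<close>
definition smooth_bounded_domain :: "'a::euclidean_space set \<Rightarrow> bool" where
  "smooth_bounded_domain \<Omega> \<longleftrightarrow> domain \<Omega> \<and> bounded \<Omega> \<and>
     (\<exists>\<rho>. smooth_fun \<rho> \<and> \<Omega> = {x. \<rho> x < 0} \<and> (\<forall>x. \<rho> x = 0 \<longrightarrow> grad \<rho> x \<noteq> 0))"

end

theory Submission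
  imports Defs
begin

text \<open>
  The eigenvalue is identified with the largest constant in a Rayleigh inequality, and every assertion
  is then read off from that inequality. Test functions enter through \<open>\<zeta> = u\<^sup>p\<close>: the density
  \<open>|\<nabla>u|\<^sup>p = \<zeta> |F|\<^sup>p\<close> with \<open>F = \<nabla>\<zeta> / (p \<zeta>)\<close> is the supremum over vectors \<open>F'\<close> of
  \<open>|F'|\<^sup>p\<^sup>-\<^sup>2 F' \<bullet> \<nabla>\<zeta> - (p - 1) |F'|\<^sup>p \<zeta>\<close> (Young), hence convex in \<open>(\<zeta>, \<nabla>\<zeta>)\<close>.

  A positive supersolution \<open>\<psi>\<close> for \<open>\<lambda>\<close> gives the Rayleigh inequality with constant \<open>\<lambda>\<close> by testing with
  \<open>\<zeta> (\<psi> + \<epsilon>)\<^sup>1\<^sup>-\<^sup>p\<close> (Picone), where \<open>\<psi>\<close> is first mollified. Conversely, if the Rayleigh inequality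
  holds with a constant larger than \<open>\<lambda>\<close>, a supersolution for \<open>\<lambda>\<close> is obtained on the whole, possibly unbounded,
  domain by minimising \<open>\<alpha> E(\<zeta>) + \<integral>(V - \<lambda>) \<zeta> - 2 \<integral>f \<surd>\<zeta>\<close> with a positive \<open>f \<in> L\<^sup>2\<close>. This functional is
  convex in \<open>\<zeta>\<close>, so the midpoint defects of a minimising sequence tend to zero; by strict convexity the
  sequence and its logarithmic gradients then converge almost everywhere, without any compactness.

  Concavity and monotonicity in \<open>\<alpha>\<close> are immediate, the limit \<open>\<alpha> \<rightarrow> 0\<close> follows with mollifiers as test functions,
  and the bounds for \<open>\<alpha> \<rightarrow> \<infinity>\<close> come from Young's inequality with explicit vector fields and from
  widely spread test functions near infinity.
\<close>

section \<open>Smooth functions and bumps\<close>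


text \<open>A positive supersolution is usually obtained from Dirichlet problems on an exhaustion,
  Harnack's inequality and elliptic compactness. Here positivity is forced by the source term: the
  square root has infinite slope at zero, so a minimiser cannot vanish on a set of positive measure;
  in the Euler-Lagrange inequality that term has the favourable sign and is dropped. A slack
  \<open>\<epsilon>\<close> below the Rayleigh constant pays for coercivity, since at the exact
  level nothing bounds the mass of a minimising sequence; it disappears in the supremum. The moduli
  of strict convexity degenerate on growing balls and shrinking distances, so the errors of the
  near-minimisers are chosen after those moduli, small enough that the midpoint defects divided by
  them are still summable. The weak formulations use \<open>lebesgue_on\<close>, while translation
  and Fubini are available for \<open>lborel\<close>; the supersolution and its weak gradient are
  therefore replaced by Borel representatives on compact sets before they are mollified.\<close>

lemma Ck_SucI:
  assumes "\<And>x. (f has_derivative D x) (at x)" "\<And>v. Ck k (\<lambda>x. D x v)"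
  shows "Ck (Suc k) f"
proof -
  have "frechet_derivative f (at x) = D x" for x
    using frechet_derivative_at[OF assms(1)] by simp
  moreover have "continuous_on UNIV f"
    using assms(1) by (meson continuous_at_imp_continuous_on has_derivative_continuous)
  ultimately show ?thesis
    using assms by (auto simp: differentiable_def)
qed

lemma Ck_SucD: "Ck (Suc k) f \<Longrightarrow> Ck k f"
  by (induction k arbitrary: f) auto

lemma Ck_deriv:
  assumes "Ck (Suc k) f"
  shows "(f has_derivative frechet_derivative f (at x)) (at x)"
    and "Ck k (\<lambda>x. frechet_derivative f (at x) v)"
  using assms by (auto simp: frechet_derivative_works)

lemma Ck_const: "Ck k (\<lambda>x. c)"
proof (induction k arbitrary: c)
  case (Suc k)
  show ?case by (rule Ck_SucI[where D="\<lambda>x v. 0"]) (auto intro: Suc)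
qed simp

lemma Ck_add: "Ck k f \<Longrightarrow> Ck k g \<Longrightarrow> Ck k (\<lambda>x. f x + g x)"
proof (induction k arbitrary: f g)
  case 0 then show ?case by (auto intro: continuous_intros)
next
  case (Suc k)
  show ?case
    by (rule Ck_SucI[OF has_derivative_add[OF Ck_deriv(1)[OF Suc.prems(1)] Ck_deriv(1)[OF Suc.prems(2)]]])
       (intro Suc.IH Ck_deriv(2) Suc.prems)
qed

lemma Ck_mult: "Ck k f \<Longrightarrow> Ck k g \<Longrightarrow> Ck k (\<lambda>x. f x * g x)"
proof (induction k arbitrary: f g)
  case 0 then show ?case by (auto intro: continuous_intros)
next
  case (Suc k)
  show ?case
    by (rule Ck_SucI[OF has_derivative_mult[OF Ck_deriv(1)[OF Suc.prems(1)] Ck_deriv(1)[OF Suc.prems(2)]]])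
       (intro Ck_add Suc.IH Ck_deriv(2) Suc.prems Ck_SucD)
qed

lemma Ck_prod: "finite I \<Longrightarrow> (\<And>i. i \<in> I \<Longrightarrow> Ck k (f i)) \<Longrightarrow> Ck k (\<lambda>x. \<Prod>i\<in>I. f i x)"
  by (induction I rule: finite_induct) (auto intro: Ck_const Ck_mult)

lemma Ck_power: "Ck k f \<Longrightarrow> Ck k (\<lambda>x. f x ^ n)"
  by (induction n) (auto intro: Ck_const Ck_mult)

text \<open>The powers of \<open>1/t\<close> close the family under differentiation, so one
  induction yields all derivatives; \<open>n = 0\<close> is the classical function
  exp(-1/t).\<close>

definition flat :: "nat \<Rightarrow> real \<Rightarrow> real" where
  "flat n t = (if t > 0 then (1/t)^n * exp (-1/t) else 0)"

lemma flat_nonneg: "flat n t \<ge> 0" and flat_pos_iff: "flat n t > 0 \<longleftrightarrow> t > 0"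
  by (auto simp: flat_def)

lemma flat_tendsto_0: "(flat n \<longlongrightarrow> 0) (at 0)"
proof (rule filterlim_split_at)
  show "(flat n \<longlongrightarrow> 0) (at_left 0)"
    by (rule tendsto_eventually) (auto simp: flat_def eventually_at_filter)
  have "((\<lambda>t. (inverse t)^n / exp (inverse t)) \<longlongrightarrow> 0) (at_right (0::real))"
    by (rule filterlim_compose[OF tendsto_power_div_exp_0 filterlim_inverse_at_top_right])
  then show "(flat n \<longlongrightarrow> 0) (at_right 0)"
    by (rule Lim_transform_eventually)
       (auto simp: flat_def eventually_at_filter exp_minus field_simps inverse_eq_divide)
qed

lemma DERIV_flat: "(flat n has_real_derivative (flat (n+2) t - n * flat (n+1) t)) (at t)"
proof -
  consider "t < 0" | "t > 0" | "t = 0" by linarith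
  then show ?thesis
  proof cases
    case 1
    have "((\<lambda>_. 0) has_real_derivative (flat (n+2) t - n * flat (n+1) t)) (at t)"
      using 1 by (simp add: flat_def)
    then show ?thesis
      by (rule has_field_derivative_transform_within_open[where S="{..<0}"]) (use 1 in \<open>auto simp: flat_def\<close>)
  next
    case 2
    have "((\<lambda>t. (1/t)^n * exp (-1/t)) has_real_derivative (flat (n+2) t - n * flat (n+1) t)) (at t)"
    proof (cases n)
      case 0
      then show ?thesis using 2
        by (auto intro!: derivative_eq_intros simp: flat_def field_simps power2_eq_square)
    next
      case (Suc m)
      show ?thesis using 2 unfolding Suc
        by (auto intro!: derivative_eq_intros simp: flat_def field_simps power2_eq_square)
           (metis Suc_pred neq0_conv power_Suc)
    qed
    then show ?thesis
      by (rule has_field_derivative_transform_within_open[where S="{0<..}"]) (use 2 in \<open>auto simp: flat_def\<close>)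
  next
    case 3
    \<comment> \<open>At the origin the difference quotient of \<open>flat n\<close> is
      \<open>flat (Suc n)\<close>, which tends to zero.\<close>
    have "((\<lambda>h. (flat n (0 + h) - flat n 0) / h) \<longlongrightarrow> 0) (at 0)"
      by (rule Lim_transform_eventually[OF flat_tendsto_0[of "Suc n"]])
         (auto simp: flat_def eventually_at_filter)
    then show ?thesis using 3 by (simp add: DERIV_def flat_def)
  qed
qed

text \<open>The affine argument is part of the statement so that the derivative, a combination of
  terms of the same shape with indices \<open>n + 1\<close> and \<open>n + 2\<close>, falls under
  the induction hypothesis.\<close>

lemma Ck_flat: "Ck k (\<lambda>x::'a::euclidean_space. flat n (c + x \<bullet> w))"
proof (induction k arbitrary: n)
  case 0
  have "continuous_on UNIV (flat n)"
    by (meson DERIV_flat DERIV_isCont continuous_at_imp_continuous_on)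
  then show ?case
    by (auto intro!: continuous_on_compose2[where g="flat n" and t=UNIV] continuous_intros)
next
  case (Suc k)
  have "((\<lambda>x. flat n (c + x \<bullet> w)) has_derivative
      (\<lambda>v. (v \<bullet> w) * (flat (n+2) (c + x \<bullet> w) + (- real n) * flat (n+1) (c + x \<bullet> w)))) (at x)" for x
    by (rule has_derivative_eq_rhs[OF DERIV_compose_FDERIV[OF DERIV_flat]])
       (auto intro!: derivative_eq_intros)
  then show ?case
    by (rule Ck_SucI) (intro Ck_mult Ck_add Ck_const Suc.IH)
qed

text \<open>Raising the bump to the power \<open>m\<close> makes its \<open>p\<close>-energy density integrable once \<open>m \<ge> p\<close>.\<close>
definition bump :: "nat \<Rightarrow> real \<Rightarrow> 'a::euclidean_space \<Rightarrow> real" where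
  "bump m r x = (\<Prod>i\<in>Basis. flat 0 (r + x \<bullet> (-i)) * flat 0 (r + x \<bullet> i)) ^ m"

lemma smooth_bump: "smooth_fun (bump m r)"
  unfolding smooth_fun_def bump_def by (intro allI Ck_power Ck_prod Ck_mult Ck_flat finite_Basis)

lemma bump_nonneg: "bump m r x \<ge> 0"
  unfolding bump_def by (intro zero_le_power prod_nonneg mult_nonneg_nonneg flat_nonneg ballI)

lemma bump_pos: "(\<And>i. i \<in> Basis \<Longrightarrow> \<bar>x \<bullet> i\<bar> < r) \<Longrightarrow> bump m r x > 0"
  unfolding bump_def by (intro zero_less_power prod_pos mult_pos_pos ballI)
   (force simp: flat_pos_iff abs_less_iff)+

lemma bump_support:
  assumes "m > 0" "bump m r x \<noteq> 0" "i \<in> Basis" shows "\<bar>x \<bullet> i\<bar> < r"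
proof -
  have "flat 0 (r + x \<bullet> (-i)) * flat 0 (r + x \<bullet> i) \<noteq> 0"
    using assms by (auto simp: bump_def)
  then have "flat 0 (r + x \<bullet> (-i)) > 0" "flat 0 (r + x \<bullet> i) > 0"
    using flat_nonneg[of 0] by (metis less_le mult_eq_0_iff)+
  then show ?thesis by (auto simp: flat_pos_iff)
qed

section \<open>Compactly supported functions of class C1\<close>


lemma has_derivative_grad:
  assumes "f differentiable (at x)"
  shows "(f has_derivative (\<lambda>h. grad f x \<bullet> h)) (at x)"
proof -
  let ?D = "frechet_derivative f (at x)"
  have D: "(f has_derivative ?D) (at x)" using assms by (simp add: frechet_derivative_works)
  then have l: "linear ?D" by (simp add: has_derivative_linear)
  have "?D h = grad f x \<bullet> h" for h
  proof -
    have "?D h = ?D (\<Sum>i\<in>Basis. (h \<bullet> i) *\<^sub>R i)" by (simp add: euclidean_representation)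
    also have "\<dots> = (\<Sum>i\<in>Basis. (h \<bullet> i) * ?D i)" by (simp add: linear_sum[OF l] linear_scale[OF l])
    also have "\<dots> = grad f x \<bullet> h"
      unfolding grad_def inner_sum_left by (intro sum.cong) (auto simp: inner_commute)
    finally show ?thesis .
  qed
  then show ?thesis using D by presburger
qed

lemma frechet_eq_grad: "f differentiable (at x) \<Longrightarrow> frechet_derivative f (at x) v = grad f x \<bullet> v"
  using frechet_derivative_at[OF has_derivative_grad, of f x] by (metis)

lemma grad_eqI:
  assumes "(f has_derivative (\<lambda>h. g \<bullet> h)) (at x)" shows "grad f x = g"
proof -
  have "frechet_derivative f (at x) = (\<lambda>h. g \<bullet> h)" using frechet_derivative_at[OF assms] by simp
  then show ?thesis by (simp add: grad_def euclidean_representation)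
qed

text \<open>One continuous derivative is the regularity that survives: p-th powers of
  \<open>\<zeta> x powr (1/p) + t * \<phi> x\<close> are in general not smooth.\<close>

definition C1c :: "'a::euclidean_space set \<Rightarrow> ('a \<Rightarrow> real) \<Rightarrow> bool" where
  "C1c S \<phi> \<longleftrightarrow> (\<forall>x. \<phi> differentiable (at x)) \<and> continuous_on UNIV (grad \<phi>) \<and>
     compact (tsupp \<phi>) \<and> tsupp \<phi> \<subseteq> S"

lemma zero_off_tsupp: "x \<notin> tsupp \<phi> \<Longrightarrow> \<phi> x = 0"
  unfolding tsupp_def using closure_subset[of "{x. \<phi> x \<noteq> 0}"] by blast

lemma tsupp_subset: "closed K \<Longrightarrow> (\<And>x. x \<notin> K \<Longrightarrow> \<phi> x = 0) \<Longrightarrow> tsupp \<phi> \<subseteq> K"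
  unfolding tsupp_def by (rule closure_minimal) auto

lemma closed_tsupp: "closed (tsupp \<phi>)"
  by (simp add: tsupp_def)

lemma C1cI:
  assumes d: "\<And>x. (\<phi> has_derivative (\<lambda>h. g x \<bullet> h)) (at x)" and "continuous_on UNIV g"
    and K: "compact K" "K \<subseteq> S" "\<And>x. x \<notin> K \<Longrightarrow> \<phi> x = 0"
  shows "C1c S \<phi>" "grad \<phi> = g"
proof -
  show g: "grad \<phi> = g" using grad_eqI[OF d] by auto
  have "tsupp \<phi> \<subseteq> K" using K tsupp_subset compact_imp_closed by metis
  moreover have "compact (tsupp \<phi>)"
    using calculation K(1) closed_tsupp by (metis compact_Int_closed inf.absorb_iff2)
  ultimately show "C1c S \<phi>"
    using assms g by (auto simp: C1c_def differentiable_def)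
qed

lemma C1cD:
  assumes "C1c S \<phi>"
  shows "(\<phi> has_derivative (\<lambda>h. grad \<phi> x \<bullet> h)) (at x)" "continuous_on A \<phi>"
    "continuous_on A (grad \<phi>)" "compact (tsupp \<phi>)" "tsupp \<phi> \<subseteq> S" "\<phi> differentiable (at x)"
proof -
  show *: "(\<phi> has_derivative (\<lambda>h. grad \<phi> x \<bullet> h)) (at x)" for x
    using assms by (auto simp: C1c_def has_derivative_grad)
  show "continuous_on A \<phi>"
    using * by (meson continuous_at_imp_continuous_on has_derivative_continuous)
  show "continuous_on A (grad \<phi>)" "compact (tsupp \<phi>)" "tsupp \<phi> \<subseteq> S"  "\<phi> differentiable (at x)"
    using assms by (auto simp: C1c_def intro: continuous_on_subset)
qed

lemma grad_zero_off_tsupp: "x \<notin> tsupp \<phi> \<Longrightarrow> grad \<phi> x = 0"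
proof (rule grad_eqI)
  assume "x \<notin> tsupp \<phi>"
  then show "(\<phi> has_derivative (\<lambda>h. 0 \<bullet> h)) (at x)"
    using has_derivative_transform_within_open[of "\<lambda>_. 0" "\<lambda>h. 0" x UNIV "- tsupp \<phi>" \<phi>]
    by (simp add: zero_off_tsupp closed_tsupp open_Compl)
qed

text \<open>Makes the value 0 of the energy density at \<open>c = 0\<close> consistent: a
  nonnegative test function has zero gradient wherever it vanishes.\<close>

lemma grad_zero_at_min:
  assumes "\<phi> differentiable (at x)" "\<And>y. \<phi> y \<ge> 0" "\<phi> x = 0"
  shows "grad \<phi> x = 0"
proof -
  have "(\<lambda>h. grad \<phi> x \<bullet> h) = (\<lambda>v. 0)"
    by (rule has_derivative_local_min[OF has_derivative_grad[OF assms(1)]])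
       (use assms in auto)
  then show ?thesis by (metis inner_eq_zero_iff)
qed

lemma test_fun_C1c:
  assumes "test_fun S \<phi>" shows "C1c S \<phi>"
proof -
  have k: "Ck (Suc 0) \<phi>" using assms by (auto simp: test_fun_def smooth_fun_def)
  have "continuous_on UNIV (grad \<phi>)" unfolding grad_def
    by (intro continuous_on_sum continuous_on_scaleR continuous_on_const)
       (use k in auto)
  then show ?thesis using k assms by (auto simp: C1c_def test_fun_def)
qed

text \<open>The gradient is glued from its formula on \<open>U\<close> and from zero on the
  complement of the support; both sets are open and cover the space, so the result is continuous.
  This admits factors \<open>w\<close> that are regular only near the support, such as fractional
  powers of a function positive there.\<close>

lemma C1c_mult_local:
  assumes \<phi>: "C1c S \<phi>" and U: "open U" "tsupp \<phi> \<subseteq> U"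
    and w: "\<And>x. x \<in> U \<Longrightarrow> (w has_derivative (\<lambda>h. g x \<bullet> h)) (at x)" and g: "continuous_on U g"
  shows "C1c S (\<lambda>x. w x * \<phi> x)"
    and "x \<in> U \<Longrightarrow> grad (\<lambda>x. w x * \<phi> x) x = w x *\<^sub>R grad \<phi> x + \<phi> x *\<^sub>R g x"
proof -
  define G where "G x = (if x \<in> U then w x *\<^sub>R grad \<phi> x + \<phi> x *\<^sub>R g x else 0)" for x
  have op: "open (- tsupp \<phi>)" by (simp add: closed_tsupp open_Compl)
  have cw: "continuous_on U w"
    using w by (meson continuous_at_imp_continuous_on has_derivative_continuous)
  have d: "((\<lambda>x. w x * \<phi> x) has_derivative (\<lambda>h. G x \<bullet> h)) (at x)" for x
  proof (cases "x \<in> U")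
    case True
    then show ?thesis
      by (auto intro!: derivative_eq_intros w C1cD(1)[OF \<phi>] simp: G_def algebra_simps)
  next
    case False
    then have "x \<in> - tsupp \<phi>" using U by auto
    have "((\<lambda>_. 0) has_derivative (\<lambda>h. G x \<bullet> h)) (at x)" using False by (simp add: G_def)
    then show ?thesis
      by (rule has_derivative_transform_within_open[OF _ op \<open>x \<in> - tsupp \<phi>\<close>])
         (auto simp: zero_off_tsupp)
  qed
  have c1: "continuous_on U G"
    unfolding G_def using C1cD[OF \<phi>] g cw by (auto intro!: continuous_intros cong: continuous_on_cong)
  have "G x = 0" if "x \<in> - tsupp \<phi>" for x
    using that by (simp add: G_def zero_off_tsupp grad_zero_off_tsupp)
  then have c2: "continuous_on (- tsupp \<phi>) G"
    using continuous_on_cong[OF refl, of "- tsupp \<phi>" G "\<lambda>_. 0"] by simp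
  have "U \<union> - tsupp \<phi> = UNIV" using U(2) by auto
  have "continuous_on UNIV G"
    using continuous_on_open_Un[OF U(1) op c1 c2] \<open>U \<union> - tsupp \<phi> = UNIV\<close> by simp
  from C1cI[OF d this C1cD(4,5)[OF \<phi>]] show "C1c S (\<lambda>x. w x * \<phi> x)"
    and "x \<in> U \<Longrightarrow> grad (\<lambda>x. w x * \<phi> x) x = w x *\<^sub>R grad \<phi> x + \<phi> x *\<^sub>R g x"
    by (auto simp: zero_off_tsupp G_def)
qed

lemma uniformly_continuous_compact_support:
  fixes g :: "'a::euclidean_space \<Rightarrow> 'b::metric_space"
  assumes g: "continuous_on UNIV g" and K: "compact K" and z: "\<And>x. x \<notin> K \<Longrightarrow> g x = z"
  shows "uniformly_continuous_on UNIV g"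
  unfolding uniformly_continuous_on_def
proof (intro allI impI)
  fix e :: real assume e: "e > 0"
  \<comment> \<open>Enlarging \<open>K\<close> by radius 1 puts both points of a close pair into one
    compact set as soon as one of them lies in \<open>K\<close>; otherwise both values equal
    \<open>z\<close>.\<close>
  define K' where "K' = {x + y | x y. x \<in> K \<and> y \<in> cball 0 (1::real)}"
  have "compact K'" unfolding K'_def by (intro compact_sums K compact_cball)
  then have "uniformly_continuous_on K' g"
    by (rule compact_uniformly_continuous[rotated]) (use g continuous_on_subset in blast)
  then obtain d where d: "d > 0" "\<And>x y. x \<in> K' \<Longrightarrow> y \<in> K' \<Longrightarrow> dist y x < d \<Longrightarrow> dist (g y) (g x) < e"
    using e unfolding uniformly_continuous_on_def by metis
  have K'I: "x \<in> K \<Longrightarrow> dist y x \<le> 1 \<Longrightarrow> y \<in> K'" for x y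
    unfolding K'_def mem_Collect_eq by (rule exI[of _ x], rule exI[of _ "y - x"]) (auto simp: dist_norm norm_minus_commute)
  have "dist (g y) (g x) < e" if "dist y x < min d 1" for x y
  proof (cases "x \<in> K \<or> y \<in> K")
    case True
    then have "x \<in> K'" "y \<in> K'" using that K'I[of x y] K'I[of y x] K'I[of x x] K'I[of y y]
      by (auto simp: dist_commute)
    then show ?thesis using d that by auto
  next
    case False
    then show ?thesis using z e by auto
  qed
  then show "\<exists>d>0. \<forall>x\<in>UNIV. \<forall>x'\<in>UNIV. dist x' x < d \<longrightarrow> dist (g x') (g x) < e"
    using d(1) by (intro exI[of _ "min d 1"]) auto
qed

text \<open>The gradient is uniformly continuous, so the mean value inequality gives a remainder
  uniform in \<open>x\<close>; it can then be integrated over a bounded set or against an integrable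
  function.\<close>

lemma C1c_uniform_derivative:
  assumes \<phi>: "C1c S \<phi>" and e: "e > 0"
  shows "\<exists>d>0. \<forall>x h. norm h < d \<longrightarrow> \<bar>\<phi> (x + h) - \<phi> x - grad \<phi> x \<bullet> h\<bar> \<le> e * norm h"
proof -
  have "uniformly_continuous_on UNIV (grad \<phi>)"
    by (rule uniformly_continuous_compact_support[OF C1cD(3,4)[OF \<phi>]]) (rule grad_zero_off_tsupp)
  then obtain d where d: "d > 0" "\<And>x y. dist y x < d \<Longrightarrow> dist (grad \<phi> y) (grad \<phi> x) < e"
    using e unfolding uniformly_continuous_on_def by (metis UNIV_I)
  have "\<bar>\<phi> (x + h) - \<phi> x - grad \<phi> x \<bullet> h\<bar> \<le> e * norm h" if h: "norm h < d" for x h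
  proof -
    have "norm (\<phi> (x + h) - \<phi> x - grad \<phi> x \<bullet> ((x + h) - x)) \<le> norm ((x + h) - x) * e"
    proof (rule differentiable_bound_linearization[where S="ball x d" and f'="\<lambda>y h. grad \<phi> y \<bullet> h" and ?x0.0=x])
      show "x + t *\<^sub>R (x + h - x) \<in> ball x d" if "t \<in> {0..1}" for t
      proof -
        have "t * norm h \<le> 1 * norm h" using that by (intro mult_right_mono) auto
        then show ?thesis using h that by (simp add: dist_norm)
      qed
      show "(\<phi> has_derivative (\<lambda>h. grad \<phi> y \<bullet> h)) (at y within ball x d)" for y
        using C1cD(1)[OF \<phi>] has_derivative_at_withinI by blast
      show "onorm ((\<lambda>h. grad \<phi> y \<bullet> h) - (\<lambda>h. grad \<phi> x \<bullet> h)) \<le> e" if "y \<in> ball x d" for y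
      proof (rule onorm_le)
        fix h
        have "norm (grad \<phi> y \<bullet> h - grad \<phi> x \<bullet> h) \<le> norm (grad \<phi> y - grad \<phi> x) * norm h"
          using Cauchy_Schwarz_ineq2[of "grad \<phi> y - grad \<phi> x" h] by (simp add: inner_diff_left)
        also have "\<dots> \<le> e * norm h"
          using d(2)[of y x] that by (intro mult_right_mono) (auto simp: dist_norm norm_minus_commute)
        finally show "norm (((\<lambda>h. grad \<phi> y \<bullet> h) - (\<lambda>h. grad \<phi> x \<bullet> h)) h) \<le> e * norm h" by simp
      qed
    qed (use d in auto)
    then show ?thesis by (simp add: mult.commute)
  qed
  then show ?thesis using d(1) by blast
qed

section \<open>Change of variables, vanishing integral of a gradient, integration by parts\<close>

lemma integrable_compact_support:
  fixes g :: "'a::euclidean_space \<Rightarrow> 'b::{banach, second_countable_topology}"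
  assumes "compact K" "continuous_on K g" "\<And>x. x \<notin> K \<Longrightarrow> g x = 0"
  shows "integrable lborel g"
proof -
  have "(\<lambda>x. indicator K x *\<^sub>R g x) = g" using assms(3) by (auto simp: indicator_def)
  then show ?thesis using borel_integrable_compact[OF assms(1,2)] by simp
qed

lemma integral_lborel_affine:
  fixes f :: "'a::euclidean_space \<Rightarrow> 'b::{banach, second_countable_topology}"
  assumes [measurable]: "f \<in> borel_measurable borel" and c: "c \<noteq> 0"
  shows "integral\<^sup>L lborel f = \<bar>c\<bar> ^ DIM('a) *\<^sub>R integral\<^sup>L lborel (\<lambda>x. f (t + c *\<^sub>R x))"
    and "integrable lborel f \<longleftrightarrow> integrable lborel (\<lambda>x. f (t + c *\<^sub>R x))"
proof -
  have l: "(lborel :: 'a measure) = density (distr lborel borel (\<lambda>x. t + c *\<^sub>R x)) (\<lambda>_. ennreal (\<bar>c\<bar> ^ DIM('a)))"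
    using lborel_affine[OF c, of t] by (simp add: ennreal_power)
  show "integral\<^sup>L lborel f = \<bar>c\<bar> ^ DIM('a) *\<^sub>R integral\<^sup>L lborel (\<lambda>x. f (t + c *\<^sub>R x))"
    by (subst l, subst integral_density) (auto simp: integral_distr)
  show "integrable lborel f \<longleftrightarrow> integrable lborel (\<lambda>x. f (t + c *\<^sub>R x))"
  proof (subst l, subst integrable_density)
    have "integrable lborel (\<lambda>x. f (t + c *\<^sub>R x))"
      if "integrable lborel (\<lambda>x. \<bar>c\<bar> ^ DIM('a) *\<^sub>R f (t + c *\<^sub>R x))"
      using integrable_scaleR_right[of "inverse (\<bar>c\<bar> ^ DIM('a))", OF that] c by simp
    then show "integrable (distr lborel borel (\<lambda>x. t + c *\<^sub>R x)) (\<lambda>x. \<bar>c\<bar> ^ DIM('a) *\<^sub>R f x) \<longleftrightarrow>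
        integrable lborel (\<lambda>x. f (t + c *\<^sub>R x))"
      by (auto simp: integrable_distr_eq)
  qed auto
qed

text \<open>By translation invariance the integral of
  \<open>\<phi> (x + s *\<^sub>R i) - \<phi> x\<close> is zero. Up to a uniformly small remainder on
  a bounded set it is \<open>s\<close> times the integral in question, which is therefore smaller
  than every positive number.\<close>

lemma integral_grad_zero:
  assumes \<phi>: "C1c S \<phi>"
  shows "integral\<^sup>L lborel (\<lambda>x. grad \<phi> x \<bullet> i) = 0"
proof -
  \<comment> \<open>Contains the support and every point that a shift of length at most
    \<open>norm i\<close> moves into it, so the remainder vanishes outside
    \<open>K'\<close>.\<close>
  define K' where "K' = {x + y | x y. x \<in> tsupp \<phi> \<and> y \<in> cball 0 (norm i)}"
  have K': "compact K'" unfolding K'_def by (intro compact_sums C1cD(4)[OF \<phi>] compact_cball)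
  define I where "I = integral\<^sup>L lborel (\<lambda>x. grad \<phi> x \<bullet> i)"
  have [measurable]: "\<phi> \<in> borel_measurable borel"
    using C1cD(2)[OF \<phi>] by (rule borel_measurable_continuous_onI)
  have i1: "integrable lborel \<phi>"
    by (rule integrable_compact_support[OF C1cD(4,2)[OF \<phi>]]) (rule zero_off_tsupp)
  have i2: "integrable lborel (\<lambda>x. grad \<phi> x \<bullet> i)"
    by (rule integrable_compact_support[OF C1cD(4)[OF \<phi>]])
       (auto intro!: continuous_intros C1cD(3)[OF \<phi>] simp: grad_zero_off_tsupp)
  have "\<bar>I\<bar> \<le> e" if e: "e > 0" for e
  proof -
    define e' where "e' = e / ((measure lborel K' + 1) * (norm i + 1))"
    have "e' > 0" using e unfolding e'_def
      by (intro divide_pos_pos mult_pos_pos add_nonneg_pos) auto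
    then obtain d where d: "d > 0"
      "\<And>x h. norm h < d \<Longrightarrow> \<bar>\<phi> (x + h) - \<phi> x - grad \<phi> x \<bullet> h\<bar> \<le> e' * norm h"
      using C1c_uniform_derivative[OF \<phi>] by metis
    \<comment> \<open>The bound 1 keeps the shift within the reach of \<open>K'\<close>; the second
      entry makes \<open>s * norm i\<close> at most \<open>d / 2\<close>, also when
      \<open>i = 0\<close>.\<close>
    define s where "s = min 1 (d / (norm i + 1) / 2)"
    have s: "s > 0" "s \<le> 1" "norm (s *\<^sub>R i) < d"
    proof -
      have ni: "norm i + 1 > 0" by (simp add: add_nonneg_pos)
      show "s > 0" "s \<le> 1" using d ni by (auto simp: s_def)
      have "s * norm i \<le> s * (norm i + 1)" using \<open>s > 0\<close> by simp
      also have "\<dots> \<le> d / (norm i + 1) / 2 * (norm i + 1)"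
        unfolding s_def using ni by (intro mult_right_mono) auto
      also have "\<dots> = d / 2" using ni by (simp add: divide_simps)
      finally show "norm (s *\<^sub>R i) < d" using \<open>s > 0\<close> d(1) by simp
    qed
    have "integral\<^sup>L lborel (\<lambda>x. \<phi> (x + s *\<^sub>R i)) = integral\<^sup>L lborel \<phi>"
      using integral_lborel_affine(1)[of \<phi> 1 "s *\<^sub>R i"] by (simp add: add.commute)
    moreover have i3: "integrable lborel (\<lambda>x. \<phi> (x + s *\<^sub>R i))"
      using integral_lborel_affine(2)[of \<phi> 1 "s *\<^sub>R i"] i1 by (simp add: add.commute)
    ultimately have "- s * I = integral\<^sup>L lborel (\<lambda>x. \<phi> (x + s *\<^sub>R i) - \<phi> x - s * (grad \<phi> x \<bullet> i))"
      using i1 i2 by (simp add: I_def)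
    also have "\<bar>\<dots>\<bar> \<le> integral\<^sup>L lborel (\<lambda>x. e' * norm (s *\<^sub>R i) * indicator K' x)"
    proof (rule integral_abs_bound_integral)
      show "integrable lborel (\<lambda>x. e' * norm (s *\<^sub>R i) * indicator K' x)"
        using K' by (intro integrable_mult_right integrable_real_indicator) (auto simp: borel_compact emeasure_bounded_finite[unfolded infinity_ennreal_def] compact_imp_bounded)
      fix x
      show "\<bar>\<phi> (x + s *\<^sub>R i) - \<phi> x - s * (grad \<phi> x \<bullet> i)\<bar> \<le> e' * norm (s *\<^sub>R i) * indicator K' x"
      proof (cases "x \<in> K'")
        case True
        then show ?thesis using d(2)[OF s(3), of x] by simp
      next
        case False
        have sn: "s * norm i \<le> norm i" using s by (simp add: mult_left_le_one_le)
        have K'I: "y + z \<in> K'" if "y \<in> tsupp \<phi>" "norm z \<le> norm i" for y z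
          using that unfolding K'_def by auto
        have "x + s *\<^sub>R i \<notin> tsupp \<phi>"
          using False sn s K'I[of "x + s *\<^sub>R i" "- s *\<^sub>R i"] by auto
        moreover have "x \<notin> tsupp \<phi>"
          using False K'I[of x 0] by auto
        ultimately show ?thesis using False by (simp add: zero_off_tsupp grad_zero_off_tsupp)
      qed
    qed (use i1 i2 i3 in auto)
    also have "\<dots> = e' * (s * norm i) * measure lborel K'"
      using s K' by (simp add: borel_compact)
    finally have "s * \<bar>I\<bar> \<le> s * (e' * norm i * measure lborel K')"
      using s(1) by (simp add: abs_mult algebra_simps)
    then have "\<bar>I\<bar> \<le> e' * (norm i * measure lborel K')" using s(1) by (simp add: mult.assoc)
    also have "\<dots> \<le> e' * ((measure lborel K' + 1) * (norm i + 1))"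
      using \<open>e' > 0\<close> by (intro mult_left_mono) (auto simp: algebra_simps)
    also have "\<dots> = e"
    proof -
      have "(measure lborel K' + 1) * (norm i + 1) > 0"
        by (intro mult_pos_pos add_nonneg_pos) auto
      then show ?thesis unfolding e'_def by (metis less_numeral_extra(3) nonzero_eq_divide_eq)
    qed
    finally show ?thesis .
  qed
  then have "\<bar>I\<bar> \<le> 0"
    by (rule dense_ge)
  then have "I = 0" by simp
  then show ?thesis by (simp add: I_def)
qed

text \<open>Apply the vanishing of the integral of a gradient to the product of \<open>w\<close> and
  \<open>\<phi>\<close>. The local hypothesis on \<open>w\<close> covers both vector fields on the
  whole space and roots of \<open>\<zeta>\<close> on the set where it is positive.\<close>

lemma integration_by_parts_C1c:
  assumes \<phi>: "C1c S \<phi>" and U: "open U" "tsupp \<phi> \<subseteq> U"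
    and w: "\<And>x. x \<in> U \<Longrightarrow> (w has_derivative (\<lambda>h. g x \<bullet> h)) (at x)" and g: "continuous_on U g"
  shows "integrable lborel (\<lambda>x. w x * (grad \<phi> x \<bullet> i))" "integrable lborel (\<lambda>x. \<phi> x * (g x \<bullet> i))"
    "integral\<^sup>L lborel (\<lambda>x. w x * (grad \<phi> x \<bullet> i)) = - integral\<^sup>L lborel (\<lambda>x. \<phi> x * (g x \<bullet> i))"
proof -
  note m = C1c_mult_local[OF assms]
  have cw: "continuous_on U w"
    using w by (meson continuous_at_imp_continuous_on has_derivative_continuous)
  show i1: "integrable lborel (\<lambda>x. w x * (grad \<phi> x \<bullet> i))"
    by (rule integrable_compact_support[OF C1cD(4)[OF \<phi>]])
       (auto intro!: continuous_intros C1cD(3)[OF \<phi>] continuous_on_subset[OF cw U(2)] simp: grad_zero_off_tsupp)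
  show i2: "integrable lborel (\<lambda>x. \<phi> x * (g x \<bullet> i))"
    by (rule integrable_compact_support[OF C1cD(4)[OF \<phi>]])
       (auto intro!: continuous_intros C1cD(2)[OF \<phi>] continuous_on_subset[OF g U(2)] simp: zero_off_tsupp)
  have "grad (\<lambda>x. w x * \<phi> x) x \<bullet> i = w x * (grad \<phi> x \<bullet> i) + \<phi> x * (g x \<bullet> i)" for x
  proof (cases "x \<in> U")
    case False
    then have nx: "x \<notin> tsupp \<phi>" using U by auto
    moreover have "tsupp (\<lambda>x. w x * \<phi> x) \<subseteq> tsupp \<phi>"
      by (rule tsupp_subset[OF closed_tsupp]) (simp add: zero_off_tsupp)
    ultimately have "x \<notin> tsupp (\<lambda>x. w x * \<phi> x)" by blast
    then show ?thesis using nx by (simp add: zero_off_tsupp grad_zero_off_tsupp)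
  qed (simp add: m inner_add_left)
  then show "integral\<^sup>L lborel (\<lambda>x. w x * (grad \<phi> x \<bullet> i)) = - integral\<^sup>L lborel (\<lambda>x. \<phi> x * (g x \<bullet> i))"
    using integral_grad_zero[OF m(1), of i] i1 i2 by simp
qed

section \<open>Convolution with mollifiers\<close>


definition conv :: "('a::euclidean_space \<Rightarrow> real) \<Rightarrow> ('a \<Rightarrow> real) \<Rightarrow> 'a \<Rightarrow> real" where
  "conv g \<eta> x = integral\<^sup>L lborel (\<lambda>y. g y * \<eta> (x - y))"

lemma bounded_compact_support:
  fixes H :: "'a::euclidean_space \<Rightarrow> 'b::real_normed_vector"
  assumes "continuous_on UNIV H" "compact K" "\<And>x. x \<notin> K \<Longrightarrow> H x = 0"
  shows "\<exists>B\<ge>0. \<forall>x. norm (H x) \<le> B"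
proof -
  have "compact (H ` K)" by (intro compact_continuous_image continuous_on_subset[OF assms(1)] assms(2)) auto
  from compact_imp_bounded[OF this] obtain B where B: "\<And>x. x \<in> K \<Longrightarrow> norm (H x) \<le> B"
    by (auto simp: bounded_iff)
  have "norm (H x) \<le> max B 0" for x
    using B[of x] assms(3)[of x] by (cases "x \<in> K") auto
  then show ?thesis by (intro exI[of _ "max B 0"]) auto
qed

lemma C1c_bounded:
  assumes "C1c S \<phi>"
  shows "\<exists>B\<ge>0. \<forall>x. norm (\<phi> x) \<le> B \<and> norm (grad \<phi> x) \<le> B"
proof -
  have c: "continuous_on UNIV (\<lambda>x. (\<phi> x, grad \<phi> x))"
    by (intro continuous_on_Pair C1cD[OF assms])
  have "\<exists>B\<ge>0. \<forall>x. norm (\<phi> x, grad \<phi> x) \<le> B"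
    by (rule bounded_compact_support[OF c C1cD(4)[OF assms]])
       (auto simp: zero_off_tsupp grad_zero_off_tsupp zero_prod_def)
  then show ?thesis using norm_fst_le norm_snd_le order_trans by metis
qed

lemma C1c_measurable: "C1c S \<phi> \<Longrightarrow> \<phi> \<in> borel_measurable borel" "C1c S \<phi> \<Longrightarrow> grad \<phi> \<in> borel_measurable borel"
  by (auto intro!: borel_measurable_continuous_onI C1cD)

lemma integrable_conv:
  fixes H :: "'a::euclidean_space \<Rightarrow> 'b::{banach, second_countable_topology}"
  assumes g: "integrable lborel g" and H: "continuous_on UNIV H" and B: "\<And>x. norm (H x) \<le> B"
  shows "integrable lborel (\<lambda>y. g y *\<^sub>R H (x - y))"
proof (rule Bochner_Integration.integrable_bound)
  show "integrable lborel (\<lambda>y. B * norm (g y))" using g by auto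
  have [measurable]: "H \<in> borel_measurable borel"
    using H by (rule borel_measurable_continuous_onI)
  show "(\<lambda>y. g y *\<^sub>R H (x - y)) \<in> borel_measurable lborel" using g by measurable
  show "AE y in lborel. norm (g y *\<^sub>R H (x - y)) \<le> norm (B * norm (g y))"
  proof (rule AE_I2)
    fix y
    have "norm (g y) * norm (H (x - y)) \<le> norm (g y) * B" by (intro mult_left_mono B) auto
    also have "\<dots> \<le> norm (B * norm (g y))" by (simp add: abs_mult mult.commute mult_right_mono)
    finally show "norm (g y *\<^sub>R H (x - y)) \<le> norm (B * norm (g y))" by simp
  qed
qed

lemma continuous_conv:
  fixes H :: "'a::euclidean_space \<Rightarrow> 'b::{banach, second_countable_topology}"
  assumes g: "integrable lborel g" and H: "continuous_on UNIV H" "compact K" "\<And>x. x \<notin> K \<Longrightarrow> H x = 0"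
  shows "continuous_on UNIV (\<lambda>x. integral\<^sup>L lborel (\<lambda>y. g y *\<^sub>R H (x - y)))"
  unfolding continuous_on_iff
proof (intro ballI allI impI)
  fix x :: 'a and e :: real assume e: "e > 0"
  obtain B where B: "\<And>x. norm (H x) \<le> B" "B \<ge> 0" using bounded_compact_support[OF H] by metis
  define I where "I = integral\<^sup>L lborel (\<lambda>y. norm (g y))"
  have I: "I \<ge> 0" unfolding I_def by simp
  have "e / (I + 1) > 0" using e I by auto
  then obtain d where d: "d > 0" "\<And>x y. dist y x < d \<Longrightarrow> dist (H y) (H x) < e / (I + 1)"
    using uniformly_continuous_compact_support[OF H] unfolding uniformly_continuous_on_def by (metis UNIV_I)
  have "dist (integral\<^sup>L lborel (\<lambda>y. g y *\<^sub>R H (x' - y))) (integral\<^sup>L lborel (\<lambda>y. g y *\<^sub>R H (x - y))) < e"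
    if "dist x' x < d" for x'
  proof -
    have i: "integrable lborel (\<lambda>y. g y *\<^sub>R H (x - y))" for x
      by (rule integrable_conv[OF g H(1) B(1)])
    have "norm (integral\<^sup>L lborel (\<lambda>y. g y *\<^sub>R H (x' - y)) - integral\<^sup>L lborel (\<lambda>y. g y *\<^sub>R H (x - y)))
       = norm (integral\<^sup>L lborel (\<lambda>y. g y *\<^sub>R H (x' - y) - g y *\<^sub>R H (x - y)))"
      by (simp add: Bochner_Integration.integral_diff[OF i i])
    also have "\<dots> \<le> integral\<^sup>L lborel (\<lambda>y. norm (g y) * (e / (I + 1)))"
    proof (rule Bochner_Integration.integral_norm_bound_integral)
      fix y
      have "norm (H (x' - y) - H (x - y)) \<le> e / (I + 1)"
        using d(2)[of "x' - y" "x - y"] that by (simp add: dist_norm)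
      then have "norm (g y) * norm (H (x' - y) - H (x - y)) \<le> norm (g y) * (e / (I + 1))"
        by (rule mult_left_mono) simp
      then show "norm (g y *\<^sub>R H (x' - y) - g y *\<^sub>R H (x - y)) \<le> norm (g y) * (e / (I + 1))"
        by (metis norm_scaleR real_norm_def scaleR_diff_right)
    qed (use i g in auto)
    also have "\<dots> = I * (e / (I + 1))" using g by (simp add: I_def)
    also have "\<dots> < e" using e I by (simp add: field_simps)
    finally show ?thesis by (simp add: dist_norm)
  qed
  then show "\<exists>d>0. \<forall>x'\<in>UNIV. dist x' x < d \<longrightarrow>
      dist (integral\<^sup>L lborel (\<lambda>y. g y *\<^sub>R H (x' - y))) (integral\<^sup>L lborel (\<lambda>y. g y *\<^sub>R H (x - y))) < e"
    using d(1) by blast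
qed

text \<open>The linearisation error of \<open>\<eta>\<close> is uniform in the base point, so
  integrating it against the absolute value of \<open>g\<close> is already the estimate that defines
  the derivative of the convolution.\<close>

lemma conv_has_derivative:
  assumes g: "integrable lborel g" and \<eta>: "C1c S \<eta>"
  shows "(conv g \<eta> has_derivative (\<lambda>h. integral\<^sup>L lborel (\<lambda>y. g y *\<^sub>R grad \<eta> (x - y)) \<bullet> h)) (at x)"
  unfolding has_derivative_at_alt
proof (intro conjI allI impI)
  show "bounded_linear ((\<bullet>) (integral\<^sup>L lborel (\<lambda>y. g y *\<^sub>R grad \<eta> (x - y))))"
    by (rule bounded_linear_inner_right)
  fix e :: real assume e: "e > 0"
  obtain B where B': "\<And>x. norm (\<eta> x) \<le> B" and B: "\<And>x. norm (grad \<eta> x) \<le> B" and "B \<ge> 0"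
    using C1c_bounded[OF \<eta>] by metis
  define I where "I = integral\<^sup>L lborel (\<lambda>y. norm (g y))"
  have I: "I \<ge> 0" unfolding I_def by simp
  have "e / (I + 1) > 0" using e I by auto
  then obtain d where d: "d > 0"
     "\<And>x h. norm h < d \<Longrightarrow> \<bar>\<eta> (x + h) - \<eta> x - grad \<eta> x \<bullet> h\<bar> \<le> e / (I + 1) * norm h"
    using C1c_uniform_derivative[OF \<eta>] by metis
  have "norm (conv g \<eta> x' - conv g \<eta> x - integral\<^sup>L lborel (\<lambda>y. g y *\<^sub>R grad \<eta> (x - y)) \<bullet> (x' - x)) \<le> e * norm (x' - x)"
    if "norm (x' - x) < d" for x'
  proof -
    have i: "integrable lborel (\<lambda>y. g y * \<eta> (x - y))" for x
      using integrable_conv[OF g C1cD(2)[OF \<eta>] B'] by simp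
    have j: "integrable lborel (\<lambda>y. g y *\<^sub>R grad \<eta> (x - y))" for x
      by (rule integrable_conv[OF g C1cD(3)[OF \<eta>] B])
    have j2: "integrable lborel (\<lambda>y. (g y *\<^sub>R grad \<eta> (x - y)) \<bullet> (x' - x))"
      using j by (rule integrable_inner_left)
    have "integral\<^sup>L lborel (\<lambda>y. g y *\<^sub>R grad \<eta> (x - y)) \<bullet> (x' - x)
       = integral\<^sup>L lborel (\<lambda>y. (g y *\<^sub>R grad \<eta> (x - y)) \<bullet> (x' - x))"
      by (rule integral_inner_left[symmetric]) (rule j)
    then have "norm (conv g \<eta> x' - conv g \<eta> x - integral\<^sup>L lborel (\<lambda>y. g y *\<^sub>R grad \<eta> (x - y)) \<bullet> (x' - x))
       = norm (integral\<^sup>L lborel (\<lambda>y. g y * \<eta> (x' - y) - g y * \<eta> (x - y) - (g y *\<^sub>R grad \<eta> (x - y)) \<bullet> (x' - x)))"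
      unfolding conv_def
      by (simp only: Bochner_Integration.integral_diff[OF Bochner_Integration.integrable_diff[OF i i] j2]
         Bochner_Integration.integral_diff[OF i i])
    also have "\<dots> \<le> integral\<^sup>L lborel (\<lambda>y. norm (g y) * (e / (I + 1) * norm (x' - x)))"
    proof (rule Bochner_Integration.integral_norm_bound_integral)
      fix y
      have "\<bar>\<eta> (x' - y) - \<eta> (x - y) - grad \<eta> (x - y) \<bullet> (x' - x)\<bar> \<le> e / (I + 1) * norm (x' - x)"
        using d(2)[OF that, of "x - y"] by simp
      then have a: "norm (g y) * \<bar>\<eta> (x' - y) - \<eta> (x - y) - grad \<eta> (x - y) \<bullet> (x' - x)\<bar> \<le> norm (g y) * (e / (I + 1) * norm (x' - x))"
        by (rule mult_left_mono) simp
      show "norm (g y * \<eta> (x' - y) - g y * \<eta> (x - y) - (g y *\<^sub>R grad \<eta> (x - y)) \<bullet> (x' - x)) \<le> norm (g y) * (e / (I + 1) * norm (x' - x))"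
      proof -
        have "g y * \<eta> (x' - y) - g y * \<eta> (x - y) - (g y *\<^sub>R grad \<eta> (x - y)) \<bullet> (x' - x)
          = g y * (\<eta> (x' - y) - \<eta> (x - y) - grad \<eta> (x - y) \<bullet> (x' - x))"
          by (simp only: inner_scaleR_left right_diff_distrib)
        then show ?thesis using a by (simp only: real_norm_def abs_mult)
      qed
    qed (use i j2 g in auto)
    also have "\<dots> = I * (e / (I + 1)) * norm (x' - x)" using g by (simp add: I_def)
    also have "\<dots> \<le> e * norm (x' - x)" using e I by (intro mult_right_mono) (auto simp: field_simps)
    finally show ?thesis .
  qed
  then show "\<exists>d>0. \<forall>y. norm (y - x) < d \<longrightarrow>
     norm (conv g \<eta> y - conv g \<eta> x - integral\<^sup>L lborel (\<lambda>y. g y *\<^sub>R grad \<eta> (x - y)) \<bullet> (y - x)) \<le> e * norm (y - x)"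
    using d(1) by blast
qed

lemma conv_grad:
  assumes g: "integrable lborel g" and \<eta>: "C1c S \<eta>"
  shows "grad (conv g \<eta>) x \<bullet> v = conv g (\<lambda>z. grad \<eta> z \<bullet> v) x"
    and "continuous_on UNIV (grad (conv g \<eta>))"
proof -
  obtain B where "\<And>x. norm (\<eta> x) \<le> B" and B: "\<And>x. norm (grad \<eta> x) \<le> B" and "B \<ge> 0"
    using C1c_bounded[OF \<eta>] by metis
  have j: "integrable lborel (\<lambda>y. g y *\<^sub>R grad \<eta> (x - y))" for x
    by (rule integrable_conv[OF g C1cD(3)[OF \<eta>] B])
  have gr: "grad (conv g \<eta>) = (\<lambda>x. integral\<^sup>L lborel (\<lambda>y. g y *\<^sub>R grad \<eta> (x - y)))"
    using grad_eqI[OF conv_has_derivative[OF assms]] by blast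
  show "grad (conv g \<eta>) x \<bullet> v = conv g (\<lambda>z. grad \<eta> z \<bullet> v) x"
    unfolding gr conv_def using integral_inner_left[OF j, where c=v] by simp
  show "continuous_on UNIV (grad (conv g \<eta>))" unfolding gr
    by (rule continuous_conv[OF g C1cD(3,4)[OF \<eta>] grad_zero_off_tsupp])
qed

text \<open>A directional derivative of the convolution is the convolution with that derivative of
  \<open>\<eta>\<close>, again smooth with compact support; hence the generalisation over
  \<open>\<eta>\<close> in the induction.\<close>

lemma conv_Ck:
  assumes g: "integrable lborel g"
  shows "smooth_fun \<eta> \<Longrightarrow> compact (tsupp \<eta>) \<Longrightarrow> Ck k (conv g \<eta>)"
proof (induction k arbitrary: \<eta>)
  case 0
  have \<eta>: "C1c UNIV \<eta>" by (rule test_fun_C1c) (use 0 in \<open>auto simp: test_fun_def\<close>)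
  then show ?case
    using conv_has_derivative[OF g \<eta>]
    by (auto intro!: continuous_at_imp_continuous_on has_derivative_continuous)
next
  case (Suc k)
  have \<eta>: "C1c UNIV \<eta>" by (rule test_fun_C1c) (use Suc.prems in \<open>auto simp: test_fun_def\<close>)
  have d: "(conv g \<eta> has_derivative (\<lambda>h. conv g (\<lambda>z. grad \<eta> z \<bullet> h) x)) (at x)" for x
  proof -
    have "conv g \<eta> differentiable at x" using conv_has_derivative[OF g \<eta>] differentiable_def by blast
    then show ?thesis using has_derivative_grad[of "conv g \<eta>" x] by (simp add: conv_grad[OF g \<eta>])
  qed
  show ?case
  proof (rule Ck_SucI[OF d])
    fix v
    have e: "(\<lambda>z. grad \<eta> z \<bullet> v) = (\<lambda>z. frechet_derivative \<eta> (at z) v)"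
      using frechet_eq_grad[OF C1cD(6)[OF \<eta>]] by simp
    show "Ck k (conv g (\<lambda>z. grad \<eta> z \<bullet> v))"
    proof (rule Suc.IH)
      show "smooth_fun (\<lambda>z. grad \<eta> z \<bullet> v)"
        unfolding smooth_fun_def e
      proof
        fix j
        have "Ck (Suc j) \<eta>" using Suc.prems(1) by (simp add: smooth_fun_def)
        then show "Ck j (\<lambda>z. frechet_derivative \<eta> (at z) v)" by simp
      qed
      have "tsupp (\<lambda>z. grad \<eta> z \<bullet> v) \<subseteq> tsupp \<eta>"
        by (rule tsupp_subset[OF closed_tsupp]) (simp add: grad_zero_off_tsupp)
      then show "compact (tsupp (\<lambda>z. grad \<eta> z \<bullet> v))"
        using Suc.prems(2) closed_tsupp by (metis compact_Int_closed inf.absorb_iff2)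
    qed
  qed
qed

lemma conv_commute:
  assumes [measurable]: "g \<in> borel_measurable borel" "\<eta> \<in> borel_measurable borel"
  shows "conv g \<eta> x = conv \<eta> g x"
  unfolding conv_def
  using integral_lborel_affine(1)[of "\<lambda>y. g y * \<eta> (x - y)" "-1" x] by (simp add: mult.commute)

text \<open>The bump lives on a cube of half side \<open>r / (2 * DIM('a))\<close>, which lies in
  the ball of radius \<open>r / 2\<close>. Exponent \<open>m = 1\<close> serves for smoothing; an
  exponent at least \<open>p\<close> makes the kernel itself a test function of finite
  energy.\<close>

definition moll :: "nat \<Rightarrow> real \<Rightarrow> 'a::euclidean_space \<Rightarrow> real" where
  "moll m r x = bump m (r / (2 * DIM('a))) x / integral\<^sup>L lborel (bump m (r / (2 * DIM('a))) :: 'a \<Rightarrow> real)"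

lemma bump_C1c:
  assumes "m > 0"
  shows "bump m r (x::'a) \<noteq> 0 \<Longrightarrow> norm x \<le> r * DIM('a)" "test_fun UNIV (bump m r :: 'a \<Rightarrow> real)" "C1c UNIV (bump m r :: 'a::euclidean_space \<Rightarrow> real)"
proof -
  show n: "norm x \<le> r * DIM('a)" if "bump m r x \<noteq> 0" for x :: 'a
  proof -
    have "norm x \<le> (\<Sum>i\<in>Basis. \<bar>x \<bullet> i\<bar>)" by (rule norm_le_l1)
    also have "\<dots> \<le> (\<Sum>i\<in>(Basis::'a set). r)"
      by (rule sum_mono) (use bump_support[OF assms that] in force)
    finally show ?thesis by (simp add: mult.commute)
  qed
  have s: "tsupp (bump m r) \<subseteq> cball (0::'a) (r * DIM('a))"
    by (rule tsupp_subset) (use n in auto)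
  then have "compact (tsupp (bump m r :: 'a \<Rightarrow> real))"
    using closed_tsupp compact_cball by (metis compact_Int_closed inf.absorb_iff2)
  then show "test_fun UNIV (bump m r :: 'a \<Rightarrow> real)" by (auto simp: test_fun_def smooth_bump)
  then show "C1c UNIV (bump m r :: 'a \<Rightarrow> real)" by (rule test_fun_C1c)
qed

lemma integral_pos_continuous:
  fixes g :: "'a::euclidean_space \<Rightarrow> real"
  assumes g: "integrable lborel g" "continuous_on UNIV g" "\<And>x. g x \<ge> 0" "g x0 > 0"
  shows "integral\<^sup>L lborel g > 0"
proof -
  have o: "open {x. g x > 0}" using g(2) by (simp add: open_Collect_less)
  have "\<not> (AE x in lborel. g x = 0)"
  proof
    assume "AE x in lborel. g x = 0"
    then have "AE x in lborel. x \<notin> {x. g x > 0}" by eventually_elim auto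
    then have "{x. g x > 0} \<in> null_sets lborel"
      using o AE_iff_null_sets[where N="{x. g x > 0}" and M=lborel] by simp
    then have "{x. g x > 0} = {}"
      using o open_not_negligible negligible_iff_null_sets null_sets_completionI by blast
    then show False using g(4) by auto
  qed
  then have "integral\<^sup>L lborel g \<noteq> 0"
    using integral_nonneg_eq_0_iff_AE[OF g(1)] g(3) by auto
  moreover have "integral\<^sup>L lborel g \<ge> 0" by (simp add: g(3))
  ultimately show ?thesis by simp
qed

lemma integrable_C1c: "C1c S \<phi> \<Longrightarrow> integrable lborel \<phi>"
  by (rule integrable_compact_support[OF C1cD(4,2) zero_off_tsupp])

lemma moll:
  assumes "m > 0" "r > 0"
  shows "test_fun UNIV (moll m r :: 'a \<Rightarrow> real)" "C1c UNIV (moll m r :: 'a::euclidean_space \<Rightarrow> real)" "moll m r (x::'a) \<ge> 0"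
    "norm x \<ge> r \<Longrightarrow> moll m r x = 0" "integral\<^sup>L lborel (moll m r :: 'a \<Rightarrow> real) = 1"
    "integrable lborel (moll m r :: 'a \<Rightarrow> real)"
proof -
  define s where "s = r / (2 * DIM('a))"
  have s: "s > 0" using assms by (simp add: s_def)
  define I where "I = integral\<^sup>L lborel (bump m s :: 'a \<Rightarrow> real)"
  note b = bump_C1c[OF assms(1), of s]
  have I: "I > 0" unfolding I_def
    by (rule integral_pos_continuous[OF integrable_C1c[OF b(3)] C1cD(2)[OF b(3)] bump_nonneg bump_pos[of 0]])
       (use s in auto)
  have meq: "moll m r = (\<lambda>x. (1/I) * bump m s (x::'a))"
    by (auto simp: moll_def I_def s_def)
  have z: "moll m r x = 0" if "norm x \<ge> r" for x :: 'a
  proof -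
    have "\<not> norm x \<le> s * DIM('a)" using that assms by (simp add: s_def)
    then show ?thesis using b(1)[of x] by (auto simp: meq)
  qed
  then show "norm x \<ge> r \<Longrightarrow> moll m r x = 0" .
  show "moll m r x \<ge> 0" using I by (auto simp: meq bump_nonneg)
  have "smooth_fun (moll m r :: 'a \<Rightarrow> real)"
    unfolding smooth_fun_def meq
    by (intro allI Ck_mult Ck_const smooth_bump[unfolded smooth_fun_def, rule_format])
  moreover have "tsupp (moll m r) \<subseteq> cball (0::'a) r"
    by (rule tsupp_subset) (use z in auto)
  ultimately show t: "test_fun UNIV (moll m r :: 'a \<Rightarrow> real)"
    using closed_tsupp compact_cball unfolding test_fun_def by (metis compact_Int_closed inf.absorb_iff2 subset_UNIV)
  then show c: "C1c UNIV (moll m r :: 'a \<Rightarrow> real)" by (rule test_fun_C1c)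
  show "integrable lborel (moll m r :: 'a \<Rightarrow> real)" by (rule integrable_C1c[OF c])
  show "integral\<^sup>L lborel (moll m r :: 'a \<Rightarrow> real) = 1"
    unfolding meq using I by (simp add: I_def)
qed

lemma integral_moll_translate:
  fixes x :: "'a::euclidean_space"
  assumes "m > 0" "r > 0"
  shows "integral\<^sup>L lborel (\<lambda>y. moll m r (x - y)) = 1" "integrable lborel (\<lambda>y. moll m r (x - y))"
        "integral\<^sup>L lborel (\<lambda>y. moll m r (y - x)) = 1" "integrable lborel (\<lambda>y. moll m r (y - x))"
proof -
  have [measurable]: "(moll m r :: 'a \<Rightarrow> real) \<in> borel_measurable borel" by (rule C1c_measurable[OF moll(2)[OF assms]])
  show "integral\<^sup>L lborel (\<lambda>y. moll m r (x - y)) = 1"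
    using integral_lborel_affine(1)[of "moll m r :: 'a \<Rightarrow> real" "-1" x] moll(5)[OF assms, where 'a='a] by simp
  show "integrable lborel (\<lambda>y. moll m r (x - y))"
    using integral_lborel_affine(2)[of "moll m r :: 'a \<Rightarrow> real" "-1" x] moll(6)[OF assms, where 'a='a] by simp
  show "integral\<^sup>L lborel (\<lambda>y. moll m r (y - x)) = 1"
    using integral_lborel_affine(1)[of "moll m r :: 'a \<Rightarrow> real" "1" "-x"] moll(5)[OF assms, where 'a='a] by simp
  show "integrable lborel (\<lambda>y. moll m r (y - x))"
    using integral_lborel_affine(2)[of "moll m r :: 'a \<Rightarrow> real" "1" "-x"] moll(6)[OF assms, where 'a='a] by simp
qed

lemma integrable_moll_conv:
  fixes g :: "'a::euclidean_space \<Rightarrow> real"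
  assumes "m > 0" "r > 0" "integrable lborel g"
  shows "integrable lborel (\<lambda>y. g y * moll m r (x - y))"
proof -
  obtain B where B: "\<And>x::'a. norm (moll m r x) \<le> B" and "\<And>x::'a. norm (grad (moll m r) x) \<le> B" "B \<ge> 0"
    using C1c_bounded[OF moll(2)[OF assms(1,2)]] by metis
  show ?thesis using integrable_conv[OF assms(3) C1cD(2)[OF moll(2)[OF assms(1,2)]] B] by simp
qed

lemma conv_moll_Tonelli:
  fixes g :: "'a::euclidean_space \<Rightarrow> real"
  assumes mr: "m > 0" "r > 0" and g: "integrable lborel g"
  shows "integrable lborel (conv g (moll m r))"
    "integral\<^sup>L lborel (conv g (moll m r)) = integral\<^sup>L lborel g"
proof -
  let ?f = "\<lambda>(y, x). g y * moll m r (x - y)"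
  have [measurable]: "(moll m r :: 'a \<Rightarrow> real) \<in> borel_measurable borel" by (rule C1c_measurable[OF moll(2)[OF mr]])
  have [measurable]: "g \<in> borel_measurable borel" using g by simp
  have n: "norm (g y * moll m r (x - y)) = norm (g y) * moll m r (x - y)" for x y
    by (simp add: abs_mult moll(3)[OF mr])
  have i: "integrable (lborel \<Otimes>\<^sub>M lborel) ?f"
  proof (rule lborel_pair.Fubini_integrable)
    show "?f \<in> borel_measurable (lborel \<Otimes>\<^sub>M lborel)" by measurable
    show "integrable lborel (\<lambda>x. integral\<^sup>L lborel (\<lambda>y. norm (?f (x, y))))"
      unfolding prod.case n using g by (simp add: integral_moll_translate[OF mr])
    show "AE x in lborel. integrable lborel (\<lambda>y. ?f (x, y))"
      by (simp add: integral_moll_translate[OF mr])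
  qed
  show "integrable lborel (conv g (moll m r))"
    using lborel_pair.integrable_snd[of "\<lambda>y x. g y * moll m r (x - y)"] i unfolding conv_def by simp
  have "integral\<^sup>L lborel (conv g (moll m r)) = (\<integral>x. (\<integral>y. g y * moll m r (x - y) \<partial>lborel) \<partial>lborel)"
    by (simp add: conv_def[abs_def])
  also have "\<dots> = (\<integral>y. (\<integral>x. g y * moll m r (x - y) \<partial>lborel) \<partial>lborel)"
    by (rule lborel_pair.Fubini_integral[of "\<lambda>y x. g y * moll m r (x - y)"]) (use i in simp)
  also have "\<dots> = integral\<^sup>L lborel g" by (simp add: integral_moll_translate[OF mr])
  finally show "integral\<^sup>L lborel (conv g (moll m r)) = integral\<^sup>L lborel g" .
qed

lemma conv_moll_mono:
  fixes g :: "'a::euclidean_space \<Rightarrow> real"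
  assumes mr: "m > 0" "r > 0" and g: "integrable lborel g"
  shows "\<bar>conv g (moll m r) x\<bar> \<le> conv (\<lambda>y. \<bar>g y\<bar>) (moll m r) x"
proof -
  have "\<bar>conv g (moll m r) x\<bar> \<le> integral\<^sup>L lborel (\<lambda>y. \<bar>g y * moll m r (x - y)\<bar>)"
    unfolding conv_def by (rule integral_abs_bound)
  also have "\<dots> = conv (\<lambda>y. \<bar>g y\<bar>) (moll m r) x"
    unfolding conv_def by (simp add: abs_mult moll(3)[OF mr])
  finally show ?thesis .
qed

section \<open>Convergence of mollifications and of integrals\<close>


lemma powr_tangent_strict:
  fixes s c p :: real
  assumes "p > 1" "s \<ge> 0" "c > 0" "s \<noteq> c"
  shows "c powr p + p * c powr (p - 1) * (s - c) < s powr p"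
proof (cases "s = 0")
  case True
  have "c powr (p - 1) * c = c powr p" using assms by (simp add: powr_diff)
  then have "c powr p + p * c powr (p - 1) * (s - c) = (1 - p) * c powr p"
    using True by (simp add: algebra_simps)
  also have "\<dots> < 0" using assms by (simp add: mult_neg_pos)
  finally show ?thesis using True by simp
next
  case False
  then have s: "s > 0" using assms by simp
  have d: "((\<lambda>x. x powr p) has_real_derivative p * x powr (p - 1)) (at x)" if "x > 0" for x
    using that by (auto intro!: derivative_eq_intros)
  show ?thesis
  proof (cases "s < c")
    case True
    obtain z where z: "s < z" "z < c" "c powr p - s powr p = (c - s) * (p * z powr (p - 1))"
      using MVT2[OF True, of "\<lambda>x. x powr p" "\<lambda>x. p * x powr (p - 1)"] d s by force
    have "z powr (p - 1) < c powr (p - 1)" using z s assms by (intro powr_less_mono2) auto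
    then have "(c - s) * (p * z powr (p - 1)) < (c - s) * (p * c powr (p - 1))"
      using True assms by (intro mult_strict_left_mono) auto
    then show ?thesis using z(3) by (simp add: algebra_simps)
  next
    case False
    then have l: "c < s" using assms by simp
    obtain z where z: "c < z" "z < s" "s powr p - c powr p = (s - c) * (p * z powr (p - 1))"
      using MVT2[OF l, of "\<lambda>x. x powr p" "\<lambda>x. p * x powr (p - 1)"] d assms by force
    have "c powr (p - 1) < z powr (p - 1)" using z assms by (intro powr_less_mono2) auto
    then have "(s - c) * (p * c powr (p - 1)) < (s - c) * (p * z powr (p - 1))"
      using l assms by (intro mult_strict_left_mono) auto
    then show ?thesis using z(3) by (simp add: algebra_simps)
  qed
qed

lemma powr_tangent:
  fixes s c p :: real
  assumes "p > 1" "s \<ge> 0" "c \<ge> 0"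
  shows "c powr p + p * c powr (p - 1) * (s - c) \<le> s powr p"
  using powr_tangent_strict[of p s c] assms by (cases "c = 0"; cases "s = c") auto

text \<open>Jensen's inequality by hand: the tangent of the power at the average \<open>c\<close> of
  the absolute values is integrated against the probability density \<open>moll m r (x - y)\<close>,
  and its linear part drops out.\<close>

lemma conv_moll_Jensen:
  fixes g :: "'a::euclidean_space \<Rightarrow> real"
  assumes mr: "m > 0" "r > 0" and p: "p > 1"
    and g: "integrable lborel g" "integrable lborel (\<lambda>x. \<bar>g x\<bar> powr p)"
  shows "\<bar>conv g (moll m r) x\<bar> powr p \<le> conv (\<lambda>x. \<bar>g x\<bar> powr p) (moll m r) x"
proof -
  define c where "c = conv (\<lambda>y. \<bar>g y\<bar>) (moll m r) x"
  have c: "\<bar>conv g (moll m r) x\<bar> \<le> c" unfolding c_def by (rule conv_moll_mono[OF mr g(1)])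
  then have c0: "c \<ge> 0" by linarith
  have g1: "integrable lborel (\<lambda>y. \<bar>g y\<bar>)" using g by simp
  note i1 = integrable_moll_conv[OF mr g1, of x]
  note i2 = integrable_moll_conv[OF mr g(2), of x]
  note i3 = integral_moll_translate(2)[OF mr, of x]
  have "\<bar>conv g (moll m r) x\<bar> powr p \<le> c powr p" using c p by (intro powr_mono2) auto
  also have "\<dots> = integral\<^sup>L lborel (\<lambda>y. (c powr p - p * c powr (p - 1) * c) * moll m r (x - y)
                        + p * c powr (p - 1) * (\<bar>g y\<bar> * moll m r (x - y)))"
    using i1 i3 by (simp add: integral_moll_translate[OF mr] c_def conv_def)
  also have "\<dots> \<le> integral\<^sup>L lborel (\<lambda>y. \<bar>g y\<bar> powr p * moll m r (x - y))"
  proof (rule integral_mono)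
    fix y
    have "(c powr p + p * c powr (p - 1) * (\<bar>g y\<bar> - c)) * moll m r (x - y) \<le> \<bar>g y\<bar> powr p * moll m r (x - y)"
      by (intro mult_right_mono powr_tangent p c0 moll(3)[OF mr]) auto
    then show "(c powr p - p * c powr (p - 1) * c) * moll m r (x - y) + p * c powr (p - 1) * (\<bar>g y\<bar> * moll m r (x - y))
        \<le> \<bar>g y\<bar> powr p * moll m r (x - y)" by (simp add: algebra_simps)
  qed (use i1 i2 i3 in auto)
  finally show ?thesis by (simp add: conv_def)
qed

lemma conv_moll_Lp:
  fixes g :: "'a::euclidean_space \<Rightarrow> real"
  assumes mr: "m > 0" "r > 0" and p: "p > 1"
    and g: "integrable lborel g" "integrable lborel (\<lambda>x. \<bar>g x\<bar> powr p)"
  shows "integrable lborel (\<lambda>x. \<bar>conv g (moll m r) x\<bar> powr p)"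
    "integral\<^sup>L lborel (\<lambda>x. \<bar>conv g (moll m r) x\<bar> powr p) \<le> integral\<^sup>L lborel (\<lambda>x. \<bar>g x\<bar> powr p)"
proof -
  note t = conv_moll_Tonelli[OF mr g(2)]
  have [measurable]: "conv g (moll m r) \<in> borel_measurable lborel"
    using conv_moll_Tonelli(1)[OF mr g(1)] by simp
  show i: "integrable lborel (\<lambda>x. \<bar>conv g (moll m r) x\<bar> powr p)"
    by (rule Bochner_Integration.integrable_bound[OF t(1)])
       (use conv_moll_Jensen[OF assms] in \<open>auto intro: order_trans[OF _ abs_ge_self]\<close>)
  show "integral\<^sup>L lborel (\<lambda>x. \<bar>conv g (moll m r) x\<bar> powr p) \<le> integral\<^sup>L lborel (\<lambda>x. \<bar>g x\<bar> powr p)"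
    unfolding t(2)[symmetric] by (intro integral_mono i t conv_moll_Jensen[OF assms])
qed

section \<open>Density of continuous functions in L1 and convergence of mollifications\<close>

lemma L1_approx_indicator:
  fixes A :: "'a::euclidean_space set"
  assumes A: "A \<in> sets lborel" "emeasure lborel A < \<infinity>" and e: "e > 0"
  shows "\<exists>h::'a \<Rightarrow> real. continuous_on UNIV h \<and> integrable lborel h \<and>
    integral\<^sup>L lborel (\<lambda>x. \<bar>indicator A x - h x\<bar>) < e"
proof -
  have "A \<in> sets lebesgue" using A(1) by simp
  then obtain T where T: "closed T" "T \<subseteq> A" "A - T \<in> lmeasurable" "emeasure lebesgue (A - T) < ennreal (e/2)"
    using sets_lebesgue_inner_closed[of A "e/2"] e by auto
  from \<open>A \<in> sets lebesgue\<close> obtain U where U: "open U" "A \<subseteq> U" "U - A \<in> lmeasurable" "emeasure lebesgue (U - A) < ennreal (e/2)"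
    using sets_lebesgue_outer_open[of A "e/2"] e by auto
  obtain h :: "'a \<Rightarrow> real" where h: "continuous_on UNIV h" "\<And>x. h x \<in> closed_segment 0 1"
     "\<And>x. x \<in> - U \<Longrightarrow> h x = 0" "\<And>x. x \<in> T \<Longrightarrow> h x = 1"
    using Urysohn[of "- U" T 0 "1::real"] T U by (auto simp: closed_Compl)
  have h01: "0 \<le> h x" "h x \<le> 1" for x using h(2)[of x] by (auto simp: closed_segment_eq_real_ivl)
  have sT: "A - T \<in> sets lborel" "U - A \<in> sets lborel" using T U A by (auto simp: borel_closed borel_open)
  have eT: "emeasure lborel (A - T) < ennreal (e/2)" "emeasure lborel (U - A) < ennreal (e/2)"
    using T(4) U(4) sT by (simp_all add: emeasure_completion)
  then have fin: "emeasure lborel (A - T) < \<infinity>" "emeasure lborel (U - A) < \<infinity>"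
    using less_top_ennreal order.strict_trans by (metis infinity_ennreal_def ennreal_less_top)+
  have mT: "measure lborel (A - T) < e/2" "measure lborel (U - A) < e/2"
  proof -
    have "measure lborel B < e/2" if "emeasure lborel B < ennreal (e/2)" "emeasure lborel B < \<infinity>" for B :: "'a set"
    proof -
      have "emeasure lborel B = ennreal (measure lborel B)"
        using that by (intro emeasure_eq_ennreal_measure) auto
      then show ?thesis using that(1) by (simp add: ennreal_less_iff)
    qed
    then show "measure lborel (A - T) < e/2" "measure lborel (U - A) < e/2" using eT fin by auto
  qed
  have [measurable]: "h \<in> borel_measurable borel" using h(1) by (rule borel_measurable_continuous_onI)
  \<comment> \<open>The Urysohn function equals 1 on \<open>T\<close> and 0 off \<open>U\<close>, so
    it can differ from the indicator only on the two thin shells.\<close>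
  have bnd: "\<bar>indicator A x - h x\<bar> \<le> indicator (A - T) x + indicator (U - A) x" for x
    using h(3,4)[of x] h01[of x] T(2) U(2) by (auto simp: indicator_def abs_if)
  have iAU: "integrable lborel (\<lambda>x. indicator (A - T) x + indicator (U - A) x :: real)"
    using sT fin by (intro Bochner_Integration.integrable_add integrable_real_indicator) auto
  have id: "integrable lborel (\<lambda>x. indicator A x - h x)"
    by (rule Bochner_Integration.integrable_bound[OF iAU]) (use A bnd in auto)
  have iA: "integrable lborel (indicator A :: 'a \<Rightarrow> real)" using A by (intro integrable_real_indicator) auto
  have "integrable lborel (\<lambda>x. indicator A x - (indicator A x - h x))"
    by (rule Bochner_Integration.integrable_diff[OF iA id])
  then have ih: "integrable lborel h" by simp
  have "integral\<^sup>L lborel (\<lambda>x. \<bar>indicator A x - h x\<bar>) \<le> integral\<^sup>L lborel (\<lambda>x. indicator (A - T) x + indicator (U - A) x :: real)"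
    using id by (intro integral_mono iAU bnd) auto
  also have "\<dots> = measure lborel (A - T) + measure lborel (U - A)"
    using sT fin by (subst Bochner_Integration.integral_add) (auto intro!: integrable_real_indicator)
  also have "\<dots> < e" using mT by simp
  finally show ?thesis using h(1) ih by blast
qed

lemma L1_approx_continuous:
  fixes g :: "'a::euclidean_space \<Rightarrow> real"
  assumes "integrable lborel g" "e > 0"
  shows "\<exists>h. continuous_on UNIV h \<and> integrable lborel h \<and> integral\<^sup>L lborel (\<lambda>x. \<bar>g x - h x\<bar>) < e"
  using assms
proof (induction arbitrary: e rule: integrable_induct)
  case (base A c)
  obtain h :: "'a \<Rightarrow> real" where h: "continuous_on UNIV h" "integrable lborel h"
      "integral\<^sup>L lborel (\<lambda>x. \<bar>indicator A x - h x\<bar>) < e / (\<bar>c\<bar> + 1)"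
    using L1_approx_indicator[of A "e / (\<bar>c\<bar> + 1)"] base by auto
  have iA: "integrable lborel (indicator A :: 'a \<Rightarrow> real)" using base by (intro integrable_real_indicator) auto
  have "integral\<^sup>L lborel (\<lambda>x. \<bar>indicator A x *\<^sub>R c - c * h x\<bar>) = integral\<^sup>L lborel (\<lambda>x. \<bar>c\<bar> * \<bar>indicator A x - h x\<bar>)"
    by (intro Bochner_Integration.integral_cong) (auto simp: abs_mult[symmetric] algebra_simps)
  also have "\<dots> = \<bar>c\<bar> * integral\<^sup>L lborel (\<lambda>x. \<bar>indicator A x - h x\<bar>)"
    by simp
  also have "\<dots> \<le> \<bar>c\<bar> * (e / (\<bar>c\<bar> + 1))" using h(3) by (intro mult_left_mono) auto
  also have "\<dots> < e" using base by (simp add: field_simps)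
  finally show ?case using h by (intro exI[of _ "\<lambda>x. c * h x"]) (auto intro!: continuous_intros)
next
  case (add f g)
  obtain h1 where h1: "continuous_on UNIV h1" "integrable lborel h1" "integral\<^sup>L lborel (\<lambda>x. \<bar>f x - h1 x\<bar>) < e/2"
    using add.IH(1)[of "e/2"] add.prems by auto
  obtain h2 where h2: "continuous_on UNIV h2" "integrable lborel h2" "integral\<^sup>L lborel (\<lambda>x. \<bar>g x - h2 x\<bar>) < e/2"
    using add.IH(2)[of "e/2"] add.prems by auto
  have "integral\<^sup>L lborel (\<lambda>x. \<bar>f x + g x - (h1 x + h2 x)\<bar>) \<le> integral\<^sup>L lborel (\<lambda>x. \<bar>f x - h1 x\<bar> + \<bar>g x - h2 x\<bar>)"
    using add.hyps h1 h2 by (intro integral_mono) auto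
  also have "\<dots> < e" using add.hyps h1 h2 by (subst Bochner_Integration.integral_add) auto
  finally show ?case using h1 h2 by (intro exI[of _ "\<lambda>x. h1 x + h2 x"]) (auto intro!: continuous_intros)
next
  case (lim f s)
  have "(\<lambda>i. integral\<^sup>L lborel (\<lambda>x. \<bar>f x - s i x\<bar>)) \<longlonglongrightarrow> integral\<^sup>L lborel (\<lambda>x::'a. 0)"
  \<comment> \<open>The simple functions of the induction rule are bounded by twice the absolute
    value of \<open>f\<close>, whence the factor 3.\<close>
  proof (rule integral_dominated_convergence[where w="\<lambda>x. 3 * \<bar>f x\<bar>"])
    show "AE x in lborel. (\<lambda>i. \<bar>f x - s i x\<bar>) \<longlonglongrightarrow> 0"
    proof (rule AE_I2)
      fix x :: 'a
      have "(\<lambda>i. f x - s i x) \<longlonglongrightarrow> f x - f x" by (intro tendsto_intros lim.hyps(2)) auto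
      then show "(\<lambda>i. \<bar>f x - s i x\<bar>) \<longlonglongrightarrow> 0" by (intro tendsto_rabs_zero) simp
    qed
    show "AE x in lborel. norm \<bar>f x - s i x\<bar> \<le> 3 * \<bar>f x\<bar>" for i
    proof (rule AE_I2)
      fix x :: 'a
      show "norm \<bar>f x - s i x\<bar> \<le> 3 * \<bar>f x\<bar>" using lim.hyps(3)[of x i] by simp
    qed
  qed (use lim.hyps in auto)
  then have "eventually (\<lambda>i. integral\<^sup>L lborel (\<lambda>x. \<bar>f x - s i x\<bar>) < e/2) sequentially"
    using order_tendstoD(2)[of _ "0::real" sequentially "e/2"] lim.prems by simp
  then obtain i where i: "integral\<^sup>L lborel (\<lambda>x. \<bar>f x - s i x\<bar>) < e/2"
    by (auto simp: eventually_sequentially)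
  obtain h where h: "continuous_on UNIV h" "integrable lborel h" "integral\<^sup>L lborel (\<lambda>x. \<bar>s i x - h x\<bar>) < e/2"
    using lim.IH[of "e/2" i] lim.prems by auto
  have "integral\<^sup>L lborel (\<lambda>x. \<bar>f x - h x\<bar>) \<le> integral\<^sup>L lborel (\<lambda>x. \<bar>f x - s i x\<bar> + \<bar>s i x - h x\<bar>)"
    using lim.hyps h by (intro integral_mono) auto
  also have "\<dots> < e" using lim.hyps h i by (subst Bochner_Integration.integral_add) auto
  finally show ?case using h by blast
qed

lemma conv_moll_uniform:
  fixes h :: "'a::euclidean_space \<Rightarrow> real"
  assumes m: "m > 0" and h: "continuous_on UNIV h" "integrable lborel h" and K: "compact K" and e: "e > 0"
  shows "\<exists>d>0. \<forall>r. 0 < r \<and> r < d \<longrightarrow> (\<forall>x\<in>K. \<bar>conv h (moll m r) x - h x\<bar> \<le> e)"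
proof -
  define K' where "K' = {x + y | x y. x \<in> K \<and> y \<in> cball 0 (1::real)}"
  have "compact K'" unfolding K'_def by (intro compact_sums K compact_cball)
  then have "uniformly_continuous_on K' h"
    by (rule compact_uniformly_continuous[rotated]) (use h continuous_on_subset in blast)
  then obtain d where d: "d > 0" "\<And>x y. x \<in> K' \<Longrightarrow> y \<in> K' \<Longrightarrow> dist y x < d \<Longrightarrow> dist (h y) (h x) < e"
    using e unfolding uniformly_continuous_on_def by metis
  have K'I: "x \<in> K \<Longrightarrow> norm (y - x) \<le> 1 \<Longrightarrow> y \<in> K'" for x y
    unfolding K'_def mem_Collect_eq by (rule exI[of _ x], rule exI[of _ "y - x"]) auto
  have "\<bar>conv h (moll m r) x - h x\<bar> \<le> e" if r: "0 < r" "r < min d 1" and x: "x \<in> K" for r x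
  proof -
    note i1 = integrable_moll_conv[OF m r(1) h(2), of x]
    note i3 = integral_moll_translate(1,2)[OF m r(1), of x]
    have "conv h (moll m r) x - h x = integral\<^sup>L lborel (\<lambda>y. h y * moll m r (x - y) - h x * moll m r (x - y))"
      using i1 i3 by (simp add: conv_def)
    also have "\<bar>\<dots>\<bar> \<le> integral\<^sup>L lborel (\<lambda>y. e * moll m r (x - y))"
    proof (rule integral_abs_bound_integral)
      fix y
      show "\<bar>h y * moll m r (x - y) - h x * moll m r (x - y)\<bar> \<le> e * moll m r (x - y)"
      proof (cases "norm (x - y) < r")
        case True
        then have "\<bar>h y - h x\<bar> \<le> e"
          using d(2)[of x y] K'I[OF x, of x] K'I[OF x, of y] r
          by (auto simp: dist_norm norm_minus_commute dist_real_def)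
        then have "\<bar>h y - h x\<bar> * moll m r (x - y) \<le> e * moll m r (x - y)"
          by (rule mult_right_mono) (rule moll(3)[OF m r(1)])
        then show ?thesis
          by (simp add: left_diff_distrib[symmetric] abs_mult moll(3)[OF m r(1)])
      qed (simp add: moll(4)[OF m r(1)])
    qed (use i1 i3 in auto)
    also have "\<dots> = e" using i3 by simp
    finally show ?thesis .
  qed
  then show ?thesis using d(1) by (intro exI[of _ "min d 1"]) auto
qed

text \<open>Split through a continuous \<open>h\<close> close to \<open>g\<close> in L1.
  Mollification does not increase the L1 norm, so replacing \<open>g\<close> by \<open>h\<close>
  costs twice \<open>e/3\<close>; the remaining \<open>e/3\<close> is the uniform convergence for
  \<open>h\<close>, which is available on compact sets.\<close>

lemma conv_moll_L1:
  fixes g :: "'a::euclidean_space \<Rightarrow> real"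
  assumes m: "m > 0" and g: "integrable lborel g" and K: "compact K" and e: "e > 0"
  shows "\<exists>d>0. \<forall>r. 0 < r \<and> r < d \<longrightarrow>
     integral\<^sup>L lborel (\<lambda>x. indicator K x * \<bar>conv g (moll m r) x - g x\<bar>) < e"
proof -
  obtain h where h: "continuous_on UNIV h" "integrable lborel h" "integral\<^sup>L lborel (\<lambda>x. \<bar>g x - h x\<bar>) < e/3"
    using L1_approx_continuous[OF g, of "e/3"] e by auto
  define k where "k = measure lborel K"
  have k: "k \<ge> 0" by (simp add: k_def)
  obtain d where d: "d > 0" "\<And>r x. 0 < r \<Longrightarrow> r < d \<Longrightarrow> x \<in> K \<Longrightarrow> \<bar>conv h (moll m r) x - h x\<bar> \<le> e / (3 * (k + 1))"
    using conv_moll_uniform[OF m h(1,2) K, of "e / (3 * (k + 1))"] e k by fastforce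
  have gh: "integrable lborel (\<lambda>y. g y - h y)" using g h by simp
  have iK: "integrable lborel (indicator K :: 'a \<Rightarrow> real)"
    using K by (intro integrable_real_indicator) (auto simp: borel_compact emeasure_compact_finite[unfolded infinity_ennreal_def])
  have "integral\<^sup>L lborel (\<lambda>x. indicator K x * \<bar>conv g (moll m r) x - g x\<bar>) < e" if r: "0 < r" "r < d" for r
  proof -
    define c where "c = conv (\<lambda>y. \<bar>g y - h y\<bar>) (moll m r)"
    have ci: "integrable lborel c" "integral\<^sup>L lborel c = integral\<^sup>L lborel (\<lambda>y. \<bar>g y - h y\<bar>)"
      unfolding c_def by (rule conv_moll_Tonelli[OF m r(1)]; use gh in simp)+
    have cc: "\<bar>conv g (moll m r) x - conv h (moll m r) x\<bar> \<le> c x" for x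
    proof -
      have "conv g (moll m r) x - conv h (moll m r) x = conv (\<lambda>y. g y - h y) (moll m r) x"
        unfolding conv_def using integrable_moll_conv[OF m r(1) g, of x] integrable_moll_conv[OF m r(1) h(2), of x]
        by (simp add: left_diff_distrib)
      then show ?thesis unfolding c_def using conv_moll_mono[OF m r(1) gh] by simp
    qed
    have iconv: "integrable lborel (conv g (moll m r))" by (rule conv_moll_Tonelli[OF m r(1) g])
    have "integral\<^sup>L lborel (\<lambda>x. indicator K x * \<bar>conv g (moll m r) x - g x\<bar>)
       \<le> integral\<^sup>L lborel (\<lambda>x. c x + (indicator K x * (e / (3 * (k + 1))) + \<bar>g x - h x\<bar>))"
    proof (rule integral_mono')
      show "integrable lborel (\<lambda>x. c x + (indicator K x * (e / (3 * (k + 1))) + \<bar>g x - h x\<bar>))"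
        using ci gh iK by auto
      fix x
      show "indicator K x * \<bar>conv g (moll m r) x - g x\<bar> \<le> c x + (indicator K x * (e / (3 * (k + 1))) + \<bar>g x - h x\<bar>)"
        using cc[of x] d(2)[OF r, of x] by (cases "x \<in> K") auto
      show "0 \<le> c x + (indicator K x * (e / (3 * (k + 1))) + \<bar>g x - h x\<bar>)"
        using cc[of x] e k by (auto simp: indicator_def)
    qed
    also have "\<dots> = integral\<^sup>L lborel (\<lambda>y. \<bar>g y - h y\<bar>) + (k * (e / (3 * (k + 1))) + integral\<^sup>L lborel (\<lambda>y. \<bar>g y - h y\<bar>))"
      using ci gh iK K by (simp add: k_def borel_compact)
    also have "k * (e / (3 * (k + 1))) \<le> e/3" using e k by (simp add: field_simps)
    finally show ?thesis using h(3) by linarith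
  qed
  then show ?thesis using d(1) by blast
qed

section \<open>Fatou's lemma and passage to the limit under the integral\<close>

lemma Fatou_eventually:
  fixes g :: "nat \<Rightarrow> 'b \<Rightarrow> real"
  assumes gn: "\<And>n. integrable M (g n)" "\<And>n. AE x in M. g n x \<ge> 0" and gi: "integrable M f"
    and lim: "AE x in M. (\<lambda>n. g n x) \<longlonglongrightarrow> f x" and e: "e > 0"
  shows "eventually (\<lambda>n. integral\<^sup>L M (g n) \<ge> integral\<^sup>L M f - e) sequentially"
proof (cases "integral\<^sup>L M f - e < 0")
  case True
  have "integral\<^sup>L M (g n) \<ge> 0" for n using gn by (intro integral_nonneg_AE) auto
  then show ?thesis using True by (intro always_eventually allI) (smt (verit))
next
  case False
  have all: "AE x in M. \<forall>n. g n x \<ge> 0" using gn(2) by (simp add: AE_all_countable)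
  have f0: "AE x in M. f x \<ge> 0"
    using all lim by eventually_elim (auto intro: LIMSEQ_le_const)
  have "ennreal (integral\<^sup>L M f) = (\<integral>\<^sup>+x. ennreal (f x) \<partial>M)"
    using nn_integral_eq_integral[OF gi f0] by simp
  also have "\<dots> = (\<integral>\<^sup>+x. liminf (\<lambda>n. ennreal (g n x)) \<partial>M)"
  proof (rule nn_integral_cong_AE)
    show "AE x in M. ennreal (f x) = liminf (\<lambda>n. ennreal (g n x))"
      using lim
    proof eventually_elim
      case (elim x)
      then have "(\<lambda>n. ennreal (g n x)) \<longlonglongrightarrow> ennreal (f x)" by (rule tendsto_ennrealI)
      then show ?case by (simp add: lim_imp_Liminf)
    qed
  qed
  also have "\<dots> \<le> liminf (\<lambda>n. \<integral>\<^sup>+x. ennreal (g n x) \<partial>M)"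
    using gn(1) by (intro nn_integral_liminf) auto
  also have "\<dots> = liminf (\<lambda>n. ennreal (integral\<^sup>L M (g n)))"
    using nn_integral_eq_integral[OF gn] by simp
  finally have "ennreal (integral\<^sup>L M f) \<le> liminf (\<lambda>n. ennreal (integral\<^sup>L M (g n)))" .
  moreover have "ennreal (integral\<^sup>L M f - e) < ennreal (integral\<^sup>L M f)"
    using False e by (simp add: ennreal_less_iff)
  ultimately have "eventually (\<lambda>n. ennreal (integral\<^sup>L M f - e) < ennreal (integral\<^sup>L M (g n))) sequentially"
    using less_LiminfD less_le_trans by blast
  then show ?thesis
  proof eventually_elim
    case (elim n)
    then show ?case using False by (metis ennreal_less_iff less_imp_le not_less)
  qed
qed

lemma Fatou_bound:
  fixes g :: "nat \<Rightarrow> 'b \<Rightarrow> real"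
  assumes gn: "\<And>n. integrable M (g n)" "\<And>n. AE x in M. g n x \<ge> 0" "\<And>n. integral\<^sup>L M (g n) \<le> C"
    and [measurable]: "f \<in> borel_measurable M" and lim: "AE x in M. (\<lambda>n. g n x) \<longlonglongrightarrow> f x"
  shows "integrable M f" "integral\<^sup>L M f \<le> C"
proof -
  have all: "AE x in M. \<forall>n. g n x \<ge> 0" using gn(2) by (simp add: AE_all_countable)
  have f0: "AE x in M. f x \<ge> 0"
    using all lim by eventually_elim (auto intro: LIMSEQ_le_const)
  have "(\<integral>\<^sup>+x. ennreal (f x) \<partial>M) = (\<integral>\<^sup>+x. liminf (\<lambda>n. ennreal (g n x)) \<partial>M)"
  proof (rule nn_integral_cong_AE)
    show "AE x in M. ennreal (f x) = liminf (\<lambda>n. ennreal (g n x))"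
      using lim
    proof eventually_elim
      case (elim x)
      then have "(\<lambda>n. ennreal (g n x)) \<longlonglongrightarrow> ennreal (f x)" by (rule tendsto_ennrealI)
      then show ?case by (simp add: lim_imp_Liminf)
    qed
  qed
  also have "\<dots> \<le> liminf (\<lambda>n. \<integral>\<^sup>+x. ennreal (g n x) \<partial>M)"
    using gn(1) by (intro nn_integral_liminf) auto
  also have "\<dots> = liminf (\<lambda>n. ennreal (integral\<^sup>L M (g n)))"
    using nn_integral_eq_integral[OF gn(1,2)] by simp
  also have "\<dots> \<le> ennreal C"
    using gn(3) by (intro Liminf_le) (auto intro!: always_eventually ennreal_leI)
  finally have le: "(\<integral>\<^sup>+x. ennreal (f x) \<partial>M) \<le> ennreal C" .
  show i: "integrable M f"
    by (rule integrableI_nonneg[OF _ f0]) (use le in \<open>auto intro: le_less_trans\<close>)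
  have "C \<ge> 0" using gn(3)[of 0] integral_nonneg_AE[OF gn(2)[of 0]] by linarith
  then show "integral\<^sup>L M f \<le> C" using le nn_integral_eq_integral[OF i f0] by simp
qed

lemma powr_add_le:
  fixes x y q :: real
  assumes "q > 0" "x \<ge> 0" "y \<ge> 0"
  shows "(x + y) powr q \<le> 2 powr q * (x powr q + y powr q)"
proof -
  have "(x + y) powr q \<le> (2 * max x y) powr q" using assms by (intro powr_mono2) auto
  also have "\<dots> = 2 powr q * (max x y) powr q" using assms by (simp add: powr_mult)
  also have "\<dots> \<le> 2 powr q * (x powr q + y powr q)"
    by (intro mult_left_mono) (auto simp: max_def)
  finally show ?thesis .
qed

text \<open>Young's inequality turns boundedness in \<open>L\<^sup>q\<close> into equi-integrability against a function of
  the dual space; Fatou's lemma then plays the role of dominated convergence.\<close>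
lemma weak_convergence_from_AE:
  fixes a :: "nat \<Rightarrow> 'b \<Rightarrow> real"
  assumes q: "q > 1" and [measurable]: "\<And>n. a n \<in> borel_measurable M" "b \<in> borel_measurable M" "h \<in> borel_measurable M"
    and lim: "AE x in M. (\<lambda>n. a n x) \<longlonglongrightarrow> b x"
    and ai: "\<And>n. integrable M (\<lambda>x. \<bar>a n x\<bar> powr q)" "\<And>n. integral\<^sup>L M (\<lambda>x. \<bar>a n x\<bar> powr q) \<le> C"
    and hi: "integrable M (\<lambda>x. \<bar>h x\<bar> powr (q / (q - 1)))"
  shows "integrable M (\<lambda>x. \<bar>b x\<bar> powr q)" "integrable M (\<lambda>x. h x * b x)"
    "\<And>n. integrable M (\<lambda>x. h x * a n x)"
    "(\<lambda>n. integral\<^sup>L M (\<lambda>x. h x * a n x)) \<longlonglongrightarrow> integral\<^sup>L M (\<lambda>x. h x * b x)"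
proof -
  define q' where "q' = q / (q - 1)"
  have q': "q' > 1" "1 / q + 1 / q' = 1" using q by (auto simp: q'_def field_simps)
  have limq: "AE x in M. (\<lambda>n. \<bar>a n x\<bar> powr q) \<longlonglongrightarrow> \<bar>b x\<bar> powr q"
    using lim
  proof eventually_elim
    case (elim x)
    then show ?case using q by (intro tendsto_powr') (auto intro: tendsto_intros)
  qed
  note bq = Fatou_bound[OF ai(1) _ ai(2) _ limq]
  show bi: "integrable M (\<lambda>x. \<bar>b x\<bar> powr q)" by (rule bq) auto
  have bC: "integral\<^sup>L M (\<lambda>x. \<bar>b x\<bar> powr q) \<le> C" by (rule bq) auto
  have C0: "C \<ge> 0" using ai(2)[of 0] by (smt (verit) integral_nonneg_AE AE_I2 powr_ge_zero)
  \<comment> \<open>The free weight \<open>t\<close> puts a small factor on the part that is only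
    bounded in \<open>L\<^sup>q\<close> and a large one on the fixed dual function.\<close>
  have young: "\<bar>c * z\<bar> \<le> t powr q * \<bar>z\<bar> powr q + t powr (- q') * \<bar>c\<bar> powr q'" if t: "t > 0" for c z t :: real
  proof -
    have "\<bar>c * z\<bar> = (t * \<bar>z\<bar>) * (\<bar>c\<bar> / t)" using t by (simp add: abs_mult)
    also have "\<dots> \<le> (t * \<bar>z\<bar>) powr q / q + (\<bar>c\<bar> / t) powr q' / q'"
      using t q q' by (intro Youngs_inequality) auto
    also have "\<dots> \<le> (t * \<bar>z\<bar>) powr q + (\<bar>c\<bar> / t) powr q'"
    proof -
      have "x / s \<le> x" if "x \<ge> 0" "s > 1" for x s :: real
        using that by (simp add: divide_le_eq mult_le_cancel_left1)
      then show ?thesis using q q' by (intro add_mono) auto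
    qed
    also have "\<dots> = t powr q * \<bar>z\<bar> powr q + t powr (- q') * \<bar>c\<bar> powr q'"
      using t by (simp add: powr_mult powr_divide powr_minus field_simps)
    finally show ?thesis .
  qed
  have dom: "integrable M (\<lambda>x. h x * z x)" if [measurable]: "z \<in> borel_measurable M" and z: "integrable M (\<lambda>x. \<bar>z x\<bar> powr q)" for z
  proof (rule Bochner_Integration.integrable_bound)
    show "integrable M (\<lambda>x. \<bar>z x\<bar> powr q + \<bar>h x\<bar> powr q')"
      using z hi by (auto simp: q'_def)
    show "AE x in M. norm (h x * z x) \<le> norm (\<bar>z x\<bar> powr q + \<bar>h x\<bar> powr q')"
      using young[of 1] by (auto intro!: AE_I2)
  qed auto
  show hb: "integrable M (\<lambda>x. h x * b x)" by (rule dom) (use bi in auto)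
  show ha: "\<And>n. integrable M (\<lambda>x. h x * a n x)" by (rule dom) (use ai in auto)
  define D where "D = 2 powr q * (2 * C)"
  have D0: "D \<ge> 0" using C0 by (simp add: D_def)
  have pw: "\<bar>a n x - b x\<bar> powr q \<le> 2 powr q * (\<bar>a n x\<bar> powr q + \<bar>b x\<bar> powr q)" for n x
  proof -
    have "\<bar>a n x - b x\<bar> powr q \<le> (\<bar>a n x\<bar> + \<bar>b x\<bar>) powr q" using q by (intro powr_mono2) auto
    also have "\<dots> \<le> 2 powr q * (\<bar>a n x\<bar> powr q + \<bar>b x\<bar> powr q)" using q by (intro powr_add_le) auto
    finally show ?thesis .
  qed
  have iab: "integrable M (\<lambda>x. 2 powr q * (\<bar>a n x\<bar> powr q + \<bar>b x\<bar> powr q))" for n using ai bi by auto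
  have dint: "integrable M (\<lambda>x. \<bar>a n x - b x\<bar> powr q)" for n
    by (rule Bochner_Integration.integrable_bound[OF iab[of n]]) (use pw[of n] in \<open>auto intro: order_trans[OF _ abs_ge_self]\<close>)
  have dD: "integral\<^sup>L M (\<lambda>x. \<bar>a n x - b x\<bar> powr q) \<le> D" for n
  proof -
    have "integral\<^sup>L M (\<lambda>x. \<bar>a n x - b x\<bar> powr q) \<le> integral\<^sup>L M (\<lambda>x. 2 powr q * (\<bar>a n x\<bar> powr q + \<bar>b x\<bar> powr q))"
      by (intro integral_mono dint iab pw)
    also have "\<dots> = 2 powr q * (integral\<^sup>L M (\<lambda>x. \<bar>a n x\<bar> powr q) + integral\<^sup>L M (\<lambda>x. \<bar>b x\<bar> powr q))"
      using ai bi by simp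
    also have "\<dots> \<le> D" unfolding D_def using ai(2)[of n] bC by (intro mult_left_mono) auto
    finally show ?thesis .
  qed
  have hd: "integrable M (\<lambda>x. h x * (a n x - b x))" for n
    by (rule dom) (use dint in auto)
  have "(\<lambda>n. integral\<^sup>L M (\<lambda>x. \<bar>h x * (a n x - b x)\<bar>)) \<longlonglongrightarrow> 0"
  proof (rule LIMSEQ_I)
    fix e :: real assume e: "e > 0"
    \<comment> \<open>Chosen so that the bounded part contributes at most \<open>e / 2\<close>; with
      the loss \<open>e / 3\<close> from Fatou the total stays below \<open>e\<close>.\<close>
    define t where "t = (e / (2 * (D + 1))) powr (1 / q)"
    have ep: "e / (2 * (D + 1)) > 0" using e D0 by simp
    then have t: "t > 0" "t powr q = e / (2 * (D + 1))" using q e D0 by (auto simp: t_def powr_powr)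
    have tD: "t powr q * D \<le> e / 2" unfolding t(2) using e D0 by (simp add: field_simps)
    \<comment> \<open>The slack in Young's inequality: it is nonnegative and converges to the term
      with \<open>h\<close> alone, so Fatou's lower bound for it is an upper bound for the integral
      of the absolute value of \<open>h x * (a n x - b x)\<close>.\<close>
    define g where "g n x = t powr q * \<bar>a n x - b x\<bar> powr q + t powr (- q') * \<bar>h x\<bar> powr q' - \<bar>h x * (a n x - b x)\<bar>" for n x
    have gi: "integrable M (g n)" for n
      unfolding g_def using dint[of n] hi hd[of n] by (auto simp: q'_def)
    have "eventually (\<lambda>n. integral\<^sup>L M (g n) \<ge> integral\<^sup>L M (\<lambda>x. t powr (- q') * \<bar>h x\<bar> powr q') - e/3) sequentially"
    proof (rule Fatou_eventually[OF gi])
      show "AE x in M. 0 \<le> g n x" for n using young[OF t(1)] by (auto simp: g_def)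
      show "integrable M (\<lambda>x. t powr (- q') * \<bar>h x\<bar> powr q')" using hi by (simp add: q'_def)
      show "AE x in M. (\<lambda>n. g n x) \<longlonglongrightarrow> t powr (- q') * \<bar>h x\<bar> powr q'"
        using lim
      proof eventually_elim
        case (elim x)
        have *: "(\<lambda>n. a n x - b x) \<longlonglongrightarrow> 0" using elim by (rule LIM_zero)
        have **: "(\<lambda>n. \<bar>a n x - b x\<bar> powr q) \<longlonglongrightarrow> 0 powr q"
          using q tendsto_rabs_zero[OF *] by (intro tendsto_powr') auto
        have "(\<lambda>n. g n x) \<longlonglongrightarrow> t powr q * 0 powr q + t powr (- q') * \<bar>h x\<bar> powr q' - \<bar>h x * 0\<bar>"
          unfolding g_def by (intro tendsto_intros * **)
        then show ?case by simp
      qed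
    qed (use e in simp)
    then have "eventually (\<lambda>n. integral\<^sup>L M (\<lambda>x. \<bar>h x * (a n x - b x)\<bar>) < e) sequentially"
    proof eventually_elim
      case (elim n)
      have "integral\<^sup>L M (g n) = t powr q * integral\<^sup>L M (\<lambda>x. \<bar>a n x - b x\<bar> powr q)
          + integral\<^sup>L M (\<lambda>x. t powr (- q') * \<bar>h x\<bar> powr q') - integral\<^sup>L M (\<lambda>x. \<bar>h x * (a n x - b x)\<bar>)"
        unfolding g_def using dint[of n] hi hd[of n] by (simp add: q'_def)
      moreover have "t powr q * integral\<^sup>L M (\<lambda>x. \<bar>a n x - b x\<bar> powr q) \<le> t powr q * D"
        using dD by (intro mult_left_mono) auto
      ultimately show ?case using elim tD e by linarith
    qed
    moreover have "integral\<^sup>L M (\<lambda>x. \<bar>h x * (a n x - b x)\<bar>) \<ge> 0" for n by simp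
    ultimately show "\<exists>no. \<forall>n\<ge>no. norm (integral\<^sup>L M (\<lambda>x. \<bar>h x * (a n x - b x)\<bar>) - 0) < e"
      by (auto simp: eventually_sequentially)
  qed
  then have "(\<lambda>n. integral\<^sup>L M (\<lambda>x. h x * a n x) - integral\<^sup>L M (\<lambda>x. h x * b x)) \<longlonglongrightarrow> 0"
  proof (rule Lim_null_comparison[rotated])
    have "norm (integral\<^sup>L M (\<lambda>x. h x * a n x) - integral\<^sup>L M (\<lambda>x. h x * b x)) \<le> integral\<^sup>L M (\<lambda>x. \<bar>h x * (a n x - b x)\<bar>)" for n
    proof -
      have "integral\<^sup>L M (\<lambda>x. h x * a n x) - integral\<^sup>L M (\<lambda>x. h x * b x) = integral\<^sup>L M (\<lambda>x. h x * (a n x - b x))"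
        using ha hb by (simp add: right_diff_distrib)
      then show ?thesis using integral_abs_bound[of M "\<lambda>x. h x * (a n x - b x)"] by simp
    qed
    then show "eventually (\<lambda>n. norm (integral\<^sup>L M (\<lambda>x. h x * a n x) - integral\<^sup>L M (\<lambda>x. h x * b x)) \<le> integral\<^sup>L M (\<lambda>x. \<bar>h x * (a n x - b x)\<bar>)) sequentially"
      by simp
  qed
  then show "(\<lambda>n. integral\<^sup>L M (\<lambda>x. h x * a n x)) \<longlonglongrightarrow> integral\<^sup>L M (\<lambda>x. h x * b x)"
    by (rule LIM_zero_cancel)
qed

section \<open>The energy density\<close>


text \<open>Cauchy-Schwarz reduces to the scalar tangent inequality, which is strict unless the
  norms agree. For equal norms the strictness comes from the inner product, because
  \<open>c \<bullet> (a - c)\<close> is then minus half the squared distance.\<close>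

lemma norm_powr_tangent_strict:
  fixes a c :: "'a::real_inner"
  assumes p: "p > 1" and ne: "a \<noteq> c"
  shows "norm c powr p + p * norm c powr (p - 2) * (c \<bullet> (a - c)) < norm a powr p"
proof (cases "c = 0")
  case True
  then show ?thesis using ne by simp
next
  case False
  then have nc: "norm c > 0" by simp
  have pw: "norm c powr (p - 2) * norm c = norm c powr (p - 1)"
    using nc by (simp add: powr_mult_base mult.commute)
  have cs: "c \<bullet> (a - c) \<le> norm c * (norm a - norm c)"
    using norm_cauchy_schwarz[of c a] by (simp add: inner_diff_right algebra_simps power2_norm_eq_inner[symmetric] power2_eq_square)
  have pp: "p * norm c powr (p - 2) > 0" using p nc by simp
  show ?thesis
  proof (cases "norm a = norm c")
    case True
    have "(a - c) \<bullet> (a - c) > 0" using ne by simp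
    moreover have "a \<bullet> a = c \<bullet> c" using True by (simp add: norm_eq)
    then have "(a - c) \<bullet> (a - c) = - 2 * (c \<bullet> (a - c))"
      by (simp add: inner_diff_left inner_diff_right inner_commute)
    ultimately have "c \<bullet> (a - c) < 0" by linarith
    then have "p * norm c powr (p - 2) * (c \<bullet> (a - c)) < 0" using pp by (rule mult_pos_neg[rotated])
    then show ?thesis using True by simp
  next
    case False
    have "p * norm c powr (p - 2) * (c \<bullet> (a - c)) \<le> p * norm c powr (p - 2) * (norm c * (norm a - norm c))"
      using pp cs by (intro mult_left_mono) auto
    also have "\<dots> = p * norm c powr (p - 1) * (norm a - norm c)" by (simp add: pw[symmetric] algebra_simps)
    finally show ?thesis using powr_tangent_strict[OF p _ nc False] by simp
  qed
qed

lemma norm_powr_tangent: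
  fixes a c :: "'a::real_inner"
  assumes p: "p > 1"
  shows "norm c powr p + p * norm c powr (p - 2) * (c \<bullet> (a - c)) \<le> norm a powr p"
  using norm_powr_tangent_strict[OF p, of a c] by (cases "a = c") auto

text \<open>\<open>en p c \<xi>\<close> is the density of the \<open>p\<close>-energy of \<open>u\<close> written in terms of \<open>c = u\<^sup>p\<close> and
  \<open>\<xi> = \<nabla>(u\<^sup>p)\<close>, that is \<open>|\<nabla>u|\<^sup>p\<close>. In these variables the energy is convex and positively
  homogeneous. For \<open>c = 0\<close> the value is \<open>0\<close>.\<close>
definition en :: "real \<Rightarrow> real \<Rightarrow> 'a::euclidean_space \<Rightarrow> real" where
  "en p c \<xi> = c * norm (\<xi> /\<^sub>R (p * c)) powr p"

lemma en_nonneg: "c \<ge> 0 \<Longrightarrow> en p c \<xi> \<ge> 0"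
  by (simp add: en_def)

lemma en_scale: "t \<ge> 0 \<Longrightarrow> p > 1 \<Longrightarrow> en p (t * c) (t *\<^sub>R \<xi>) = t * en p c \<xi>"
proof (cases "t = 0")
  case False
  have "(t *\<^sub>R \<xi>) /\<^sub>R (p * (t * c)) = \<xi> /\<^sub>R (p * c)" using False by (simp add: field_simps)
  then show ?thesis by (simp only: en_def mult.assoc)
qed (simp add: en_def)

lemma norm_powr_mult_inner: "norm F powr (p - 2) * (F \<bullet> F) = norm F powr p" for F :: "'a::real_inner"
proof (cases "F = 0")
  case False
  have "norm F powr (p - 2) * (F \<bullet> F) = norm F powr (p - 2) * norm F powr 2"
    using False by (simp add: power2_norm_eq_inner)
  also have "\<dots> = norm F powr (p - 2 + 2)" by (rule powr_add[symmetric])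
  finally show ?thesis by simp
qed simp

text \<open>The tangent inequality at \<open>F\<close>, evaluated at the logarithmic gradient
  \<open>\<xi> /\<^sub>R (p * c)\<close> and multiplied by \<open>c\<close>. What results is linear
  in the pair of \<open>c\<close> and \<open>\<xi>\<close>; the condition at \<open>c = 0\<close> is
  the one that \<open>adm_zero_grad\<close> supplies.\<close>

lemma en_young:
  fixes F \<xi> :: "'a::euclidean_space"
  assumes p: "p > 1" and c: "c \<ge> 0" "c = 0 \<Longrightarrow> \<xi> = 0"
  shows "norm F powr (p - 2) * (F \<bullet> \<xi>) - (p - 1) * norm F powr p * c \<le> en p c \<xi>"
proof (cases "c = 0")
  case False
  define R where "R = \<xi> /\<^sub>R (p * c)"
  have \<xi>: "\<xi> = (p * c) *\<^sub>R R" using False p by (simp add: R_def field_simps)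
  have "c * (norm F powr p + p * norm F powr (p - 2) * (F \<bullet> (R - F))) \<le> c * norm R powr p"
    by (intro mult_left_mono norm_powr_tangent p c)
  also have "c * (norm F powr p + p * norm F powr (p - 2) * (F \<bullet> (R - F)))
     = c * norm F powr p + norm F powr (p - 2) * (F \<bullet> \<xi>) - p * c * (norm F powr (p - 2) * (F \<bullet> F))"
    by (simp add: \<xi> inner_diff_right algebra_simps)
  finally show ?thesis unfolding norm_powr_mult_inner by (simp add: en_def R_def algebra_simps)
qed (use c in \<open>simp add: en_def\<close>)

lemma en_young_eq:
  fixes \<xi> :: "'a::euclidean_space"
  assumes p: "p > 1" and c: "c > 0" and F: "F = \<xi> /\<^sub>R (p * c)"
  shows "norm F powr (p - 2) * (F \<bullet> \<xi>) - (p - 1) * norm F powr p * c = en p c \<xi>"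
proof -
  have \<xi>: "\<xi> = (p * c) *\<^sub>R F" using c p by (simp add: F field_simps)
  have "norm F powr (p - 2) * (F \<bullet> \<xi>) = p * c * (norm F powr (p - 2) * (F \<bullet> F))" by (simp add: \<xi>)
  also have "\<dots> = p * c * norm F powr p" unfolding norm_powr_mult_inner ..
  finally have "norm F powr (p - 2) * (F \<bullet> \<xi>) - (p - 1) * norm F powr p * c = c * norm F powr p"
    by (simp add: algebra_simps)
  then show ?thesis by (simp only: en_def F)
qed

text \<open>With \<open>F\<close> the logarithmic gradient of the sum, Young's inequality is an
  equality for the sum and a lower bound for each summand. Together with homogeneity this is
  convexity.\<close>

lemma en_add:
  fixes \<xi>1 \<xi>2 :: "'a::euclidean_space"
  assumes p: "p > 1" and c: "c1 \<ge> 0" "c1 = 0 \<Longrightarrow> \<xi>1 = 0" "c2 \<ge> 0" "c2 = 0 \<Longrightarrow> \<xi>2 = 0"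
  shows "en p (c1 + c2) (\<xi>1 + \<xi>2) \<le> en p c1 \<xi>1 + en p c2 \<xi>2"
proof (cases "c1 + c2 = 0")
  case True
  then have "c1 = 0" "c2 = 0" using c by auto
  then show ?thesis by (simp add: en_def)
next
  case False
  then have pos: "c1 + c2 > 0" using c by auto
  define F where "F = (\<xi>1 + \<xi>2) /\<^sub>R (p * (c1 + c2))"
  show ?thesis
    using en_young[OF p c(1,2), of F] en_young[OF p c(3,4), of F] en_young_eq[OF p pos F_def]
    by (simp add: inner_add_right algebra_simps)
qed

section \<open>Quantitative strict convexity\<close>

definition gap :: "real \<Rightarrow> real \<Rightarrow> 'a::euclidean_space \<Rightarrow> 'a \<Rightarrow> real" where
  "gap p \<theta> a b = \<theta> * norm a powr p + (1 - \<theta>) * norm b powr p - norm (\<theta> *\<^sub>R a + (1 - \<theta>) *\<^sub>R b) powr p"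

lemma gap_pos:
  assumes p: "p > 1" and t: "0 < \<theta>" "\<theta> < 1" and ne: "a \<noteq> b"
  shows "gap p \<theta> a b > 0"
proof -
  define c where "c = \<theta> *\<^sub>R a + (1 - \<theta>) *\<^sub>R b"
  have ac: "a - c = (1 - \<theta>) *\<^sub>R (a - b)" and bc: "b - c = (- \<theta>) *\<^sub>R (a - b)"
    by (auto simp: c_def algebra_simps)
  have "a \<noteq> c" using ac t ne by auto
  from norm_powr_tangent_strict[OF p this]
  have "\<theta> * (norm c powr p + p * norm c powr (p - 2) * (c \<bullet> (a - c))) < \<theta> * norm a powr p"
    using t by simp
  moreover have "(1 - \<theta>) * (norm c powr p + p * norm c powr (p - 2) * (c \<bullet> (b - c))) \<le> (1 - \<theta>) * norm b powr p"
    using t by (intro mult_left_mono norm_powr_tangent p) auto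
  moreover have "\<theta> * (norm c powr p + p * norm c powr (p - 2) * (c \<bullet> (a - c)))
     + (1 - \<theta>) * (norm c powr p + p * norm c powr (p - 2) * (c \<bullet> (b - c))) = norm c powr p"
    unfolding ac bc inner_scaleR_right by (simp add: algebra_simps)
  ultimately show ?thesis unfolding gap_def c_def[symmetric] by linarith
qed

text \<open>A positive continuous function on a compact set has a positive minimum. The weights stay
  away from 0 and 1, where the deficit would degenerate; an empty set \<open>S\<close> is the case
  of a distance that bounded vectors cannot reach.\<close>

lemma gap_uniform:
  assumes p: "p > 1" and d: "d > 0"
  shows "\<exists>c>0. \<forall>\<theta> (a::'a::euclidean_space) b. 1/4 \<le> \<theta> \<and> \<theta> \<le> 3/4 \<and> norm a \<le> K \<and> norm b \<le> K \<and> norm (a - b) \<ge> d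
     \<longrightarrow> gap p \<theta> a b \<ge> c"
proof -
  define S where "S = ({1/4..3/4::real} \<times> cball (0::'a) K \<times> cball (0::'a) K) \<inter> {z. norm (fst (snd z) - snd (snd z)) \<ge> d}"
  have "closed {z::real \<times> 'a \<times> 'a. norm (fst (snd z) - snd (snd z)) \<ge> d}"
    by (intro closed_Collect_le continuous_intros)
  then have S: "compact S" unfolding S_def
    by (intro compact_Int_closed compact_Times compact_cball) auto
  have cont: "continuous_on S (\<lambda>z. gap p (fst z) (fst (snd z)) (snd (snd z)))"
    unfolding gap_def using p by (intro continuous_intros continuous_on_powr') auto
  show ?thesis
  proof (cases "S = {}")
    case True
    have "(\<theta>, a, b) \<in> S" if "1/4 \<le> \<theta> \<and> \<theta> \<le> 3/4 \<and> norm a \<le> K \<and> norm b \<le> K \<and> norm (a - b) \<ge> d" for \<theta> and a b :: 'a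
      using that by (auto simp: S_def)
    then show ?thesis using True by (intro exI[of _ 1]) auto
  next
    case False
    then obtain z where z: "z \<in> S" "\<And>y. y \<in> S \<Longrightarrow> gap p (fst z) (fst (snd z)) (snd (snd z)) \<le> gap p (fst y) (fst (snd y)) (snd (snd y))"
      using continuous_attains_inf[OF S _ cont] by blast
    have "gap p (fst z) (fst (snd z)) (snd (snd z)) > 0"
      by (rule gap_pos[OF p]) (use z(1) d in \<open>auto simp: S_def\<close>)
    moreover have "gap p (fst z) (fst (snd z)) (snd (snd z)) \<le> gap p \<theta> a b"
      if "1/4 \<le> \<theta> \<and> \<theta> \<le> 3/4 \<and> norm a \<le> K \<and> norm b \<le> K \<and> norm (a - b) \<ge> d" for \<theta> and a b :: 'a
      using z(2)[of "(\<theta>, a, b)"] that by (auto simp: S_def)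
    ultimately show ?thesis by blast
  qed
qed

text \<open>Turns an energy deficit into closeness of logarithmic gradients: the deficit is exactly
  the Jensen deficit of the p-th power between them, with weights proportional to \<open>c1\<close>
  and \<open>c2\<close>.\<close>

lemma en_gap:
  fixes \<xi>1 \<xi>2 :: "'a::euclidean_space"
  assumes p: "p > 1" and c: "c1 > 0" "c2 > 0"
  shows "en p c1 \<xi>1 + en p c2 \<xi>2 - en p (c1 + c2) (\<xi>1 + \<xi>2)
     = (c1 + c2) * gap p (c1 / (c1 + c2)) (\<xi>1 /\<^sub>R (p * c1)) (\<xi>2 /\<^sub>R (p * c2))"
proof -
  have s: "c1 + c2 > 0" using c by simp
  have t: "1 - c1 / (c1 + c2) = c2 / (c1 + c2)" using s by (simp add: field_simps)
  have "(c1 / (c1 + c2)) *\<^sub>R (\<xi>1 /\<^sub>R (p * c1)) + (c2 / (c1 + c2)) *\<^sub>R (\<xi>2 /\<^sub>R (p * c2)) = (\<xi>1 + \<xi>2) /\<^sub>R (p * (c1 + c2))"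
    using c p by (simp add: scaleR_add_right field_simps)
  then show ?thesis
    using s c unfolding gap_def en_def t by (simp add: right_diff_distrib distrib_left)
qed

text \<open>Strict concavity of the square root, written in the roots \<open>a\<close> and
  \<open>b\<close>: the difference of the squares of quadratic and arithmetic mean is
  \<open>(a - b)\<^sup>2 / 4\<close>, and it factors with a sum of means that is at most
  \<open>2 * K\<close>.\<close>

lemma sqrt_midpoint_gap:
  fixes a b K :: real
  assumes "a \<ge> 0" "b \<ge> 0" "a \<le> K" "b \<le> K" "K > 0"
  shows "(a - b)\<^sup>2 / (4 * K) \<le> 2 * sqrt ((a\<^sup>2 + b\<^sup>2) / 2) - a - b"
proof -
  define S where "S = sqrt ((a\<^sup>2 + b\<^sup>2) / 2)"
  have S2: "S\<^sup>2 = (a\<^sup>2 + b\<^sup>2) / 2" unfolding S_def by (simp)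
  have S0: "S \<ge> 0" by (simp add: S_def)
  have "(a\<^sup>2 + b\<^sup>2) / 2 \<le> K\<^sup>2" 
  proof -
    have "a\<^sup>2 \<le> K\<^sup>2" "b\<^sup>2 \<le> K\<^sup>2" using assms by (auto intro: power_mono)
    then show ?thesis by simp
  qed
  then have SK: "S \<le> K" unfolding S_def using assms by (metis real_sqrt_le_iff real_sqrt_abs abs_of_pos)
  have m: "(a - b)\<^sup>2 / 4 = S\<^sup>2 - ((a + b) / 2)\<^sup>2" unfolding S2 by (simp add: power2_eq_square field_simps)
  have ge: "S \<ge> (a + b) / 2"
  proof (rule power2_le_imp_le)
    show "((a + b) / 2)\<^sup>2 \<le> S\<^sup>2" using m zero_le_power2[of "a - b"] by linarith
  qed (rule S0)
  have "(a - b)\<^sup>2 / 4 = (S - (a + b) / 2) * (S + (a + b) / 2)" unfolding m by (simp add: power2_eq_square algebra_simps)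
  also have "\<dots> \<le> (S - (a + b) / 2) * (2 * K)" using ge SK assms by (intro mult_left_mono; linarith)
  finally have "(a - b)\<^sup>2 \<le> (2 * S - a - b) * (4 * K)" by (simp add: field_simps)
  then show ?thesis unfolding S_def[symmetric] using assms by (simp add: pos_divide_le_eq)
qed

text \<open>Stands for p-th powers of nonnegative functions of finite p-energy with compact support.
  Integrability is demanded separately because the density divides by \<open>\<zeta>\<close> and may
  blow up near its zeros.\<close>

definition adm :: "real \<Rightarrow> 'a::euclidean_space set \<Rightarrow> ('a \<Rightarrow> real) \<Rightarrow> bool" where
  "adm p \<Omega> \<zeta> \<longleftrightarrow> C1c \<Omega> \<zeta> \<and> (\<forall>x. \<zeta> x \<ge> 0) \<and> integrable lborel (\<lambda>x. en p (\<zeta> x) (grad \<zeta> x))"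

lemma adm_zero_grad: "adm p \<Omega> \<zeta> \<Longrightarrow> \<zeta> x = 0 \<Longrightarrow> grad \<zeta> x = 0"
  unfolding adm_def by (metis grad_zero_at_min C1cD(6))

lemma en_measurable:
  assumes [measurable]: "f \<in> borel_measurable M" "g \<in> borel_measurable M"
  shows "(\<lambda>x. en p (f x) (g x)) \<in> borel_measurable M"
  unfolding en_def by measurable

lemma C1c_lincomb:
  assumes f: "C1c S f" and g: "C1c S g"
  shows "C1c S (\<lambda>x. s * f x + t * g x)" "grad (\<lambda>x. s * f x + t * g x) = (\<lambda>x. s *\<^sub>R grad f x + t *\<^sub>R grad g x)"
proof -
  have d: "((\<lambda>x. s * f x + t * g x) has_derivative (\<lambda>h. (s *\<^sub>R grad f x + t *\<^sub>R grad g x) \<bullet> h)) (at x)" for x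
    by (auto intro!: derivative_eq_intros C1cD(1)[OF f] C1cD(1)[OF g] simp: inner_add_left)
  have c: "continuous_on UNIV (\<lambda>x. s *\<^sub>R grad f x + t *\<^sub>R grad g x)"
    by (intro continuous_intros C1cD(3)[OF f] C1cD(3)[OF g])
  have K: "compact (tsupp f \<union> tsupp g)" "tsupp f \<union> tsupp g \<subseteq> S"
    using C1cD[OF f] C1cD[OF g] by auto
  show "C1c S (\<lambda>x. s * f x + t * g x)" "grad (\<lambda>x. s * f x + t * g x) = (\<lambda>x. s *\<^sub>R grad f x + t *\<^sub>R grad g x)"
    by (rule C1cI[OF d c K]; simp add: zero_off_tsupp)+
qed

text \<open>Homogeneity and subadditivity give the pointwise bound, and the same bound serves as the
  integrable majorant that keeps the combination admissible.\<close>

lemma adm_lincomb: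
  assumes p: "p > 1" and f: "adm p \<Omega> f" and g: "adm p \<Omega> g" and st: "s \<ge> 0" "t \<ge> 0"
  shows "adm p \<Omega> (\<lambda>x. s * f x + t * g x)"
    "en p (s * f x + t * g x) (grad (\<lambda>x. s * f x + t * g x) x) \<le> s * en p (f x) (grad f x) + t * en p (g x) (grad g x)"
proof -
  have fc: "C1c \<Omega> f" "C1c \<Omega> g" using f g by (auto simp: adm_def)
  note l = C1c_lincomb[OF fc, of s t]
  show le: "en p (s * f x + t * g x) (grad (\<lambda>x. s * f x + t * g x) x) \<le> s * en p (f x) (grad f x) + t * en p (g x) (grad g x)" for x
  proof -
    have "en p (s * f x + t * g x) (s *\<^sub>R grad f x + t *\<^sub>R grad g x)
       \<le> en p (s * f x) (s *\<^sub>R grad f x) + en p (t * g x) (t *\<^sub>R grad g x)"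
      using f g st adm_zero_grad[OF f] adm_zero_grad[OF g]
      by (intro en_add p) (auto simp: adm_def)
    then show ?thesis using st p by (simp add: l en_scale)
  qed
  have [measurable]: "(\<lambda>x. en p (s * f x + t * g x) (grad (\<lambda>x. s * f x + t * g x) x)) \<in> borel_measurable lborel"
    by (rule en_measurable) (use C1c_measurable[OF l(1)] in auto)
  have i: "integrable lborel (\<lambda>x. s * en p (f x) (grad f x) + t * en p (g x) (grad g x))"
    using f g by (auto simp: adm_def)
  have "integrable lborel (\<lambda>x. en p (s * f x + t * g x) (grad (\<lambda>x. s * f x + t * g x) x))"
    by (rule Bochner_Integration.integrable_bound[OF i])
       (use le f g st in \<open>auto simp: adm_def en_nonneg intro!: order_trans[OF _ abs_ge_self]\<close>)
  then show "adm p \<Omega> (\<lambda>x. s * f x + t * g x)"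
    using l f g st by (auto simp: adm_def)
qed

text \<open>The gradient of \<open>\<zeta> x powr (1/p)\<close> where \<open>\<zeta>\<close> is
  positive, and zero where it vanishes.\<close>

definition rgrad :: "real \<Rightarrow> ('a::euclidean_space \<Rightarrow> real) \<Rightarrow> 'a \<Rightarrow> 'a" where
  "rgrad p \<zeta> x = (\<zeta> x powr (1/p)) *\<^sub>R (grad \<zeta> x /\<^sub>R (p * \<zeta> x))"

lemma en_rgrad: "p > 1 \<Longrightarrow> \<zeta> x \<ge> 0 \<Longrightarrow> en p (\<zeta> x) (grad \<zeta> x) = norm (rgrad p \<zeta> x) powr p"
  by (simp add: en_def rgrad_def powr_mult powr_powr)

lemma root_has_derivative:
  assumes "p > 1" "\<zeta> differentiable (at x)" "\<zeta> x > 0"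
  shows "((\<lambda>x. \<zeta> x powr (1/p)) has_derivative (\<lambda>h. rgrad p \<zeta> x \<bullet> h)) (at x)"
proof -
  have "((\<lambda>y. y powr (1/p)) has_real_derivative (1/p) * \<zeta> x powr (1/p - 1)) (at (\<zeta> x))"
    using assms by (auto intro!: derivative_eq_intros)
  then have "((\<lambda>x. \<zeta> x powr (1/p)) has_derivative (\<lambda>h. (grad \<zeta> x \<bullet> h) * ((1/p) * \<zeta> x powr (1/p - 1)))) (at x)"
    by (rule DERIV_compose_FDERIV) (rule has_derivative_grad[OF assms(2)])
  moreover have "(grad \<zeta> x \<bullet> h) * ((1/p) * \<zeta> x powr (1/p - 1)) = rgrad p \<zeta> x \<bullet> h" for h
  proof -
    have "\<zeta> x powr (1/p - 1) = \<zeta> x powr (1/p) / \<zeta> x" using assms by (simp add: powr_diff)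
    then show ?thesis by (simp only: rgrad_def inner_scaleR_left) (simp add: divide_inverse mult_ac)
  qed
  ultimately show ?thesis by simp
qed

lemma continuous_on_rgrad:
  assumes "C1c S \<zeta>" "p > 1"
  shows "continuous_on {x. \<zeta> x > 0} (rgrad p \<zeta>)"
  unfolding rgrad_def using assms C1cD(2,3)[OF assms(1)]
  by (intro continuous_intros) auto

text \<open>The Euler-Lagrange inequality is linear in variations of the root, not of
  \<open>\<zeta>\<close>, so the root is moved by \<open>t * \<phi> x\<close>. Positivity on the
  support of \<open>\<phi>\<close> makes the root differentiable where it is changed; elsewhere
  nothing happens.\<close>

lemma adm_root_perturb:
  assumes p: "p > 1" and \<zeta>: "adm p \<Omega> \<zeta>" and \<phi>: "C1c \<Omega> \<phi>" "\<And>x. \<phi> x \<ge> 0" and t: "t \<ge> 0"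
    and pos0: "\<forall>x\<in>tsupp \<phi>. \<zeta> x > 0"
  defines "\<zeta>' \<equiv> \<lambda>x. (\<zeta> x powr (1/p) + t * \<phi> x) powr p"
  shows "adm p \<Omega> \<zeta>'"
    "x \<in> tsupp \<phi> \<Longrightarrow> en p (\<zeta>' x) (grad \<zeta>' x) = norm (rgrad p \<zeta> x + t *\<^sub>R grad \<phi> x) powr p"
    "x \<notin> tsupp \<phi> \<Longrightarrow> \<zeta>' x = \<zeta> x \<and> grad \<zeta>' x = grad \<zeta> x"
proof -
  have \<zeta>c: "C1c \<Omega> \<zeta>" and \<zeta>0: "\<And>x. \<zeta> x \<ge> 0" and \<zeta>i: "integrable lborel (\<lambda>x. en p (\<zeta> x) (grad \<zeta> x))"
    using \<zeta> by (auto simp: adm_def)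
  note pos = pos0[rule_format]
  define U where "U x = \<zeta> x powr (1/p) + t * \<phi> x" for x
  define G where "G x = (if x \<in> tsupp \<phi> then (p * U x powr (p - 1)) *\<^sub>R (rgrad p \<zeta> x + t *\<^sub>R grad \<phi> x) else grad \<zeta> x)" for x
  have Upos: "U x > 0" if "\<zeta> x > 0" for x
    unfolding U_def using that t \<phi>(2)[of x] by (intro add_pos_nonneg) auto
  \<comment> \<open>Both formulas for the gradient agree where \<open>\<phi>\<close> is absent and
    \<open>\<zeta>\<close> positive, so continuity can be checked separately on the open sets where
    \<open>\<zeta> x > 0\<close> and off the support.\<close>
  have Goff: "(p * U x powr (p - 1)) *\<^sub>R (rgrad p \<zeta> x + t *\<^sub>R grad \<phi> x) = grad \<zeta> x"
    if "x \<notin> tsupp \<phi>" "\<zeta> x > 0" for x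
  proof -
    have "p * (\<zeta> x powr (1/p)) powr (p - 1) * \<zeta> x powr (1/p) = p * \<zeta> x"
      using that p by (simp add: powr_powr powr_add[symmetric] diff_divide_distrib)
    then have "p * (\<zeta> x powr (1/p)) powr (p - 1) * (\<zeta> x powr (1/p) * inverse (p * \<zeta> x)) = 1"
      using that p by (simp add: field_simps)
    then show ?thesis using that p
      by (simp add: U_def zero_off_tsupp grad_zero_off_tsupp rgrad_def mult.assoc)
  qed
  have GU: "G x = (p * U x powr (p - 1)) *\<^sub>R (rgrad p \<zeta> x + t *\<^sub>R grad \<phi> x)" if "\<zeta> x > 0" for x
    using Goff that by (auto simp: G_def)
  have off: "\<zeta>' x = \<zeta> x" if "x \<notin> tsupp \<phi>" for x
    using that \<zeta>0[of x] p by (simp add: \<zeta>'_def zero_off_tsupp powr_powr)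
  have op: "open (- tsupp \<phi>)" by (simp add: closed_tsupp open_Compl)
  have op2: "open {x. \<zeta> x > 0}" using C1cD(2)[OF \<zeta>c] by (intro open_Collect_less) auto
  have cov: "{x. \<zeta> x > 0} \<union> - tsupp \<phi> = UNIV" using pos by auto
  have d: "(\<zeta>' has_derivative (\<lambda>h. G x \<bullet> h)) (at x)" for x
  proof (cases "x \<in> tsupp \<phi>")
    case True
    have "((\<lambda>y. y powr p) has_real_derivative p * U x powr (p - 1)) (at (U x))"
      using p Upos pos[OF True] by (auto intro!: derivative_eq_intros)
    moreover have "(U has_derivative (\<lambda>h. (rgrad p \<zeta> x + t *\<^sub>R grad \<phi> x) \<bullet> h)) (at x)"
      unfolding U_def
      by (rule has_derivative_eq_rhs[OF has_derivative_add[OF root_has_derivative[OF p C1cD(6)[OF \<zeta>c] pos[OF True]]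
            has_derivative_mult_right[OF C1cD(1)[OF \<phi>(1)]]]]) (auto simp: inner_add_left)
    ultimately have "((\<lambda>x. U x powr p) has_derivative (\<lambda>h. ((rgrad p \<zeta> x + t *\<^sub>R grad \<phi> x) \<bullet> h) * (p * U x powr (p - 1)))) (at x)"
      by (rule DERIV_compose_FDERIV)
    then show ?thesis using True by (simp add: G_def \<zeta>'_def U_def mult.commute)
  next
    case False
    have "(\<zeta> has_derivative (\<lambda>h. G x \<bullet> h)) (at x)" using False C1cD(1)[OF \<zeta>c] by (simp add: G_def)
    then show ?thesis
      by (rule has_derivative_transform_within_open[OF _ op]) (use False off in auto)
  qed
  have cU: "continuous_on {x. \<zeta> x > 0} U" unfolding U_def
    using C1cD(2)[OF \<zeta>c] C1cD(2)[OF \<phi>(1)] by (intro continuous_intros) auto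
  have c1: "continuous_on {x. \<zeta> x > 0} (\<lambda>x. (p * U x powr (p - 1)) *\<^sub>R (rgrad p \<zeta> x + t *\<^sub>R grad \<phi> x))"
    using Upos by (intro continuous_intros cU continuous_on_rgrad[OF \<zeta>c p] C1cD(3)[OF \<phi>(1)]) force
  have c1': "continuous_on {x. \<zeta> x > 0} G"
    using c1 GU by (metis (no_types, lifting) continuous_on_cong mem_Collect_eq)
  have c2: "continuous_on (- tsupp \<phi>) G"
    using C1cD(3)[OF \<zeta>c, of "- tsupp \<phi>"] by (rule continuous_on_eq) (simp add: G_def)
  have cG: "continuous_on UNIV G"
    using continuous_on_open_Un[OF op2 op c1' c2] cov by simp
  have K: "compact (tsupp \<zeta> \<union> tsupp \<phi>)" "tsupp \<zeta> \<union> tsupp \<phi> \<subseteq> \<Omega>"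
    using C1cD[OF \<zeta>c] C1cD[OF \<phi>(1)] by auto
  have z: "\<zeta>' x = 0" if "x \<notin> tsupp \<zeta> \<union> tsupp \<phi>" for x
    using that by (simp add: \<zeta>'_def zero_off_tsupp)
  note C = C1cI[OF d cG K z]
  show offg: "x \<notin> tsupp \<phi> \<Longrightarrow> \<zeta>' x = \<zeta> x \<and> grad \<zeta>' x = grad \<zeta> x" for x
    using off C(2) by (simp add: G_def)
  show on: "en p (\<zeta>' x) (grad \<zeta>' x) = norm (rgrad p \<zeta> x + t *\<^sub>R grad \<phi> x) powr p" if "x \<in> tsupp \<phi>" for x
  proof -
    have U: "U x > 0" by (rule Upos[OF pos[OF that]])
    have e: "\<zeta>' x = U x powr p" by (simp add: \<zeta>'_def U_def)
    have "grad \<zeta>' x /\<^sub>R (p * \<zeta>' x) = (1 / U x) *\<^sub>R (rgrad p \<zeta> x + t *\<^sub>R grad \<phi> x)"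
    proof -
      have "grad \<zeta>' x = (p * U x powr (p - 1)) *\<^sub>R (rgrad p \<zeta> x + t *\<^sub>R grad \<phi> x)"
        using that C(2) by (simp add: G_def)
      moreover have "inverse (p * \<zeta>' x) * (p * U x powr (p - 1)) = 1 / U x"
        using p U by (simp add: e powr_diff field_simps)
      ultimately show ?thesis by (simp only: scaleR_scaleR)
    qed
    then show ?thesis using U p unfolding en_def e
      by (simp add: powr_divide)
  qed
  have "integrable lborel (\<lambda>x. en p (\<zeta>' x) (grad \<zeta>' x))"
  proof (rule Bochner_Integration.integrable_bound)
    have "continuous_on (tsupp \<phi>) (\<lambda>x. norm (rgrad p \<zeta> x + t *\<^sub>R grad \<phi> x) powr p)"
      using p pos C1cD(3)[OF \<phi>(1)] continuous_on_subset[OF continuous_on_rgrad[OF \<zeta>c p], of "tsupp \<phi>"]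
      by (intro continuous_on_powr' continuous_intros) auto
    from borel_integrable_compact[OF C1cD(4)[OF \<phi>(1)] this]
    show "integrable lborel (\<lambda>x. indicator (tsupp \<phi>) x *\<^sub>R norm (rgrad p \<zeta> x + t *\<^sub>R grad \<phi> x) powr p + en p (\<zeta> x) (grad \<zeta> x))"
      using \<zeta>i by auto
    show "(\<lambda>x. en p (\<zeta>' x) (grad \<zeta>' x)) \<in> borel_measurable lborel"
      by (rule en_measurable) (use C1c_measurable[OF C(1)] in auto)
    show "AE x in lborel. norm (en p (\<zeta>' x) (grad \<zeta>' x)) \<le> norm (indicator (tsupp \<phi>) x *\<^sub>R norm (rgrad p \<zeta> x + t *\<^sub>R grad \<phi> x) powr p + en p (\<zeta> x) (grad \<zeta> x))"
    proof (rule AE_I2)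
      fix x
      show "norm (en p (\<zeta>' x) (grad \<zeta>' x)) \<le> norm (indicator (tsupp \<phi>) x *\<^sub>R norm (rgrad p \<zeta> x + t *\<^sub>R grad \<phi> x) powr p + en p (\<zeta> x) (grad \<zeta> x))"
        using on[of x] offg[of x] en_nonneg[OF \<zeta>0[of x], of p "grad \<zeta> x"] by (cases "x \<in> tsupp \<phi>") auto
    qed
  qed
  then show "adm p \<Omega> \<zeta>'" using C(1) by (auto simp: adm_def \<zeta>'_def)
qed

section \<open>Admissible functions\<close>


lemma borel_measurable_lebesgue_on: "f \<in> borel_measurable borel \<Longrightarrow> f \<in> borel_measurable (lebesgue_on S)"
  by (intro measurable_restrict_space1 measurable_completion) auto

text \<open>Bridge between the measure of the statement and \<open>lborel\<close>, in which
  translations, dilations and integration by parts are carried out.\<close>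

lemma lebesgue_on_eq_lborel:
  fixes f :: "'a::euclidean_space \<Rightarrow> 'b::{banach, second_countable_topology}"
  assumes S: "open S" and f: "f \<in> borel_measurable borel" and z: "\<And>x. x \<notin> S \<Longrightarrow> f x = 0"
  shows "integrable (lebesgue_on S) f \<longleftrightarrow> integrable lborel f"
    "integral\<^sup>L (lebesgue_on S) f = integral\<^sup>L lborel f"
proof -
  have e: "(\<lambda>x. indicator S x *\<^sub>R f x) = f" using z by (auto simp: indicator_def)
  have s: "S \<inter> space lebesgue \<in> sets lebesgue" using S by simp
  show "integrable (lebesgue_on S) f \<longleftrightarrow> integrable lborel f"
    using f by (simp add: integrable_restrict_space[OF s] e integrable_completion)
  show "integral\<^sup>L (lebesgue_on S) f = integral\<^sup>L lborel f"
    using f by (simp add: integral_restrict_space[OF s] e integral_completion)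
qed

lemma AE_lebesgue_on_iff:
  assumes "S \<in> sets lebesgue"
  shows "(AE x in lebesgue_on S. P x) \<longleftrightarrow> (AE x in lebesgue. x \<in> S \<longrightarrow> P x)"
  using assms by (intro AE_restrict_space_iff) auto

lemma Linf_loc_bounded:
  assumes V: "Linf_loc S V" and S: "open S" and K: "compact K" "K \<subseteq> S"
  shows "\<exists>C\<ge>0. AE x in lebesgue_on S. x \<in> K \<longrightarrow> \<bar>V x\<bar> \<le> C"
proof -
  obtain C where "AE x in lebesgue_on K. \<bar>V x\<bar> \<le> C" using V K by (auto simp: Linf_loc_def)
  then have "AE x in lebesgue. x \<in> K \<longrightarrow> \<bar>V x\<bar> \<le> C"
    using K by (subst (asm) AE_lebesgue_on_iff) (auto simp: borel_compact)
  then have "AE x in lebesgue. x \<in> S \<longrightarrow> x \<in> K \<longrightarrow> \<bar>V x\<bar> \<le> max C 0" by eventually_elim auto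
  then have "AE x in lebesgue_on S. x \<in> K \<longrightarrow> \<bar>V x\<bar> \<le> max C 0"
    using S by (subst AE_lebesgue_on_iff) auto
  then show ?thesis by (intro exI[of _ "max C 0"]) auto
qed

lemma integrable_Linf_loc_mult:
  assumes V: "Linf_loc S V" and S: "open S" and K: "compact K" "K \<subseteq> S"
    and g: "integrable (lebesgue_on S) g" "\<And>x. x \<notin> K \<Longrightarrow> g x = 0"
  shows "integrable (lebesgue_on S) (\<lambda>x. V x * g x)"
proof -
  obtain C where C: "C \<ge> 0" "AE x in lebesgue_on S. x \<in> K \<longrightarrow> \<bar>V x\<bar> \<le> C"
    using Linf_loc_bounded[OF V S K] by blast
  have [measurable]: "V \<in> borel_measurable (lebesgue_on S)" using V by (simp add: Linf_loc_def)
  show ?thesis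
  proof (rule Bochner_Integration.integrable_bound)
    show "integrable (lebesgue_on S) (\<lambda>x. C * \<bar>g x\<bar>)" using g by auto
    show "AE x in lebesgue_on S. norm (V x * g x) \<le> norm (C * \<bar>g x\<bar>)"
      using C(2)
    proof eventually_elim
      case (elim x)
      then show ?case using C(1) g(2)[of x] by (cases "x \<in> K") (auto simp: abs_mult mult_right_mono)
    qed
  qed (use g in measurable)
qed

lemma C1c_lebesgue_on:
  assumes "open S" "C1c S \<phi>"
  shows "integrable (lebesgue_on S) \<phi>" "integral\<^sup>L (lebesgue_on S) \<phi> = integral\<^sup>L lborel \<phi>"
    "\<phi> \<in> borel_measurable (lebesgue_on S)" "grad \<phi> \<in> borel_measurable (lebesgue_on S)"
proof -
  have "x \<notin> S \<Longrightarrow> \<phi> x = 0" for x using C1cD(5)[OF assms(2)] zero_off_tsupp by blast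
  from lebesgue_on_eq_lborel[OF assms(1) C1c_measurable(1)[OF assms(2)] this]
  show "integrable (lebesgue_on S) \<phi>" "integral\<^sup>L (lebesgue_on S) \<phi> = integral\<^sup>L lborel \<phi>"
    using integrable_C1c[OF assms(2)] by auto
  show "\<phi> \<in> borel_measurable (lebesgue_on S)" "grad \<phi> \<in> borel_measurable (lebesgue_on S)"
    by (intro borel_measurable_lebesgue_on C1c_measurable[OF assms(2)])+
qed

abbreviation energy :: "real \<Rightarrow> 'a::euclidean_space set \<Rightarrow> ('a \<Rightarrow> real) \<Rightarrow> real" where
  "energy p S \<zeta> \<equiv> integral\<^sup>L (lebesgue_on S) (\<lambda>x. en p (\<zeta> x) (grad \<zeta> x))"

lemma adm_lebesgue_on:
  assumes S: "open S" and \<zeta>: "adm p S \<zeta>"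
  shows "integrable (lebesgue_on S) (\<lambda>x. en p (\<zeta> x) (grad \<zeta> x))"
    "energy p S \<zeta> = integral\<^sup>L lborel (\<lambda>x. en p (\<zeta> x) (grad \<zeta> x))"
    "integrable (lebesgue_on S) \<zeta>" "C1c S \<zeta>" "\<zeta> x \<ge> 0"
    "Linf_loc S V \<Longrightarrow> integrable (lebesgue_on S) (\<lambda>x. V x * \<zeta> x)"
proof -
  show c: "C1c S \<zeta>" "\<zeta> x \<ge> 0" using \<zeta> by (auto simp: adm_def)
  show i: "integrable (lebesgue_on S) \<zeta>" by (rule C1c_lebesgue_on[OF S c(1)])
  have m: "(\<lambda>x. en p (\<zeta> x) (grad \<zeta> x)) \<in> borel_measurable borel"
    by (intro en_measurable C1c_measurable[OF c(1)])
  have z: "en p (\<zeta> x) (grad \<zeta> x) = 0" if "x \<notin> S" for x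
    using that C1cD(5)[OF c(1)] zero_off_tsupp[of x \<zeta>] by (auto simp: en_def)
  show "integrable (lebesgue_on S) (\<lambda>x. en p (\<zeta> x) (grad \<zeta> x))"
    "energy p S \<zeta> = integral\<^sup>L lborel (\<lambda>x. en p (\<zeta> x) (grad \<zeta> x))"
    using lebesgue_on_eq_lborel[OF S m z] \<zeta> by (auto simp: adm_def)
  show "Linf_loc S V \<Longrightarrow> integrable (lebesgue_on S) (\<lambda>x. V x * \<zeta> x)"
    by (rule integrable_Linf_loc_mult[OF _ S C1cD(4,5)[OF c(1)] i]) (auto simp: zero_off_tsupp)
qed

text \<open>The density of the m-th power is
  \<open>(m/p) powr p * B x powr (m - p) * norm (grad B x) powr p\<close>, with no negative power of
  \<open>B\<close> left once \<open>m\<close> is at least \<open>p\<close>.\<close>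

lemma adm_power:
  fixes B :: "'a::euclidean_space \<Rightarrow> real"
  assumes p: "p > 1" and B: "C1c S B" "\<And>x. B x \<ge> 0" and m: "real m \<ge> p"
  shows "adm p S (\<lambda>x. B x ^ m)"
proof -
  have d: "((\<lambda>x. B x ^ m) has_derivative (\<lambda>h. ((real m * B x ^ (m - 1)) *\<^sub>R grad B x) \<bullet> h)) (at x)" for x
    by (auto intro!: derivative_eq_intros C1cD(1)[OF B(1)])
  have c: "continuous_on UNIV (\<lambda>x. (real m * B x ^ (m - 1)) *\<^sub>R grad B x)"
    by (intro continuous_intros C1cD(2,3)[OF B(1)])
  have m0: "m > 0" using m p by (cases m) auto
  note C = C1cI[OF d c C1cD(4,5)[OF B(1)]]
  have C1: "C1c S (\<lambda>x. B x ^ m)" and C2: "grad (\<lambda>x. B x ^ m) = (\<lambda>x. (real m * B x ^ (m - 1)) *\<^sub>R grad B x)"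
    using C m0 by (auto simp: zero_off_tsupp)
  obtain b where b: "b \<ge> 0" "\<And>x. norm (B x) \<le> b" "\<And>x. norm (grad B x) \<le> b"
    using C1c_bounded[OF B(1)] by metis
  define A where "A = (real m / p) powr p * ((max b 1) powr (real m - p) * b powr p)"
  have le: "en p (B x ^ m) (grad (\<lambda>x. B x ^ m) x) \<le> A * indicator (tsupp B) x" for x
  proof (cases "B x = 0")
    case True
    then show ?thesis using m0 by (simp add: en_def A_def zero_power)
  next
    case False
    then have Bx: "B x > 0" using B(2)[of x] by simp
    have ts: "x \<in> tsupp B" using False zero_off_tsupp by blast
    have pw: "B x ^ m = B x ^ (m - 1) * B x" using m0 by (metis power_minus_mult mult.commute)
    have "grad (\<lambda>x. B x ^ m) x /\<^sub>R (p * B x ^ m) = (real m / p / B x) *\<^sub>R grad B x"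
    proof -
      have "inverse (p * B x ^ m) * (real m * B x ^ (m - 1)) = real m / p / B x"
        unfolding pw using Bx p by (simp add: field_simps)
      then show ?thesis unfolding C2 by (simp only: scaleR_scaleR)
    qed
    then have "en p (B x ^ m) (grad (\<lambda>x. B x ^ m) x) = B x ^ m * (real m / p / B x * norm (grad B x)) powr p"
      unfolding en_def using Bx p by simp
    also have "\<dots> = (real m / p) powr p * ((B x ^ m / B x powr p) * norm (grad B x) powr p)"
      using Bx p by (simp add: powr_mult powr_divide)
    also have "B x ^ m / B x powr p = B x powr (real m - p)"
      using Bx by (simp add: powr_diff powr_realpow)
    also have "(real m / p) powr p * (B x powr (real m - p) * norm (grad B x) powr p) \<le> A"
      unfolding A_def using Bx p m b(2)[of x] b(3)[of x]
      by (intro mult_left_mono mult_mono powr_mono2) auto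
    finally show ?thesis using ts by simp
  qed
  have "integrable lborel (\<lambda>x. en p (B x ^ m) (grad (\<lambda>x. B x ^ m) x))"
  proof (rule Bochner_Integration.integrable_bound)
    have "integrable lborel (\<lambda>x. indicator (tsupp B) x *\<^sub>R A)"
      by (rule borel_integrable_compact[OF C1cD(4)[OF B(1)]]) auto
    then show "integrable lborel (\<lambda>x. A * indicator (tsupp B) x)" by (simp add: mult.commute)
    show "(\<lambda>x. en p (B x ^ m) (grad (\<lambda>x. B x ^ m) x)) \<in> borel_measurable lborel"
      by (rule en_measurable) (use C1c_measurable[OF C1] in auto)
    show "AE x in lborel. norm (en p (B x ^ m) (grad (\<lambda>x. B x ^ m) x)) \<le> norm (A * indicator (tsupp B) x)"
      using le B(2) by (auto intro!: AE_I2 order_trans[OF _ abs_ge_self] simp: en_nonneg)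
  qed
  then show ?thesis using C1 B(2) by (auto simp: adm_def)
qed

lemma C1c_affine:
  fixes B :: "'a::euclidean_space \<Rightarrow> real"
  assumes B: "C1c S' B" and c: "c \<noteq> 0" and S: "\<And>x. t + c *\<^sub>R x \<in> tsupp B \<Longrightarrow> x \<in> S"
  shows "C1c S (\<lambda>x. B (t + c *\<^sub>R x))" "grad (\<lambda>x. B (t + c *\<^sub>R x)) = (\<lambda>x. c *\<^sub>R grad B (t + c *\<^sub>R x))"
proof -
  have a: "((\<lambda>x. t + c *\<^sub>R x) has_derivative (\<lambda>h. c *\<^sub>R h)) (at x)" for x :: 'a
    by (auto intro!: derivative_eq_intros)
  have d: "((\<lambda>x. B (t + c *\<^sub>R x)) has_derivative (\<lambda>h. (c *\<^sub>R grad B (t + c *\<^sub>R x)) \<bullet> h)) (at x)" for x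
    using has_derivative_compose[OF a[of x] C1cD(1)[OF B, of "t + c *\<^sub>R x"]] by simp
  have cg: "continuous_on UNIV (\<lambda>x. c *\<^sub>R grad B (t + c *\<^sub>R x))"
    by (intro continuous_intros continuous_on_compose2[OF C1cD(3)[OF B, of UNIV]]) auto
  define K where "K = (\<lambda>y. (y - t) /\<^sub>R c) ` tsupp B"
  have K: "compact K" unfolding K_def
    by (intro compact_continuous_image continuous_intros C1cD(4)[OF B])
  have KS: "K \<subseteq> S" unfolding K_def using S c by auto
  have z: "B (t + c *\<^sub>R x) = 0" if "x \<notin> K" for x
  proof (rule zero_off_tsupp[of "t + c *\<^sub>R x" B])
    show "t + c *\<^sub>R x \<notin> tsupp B"
    proof
      assume "t + c *\<^sub>R x \<in> tsupp B"
      then have "(t + c *\<^sub>R x - t) /\<^sub>R c \<in> K" unfolding K_def by (rule imageI)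
      then show False using that c by simp
    qed
  qed
  show "C1c S (\<lambda>x. B (t + c *\<^sub>R x))" "grad (\<lambda>x. B (t + c *\<^sub>R x)) = (\<lambda>x. c *\<^sub>R grad B (t + c *\<^sub>R x))"
    using C1cI[OF d cg K KS z] by auto
qed

lemma adm_zero: "p > 1 \<Longrightarrow> adm p S (\<lambda>x. 0)"
  using C1cI[of "\<lambda>x. 0" "\<lambda>x. 0" "{}" S] by (auto simp: adm_def en_def)

text \<open>Finitely many powers of bumps cover the compact set, and sums stay admissible by
  convexity of the density.\<close>

lemma adm_cover:
  fixes K :: "'a::euclidean_space set"
  assumes p: "p > 1" and S: "open S" and K: "compact K" "K \<subseteq> S"
  shows "\<exists>\<Phi>. adm p S \<Phi> \<and> (\<forall>x\<in>K. \<Phi> x > 0)"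
proof -
  define m where "m = nat \<lceil>p\<rceil>"
  have m: "real m \<ge> p" unfolding m_def by linarith
  have ex: "\<exists>\<Phi>. adm p S \<Phi> \<and> \<Phi> x > 0" if "x \<in> K" for x
  proof -
    have "x \<in> S" using that K(2) by blast
    then obtain e where e: "e > 0" "cball x e \<subseteq> S" using S by (auto simp: open_contains_cball)
    define r where "r = e / DIM('a)"
    have r: "r > 0" using e by (simp add: r_def)
    have D: "r * DIM('a) = e" by (simp add: r_def)
    define B where "B y = bump 1 r (- x + 1 *\<^sub>R y)" for y
    have sup: "tsupp (bump 1 r) \<subseteq> cball (0::'a) e"
    proof (rule tsupp_subset)
      fix y :: 'a assume "y \<notin> cball 0 e"
      then show "bump 1 r y = 0" using bump_C1c(1)[of 1 r y] D by auto
    qed simp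
    have B: "C1c S B" unfolding B_def
    proof (rule C1c_affine(1)[OF bump_C1c(3)])
      fix y assume "- x + 1 *\<^sub>R y \<in> tsupp (bump 1 r)"
      then have "- x + y \<in> cball 0 e" using sup by auto
      then have "y \<in> cball x e" by (simp add: dist_norm norm_minus_commute)
      then show "y \<in> S" using e by auto
    qed auto
    have "adm p S (\<lambda>y. B y ^ m)" by (rule adm_power[OF p B _ m]) (simp add: B_def bump_nonneg)
    moreover have "B x > 0" unfolding B_def using bump_pos[of "0::'a" r 1] r by simp
    ultimately show ?thesis by (intro exI[of _ "\<lambda>y. B y ^ m"]) auto
  qed
  then have "\<forall>x\<in>K. \<exists>\<Phi>. adm p S \<Phi> \<and> \<Phi> x > 0" by blast
  from bchoice[OF this] obtain \<Phi> where \<Phi>: "\<And>x. x \<in> K \<Longrightarrow> adm p S (\<Phi> x) \<and> \<Phi> x x > 0" by auto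
  have op: "open {y. \<Phi> x y > 0}" if "x \<in> K" for x
    using \<Phi>[OF that] by (intro open_Collect_less) (auto simp: adm_def intro: C1cD(2))
  have cov: "K \<subseteq> (\<Union>x\<in>K. {y. \<Phi> x y > 0})" using \<Phi> by auto
  obtain T where T: "T \<subseteq> K" "finite T" "K \<subseteq> (\<Union>x\<in>T. {y. \<Phi> x y > 0})"
    by (rule compactE_image[OF K(1) op cov])
  have "adm p S (\<lambda>y. \<Sum>x\<in>T. \<Phi> x y)" using T(2,1)
  proof (induction T rule: finite_induct)
    case empty then show ?case using adm_zero[OF p] by simp
  next
    case (insert x T)
    then show ?case using adm_lincomb(1)[OF p, of S "\<Phi> x" "\<lambda>y. \<Sum>x\<in>T. \<Phi> x y" 1 1] \<Phi>[of x] by simp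
  qed
  moreover have "(\<Sum>x\<in>T. \<Phi> x y) > 0" if "y \<in> K" for y
  proof -
    obtain x where x: "x \<in> T" "\<Phi> x y > 0" using T(3) \<open>y \<in> K\<close> by auto
    have "0 \<le> \<Phi> x' y" if "x' \<in> T" for x' using \<Phi>[of x'] T(1) that by (auto simp: adm_def)
    then show ?thesis using x T(2) by (intro sum_pos2[of T x]) auto
  qed
  ultimately show ?thesis by blast
qed

text \<open>Sigma-finiteness provides a positive integrable function even on unbounded sets; its
  root becomes the source term of the minimisation.\<close>

lemma ex_positive_L2:
  fixes S :: "'a::euclidean_space set"
  assumes "open S"
  shows "\<exists>f::'a \<Rightarrow> real. f \<in> borel_measurable (lebesgue_on S) \<and> (\<forall>x. f x > 0) \<and> integrable (lebesgue_on S) (\<lambda>x. (f x)\<^sup>2)"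
proof -
  obtain h :: "'a \<Rightarrow> ennreal" where h: "h \<in> borel_measurable lborel" "integral\<^sup>N lborel h \<noteq> \<infinity>" "\<And>x. 0 < h x \<and> h x < \<infinity>"
    using sigma_finite_measure.Ex_finite_integrable_function[OF sigma_finite_lborel] by auto
  define f where "f x = sqrt (enn2real (h x))" for x
  have [measurable]: "f \<in> borel_measurable borel" unfolding f_def using h(1) by simp
  have pos: "f x > 0" for x using h(3)[of x] by (simp add: f_def enn2real_positive_iff)
  have "(\<integral>\<^sup>+x. ennreal ((f x)\<^sup>2) \<partial>lborel) = integral\<^sup>N lborel h"
    by (intro nn_integral_cong) (use h(3) in \<open>simp add: f_def\<close>)
  then have "integrable lborel (\<lambda>x. (f x)\<^sup>2)"
    using h(2) by (intro integrableI_nonneg) (auto simp: top.not_eq_extremum)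
  then have "integrable lebesgue (\<lambda>x. (f x)\<^sup>2)" by (subst integrable_completion) auto
  then have "integrable (lebesgue_on S) (\<lambda>x. (f x)\<^sup>2)"
    using assms by (intro integrable_restrict_space[THEN iffD2] integrable_mult_indicator) auto
  then show ?thesis using pos borel_measurable_lebesgue_on[of f S] by auto
qed

section \<open>Almost everywhere convergence from summable defects\<close>

lemma AE_tendsto_zero_geometric:
  fixes h :: "nat \<Rightarrow> 'b \<Rightarrow> real"
  assumes h: "\<And>k. integrable M (h k)" "\<And>k. AE x in M. h k x \<ge> 0" "\<And>k. integral\<^sup>L M (h k) \<le> B * (1/2)^k"
  shows "AE x in M. (\<lambda>k. h k x) \<longlonglongrightarrow> 0"
proof -
  have all: "AE x in M. \<forall>k. h k x \<ge> 0" using h(2) by (simp add: AE_all_countable)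
  have [measurable]: "h k \<in> borel_measurable M" for k using h(1)[of k] by simp
  have B: "B \<ge> 0" using h(3)[of 0] integral_nonneg_AE[OF h(2)[of 0]] by simp
  \<comment> \<open>Borel-Cantelli in integral form: the series has finite integral, so it converges
    at almost every point and its terms tend to zero.\<close>
  have "(\<integral>\<^sup>+x. (\<Sum>k. ennreal (h k x)) \<partial>M) = (\<Sum>k. \<integral>\<^sup>+x. ennreal (h k x) \<partial>M)"
    by (rule nn_integral_suminf) auto
  also have "\<dots> = (\<Sum>k. ennreal (integral\<^sup>L M (h k)))"
    using nn_integral_eq_integral[OF h(1,2)] by simp
  also have "\<dots> \<le> (\<Sum>k. ennreal (B * (1/2)^k))"
    by (intro suminf_le ennreal_leI h(3)) auto
  also have "\<dots> = ennreal (\<Sum>k. B * (1/2)^k)"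
    using B by (intro suminf_ennreal2) (auto intro!: summable_mult summable_geometric)
  also have "\<dots> < \<infinity>" by simp
  finally have "(\<integral>\<^sup>+x. (\<Sum>k. ennreal (h k x)) \<partial>M) \<noteq> \<infinity>" by simp
  then have "AE x in M. (\<Sum>k. ennreal (h k x)) \<noteq> \<infinity>"
    by (intro nn_integral_PInf_AE) auto
  then show ?thesis using all
  proof eventually_elim
    case (elim x)
    then have "summable (\<lambda>k. h k x)" by (intro summable_suminf_not_top) auto
    then show ?case by (rule summable_LIMSEQ_zero)
  qed
qed

lemma convergent_geometric:
  fixes a :: "nat \<Rightarrow> 'b::banach"
  assumes "eventually (\<lambda>k. norm (a (Suc k) - a k) \<le> c * (1/2)^k) sequentially"
  shows "convergent a"
proof -
  have "summable (\<lambda>k. a (Suc k) - a k)"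
    by (rule summable_comparison_test_ev[OF assms]) (intro summable_mult summable_geometric, simp)
  then have "convergent (\<lambda>n. \<Sum>k<n. a (Suc k) - a k)" by (simp add: summable_iff_convergent)
  then have "convergent (\<lambda>n. a n - a 0)" by (simp add: sum_lessThan_telescope)
  then show ?thesis using convergent_add[OF _ convergent_const[of "a 0"]] by fastforce
qed

text \<open>The rates fit together: values up to \<open>2^k\<close> let the concavity modulus
  degrade like \<open>4 * 2^Suc k\<close>, and a defect of \<open>(1/8)^k\<close> still leaves
  \<open>8 * ((1/2)^k)\<^sup>2\<close> for the squared increment of the roots. The increments are
  thus geometric.\<close>

lemma sqrt_sequence_convergent:
  fixes z :: "nat \<Rightarrow> real"
  assumes f: "f > 0" and z: "\<And>k. z k \<ge> 0"
    and ev1: "eventually (\<lambda>k. z k \<le> 2^k) sequentially"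
    and ev2: "eventually (\<lambda>k. f * (2 * sqrt ((z k + z (Suc k)) / 2) - sqrt (z k) - sqrt (z (Suc k))) \<le> (1/8)^k) sequentially"
  shows "convergent z"
proof -
  define a where "a k = sqrt (z k)" for k
  have a: "a k \<ge> 0" "(a k)\<^sup>2 = z k" for k using z[of k] by (auto simp: a_def)
  have ev1': "eventually (\<lambda>k. z (Suc k) \<le> 2^Suc k) sequentially"
    by (rule eventually_compose_filterlim[OF ev1 filterlim_Suc])
  have "eventually (\<lambda>k. norm (a (Suc k) - a k) \<le> sqrt (8 / f) * (1/2)^k) sequentially"
    using ev1 ev1' ev2
  proof eventually_elim
    case (elim k)
    have bd: "a j \<le> 2^j" if "z j \<le> 2^j" for j
    proof -
      have "(a j)\<^sup>2 \<le> (2^j)\<^sup>2" 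
        by (subst a(2), rule order_trans[OF that]) (simp add: power2_eq_square)
      then show ?thesis by (rule power2_le_imp_le) simp
    qed
    have K: "a k \<le> 2^Suc k" "a (Suc k) \<le> 2^Suc k" using bd[of k] bd[of "Suc k"] elim by (auto intro: order_trans)
    have "(a k - a (Suc k))\<^sup>2 / (4 * 2^Suc k) \<le> 2 * sqrt (((a k)\<^sup>2 + (a (Suc k))\<^sup>2) / 2) - a k - a (Suc k)"
      by (rule sqrt_midpoint_gap[OF a(1) a(1) K]) simp
    then have h: "(a k - a (Suc k))\<^sup>2 / (4 * 2^Suc k) \<le> 2 * sqrt ((z k + z (Suc k)) / 2) - sqrt (z k) - sqrt (z (Suc k))"
      unfolding a(2) by (simp only: a_def)
    have "f * ((a k - a (Suc k))\<^sup>2 / (4 * 2^Suc k)) \<le> f * (2 * sqrt ((z k + z (Suc k)) / 2) - sqrt (z k) - sqrt (z (Suc k)))"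
      by (rule mult_left_mono[OF h]) (use f in simp)
    also have "\<dots> \<le> (1/8)^k" by (rule elim)
    finally have "(a k - a (Suc k))\<^sup>2 \<le> (1/8)^k * (4 * 2^Suc k) / f" using f by (simp add: field_simps)
    also have "(1/8::real)^k * (4 * 2^Suc k) = 8 * ((1/2)^k)\<^sup>2"
    proof -
      have "(1/8::real)^k * 2^k = ((1/2)^k)\<^sup>2"
        by (simp add: power_mult_distrib[symmetric] power2_eq_square)
      then show ?thesis by simp
    qed
    finally have "(a k - a (Suc k))\<^sup>2 \<le> (sqrt (8 / f) * (1/2)^k)\<^sup>2" using f by (simp add: power_mult_distrib)
    then have "\<bar>a k - a (Suc k)\<bar> \<le> sqrt (8 / f) * (1/2)^k" using f by (subst (asm) power2_le_iff_abs_le) auto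
    then show ?case by simp
  qed
  then have "convergent a" by (rule convergent_geometric)
  then obtain L where "a \<longlonglongrightarrow> L" by (auto simp: convergent_def)
  then have "(\<lambda>k. (a k)\<^sup>2) \<longlonglongrightarrow> L\<^sup>2" by (rule tendsto_power)
  then show ?thesis unfolding a(2) by (auto simp: convergent_def)
qed

text \<open>Since \<open>z\<close> tends to a positive limit, the weights tend to 1/2. Were two
  consecutive vectors \<open>(1/2)^k\<close> apart, their energy defect would be at least
  \<open>\<alpha> * L * c k\<close>, more than the permitted \<open>c k * (1/2)^k\<close> for large
  \<open>k\<close>. The radius \<open>4^Suc k\<close> accommodates both of them.\<close>

lemma log_gradient_sequence_convergent:
  fixes F :: "nat \<Rightarrow> 'a::euclidean_space" and z c :: "nat \<Rightarrow> real"
  assumes p: "p > 1" and \<alpha>: "\<alpha> > 0" and L: "L > 0" and zL: "z \<longlonglongrightarrow> L" and c: "\<And>k. c k > 0"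
    and cgap: "\<And>k \<theta> (a::'a) b. 1/4 \<le> \<theta> \<Longrightarrow> \<theta> \<le> 3/4 \<Longrightarrow> norm a \<le> 4^Suc k \<Longrightarrow> norm b \<le> 4^Suc k \<Longrightarrow> norm (a - b) \<ge> (1/2)^k
        \<Longrightarrow> gap p \<theta> a b \<ge> c k"
    and ev1: "eventually (\<lambda>k. z k * norm (F k) powr p \<le> 2^k) sequentially"
    and ev2: "eventually (\<lambda>k. \<alpha> * ((z k + z (Suc k)) * gap p (z k / (z k + z (Suc k))) (F k) (F (Suc k))) \<le> c k * (1/2)^k) sequentially"
  shows "convergent F"
proof -
  have zS: "(\<lambda>k. z (Suc k)) \<longlonglongrightarrow> L" using zL by (rule LIMSEQ_Suc)
  have t: "(\<lambda>k. z k / (z k + z (Suc k))) \<longlonglongrightarrow> L / (L + L)" using L by (intro tendsto_intros zL zS) auto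
  then have t: "(\<lambda>k. z k / (z k + z (Suc k))) \<longlonglongrightarrow> 1/2" using L by simp
  have e1: "eventually (\<lambda>k. z k > L/2) sequentially" using order_tendstoD(1)[OF zL, of "L/2"] L by simp
  have e2: "eventually (\<lambda>k. z (Suc k) > L/2) sequentially" using order_tendstoD(1)[OF zS, of "L/2"] L by simp
  have e3: "eventually (\<lambda>k. z k / (z k + z (Suc k)) > 1/4) sequentially" using order_tendstoD(1)[OF t, of "1/4"] by simp
  have e4: "eventually (\<lambda>k. z k / (z k + z (Suc k)) < 3/4) sequentially" using order_tendstoD(2)[OF t, of "3/4"] by simp
  have p0: "(\<lambda>k. (1/2::real)^k) \<longlonglongrightarrow> 0" by (rule LIMSEQ_power_zero) simp
  have e5: "eventually (\<lambda>k. (1/2::real)^k < L/2) sequentially" using order_tendstoD(2)[OF p0, of "L/2"] L by simp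
  have e6: "eventually (\<lambda>k. (1/2::real)^k < \<alpha> * L) sequentially" using order_tendstoD(2)[OF p0, of "\<alpha> * L"] L \<alpha> by simp
  \<comment> \<open>The lower bound \<open>L/2\<close> on \<open>z k\<close> is traded for
    \<open>(1/2)^k\<close>, so the growth bound does not depend on the unknown limit; this allows
    the moduli \<open>c k\<close> to be fixed before the sequence is constructed.\<close>
  have Fb: "norm (F k) \<le> 4^k" if "z k * norm (F k) powr p \<le> 2^k" "z k > L/2" "(1/2::real)^k < L/2" for k
  proof (cases "norm (F k) \<le> 1")
    case True
    show ?thesis by (rule order_trans[OF True one_le_power]) simp
  next
    case False
    have "(1/2)^k * norm (F k) powr p \<le> z k * norm (F k) powr p"
      using that by (intro mult_right_mono) auto
    then have "(1/2)^k * norm (F k) powr p \<le> 2^k" using that by linarith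
    then have "norm (F k) powr p \<le> 2^k * 2^k" by (simp add: field_simps power_one_over)
    also have "\<dots> = 4^k" by (simp add: power_mult_distrib[symmetric])
    finally have "norm (F k) powr p \<le> 4^k" .
    moreover have "norm (F k) powr 1 \<le> norm (F k) powr p" using False p by (intro powr_mono) auto
    ultimately show ?thesis using False by simp
  qed
  have ev1': "eventually (\<lambda>k. z (Suc k) * norm (F (Suc k)) powr p \<le> 2^Suc k) sequentially"
    by (rule eventually_compose_filterlim[OF ev1 filterlim_Suc])
  have "eventually (\<lambda>k. norm (F (Suc k) - F k) \<le> 1 * (1/2)^k) sequentially"
    using ev1 ev1' ev2 e1 e2 e3 e4 e5 e6
  proof eventually_elim
    case (elim k)
    have f1: "norm (F k) \<le> 4^Suc k" using Fb[of k] elim by (auto intro: order_trans)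
    have "(0::real) < (1/2)^k" by simp
    with elim(8) have "(1/2::real)^Suc k < L/2" unfolding power_Suc by linarith
    then have f2: "norm (F (Suc k)) \<le> 4^Suc k" using Fb[of "Suc k"] elim by simp
    show ?case
    proof (rule ccontr)
      assume "\<not> ?case"
      then have "norm (F k - F (Suc k)) \<ge> (1/2)^k" by (simp add: norm_minus_commute)
      then have g: "gap p (z k / (z k + z (Suc k))) (F k) (F (Suc k)) \<ge> c k"
        using cgap[OF _ _ f1 f2] elim by simp
      have "\<alpha> * (L * c k) \<le> \<alpha> * ((z k + z (Suc k)) * gap p (z k / (z k + z (Suc k))) (F k) (F (Suc k)))"
        using \<alpha> L c[of k] elim g by (intro mult_left_mono mult_mono) auto
      also have "\<dots> \<le> c k * (1/2)^k" by (rule elim)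
      finally have "c k * (\<alpha> * L) \<le> c k * (1/2)^k" by (simp add: mult_ac)
      then show False using c[of k] elim(9) by simp
    qed
  qed
  then show ?thesis by (rule convergent_geometric)
qed

section \<open>Minimisation\<close>


lemma open_compact_exhaustion:
  fixes S :: "'a::euclidean_space set"
  assumes "open S"
  shows "\<exists>C::nat \<Rightarrow> 'a set. (\<forall>n. compact (C n)) \<and> (\<forall>n. C n \<subseteq> S) \<and> \<Union>(range C) = S \<and>
    (\<forall>K. compact K \<longrightarrow> K \<subseteq> S \<longrightarrow> (\<exists>N. \<forall>n\<ge>N. K \<subseteq> C n))"
proof (rule open_Union_compact_subsets[OF assms])
  fix C :: "nat \<Rightarrow> 'a set"
  assume "\<And>n. compact (C n)" "\<And>n. C n \<subseteq> S" "\<Union>(range C) = S"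
    "\<And>K. compact K \<Longrightarrow> K \<subseteq> S \<Longrightarrow> \<exists>N. \<forall>n\<ge>N. K \<subseteq> C n"
  then show ?thesis by (intro exI[of _ C]) auto
qed

text \<open>A supersolution is to be built at level \<open>l\<close>, while the Rayleigh inequality
  holds at \<open>l + \<epsilon>\<close>. The positive square-integrable \<open>f\<close> is the
  source of the auxiliary variational problem.\<close>

locale rayleigh_bound =
  fixes p \<alpha> l \<epsilon> C0 :: real and \<Omega> :: "'a::euclidean_space set" and V f :: "'a \<Rightarrow> real"
  assumes p: "p > 1" and Om: "open \<Omega>" and V: "Linf_loc \<Omega> V"
    and Vlow: "AE x in lebesgue_on \<Omega>. - C0 \<le> V x" and al: "\<alpha> > 0" and ep: "\<epsilon> > 0"
    and ray: "\<And>\<zeta>. adm p \<Omega> \<zeta> \<Longrightarrow> (l + \<epsilon>) * integral\<^sup>L (lebesgue_on \<Omega>) \<zeta>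
        \<le> \<alpha> * energy p \<Omega> \<zeta> + integral\<^sup>L (lebesgue_on \<Omega>) (\<lambda>x. V x * \<zeta> x)"
    and fm: "f \<in> borel_measurable (lebesgue_on \<Omega>)" and fpos: "\<And>x. f x > 0"
    and f2: "integrable (lebesgue_on \<Omega>) (\<lambda>x. (f x)\<^sup>2)"
begin

abbreviation "M \<equiv> lebesgue_on \<Omega>"

text \<open>With \<open>\<zeta> = u\<^sup>p\<close> all terms of \<open>J\<close> are convex in \<open>\<zeta>\<close>, the last one strictly; its infinite slope at
  \<open>\<zeta> = 0\<close> forces the minimiser to be positive.\<close>
definition J :: "('a \<Rightarrow> real) \<Rightarrow> real" where
  "J \<zeta> = \<alpha> * energy p \<Omega> \<zeta> + integral\<^sup>L M (\<lambda>x. (V x - l) * \<zeta> x) - 2 * integral\<^sup>L M (\<lambda>x. f x * sqrt (\<zeta> x))"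

definition J0 :: real where "J0 = Inf (J ` {\<zeta>. adm p \<Omega> \<zeta>})"

lemma sqrt_young: "t > 0 \<Longrightarrow> z \<ge> 0 \<Longrightarrow> 2 * (a * sqrt z) \<le> a\<^sup>2 / t + t * z"
proof -
  assume t: "t > 0" and z: "z \<ge> 0"
  have "0 \<le> (a / sqrt t - sqrt t * sqrt z)\<^sup>2" by simp
  also have "\<dots> = a\<^sup>2 / t + t * z - 2 * (a * sqrt z)"
    using t z by (simp add: power2_diff power_divide power_mult_distrib)
  finally show ?thesis by simp
qed

lemma integrable_f_sqrt:
  assumes "adm p \<Omega> \<zeta>" shows "integrable M (\<lambda>x. f x * sqrt (\<zeta> x))"
proof (rule Bochner_Integration.integrable_bound)
  note a = adm_lebesgue_on[OF Om assms]
  show "integrable M (\<lambda>x. (f x)\<^sup>2 + \<zeta> x)" using f2 a(3) by simp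
  show "(\<lambda>x. f x * sqrt (\<zeta> x)) \<in> borel_measurable M" using fm a(3) by simp
  show "AE x in M. norm (f x * sqrt (\<zeta> x)) \<le> norm ((f x)\<^sup>2 + \<zeta> x)"
  proof (rule AE_I2)
    fix x
    have "0 \<le> f x * sqrt (\<zeta> x)" using fpos[of x] a(5)[of x] by simp
    moreover have "0 \<le> (f x)\<^sup>2 + \<zeta> x" using a(5)[of x] by simp
    ultimately show "norm (f x * sqrt (\<zeta> x)) \<le> norm ((f x)\<^sup>2 + \<zeta> x)"
      using sqrt_young[of 1 "\<zeta> x" "f x"] a(5)[of x] by simp
  qed
qed

lemma integrable_potential:
  assumes "adm p \<Omega> \<zeta>" shows "integrable M (\<lambda>x. (V x - l) * \<zeta> x)"
    "integral\<^sup>L M (\<lambda>x. (V x - l) * \<zeta> x) = integral\<^sup>L M (\<lambda>x. V x * \<zeta> x) - l * integral\<^sup>L M \<zeta>"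
  using adm_lebesgue_on(3)[OF Om assms] adm_lebesgue_on(6)[OF Om assms V] by (simp_all add: left_diff_distrib)

lemma f_sqrt_le:
  assumes "adm p \<Omega> \<zeta>" "t > 0"
  shows "2 * integral\<^sup>L M (\<lambda>x. f x * sqrt (\<zeta> x)) \<le> integral\<^sup>L M (\<lambda>x. (f x)\<^sup>2) / t + t * integral\<^sup>L M \<zeta>"
proof -
  note a = adm_lebesgue_on[OF Om assms(1)]
  have "2 * integral\<^sup>L M (\<lambda>x. f x * sqrt (\<zeta> x)) = integral\<^sup>L M (\<lambda>x. 2 * (f x * sqrt (\<zeta> x)))" by simp
  also have "\<dots> \<le> integral\<^sup>L M (\<lambda>x. (f x)\<^sup>2 / t + t * \<zeta> x)"
    using integrable_f_sqrt[OF assms(1)] f2 a(3) by (intro integral_mono sqrt_young assms(2) a(5)) auto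
  also have "\<dots> = integral\<^sup>L M (\<lambda>x. (f x)\<^sup>2) / t + t * integral\<^sup>L M \<zeta>" using f2 a(3) by simp
  finally show ?thesis .
qed

lemma J_lower:
  assumes "adm p \<Omega> \<zeta>"
  shows "\<epsilon> / 2 * integral\<^sup>L M \<zeta> - 2 / \<epsilon> * integral\<^sup>L M (\<lambda>x. (f x)\<^sup>2) \<le> J \<zeta>"
proof -
  \<comment> \<open>The weight \<open>\<epsilon> / 2\<close> lets the source consume half of the
    slack; the other half remains as coercivity in the mass.\<close>
  have "2 * integral\<^sup>L M (\<lambda>x. f x * sqrt (\<zeta> x)) \<le> integral\<^sup>L M (\<lambda>x. (f x)\<^sup>2) / (\<epsilon> / 2) + \<epsilon> / 2 * integral\<^sup>L M \<zeta>"
    by (rule f_sqrt_le[OF assms]) (use ep in simp)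
  moreover have "integral\<^sup>L M (\<lambda>x. (f x)\<^sup>2) / (\<epsilon> / 2) = 2 / \<epsilon> * integral\<^sup>L M (\<lambda>x. (f x)\<^sup>2)" by simp
  ultimately show ?thesis
    using ray[OF assms] unfolding J_def integrable_potential(2)[OF assms] by (simp add: algebra_simps)
qed

lemma integral_adm_nonneg: "adm p \<Omega> \<zeta> \<Longrightarrow> integral\<^sup>L M \<zeta> \<ge> 0"
  using adm_lebesgue_on(5)[OF Om] by simp

lemma J0_le:
  assumes "adm p \<Omega> \<zeta>" shows "J0 \<le> J \<zeta>"
  unfolding J0_def
proof (rule cInf_lower)
  show "bdd_below (J ` {\<zeta>. adm p \<Omega> \<zeta>})"
  proof (rule bdd_belowI)
    fix y assume "y \<in> J ` {\<zeta>. adm p \<Omega> \<zeta>}"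
    then obtain \<zeta> where z: "adm p \<Omega> \<zeta>" "y = J \<zeta>" by auto
    have "0 \<le> \<epsilon> / 2 * integral\<^sup>L M \<zeta>" using ep integral_adm_nonneg[OF z(1)] by simp
    then show "- (2 / \<epsilon> * integral\<^sup>L M (\<lambda>x. (f x)\<^sup>2)) \<le> y" using J_lower[OF z(1)] z(2) by linarith
  qed
qed (use assms in auto)

text \<open>Adding \<open>s * \<Phi> x\<close> costs at most a multiple of \<open>s\<close>, by
  subadditivity and homogeneity of the energy, while the gain in the square root term is kept
  exactly. This gain is what decides where the limit may vanish.\<close>

lemma J_add:
  assumes z: "adm p \<Omega> \<zeta>" and P: "adm p \<Omega> \<Phi>" and s: "s \<ge> 0"
  shows "adm p \<Omega> (\<lambda>x. \<zeta> x + s * \<Phi> x)"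
    "integrable M (\<lambda>x. f x * (sqrt (\<zeta> x + s * \<Phi> x) - sqrt (\<zeta> x)))"
    "J (\<lambda>x. \<zeta> x + s * \<Phi> x) + 2 * integral\<^sup>L M (\<lambda>x. f x * (sqrt (\<zeta> x + s * \<Phi> x) - sqrt (\<zeta> x)))
      \<le> J \<zeta> + s * (\<alpha> * energy p \<Omega> \<Phi> + integral\<^sup>L M (\<lambda>x. (V x - l) * \<Phi> x))"
proof -
  note L = adm_lincomb[OF p z P _ s, of 1]
  show A: "adm p \<Omega> (\<lambda>x. \<zeta> x + s * \<Phi> x)" using L(1) by simp
  note i = integrable_f_sqrt[OF A] integrable_f_sqrt[OF z]
  show "integrable M (\<lambda>x. f x * (sqrt (\<zeta> x + s * \<Phi> x) - sqrt (\<zeta> x)))"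
    using i by (simp add: right_diff_distrib)
  have f: "integral\<^sup>L M (\<lambda>x. f x * (sqrt (\<zeta> x + s * \<Phi> x) - sqrt (\<zeta> x)))
     = integral\<^sup>L M (\<lambda>x. f x * sqrt (\<zeta> x + s * \<Phi> x)) - integral\<^sup>L M (\<lambda>x. f x * sqrt (\<zeta> x))"
    using i by (simp add: right_diff_distrib)
  note az = adm_lebesgue_on[OF Om z] and aP = adm_lebesgue_on[OF Om P] and aA = adm_lebesgue_on[OF Om A]
  have "energy p \<Omega> (\<lambda>x. \<zeta> x + s * \<Phi> x) \<le> integral\<^sup>L M (\<lambda>x. en p (\<zeta> x) (grad \<zeta> x) + s * en p (\<Phi> x) (grad \<Phi> x))"
    using aA(1) az(1) aP(1) L(2) by (intro integral_mono) auto
  also have "\<dots> = energy p \<Omega> \<zeta> + s * energy p \<Omega> \<Phi>" using az(1) aP(1) by simp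
  finally have E: "\<alpha> * energy p \<Omega> (\<lambda>x. \<zeta> x + s * \<Phi> x) \<le> \<alpha> * (energy p \<Omega> \<zeta> + s * energy p \<Omega> \<Phi>)"
    using al by simp
  have "integral\<^sup>L M (\<lambda>x. (V x - l) * (\<zeta> x + s * \<Phi> x)) = integral\<^sup>L M (\<lambda>x. (V x - l) * \<zeta> x + s * ((V x - l) * \<Phi> x))"
    by (intro Bochner_Integration.integral_cong) (auto simp: algebra_simps)
  also have "\<dots> = integral\<^sup>L M (\<lambda>x. (V x - l) * \<zeta> x) + s * integral\<^sup>L M (\<lambda>x. (V x - l) * \<Phi> x)"
    using integrable_potential(1)[OF z] integrable_potential(1)[OF P] by simp
  finally show "J (\<lambda>x. \<zeta> x + s * \<Phi> x) + 2 * integral\<^sup>L M (\<lambda>x. f x * (sqrt (\<zeta> x + s * \<Phi> x) - sqrt (\<zeta> x)))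
      \<le> J \<zeta> + s * (\<alpha> * energy p \<Omega> \<Phi> + integral\<^sup>L M (\<lambda>x. (V x - l) * \<Phi> x))"
    using E unfolding J_def f by (simp add: algebra_simps)
qed

text \<open>A small multiple of a test function positive on \<open>K\<close> repairs zeros of a
  near-minimiser; \<open>s\<close> is chosen so that this costs at most half of
  \<open>\<delta>\<close>. Positivity on compacts is the prerequisite for perturbing the
  root.\<close>

lemma near_minimiser:
  assumes "\<delta> > 0" "compact K" "K \<subseteq> \<Omega>"
  shows "\<exists>\<zeta>. adm p \<Omega> \<zeta> \<and> J \<zeta> \<le> J0 + \<delta> \<and> (\<forall>x\<in>K. \<zeta> x > 0)"
proof -
  have "J ` {\<zeta>. adm p \<Omega> \<zeta>} \<noteq> {}" using adm_zero[OF p] by auto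
  moreover have "J0 < J0 + \<delta> / 2" using assms by simp
  ultimately have "\<exists>y\<in>J ` {\<zeta>. adm p \<Omega> \<zeta>}. y < J0 + \<delta> / 2"
    by (intro cInf_lessD) (auto simp: J0_def)
  then obtain \<zeta> where z: "adm p \<Omega> \<zeta>" "J \<zeta> < J0 + \<delta> / 2" by auto
  obtain \<Phi> where P: "adm p \<Omega> \<Phi>" "\<forall>x\<in>K. \<Phi> x > 0" using adm_cover[OF p Om assms(2,3)] by blast
  define A where "A = \<alpha> * energy p \<Omega> \<Phi> + integral\<^sup>L M (\<lambda>x. (V x - l) * \<Phi> x)"
  define s where "s = \<delta> / (2 * (\<bar>A\<bar> + 1))"
  have s: "s > 0" using assms by (simp add: s_def)
  have "s * A \<le> s * (\<bar>A\<bar> + 1)" using s by (intro mult_left_mono) auto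
  also have "\<dots> = \<delta> / 2" by (simp add: s_def field_simps)
  finally have sA: "s * A \<le> \<delta> / 2" .
  have n: "0 \<le> integral\<^sup>L M (\<lambda>x. f x * (sqrt (\<zeta> x + s * \<Phi> x) - sqrt (\<zeta> x)))"
    using fpos adm_lebesgue_on(5)[OF Om P(1)] s
    by (intro Bochner_Integration.integral_nonneg) (auto intro!: mult_nonneg_nonneg simp: less_imp_le)
  note JA = J_add[OF z(1) P(1), of s]
  have "J (\<lambda>x. \<zeta> x + s * \<Phi> x) \<le> J0 + \<delta>" using JA(3) s n z(2) sA unfolding A_def[symmetric] by linarith
  moreover have "\<zeta> x + s * \<Phi> x > 0" if "x \<in> K" for x
    using that P(2) s adm_lebesgue_on(5)[OF Om z(1), of x] by (simp add: add_nonneg_pos)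
  ultimately show ?thesis using JA(1) s by (intro exI[of _ "\<lambda>x. \<zeta> x + s * \<Phi> x"]) auto
qed

text \<open>Coercivity bounds the mass; the lower bound on \<open>V\<close> makes the potential term
  no worse than a multiple of the mass, and the bound on \<open>J\<close> then controls the
  energy.\<close>

lemma near_minimiser_bounds:
  "\<exists>B. \<forall>\<zeta>. adm p \<Omega> \<zeta> \<and> J \<zeta> \<le> J0 + 1 \<longrightarrow> integral\<^sup>L M \<zeta> \<le> B \<and> energy p \<Omega> \<zeta> \<le> B"
proof -
  define F2 where "F2 = integral\<^sup>L M (\<lambda>x. (f x)\<^sup>2)"
  define B1 where "B1 = 2 / \<epsilon> * (J0 + 1 + 2 / \<epsilon> * F2)"
  define B2 where "B2 = (J0 + 1 + F2 + (\<bar>C0\<bar> + \<bar>l\<bar> + 1) * B1) / \<alpha>"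
  have "integral\<^sup>L M \<zeta> \<le> B1 \<and> energy p \<Omega> \<zeta> \<le> B2" if z: "adm p \<Omega> \<zeta>" "J \<zeta> \<le> J0 + 1" for \<zeta>
  proof -
    note a = adm_lebesgue_on[OF Om z(1)]
    have "\<epsilon> / 2 * integral\<^sup>L M \<zeta> \<le> J0 + 1 + 2 / \<epsilon> * F2" using J_lower[OF z(1)] z(2) by (simp add: F2_def)
    then have "2 / \<epsilon> * (\<epsilon> / 2 * integral\<^sup>L M \<zeta>) \<le> B1" unfolding B1_def using ep by (intro mult_left_mono) auto
    then have 1: "integral\<^sup>L M \<zeta> \<le> B1" using ep by simp
    have "- (\<bar>C0\<bar> + \<bar>l\<bar>) * integral\<^sup>L M \<zeta> = integral\<^sup>L M (\<lambda>x. - (\<bar>C0\<bar> + \<bar>l\<bar>) * \<zeta> x)" by simp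
    also have "\<dots> \<le> integral\<^sup>L M (\<lambda>x. (V x - l) * \<zeta> x)"
    proof (rule integral_mono_AE)
      show "AE x in M. - (\<bar>C0\<bar> + \<bar>l\<bar>) * \<zeta> x \<le> (V x - l) * \<zeta> x"
        using Vlow
      proof eventually_elim
        case (elim x)
        then show ?case by (intro mult_right_mono a(5)) linarith
      qed
    qed (use a(3) integrable_potential(1)[OF z(1)] in auto)
    finally have v: "- (\<bar>C0\<bar> + \<bar>l\<bar>) * integral\<^sup>L M \<zeta> \<le> integral\<^sup>L M (\<lambda>x. (V x - l) * \<zeta> x)" .
    have "2 * integral\<^sup>L M (\<lambda>x. f x * sqrt (\<zeta> x)) \<le> F2 + integral\<^sup>L M \<zeta>"
      using f_sqrt_le[OF z(1), of 1] by (simp add: F2_def)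
    then have "\<alpha> * energy p \<Omega> \<zeta> \<le> J0 + 1 + F2 + (\<bar>C0\<bar> + \<bar>l\<bar> + 1) * integral\<^sup>L M \<zeta>"
      using z(2) v unfolding J_def by (simp add: algebra_simps)
    also have "\<dots> \<le> J0 + 1 + F2 + (\<bar>C0\<bar> + \<bar>l\<bar> + 1) * B1" using 1 by (intro add_left_mono mult_left_mono) auto
    finally have "energy p \<Omega> \<zeta> \<le> B2" unfolding B2_def using al by (simp add: pos_le_divide_eq mult.commute)
    then show ?thesis using 1 by simp
  qed
  then show ?thesis by (intro exI[of _ "max B1 B2"]) (auto simp: le_max_iff_disj)
qed

text \<open>The density of the defect of convexity of \<open>J\<close> at the midpoint. The
  potential term is linear and cancels; homogeneity turns the energy of the midpoint into half the
  energy of the sum.\<close>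

definition D :: "('a \<Rightarrow> real) \<Rightarrow> ('a \<Rightarrow> real) \<Rightarrow> 'a \<Rightarrow> real" where
  "D \<zeta> \<xi> x = \<alpha> / 2 * (en p (\<zeta> x) (grad \<zeta> x) + en p (\<xi> x) (grad \<xi> x) - en p (\<zeta> x + \<xi> x) (grad \<zeta> x + grad \<xi> x))
     + f x * (2 * sqrt ((\<zeta> x + \<xi> x) / 2) - sqrt (\<zeta> x) - sqrt (\<xi> x))"

lemma midpoint_deficit:
  assumes z: "adm p \<Omega> \<zeta>" and x: "adm p \<Omega> \<xi>"
  shows "integrable M (D \<zeta> \<xi>)" "integral\<^sup>L M (D \<zeta> \<xi>) \<le> (J \<zeta> + J \<xi>) / 2 - J0"
    "\<alpha> / 2 * (en p (\<zeta> y) (grad \<zeta> y) + en p (\<xi> y) (grad \<xi> y) - en p (\<zeta> y + \<xi> y) (grad \<zeta> y + grad \<xi> y)) \<ge> 0"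
    "f y * (2 * sqrt ((\<zeta> y + \<xi> y) / 2) - sqrt (\<zeta> y) - sqrt (\<xi> y)) \<ge> 0"
proof -
  note az = adm_lebesgue_on[OF Om z] and ax = adm_lebesgue_on[OF Om x]
  define \<mu> where "\<mu> = (\<lambda>x. 1/2 * \<zeta> x + 1/2 * \<xi> x)"
  have m: "adm p \<Omega> \<mu>" unfolding \<mu>_def by (rule adm_lincomb(1)[OF p z x]) auto
  have g: "grad \<mu> = (\<lambda>x. (1/2) *\<^sub>R grad \<zeta> x + (1/2) *\<^sub>R grad \<xi> x)"
    unfolding \<mu>_def by (rule C1c_lincomb(2)[OF az(4) ax(4)])
  have en\<mu>: "en p (\<mu> x) (grad \<mu> x) = 1/2 * en p (\<zeta> x + \<xi> x) (grad \<zeta> x + grad \<xi> x)" for x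
  proof -
    have e: "grad \<mu> x = (1/2) *\<^sub>R (grad \<zeta> x + grad \<xi> x)" "\<mu> x = 1/2 * (\<zeta> x + \<xi> x)"
      by (auto simp: g scaleR_add_right) (simp add: \<mu>_def)
    show ?thesis unfolding e using p by (intro en_scale) auto
  qed
  note am = adm_lebesgue_on[OF Om m]
  have s: "sqrt ((\<zeta> x + \<xi> x) / 2) = sqrt (\<mu> x)" for x by (simp add: \<mu>_def)
  have Deq: "D \<zeta> \<xi> = (\<lambda>x. \<alpha> / 2 * en p (\<zeta> x) (grad \<zeta> x) + \<alpha> / 2 * en p (\<xi> x) (grad \<xi> x) - \<alpha> * en p (\<mu> x) (grad \<mu> x)
      + 2 * (f x * sqrt (\<mu> x)) - f x * sqrt (\<zeta> x) - f x * sqrt (\<xi> x))"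
    unfolding D_def en\<mu> s by (auto simp: algebra_simps)
  note i = az(1) ax(1) am(1) integrable_f_sqrt[OF z] integrable_f_sqrt[OF x] integrable_f_sqrt[OF m]
  show "integrable M (D \<zeta> \<xi>)" unfolding Deq using i by simp
  have "integral\<^sup>L M (D \<zeta> \<xi>) = \<alpha> / 2 * energy p \<Omega> \<zeta> + \<alpha> / 2 * energy p \<Omega> \<xi> - \<alpha> * energy p \<Omega> \<mu>
     + 2 * integral\<^sup>L M (\<lambda>x. f x * sqrt (\<mu> x)) - integral\<^sup>L M (\<lambda>x. f x * sqrt (\<zeta> x)) - integral\<^sup>L M (\<lambda>x. f x * sqrt (\<xi> x))"
    unfolding Deq using i by simp
  moreover have "integral\<^sup>L M (\<lambda>x. (V x - l) * \<mu> x) = integral\<^sup>L M (\<lambda>x. 1/2 * ((V x - l) * \<zeta> x) + 1/2 * ((V x - l) * \<xi> x))"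
    by (intro Bochner_Integration.integral_cong) (auto simp: \<mu>_def field_simps)
  then have "integral\<^sup>L M (\<lambda>x. (V x - l) * \<mu> x) = 1/2 * integral\<^sup>L M (\<lambda>x. (V x - l) * \<zeta> x) + 1/2 * integral\<^sup>L M (\<lambda>x. (V x - l) * \<xi> x)"
    using integrable_potential(1)[OF z] integrable_potential(1)[OF x] by simp
  ultimately have "integral\<^sup>L M (D \<zeta> \<xi>) = (J \<zeta> + J \<xi>) / 2 - J \<mu>"
    unfolding J_def by (simp add: field_simps)
  then show "integral\<^sup>L M (D \<zeta> \<xi>) \<le> (J \<zeta> + J \<xi>) / 2 - J0" using J0_le[OF m] by simp
  show "\<alpha> / 2 * (en p (\<zeta> y) (grad \<zeta> y) + en p (\<xi> y) (grad \<xi> y) - en p (\<zeta> y + \<xi> y) (grad \<zeta> y + grad \<xi> y)) \<ge> 0"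
    using en_add[OF p az(5) adm_zero_grad[OF z] ax(5) adm_zero_grad[OF x], of y y] al by simp
  have "(sqrt (\<zeta> y) - sqrt (\<xi> y))\<^sup>2 / (4 * (sqrt (\<zeta> y) + sqrt (\<xi> y) + 1))
     \<le> 2 * sqrt (((sqrt (\<zeta> y))\<^sup>2 + (sqrt (\<xi> y))\<^sup>2) / 2) - sqrt (\<zeta> y) - sqrt (\<xi> y)"
    using az(5)[of y] ax(5)[of y] by (intro sqrt_midpoint_gap) (auto intro!: add_nonneg_pos)
  moreover have "0 \<le> (sqrt (\<zeta> y) - sqrt (\<xi> y))\<^sup>2 / (4 * (sqrt (\<zeta> y) + sqrt (\<xi> y) + 1))"
    using az(5)[of y] ax(5)[of y] by (intro divide_nonneg_nonneg) auto
  ultimately have "0 \<le> 2 * sqrt (((sqrt (\<zeta> y))\<^sup>2 + (sqrt (\<xi> y))\<^sup>2) / 2) - sqrt (\<zeta> y) - sqrt (\<xi> y)" by (rule order_trans[rotated])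
  then have "0 \<le> 2 * sqrt ((\<zeta> y + \<xi> y) / 2) - sqrt (\<zeta> y) - sqrt (\<xi> y)"
    using az(5)[of y] ax(5)[of y] by simp
  then show "f y * (2 * sqrt ((\<zeta> y + \<xi> y) / 2) - sqrt (\<zeta> y) - sqrt (\<xi> y)) \<ge> 0"
    using fpos[of y] by simp
qed

text \<open>Adding \<open>t * \<Phi> x\<close> to a near-minimiser changes energy and potential by
  at most a multiple of \<open>t\<close>, whereas on the zero set of the limit the source term gains
  a multiple of \<open>sqrt t\<close>. As \<open>t\<close> tends to 0 this contradicts minimality
  unless \<open>\<Phi>\<close> vanishes almost everywhere there.\<close>

lemma minimising_limit_positive:
  assumes z: "\<And>k. adm p \<Omega> (\<zeta> k)" "\<And>k. J (\<zeta> k) \<le> J0 + \<delta> k" and d: "\<delta> \<longlonglongrightarrow> 0"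
    and lim: "AE x in M. (\<lambda>k. \<zeta> k x) \<longlonglongrightarrow> Z x" and [measurable]: "Z \<in> borel_measurable M" and P: "adm p \<Omega> \<Phi>"
  shows "AE x in M. Z x = 0 \<longrightarrow> \<Phi> x = 0"
proof -
  note [measurable] = fm
  have [measurable]: "\<Phi> \<in> borel_measurable M" using adm_lebesgue_on(3)[OF Om P] by simp
  define A where "A = \<alpha> * energy p \<Omega> \<Phi> + integral\<^sup>L M (\<lambda>x. (V x - l) * \<Phi> x)"
  have P0: "\<Phi> x \<ge> 0" for x by (rule adm_lebesgue_on(5)[OF Om P])
  have z0: "\<zeta> k x \<ge> 0" for k x by (rule adm_lebesgue_on(5)[OF Om z(1)])
  have iP: "integrable M (\<lambda>x. f x * sqrt (\<Phi> x))" by (rule integrable_f_sqrt[OF P])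
  \<comment> \<open>The gain per \<open>sqrt t\<close> on the zero set of the limit; showing that
    its integral is zero is the goal.\<close>
  define W where "W x = (if Z x = 0 then f x * sqrt (\<Phi> x) else 0)" for x
  have W0: "W x \<ge> 0" for x using fpos[of x] P0[of x] by (simp add: W_def)
  have [measurable]: "W \<in> borel_measurable M" unfolding W_def by measurable
  have iW: "integrable M W"
    by (rule Bochner_Integration.integrable_bound[OF iP]) (auto simp: W_def)
  have key: "integral\<^sup>L M W * 2 \<le> sqrt t * (1 + A)" if t: "t > 0" for t
  proof -
    \<comment> \<open>From index \<open>N\<close> on the error of minimality is at most
      \<open>t\<close>, the order of the perturbation cost, and is absorbed into
      \<open>t * (1 + A)\<close>.\<close>
    obtain N where N: "\<And>k. k \<ge> N \<Longrightarrow> \<delta> k \<le> t"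
      using order_tendstoD(2)[OF d t] by (auto simp: eventually_sequentially intro: less_imp_le)
    define g where "g k x = f x * (sqrt (\<zeta> (k + N) x + t * \<Phi> x) - sqrt (\<zeta> (k + N) x))" for k x
    define h where "h x = f x * (sqrt (Z x + t * \<Phi> x) - sqrt (Z x))" for x
    have gi: "integrable M (g k)" for k unfolding g_def by (rule J_add(2)[OF z(1) P]) (use t in simp)
    have g0: "g k x \<ge> 0" for k x using fpos[of x] P0[of x] t by (simp add: g_def)
    have gb: "integral\<^sup>L M (g k) \<le> t * (1 + A) / 2" for k
    proof -
      have "J0 \<le> J (\<lambda>x. \<zeta> (k + N) x + t * \<Phi> x)"
        by (rule J0_le[OF J_add(1)[OF z(1) P]]) (use t in simp)
      then show ?thesis using J_add(3)[OF z(1)[of "k + N"] P, of t] z(2)[of "k + N"] N[of "k + N"] t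
        unfolding A_def[symmetric] g_def by (simp add: algebra_simps)
    qed
    have gl: "AE x in M. (\<lambda>k. g k x) \<longlonglongrightarrow> h x"
      using lim
    proof eventually_elim
      case (elim x)
      then have "(\<lambda>k. \<zeta> (k + N) x) \<longlonglongrightarrow> Z x" by (rule LIMSEQ_ignore_initial_segment)
      then show ?case unfolding g_def h_def by (intro tendsto_intros)
    qed
    have hm: "h \<in> borel_measurable M" unfolding h_def by measurable
    have H: "integrable M h" "integral\<^sup>L M h \<le> t * (1 + A) / 2"
      using Fatou_bound[OF gi _ gb hm gl] g0 by auto
    have Z0: "AE x in M. Z x \<ge> 0"
      using lim by eventually_elim (auto intro: LIMSEQ_le_const z0)
    have "sqrt t * integral\<^sup>L M W = integral\<^sup>L M (\<lambda>x. sqrt t * W x)" by simp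
    also have "\<dots> \<le> integral\<^sup>L M h"
    proof (rule integral_mono_AE)
      show "AE x in M. sqrt t * W x \<le> h x" using Z0
      proof eventually_elim
        case (elim x)
        then show ?case using fpos[of x] P0[of x] t by (auto simp: W_def h_def real_sqrt_mult)
      qed
    qed (use iW H in auto)
    also have "\<dots> \<le> sqrt t * (sqrt t * (1 + A) / 2)" using H(2) t by (simp add: mult.assoc[symmetric])
    finally show ?thesis using t by simp
  qed
  have "integral\<^sup>L M W * 2 \<le> 0"
  proof (rule tendsto_lowerbound)
    show "((\<lambda>t. sqrt t * (1 + A)) \<longlongrightarrow> 0) (at_right 0)"
      by (auto intro!: tendsto_eq_intros)
    show "eventually (\<lambda>t. integral\<^sup>L M W * 2 \<le> sqrt t * (1 + A)) (at_right 0)"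
      using key by (auto simp: eventually_at_filter)
  qed simp
  moreover have "integral\<^sup>L M W \<ge> 0" using W0 by simp
  ultimately have "integral\<^sup>L M W = 0" by simp
  then have "AE x in M. W x = 0" using integral_nonneg_eq_0_iff_AE[OF iW] W0 by auto
  then show ?thesis
  proof eventually_elim
    case (elim x)
    show ?case
    proof
      assume "Z x = 0"
      then have "f x * sqrt (\<Phi> x) = 0" using elim by (simp add: W_def)
      then show "\<Phi> x = 0" using fpos[of x] by (simp add: mult_eq_0_iff)
    qed
  qed
qed

text \<open>Midpoint defects of consecutive members are made summable relative to prescribed
  weights. At almost every point this forces geometric increments of the roots, then of the
  logarithmic gradients; the product of the two limits is the limit of the root gradients.\<close>

lemma minimising_sequence:
  "\<exists>\<zeta> \<delta> \<psi> G B. (\<forall>k. adm p \<Omega> (\<zeta> k)) \<and> (\<forall>k. \<delta> k > 0) \<and> \<delta> \<longlonglongrightarrow> 0 \<and> (\<forall>k. J (\<zeta> k) \<le> J0 + \<delta> k)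
    \<and> (\<forall>K. compact K \<and> K \<subseteq> \<Omega> \<longrightarrow> (\<exists>N. \<forall>k\<ge>N. \<forall>x\<in>K. \<zeta> k x > 0))
    \<and> \<psi> \<in> borel_measurable M \<and> G \<in> borel_measurable M \<and> (\<forall>x. \<psi> x > 0)
    \<and> (AE x in M. (\<lambda>k. \<zeta> k x powr (1/p)) \<longlonglongrightarrow> \<psi> x) \<and> (AE x in M. (\<lambda>k. rgrad p (\<zeta> k) x) \<longlonglongrightarrow> G x)
    \<and> (\<forall>k. integral\<^sup>L M (\<zeta> k) \<le> B \<and> energy p \<Omega> (\<zeta> k) \<le> B)"
proof -
  have "\<forall>k. \<exists>c>0. \<forall>\<theta> (a::'a) b. 1/4 \<le> \<theta> \<and> \<theta> \<le> 3/4 \<and> norm a \<le> 4^Suc k \<and> norm b \<le> 4^Suc k \<and> norm (a - b) \<ge> (1/2)^k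
     \<longrightarrow> gap p \<theta> a b \<ge> c"
    by (intro allI gap_uniform[OF p]) simp
  then obtain c where c: "\<And>k. c k > 0"
    "\<And>k \<theta> (a::'a) b. 1/4 \<le> \<theta> \<Longrightarrow> \<theta> \<le> 3/4 \<Longrightarrow> norm a \<le> 4^Suc k \<Longrightarrow> norm b \<le> 4^Suc k \<Longrightarrow> norm (a - b) \<ge> (1/2)^k
        \<Longrightarrow> gap p \<theta> a b \<ge> c k" by metis
  obtain Cc :: "nat \<Rightarrow> 'a set" where "(\<forall>n. compact (Cc n)) \<and> (\<forall>n. Cc n \<subseteq> \<Omega>) \<and> \<Union>(range Cc) = \<Omega> \<and>
      (\<forall>K. compact K \<longrightarrow> K \<subseteq> \<Omega> \<longrightarrow> (\<exists>N. \<forall>n\<ge>N. K \<subseteq> Cc n))"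
    using open_compact_exhaustion[OF Om] by blast
  then have Cc: "\<And>n. compact (Cc n)" "\<And>n. Cc n \<subseteq> \<Omega>" "\<Union>(range Cc) = \<Omega>"
      "\<And>K. compact K \<Longrightarrow> K \<subseteq> \<Omega> \<Longrightarrow> \<exists>N. \<forall>n\<ge>N. K \<subseteq> Cc n"
    by blast+
  \<comment> \<open>Two demands on one defect: \<open>(1/8)^k\<close> for its square root part and
    \<open>c k * (1/2)^k\<close> for its energy part.\<close>
  define \<eta> where "\<eta> k = min ((1/8)^k) (c k * (1/2)^k)" for k
  have \<eta>: "\<eta> k > 0" "\<eta> k \<le> (1/8)^k" "\<eta> k \<le> c k * (1/2)^k" "\<eta> k \<le> 1" for k
    using c(1)[of k] power_le_one[of "1/8::real" k] by (auto simp: \<eta>_def)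
  \<comment> \<open>The defect of members \<open>k\<close> and \<open>Suc k\<close> is at most the
    mean of their errors; the second entry makes \<open>\<delta> (Suc k)\<close> obey the bound of
    index \<open>k\<close> as well. At \<open>k = 0\<close> truncated subtraction repeats the first
    entry.\<close>
  define \<delta> where "\<delta> k = min (\<eta> k * (1/2)^k) (\<eta> (k - 1) * (1/2)^(k - 1))" for k
  have \<delta>: "\<delta> k > 0" "\<delta> k \<le> \<eta> k * (1/2)^k" "\<delta> (Suc k) \<le> \<eta> k * (1/2)^k" "\<delta> k \<le> (1/2)^k" "\<delta> k \<le> 1" for k
  proof -
    show "\<delta> k > 0" "\<delta> k \<le> \<eta> k * (1/2)^k" "\<delta> (Suc k) \<le> \<eta> k * (1/2)^k" using \<eta>(1) by (auto simp: \<delta>_def)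
    have "\<eta> k * (1/2)^k \<le> 1 * (1/2)^k" by (intro mult_right_mono \<eta>(4)) simp
    moreover have "\<delta> k \<le> \<eta> k * (1/2)^k" unfolding \<delta>_def by (rule min.cobounded1)
    ultimately show "\<delta> k \<le> (1/2)^k" by linarith
    also have "\<dots> \<le> 1" by (rule power_le_one) auto
    finally show "\<delta> k \<le> 1" .
  qed
  have \<delta>0: "\<delta> \<longlonglongrightarrow> 0"
  proof (rule Lim_null_comparison)
    show "eventually (\<lambda>k. norm (\<delta> k) \<le> (1/2)^k) sequentially"
      using \<delta>(1,4) by (intro always_eventually allI) (simp add: less_imp_le abs_of_pos)
    show "(\<lambda>k. (1/2::real)^k) \<longlonglongrightarrow> 0" by (rule LIMSEQ_power_zero) simp
  qed
  have "\<forall>k. \<exists>\<zeta>. adm p \<Omega> \<zeta> \<and> J \<zeta> \<le> J0 + \<delta> k \<and> (\<forall>x\<in>Cc k. \<zeta> x > 0)"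
    using near_minimiser[OF \<delta>(1) Cc(1,2)] by blast
  from choice[OF this] obtain \<zeta> where z: "\<And>k. adm p \<Omega> (\<zeta> k)" "\<And>k. J (\<zeta> k) \<le> J0 + \<delta> k" "\<And>k x. x \<in> Cc k \<Longrightarrow> \<zeta> k x > 0"
    by auto
  obtain B where B: "\<And>\<zeta>. adm p \<Omega> \<zeta> \<Longrightarrow> J \<zeta> \<le> J0 + 1 \<Longrightarrow> integral\<^sup>L M \<zeta> \<le> B \<and> energy p \<Omega> \<zeta> \<le> B"
    using near_minimiser_bounds by blast
  have "J (\<zeta> k) \<le> J0 + 1" for k using z(2)[of k] \<delta>(5)[of k] by linarith
  then have Bz: "integral\<^sup>L M (\<zeta> k) \<le> B \<and> energy p \<Omega> (\<zeta> k) \<le> B" for k using B z(1) by blast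
  note a = adm_lebesgue_on[OF Om z(1)]
  have [measurable]: "\<zeta> k \<in> borel_measurable M" "grad (\<zeta> k) \<in> borel_measurable M" for k
    using C1c_lebesgue_on(3,4)[OF Om a(4)] by auto
  define en\<^sub>k where "en\<^sub>k k x = en p (\<zeta> k x) (grad (\<zeta> k) x)" for k x
  have AE1: "AE x in M. (\<lambda>k. D (\<zeta> k) (\<zeta> (Suc k)) x / \<eta> k) \<longlonglongrightarrow> 0"
  proof (rule AE_tendsto_zero_geometric[where B=1])
    fix k
    note m = midpoint_deficit[OF z(1)[of k] z(1)[of "Suc k"]]
    show "integrable M (\<lambda>x. D (\<zeta> k) (\<zeta> (Suc k)) x / \<eta> k)" using m(1) by simp
    show "AE x in M. 0 \<le> D (\<zeta> k) (\<zeta> (Suc k)) x / \<eta> k"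
      using m(3,4) \<eta>(1)[of k] unfolding D_def by (intro AE_I2 divide_nonneg_pos add_nonneg_nonneg) auto
    have "integral\<^sup>L M (D (\<zeta> k) (\<zeta> (Suc k))) \<le> \<eta> k * (1/2)^k"
    proof -
      define q where "q = \<eta> k * (1/2)^k"
      show ?thesis using m(2) z(2)[of k] z(2)[of "Suc k"] \<delta>(2,3)[of k]
        unfolding q_def[symmetric] by (simp add: field_simps)
    qed
    then show "integral\<^sup>L M (\<lambda>x. D (\<zeta> k) (\<zeta> (Suc k)) x / \<eta> k) \<le> 1 * (1/2)^k"
      using \<eta>(1)[of k] by (simp add: pos_divide_le_eq mult.commute)
  qed
  \<comment> \<open>Masses bounded by \<open>B\<close> become summable with the factor
    \<open>(1/2)^k\<close>, so almost every point sees values of at most \<open>2^k\<close>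
    eventually; likewise for the energy densities.\<close>
  have AE2: "AE x in M. (\<lambda>k. (1/2)^k * \<zeta> k x) \<longlonglongrightarrow> 0"
    by (rule AE_tendsto_zero_geometric[where B=B]) (use a(3,5) Bz in \<open>auto simp: mult.commute mult_right_mono\<close>)
  have AE3: "AE x in M. (\<lambda>k. (1/2)^k * en\<^sub>k k x) \<longlonglongrightarrow> 0"
    unfolding en\<^sub>k_def
    by (rule AE_tendsto_zero_geometric[where B=B]) (use a(1,5) Bz in \<open>auto simp: en_nonneg mult.commute mult_right_mono\<close>)
  have half: "eventually (\<lambda>k. s k \<le> 2^k) sequentially" if "(\<lambda>k. (1/2)^k * s k) \<longlonglongrightarrow> 0" for s :: "nat \<Rightarrow> real"
    using order_tendstoD(2)[OF that, of 1] by (auto elim!: eventually_mono simp: power_one_over field_simps)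
  have evD: "eventually (\<lambda>k. D (\<zeta> k) (\<zeta> (Suc k)) x \<le> \<eta> k) sequentially" if "(\<lambda>k. D (\<zeta> k) (\<zeta> (Suc k)) x / \<eta> k) \<longlonglongrightarrow> 0" for x
    using order_tendstoD(2)[OF that, of 1] \<eta>(1) by (auto elim!: eventually_mono simp: pos_divide_less_eq)
  have conv: "AE x in M. convergent (\<lambda>k. \<zeta> k x)"
    using AE1 AE2
  proof eventually_elim
    case (elim x)
    show ?case
    proof (rule sqrt_sequence_convergent[OF fpos[of x] a(5) half[OF elim(2)]])
      show "eventually (\<lambda>k. f x * (2 * sqrt ((\<zeta> k x + \<zeta> (Suc k) x) / 2) - sqrt (\<zeta> k x) - sqrt (\<zeta> (Suc k) x)) \<le> (1/8)^k) sequentially"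
        using evD[OF elim(1)]
      proof eventually_elim
        case (elim k)
        then show ?case using midpoint_deficit(3)[OF z(1)[of k] z(1)[of "Suc k"], of x] \<eta>(2)[of k] unfolding D_def by linarith
      qed
    qed
  qed
  define Z where "Z x = lim (\<lambda>k. \<zeta> k x)" for x
  have Zm: "Z \<in> borel_measurable M" unfolding Z_def by measurable
  have Zlim: "AE x in M. (\<lambda>k. \<zeta> k x) \<longlonglongrightarrow> Z x"
    using conv by eventually_elim (simp add: Z_def convergent_LIMSEQ_iff)
  \<comment> \<open>Countably many test functions, positive on the members of the exhaustion,
    exclude zeros of the limit almost everywhere in the whole domain.\<close>
  have "\<forall>n. \<exists>\<Phi>. adm p \<Omega> \<Phi> \<and> (\<forall>x\<in>Cc n. \<Phi> x > 0)" using adm_cover[OF p Om Cc(1,2)] by blast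
  from choice[OF this] obtain \<Phi> where \<Phi>: "\<And>n. adm p \<Omega> (\<Phi> n)" "\<And>n x. x \<in> Cc n \<Longrightarrow> \<Phi> n x > 0" by auto
  have "AE x in M. Z x = 0 \<longrightarrow> \<Phi> n x = 0" for n
    by (rule minimising_limit_positive[OF z(1,2) \<delta>0 Zlim Zm \<Phi>(1)])
  then have "AE x in M. \<forall>n. Z x = 0 \<longrightarrow> \<Phi> n x = 0" by (subst AE_all_countable) blast
  then have Zpos: "AE x in M. Z x > 0"
    using Zlim AE_space
  proof eventually_elim
    case (elim x)
    then have "x \<in> \<Omega>" by simp
    then obtain n where "x \<in> Cc n" using Cc(3) by blast
    then have "Z x \<noteq> 0" using \<Phi>(2)[of x n] elim(1) by force
    moreover have "Z x \<ge> 0" using elim(2) by (rule LIMSEQ_le_const) (use a(5) in auto)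
    ultimately show ?case by simp
  qed
  define F where "F k x = grad (\<zeta> k) x /\<^sub>R (p * \<zeta> k x)" for k x
  have convF: "AE x in M. convergent (\<lambda>k. F k x)"
    using AE1 AE3 Zlim Zpos
  proof eventually_elim
    case (elim x)
    show ?case
    proof (rule log_gradient_sequence_convergent[OF p _ elim(4,3) c])
      show "\<alpha> / 2 > 0" using al by simp
      show "eventually (\<lambda>k. \<zeta> k x * norm (F k x) powr p \<le> 2^k) sequentially"
        using half[OF elim(2)] by (simp add: en\<^sub>k_def en_def F_def)
      have e1: "eventually (\<lambda>k. \<zeta> k x > 0) sequentially" using order_tendstoD(1)[OF elim(3,4)] .
      have e2: "eventually (\<lambda>k. \<zeta> (Suc k) x > 0) sequentially" by (rule eventually_compose_filterlim[OF e1 filterlim_Suc])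
      show "eventually (\<lambda>k. \<alpha> / 2 * ((\<zeta> k x + \<zeta> (Suc k) x) * gap p (\<zeta> k x / (\<zeta> k x + \<zeta> (Suc k) x)) (F k x) (F (Suc k) x)) \<le> c k * (1/2)^k) sequentially"
        using evD[OF elim(1)] e1 e2
      proof eventually_elim
        case (elim k)
        have "\<alpha> / 2 * ((\<zeta> k x + \<zeta> (Suc k) x) * gap p (\<zeta> k x / (\<zeta> k x + \<zeta> (Suc k) x)) (F k x) (F (Suc k) x))
          = \<alpha> / 2 * (en p (\<zeta> k x) (grad (\<zeta> k) x) + en p (\<zeta> (Suc k) x) (grad (\<zeta> (Suc k)) x) - en p (\<zeta> k x + \<zeta> (Suc k) x) (grad (\<zeta> k) x + grad (\<zeta> (Suc k)) x))"
          unfolding F_def en_gap[OF p elim(2,3)] ..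
        then show ?case using elim(1) midpoint_deficit(4)[OF z(1)[of k] z(1)[of "Suc k"], of x] \<eta>(3)[of k] unfolding D_def by linarith
      qed
    qed auto
  qed
  \<comment> \<open>The default 1 on an exceptional null set makes the limit positive everywhere, as
    the definition of the eigenvalue asks.\<close>
  define \<psi> where "\<psi> x = (if Z x > 0 then Z x powr (1/p) else 1)" for x
  define G where "G x = lim (\<lambda>k. rgrad p (\<zeta> k) x)" for x
  have \<psi>m: "\<psi> \<in> borel_measurable M" unfolding \<psi>_def using Zm by measurable
  have Gm: "G \<in> borel_measurable M" unfolding G_def rgrad_def by measurable
  have \<psi>lim: "AE x in M. (\<lambda>k. \<zeta> k x powr (1/p)) \<longlonglongrightarrow> \<psi> x"
    using Zlim Zpos by eventually_elim (auto simp: \<psi>_def intro!: tendsto_intros)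
  have Glim: "AE x in M. (\<lambda>k. rgrad p (\<zeta> k) x) \<longlonglongrightarrow> G x"
    using \<psi>lim convF
  proof eventually_elim
    case (elim x)
    then have "convergent (\<lambda>k. (\<zeta> k x powr (1/p)) *\<^sub>R F k x)"
      unfolding convergent_def by (auto intro: tendsto_scaleR)
    then show ?case by (simp add: G_def rgrad_def F_def convergent_LIMSEQ_iff)
  qed
  have "\<exists>N. \<forall>k\<ge>N. \<forall>x\<in>K. \<zeta> k x > 0" if "compact K" "K \<subseteq> \<Omega>" for K
    using Cc(4)[OF that] z(3) by blast
  then show ?thesis using z(1,2) \<delta>(1) \<delta>0 \<psi>m Gm \<psi>lim Glim Bz
    by (intro exI[of _ \<zeta>] exI[of _ \<delta>] exI[of _ \<psi>] exI[of _ G] exI[of _ B]) (auto simp: \<psi>_def)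
qed

end

section \<open>Existence of supersolutions\<close>


lemma pflux_bound:
  fixes H v :: "'a::real_inner"
  shows "\<bar>norm H powr (p - 2) * (H \<bullet> v)\<bar> \<le> norm H powr (p - 1) * norm v"
proof (cases "H = 0")
  case False
  then have pw: "norm H powr (p - 2) * norm H = norm H powr (p - 1)" by (simp add: powr_mult_base mult.commute)
  have "\<bar>norm H powr (p - 2) * (H \<bullet> v)\<bar> = norm H powr (p - 2) * \<bar>H \<bullet> v\<bar>" by (simp add: abs_mult)
  also have "\<dots> \<le> norm H powr (p - 2) * (norm H * norm v)" by (intro mult_left_mono Cauchy_Schwarz_ineq2) simp
  also have "\<dots> = norm H powr (p - 1) * norm v" by (simp add: pw[symmetric])
  finally show ?thesis .
qed simp

text \<open>For \<open>p < 2\<close> the factor \<open>norm H powr (p - 2)\<close> is singular at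
  zero; there the bound by \<open>norm H powr (p - 1)\<close> takes the place of continuity.\<close>

lemma pflux_tendsto:
  fixes H :: "nat \<Rightarrow> 'a::real_inner"
  assumes p: "p > 1" and H: "H \<longlonglongrightarrow> G"
  shows "(\<lambda>k. norm (H k) powr (p - 2) * (H k \<bullet> v)) \<longlonglongrightarrow> norm G powr (p - 2) * (G \<bullet> v)"
proof (cases "G = 0")
  case False
  then show ?thesis by (intro tendsto_intros H) auto
next
  case True
  have "(\<lambda>k. norm (H k) powr (p - 1) * norm v) \<longlonglongrightarrow> 0 powr (p - 1) * norm v"
    using tendsto_norm[OF H] p True by (intro tendsto_intros tendsto_powr') auto
  then have "(\<lambda>k. norm (H k) powr (p - 1) * norm v) \<longlonglongrightarrow> 0" by simp
  then have "(\<lambda>k. norm (H k) powr (p - 2) * (H k \<bullet> v)) \<longlonglongrightarrow> 0"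
    by (rule Lim_null_comparison[rotated]) (use pflux_bound in \<open>auto intro!: always_eventually\<close>)
  then show ?thesis using True by simp
qed

lemma integrable_lebesgue_on_subset:
  fixes f :: "'a::euclidean_space \<Rightarrow> 'b::{banach, second_countable_topology}"
  assumes f: "integrable (lebesgue_on S) f" and K: "K \<subseteq> S" "K \<in> sets lebesgue" "S \<in> sets lebesgue"
  shows "integrable (lebesgue_on K) f"
proof -
  have "integrable lebesgue (\<lambda>x. indicator S x *\<^sub>R f x)" using f K(3) integrable_restrict_space[of S lebesgue f] by simp
  then have "integrable lebesgue (\<lambda>x. indicator K x *\<^sub>R (indicator S x *\<^sub>R f x))"
    by (rule integrable_mult_indicator[OF K(2)])
  moreover have "(\<lambda>x. indicator K x *\<^sub>R (indicator S x *\<^sub>R f x)) = (\<lambda>x. indicator K x *\<^sub>R f x)"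
    using K(1) by (auto intro!: ext simp: indicator_def)
  ultimately show ?thesis using K(2) integrable_restrict_space[of K lebesgue f] by simp
qed

lemma integrable_on_compact_lebesgue_on:
  fixes g :: "'a::euclidean_space \<Rightarrow> real"
  assumes S: "open S" and K: "compact K" "K \<subseteq> S" and g: "continuous_on K g"
  shows "integrable (lebesgue_on S) (\<lambda>x. indicator K x * g x)"
proof -
  have i: "integrable lborel (\<lambda>x. indicator K x * g x)" using borel_integrable_compact[OF K(1) g] by simp
  then have m: "(\<lambda>x. indicator K x * g x) \<in> borel_measurable borel" by simp
  show ?thesis using lebesgue_on_eq_lborel(1)[OF S m] i K(2) by (auto simp: indicator_def)
qed

lemma C1c_powr_integrable:
  fixes \<phi> :: "'a::euclidean_space \<Rightarrow> real"
  assumes S: "open S" and \<phi>: "C1c S \<phi>" and q: "q > 0"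
  shows "integrable (lebesgue_on S) (\<lambda>x. \<bar>\<phi> x\<bar> powr q)" "integrable (lebesgue_on S) (\<lambda>x. norm (grad \<phi> x) powr q)"
    "integrable (lebesgue_on S) (\<lambda>x. \<bar>grad \<phi> x \<bullet> i\<bar> powr q)"
proof -
  note I = integrable_on_compact_lebesgue_on[OF S C1cD(4,5)[OF \<phi>]]
  have c1: "continuous_on (tsupp \<phi>) (\<lambda>x. g x powr q)" if "continuous_on (tsupp \<phi>) g" "\<And>x. g x \<ge> 0" for g
    using q that by (intro continuous_on_powr' continuous_on_const) auto
  have c: "continuous_on (tsupp \<phi>) (\<lambda>x. \<bar>\<phi> x\<bar> powr q)" "continuous_on (tsupp \<phi>) (\<lambda>x. norm (grad \<phi> x) powr q)"
    "continuous_on (tsupp \<phi>) (\<lambda>x. \<bar>grad \<phi> x \<bullet> i\<bar> powr q)"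
    by (auto intro!: c1 continuous_intros C1cD(2,3)[OF \<phi>])
  have e: "(\<lambda>x. indicator (tsupp \<phi>) x * \<bar>\<phi> x\<bar> powr q) = (\<lambda>x. \<bar>\<phi> x\<bar> powr q)"
    "(\<lambda>x. indicator (tsupp \<phi>) x * norm (grad \<phi> x) powr q) = (\<lambda>x. norm (grad \<phi> x) powr q)"
    "(\<lambda>x. indicator (tsupp \<phi>) x * \<bar>grad \<phi> x \<bullet> i\<bar> powr q) = (\<lambda>x. \<bar>grad \<phi> x \<bullet> i\<bar> powr q)"
    by (rule ext; auto simp: indicator_def zero_off_tsupp grad_zero_off_tsupp)+
  show "integrable (lebesgue_on S) (\<lambda>x. \<bar>\<phi> x\<bar> powr q)" "integrable (lebesgue_on S) (\<lambda>x. norm (grad \<phi> x) powr q)"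
    "integrable (lebesgue_on S) (\<lambda>x. \<bar>grad \<phi> x \<bullet> i\<bar> powr q)"
    using I[OF c(1)] I[OF c(2)] I[OF c(3)] unfolding e by auto
qed

lemma root_integration_by_parts:
  fixes \<zeta> \<phi> :: "'a::euclidean_space \<Rightarrow> real"
  assumes S: "open S" and p: "p > 1" and z: "C1c S \<zeta>" and \<phi>: "C1c S \<phi>" and pos: "\<And>x. x \<in> tsupp \<phi> \<Longrightarrow> \<zeta> x > 0"
  shows "integral\<^sup>L (lebesgue_on S) (\<lambda>x. (grad \<phi> x \<bullet> i) * \<zeta> x powr (1/p))
     = - integral\<^sup>L (lebesgue_on S) (\<lambda>x. \<phi> x * (rgrad p \<zeta> x \<bullet> i))"
proof -
  have off: "x \<notin> tsupp \<phi>" if "x \<notin> S" for x using that C1cD(5)[OF \<phi>] by auto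
  have op: "open {x. \<zeta> x > 0}" using C1cD(2)[OF z] by (intro open_Collect_less) auto
  have [measurable]: "\<zeta> \<in> borel_measurable borel" "grad \<zeta> \<in> borel_measurable borel"
    "\<phi> \<in> borel_measurable borel" "grad \<phi> \<in> borel_measurable borel"
    using C1c_measurable[OF z] C1c_measurable[OF \<phi>] by auto
  have "integral\<^sup>L lborel (\<lambda>x. \<zeta> x powr (1/p) * (grad \<phi> x \<bullet> i)) = - integral\<^sup>L lborel (\<lambda>x. \<phi> x * (rgrad p \<zeta> x \<bullet> i))"
    by (rule integration_by_parts_C1c(3)[OF \<phi> op _ root_has_derivative[OF p C1cD(6)[OF z]] continuous_on_rgrad[OF z p]])
       (use pos in auto)
  moreover have "integral\<^sup>L (lebesgue_on S) (\<lambda>x. (grad \<phi> x \<bullet> i) * \<zeta> x powr (1/p)) = integral\<^sup>L lborel (\<lambda>x. (grad \<phi> x \<bullet> i) * \<zeta> x powr (1/p))"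
    by (rule lebesgue_on_eq_lborel(2)[OF S]) (auto simp: off grad_zero_off_tsupp)
  moreover have "integral\<^sup>L (lebesgue_on S) (\<lambda>x. \<phi> x * (rgrad p \<zeta> x \<bullet> i)) = integral\<^sup>L lborel (\<lambda>x. \<phi> x * (rgrad p \<zeta> x \<bullet> i))"
    unfolding rgrad_def
    by (rule lebesgue_on_eq_lborel(2)[OF S]) (auto simp: off zero_off_tsupp)
  ultimately show ?thesis by (simp add: mult.commute)
qed

context rayleigh_bound
begin

text \<open>Compare \<open>J\<close> at the function with perturbed root to the infimum and divide
  by \<open>t\<close>: the lack of minimality leaves the error \<open>\<delta> / t\<close>. The flux
  appears at the perturbed gradient because that is where convexity is used.\<close>

lemma almost_Euler_Lagrange:
  assumes z: "adm p \<Omega> \<zeta>" "J \<zeta> \<le> J0 + \<delta>" and \<phi>: "C1c \<Omega> \<phi>" "\<And>x. \<phi> x \<ge> 0" and t: "t > 0"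
    and pos: "\<forall>x\<in>tsupp \<phi>. \<zeta> x > 0"
  shows "0 \<le> \<alpha> * p * integral\<^sup>L M (\<lambda>x. norm (rgrad p \<zeta> x + t *\<^sub>R grad \<phi> x) powr (p - 2) * ((rgrad p \<zeta> x + t *\<^sub>R grad \<phi> x) \<bullet> grad \<phi> x))
    + integral\<^sup>L M (\<lambda>x. (V x - l) * (((\<zeta> x powr (1/p) + t * \<phi> x) powr p - \<zeta> x) / t)) + \<delta> / t"
proof -
  define H where "H x = rgrad p \<zeta> x + t *\<^sub>R grad \<phi> x" for x
  define \<zeta>' where "\<zeta>' = (\<lambda>x. (\<zeta> x powr (1/p) + t * \<phi> x) powr p)"
  have t0: "t \<ge> 0" using t by simp
  note R = adm_root_perturb[OF p z(1) \<phi> t0 pos, folded \<zeta>'_def]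
  note a = adm_lebesgue_on[OF Om z(1)] and a' = adm_lebesgue_on[OF Om R(1)]
  have [measurable]: "grad \<phi> \<in> borel_measurable M" "\<zeta> \<in> borel_measurable M" "grad \<zeta> \<in> borel_measurable M"
    using C1c_lebesgue_on[OF Om \<phi>(1)] C1c_lebesgue_on[OF Om a(4)] by auto
  have [measurable]: "H \<in> borel_measurable M" unfolding H_def rgrad_def by measurable
  define a1 where "a1 x = norm (H x) powr (p - 2) * (H x \<bullet> grad \<phi> x)" for x
  have a1i: "integrable M a1"
  proof (rule Bochner_Integration.integrable_bound)
    have "continuous_on (tsupp \<phi>) (\<lambda>x. norm (H x) powr (p - 1) * norm (grad \<phi> x))"
      unfolding H_def using p pos C1cD(3)[OF \<phi>(1)] continuous_on_subset[OF continuous_on_rgrad[OF a(4) p], of "tsupp \<phi>"]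
      by (intro continuous_on_powr' continuous_intros) auto
    then show "integrable M (\<lambda>x. indicator (tsupp \<phi>) x * (norm (H x) powr (p - 1) * norm (grad \<phi> x)))"
      by (rule integrable_on_compact_lebesgue_on[OF Om C1cD(4,5)[OF \<phi>(1)]])
    show "a1 \<in> borel_measurable M" unfolding a1_def by measurable
    show "AE x in M. norm (a1 x) \<le> norm (indicator (tsupp \<phi>) x * (norm (H x) powr (p - 1) * norm (grad \<phi> x)))"
    proof (rule AE_I2)
      fix x
      show "norm (a1 x) \<le> norm (indicator (tsupp \<phi>) x * (norm (H x) powr (p - 1) * norm (grad \<phi> x)))"
        using pflux_bound[of "H x" p "grad \<phi> x"] by (cases "x \<in> tsupp \<phi>") (auto simp: a1_def grad_zero_off_tsupp)
    qed
  qed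
  have "energy p \<Omega> \<zeta>' - energy p \<Omega> \<zeta> = integral\<^sup>L M (\<lambda>x. en p (\<zeta>' x) (grad \<zeta>' x) - en p (\<zeta> x) (grad \<zeta> x))"
    using a(1) a'(1) by simp
  also have "\<dots> \<le> integral\<^sup>L M (\<lambda>x. p * t * a1 x)"
  proof (rule integral_mono)
    show "integrable M (\<lambda>x. p * t * a1 x)" using a1i by simp
    fix x
    show "en p (\<zeta>' x) (grad \<zeta>' x) - en p (\<zeta> x) (grad \<zeta> x) \<le> p * t * a1 x"
    proof (cases "x \<in> tsupp \<phi>")
      case True
      \<comment> \<open>The tangent is taken at the perturbed gradient \<open>H x\<close>, which
        bounds the increase of the energy from above.\<close>
      have e: "H x \<bullet> (rgrad p \<zeta> x - H x) = - t * (H x \<bullet> grad \<phi> x)" by (simp add: H_def)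
      have "norm (H x) powr p + p * norm (H x) powr (p - 2) * (- t * (H x \<bullet> grad \<phi> x)) \<le> norm (rgrad p \<zeta> x) powr p"
        using norm_powr_tangent[OF p, of "H x" "rgrad p \<zeta> x"] unfolding e .
      moreover have "en p (\<zeta>' x) (grad \<zeta>' x) = norm (H x) powr p"
        using R(2)[OF True] unfolding \<zeta>'_def H_def by simp
      moreover have "en p (\<zeta> x) (grad \<zeta> x) = norm (rgrad p \<zeta> x) powr p"
        using en_rgrad[of p \<zeta> x] p a(5)[of x] by simp
      ultimately show ?thesis by (simp add: a1_def algebra_simps)
    next
      case False
      have "\<zeta>' x = \<zeta> x \<and> grad \<zeta>' x = grad \<zeta> x" using R(3)[OF False] unfolding \<zeta>'_def by simp
      then show ?thesis using False by (simp add: a1_def grad_zero_off_tsupp)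
    qed
  qed (use a(1) a'(1) in auto)
  finally have "\<alpha> * (energy p \<Omega> \<zeta>' - energy p \<Omega> \<zeta>) \<le> \<alpha> * (p * t * integral\<^sup>L M a1)" using al by simp
  then have E: "\<alpha> * energy p \<Omega> \<zeta>' \<le> \<alpha> * energy p \<Omega> \<zeta> + \<alpha> * (p * t * integral\<^sup>L M a1)" by (simp add: algebra_simps)
  \<comment> \<open>The perturbation raises the root, so the source term of \<open>J\<close> only
    decreases and can be discarded.\<close>
  have F: "integral\<^sup>L M (\<lambda>x. f x * sqrt (\<zeta> x)) \<le> integral\<^sup>L M (\<lambda>x. f x * sqrt (\<zeta>' x))"
  proof (intro integral_mono integrable_f_sqrt z(1) R(1))
    fix x
    have "\<zeta> x = (\<zeta> x powr (1/p)) powr p" using a(5)[of x] p by (simp add: powr_powr)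
    also have "\<dots> \<le> \<zeta>' x" unfolding \<zeta>'_def using \<phi>(2)[of x] t p by (intro powr_mono2) auto
    finally show "f x * sqrt (\<zeta> x) \<le> f x * sqrt (\<zeta>' x)" using fpos[of x] by simp
  qed
  note iV = integrable_potential(1)[OF R(1)] integrable_potential(1)[OF z(1)]
  have "(\<lambda>x. (V x - l) * ((\<zeta>' x - \<zeta> x) / t)) = (\<lambda>x. ((V x - l) * \<zeta>' x - (V x - l) * \<zeta> x) / t)"
    by (auto simp: right_diff_distrib diff_divide_distrib)
  then have Vt: "integral\<^sup>L M (\<lambda>x. (V x - l) * ((\<zeta>' x - \<zeta> x) / t))
     = (integral\<^sup>L M (\<lambda>x. (V x - l) * \<zeta>' x) - integral\<^sup>L M (\<lambda>x. (V x - l) * \<zeta> x)) / t"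
    using iV by simp
  have "0 \<le> \<alpha> * (p * t * integral\<^sup>L M a1) + (integral\<^sup>L M (\<lambda>x. (V x - l) * \<zeta>' x) - integral\<^sup>L M (\<lambda>x. (V x - l) * \<zeta> x)) + \<delta>"
    using J0_le[OF R(1)] z(2) E F unfolding J_def by linarith
  then have "0 \<le> (\<alpha> * (p * t * integral\<^sup>L M a1) + (integral\<^sup>L M (\<lambda>x. (V x - l) * \<zeta>' x) - integral\<^sup>L M (\<lambda>x. (V x - l) * \<zeta> x)) + \<delta>) / t"
    using t by simp
  also have "\<dots> = \<alpha> * p * integral\<^sup>L M a1 + integral\<^sup>L M (\<lambda>x. (V x - l) * ((\<zeta>' x - \<zeta> x) / t)) + \<delta> / t"
    unfolding Vt using t by (simp add: field_simps)
  finally show ?thesis by (simp add: a1_def[abs_def] H_def[abs_def] \<zeta>'_def)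
qed

text \<open>Both the weak gradient identity and the approximate Euler-Lagrange inequality hold along
  the sequence from some index on; Young's inequality and Fatou carry them to the limit, with
  \<open>p\<close> as exponent for the roots and their gradients and \<open>q = p / (p - 1)\<close>
  for fluxes and powers.\<close>

lemma supersolution_exists:
  "\<exists>\<psi> G. W1p_loc p \<Omega> \<psi> G \<and> (\<forall>x\<in>\<Omega>. \<psi> x > 0) \<and>
      (\<forall>\<phi>. test_fun \<Omega> \<phi> \<and> (\<forall>x. \<phi> x \<ge> 0) \<longrightarrow>
         \<alpha> * integral\<^sup>L M (\<lambda>x. norm (G x) powr (p - 2) * (G x \<bullet> grad \<phi> x))
         + integral\<^sup>L M (\<lambda>x. V x * \<psi> x powr (p - 1) * \<phi> x)
         \<ge> l * integral\<^sup>L M (\<lambda>x. \<psi> x powr (p - 1) * \<phi> x))"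
proof -
  obtain \<zeta> \<delta> \<psi> G B where z: "\<forall>k. adm p \<Omega> (\<zeta> k)" and \<delta>: "\<forall>k. \<delta> k > 0" "\<delta> \<longlonglongrightarrow> 0" and Jz: "\<forall>k. J (\<zeta> k) \<le> J0 + \<delta> k"
    and pos: "\<forall>K. compact K \<and> K \<subseteq> \<Omega> \<longrightarrow> (\<exists>N. \<forall>k\<ge>N. \<forall>x\<in>K. \<zeta> k x > 0)"
    and \<psi>m: "\<psi> \<in> borel_measurable M" and Gm: "G \<in> borel_measurable M" and \<psi>pos: "\<forall>x. \<psi> x > 0"
    and \<psi>lim: "AE x in M. (\<lambda>k. \<zeta> k x powr (1/p)) \<longlonglongrightarrow> \<psi> x" and Glim: "AE x in M. (\<lambda>k. rgrad p (\<zeta> k) x) \<longlonglongrightarrow> G x"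
    and B: "\<forall>k. integral\<^sup>L M (\<zeta> k) \<le> B \<and> energy p \<Omega> (\<zeta> k) \<le> B"
    using minimising_sequence by auto
  note [measurable] = \<psi>m Gm
  note a = adm_lebesgue_on[OF Om z[rule_format]]
  define q where "q = p / (p - 1)"
  have q: "q > 1" "q / (q - 1) = p" "(p - 1) * q = p" using p by (auto simp: q_def field_simps)
  have [measurable]: "\<zeta> k \<in> borel_measurable M" "grad (\<zeta> k) \<in> borel_measurable M" for k
    using C1c_lebesgue_on(3,4)[OF Om a(4)] by auto
  have [measurable]: "rgrad p (\<zeta> k) \<in> borel_measurable M" for k unfolding rgrad_def by measurable
  have up: "\<bar>\<zeta> k x powr (1/p)\<bar> powr p = \<zeta> k x" for k x using a(5)[of k x] p by (simp add: powr_powr)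
  have up2: "(\<zeta> k x powr (1/p)) powr p = \<zeta> k x" for k x using up[of k x] by simp
  have ge: "norm (rgrad p (\<zeta> k) x) powr p = en p (\<zeta> k x) (grad (\<zeta> k) x)" for k x
    using en_rgrad[of p "\<zeta> k" x] p a(5)[of k x] by simp
  have \<psi>p: "integrable M (\<lambda>x. \<bar>\<psi> x\<bar> powr p)"
  proof (rule Fatou_bound(1)[where g="\<lambda>k x. \<bar>\<zeta> k x powr (1/p)\<bar> powr p" and C=B])
    show "AE x in M. (\<lambda>k. \<bar>\<zeta> k x powr (1/p)\<bar> powr p) \<longlonglongrightarrow> \<bar>\<psi> x\<bar> powr p"
      using \<psi>lim
    proof eventually_elim
      case (elim x)
      show ?case using p by (intro tendsto_powr' tendsto_rabs elim tendsto_const) auto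
    qed
  qed (use B a(3) in \<open>auto simp: up2 a(5)\<close>)
  have Gp: "integrable M (\<lambda>x. norm (G x) powr p)"
  proof (rule Fatou_bound(1)[where g="\<lambda>k x. norm (rgrad p (\<zeta> k) x) powr p" and C=B])
    show "AE x in M. (\<lambda>k. norm (rgrad p (\<zeta> k) x) powr p) \<longlonglongrightarrow> norm (G x) powr p"
      using Glim by eventually_elim (use p in \<open>auto intro!: tendsto_powr' tendsto_norm\<close>)
  qed (use B a(1) in \<open>auto simp: ge en_nonneg a(5)\<close>)
  have Wp: "Lp_loc p \<Omega> \<psi>" "Lp_loc p \<Omega> (\<lambda>x. norm (G x))"
    unfolding Lp_loc_def using \<psi>p Gp Om
    by (auto intro!: integrable_lebesgue_on_subset[of \<Omega>] simp: borel_compact)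
  have wg: "weak_grad \<Omega> \<psi> G" unfolding weak_grad_def
  proof (intro allI impI ballI)
    fix \<phi> :: "'a \<Rightarrow> real" and i :: 'a
    assume tf: "test_fun \<Omega> \<phi>" and i: "i \<in> Basis"
    note \<phi> = test_fun_C1c[OF tf]
    have [measurable]: "\<phi> \<in> borel_measurable M" "grad \<phi> \<in> borel_measurable M" using C1c_lebesgue_on[OF Om \<phi>] by auto
    have q0: "q > 0" using q by simp
    have 1: "(\<lambda>k. integral\<^sup>L M (\<lambda>x. (grad \<phi> x \<bullet> i) * \<zeta> k x powr (1/p))) \<longlonglongrightarrow> integral\<^sup>L M (\<lambda>x. (grad \<phi> x \<bullet> i) * \<psi> x)"
    proof (rule weak_convergence_from_AE(4)[OF p _ _ _ \<psi>lim])
      show "integrable M (\<lambda>x. \<bar>\<zeta> k x powr (1/p)\<bar> powr p)" "integral\<^sup>L M (\<lambda>x. \<bar>\<zeta> k x powr (1/p)\<bar> powr p) \<le> B" for k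
        unfolding up using a(3) B by auto
      show "integrable M (\<lambda>x. \<bar>grad \<phi> x \<bullet> i\<bar> powr (p / (p - 1)))"
        using C1c_powr_integrable(3)[OF Om \<phi> q0, of i] unfolding q_def .
    qed measurable
    have nle: "\<bar>rgrad p (\<zeta> k) x \<bullet> i\<bar> powr p \<le> en p (\<zeta> k x) (grad (\<zeta> k) x)" for k x
      unfolding ge[symmetric] using p Basis_le_norm[OF i] by (intro powr_mono2) auto
    have ni: "integrable M (\<lambda>x. \<bar>rgrad p (\<zeta> k) x \<bullet> i\<bar> powr p)" for k
      by (rule Bochner_Integration.integrable_bound[OF a(1)[of k]])
         (use nle in \<open>auto intro: order_trans[OF _ abs_ge_self]\<close>)
    have nB: "integral\<^sup>L M (\<lambda>x. \<bar>rgrad p (\<zeta> k) x \<bullet> i\<bar> powr p) \<le> B" for k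
      using integral_mono[OF ni[of k] a(1)[of k] nle] B[rule_format, of k] by linarith
    have Gi: "AE x in M. (\<lambda>k. rgrad p (\<zeta> k) x \<bullet> i) \<longlonglongrightarrow> G x \<bullet> i"
      using Glim by eventually_elim (rule tendsto_inner[OF _ tendsto_const])
    have 2: "(\<lambda>k. integral\<^sup>L M (\<lambda>x. \<phi> x * (rgrad p (\<zeta> k) x \<bullet> i))) \<longlonglongrightarrow> integral\<^sup>L M (\<lambda>x. \<phi> x * (G x \<bullet> i))"
    proof (rule weak_convergence_from_AE(4)[OF p _ _ _ Gi ni nB])
      show "integrable M (\<lambda>x. \<bar>\<phi> x\<bar> powr (p / (p - 1)))"
        using C1c_powr_integrable(1)[OF Om \<phi> q0] unfolding q_def .
    qed measurable
    \<comment> \<open>Only from \<open>N\<close> on is the root of \<open>\<zeta> k\<close>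
      differentiable on the support, so that classical integration by parts applies.\<close>
    have "\<exists>N. \<forall>k\<ge>N. \<forall>x\<in>tsupp \<phi>. \<zeta> k x > 0" using pos[rule_format, of "tsupp \<phi>"] C1cD(4,5)[OF \<phi>] by simp
    then obtain N where N: "\<forall>k\<ge>N. \<forall>x\<in>tsupp \<phi>. \<zeta> k x > 0" ..
    have "eventually (\<lambda>k. - integral\<^sup>L M (\<lambda>x. \<phi> x * (rgrad p (\<zeta> k) x \<bullet> i)) = integral\<^sup>L M (\<lambda>x. (grad \<phi> x \<bullet> i) * \<zeta> k x powr (1/p))) sequentially"
      unfolding eventually_sequentially
    proof (intro exI[of _ N] allI impI)
      fix k assume "N \<le> k"
      then have "\<And>x. x \<in> tsupp \<phi> \<Longrightarrow> \<zeta> k x > 0" using N by blast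
      from root_integration_by_parts[OF Om p a(4)[of k] \<phi> this, of i]
      show "- integral\<^sup>L M (\<lambda>x. \<phi> x * (rgrad p (\<zeta> k) x \<bullet> i)) = integral\<^sup>L M (\<lambda>x. (grad \<phi> x \<bullet> i) * \<zeta> k x powr (1/p))" by simp
    qed
    then have "(\<lambda>k. integral\<^sup>L M (\<lambda>x. (grad \<phi> x \<bullet> i) * \<zeta> k x powr (1/p))) \<longlonglongrightarrow> - integral\<^sup>L M (\<lambda>x. \<phi> x * (G x \<bullet> i))"
      by (rule Lim_transform_eventually[OF tendsto_minus[OF 2]])
    then have "integral\<^sup>L M (\<lambda>x. (grad \<phi> x \<bullet> i) * \<psi> x) = - integral\<^sup>L M (\<lambda>x. \<phi> x * (G x \<bullet> i))"
      using LIMSEQ_unique[OF 1] by blast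
    then show "integral\<^sup>L M (\<lambda>x. \<psi> x * frechet_derivative \<phi> (at x) i) = - integral\<^sup>L M (\<lambda>x. (G x \<bullet> i) * \<phi> x)"
      by (simp add: frechet_eq_grad[OF C1cD(6)[OF \<phi>]] mult.commute)
  qed
  have EL: "\<alpha> * integral\<^sup>L M (\<lambda>x. norm (G x) powr (p - 2) * (G x \<bullet> grad \<phi> x))
         + integral\<^sup>L M (\<lambda>x. V x * \<psi> x powr (p - 1) * \<phi> x) \<ge> l * integral\<^sup>L M (\<lambda>x. \<psi> x powr (p - 1) * \<phi> x)"
    if tf: "test_fun \<Omega> \<phi>" and \<phi>0: "\<forall>x. \<phi> x \<ge> 0" for \<phi>
  proof -
    note \<phi> = test_fun_C1c[OF tf]
    define S where "S = tsupp \<phi>"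
    have Sm[measurable]: "S \<in> sets M"
    proof -
      have "S \<in> sets lebesgue" unfolding S_def using borel_closed[OF closed_tsupp[of \<phi>]] by simp
      then show ?thesis using C1cD(5)[OF \<phi>] Om by (subst sets_restrict_space_iff) (auto simp: S_def)
    qed
    have [measurable]: "\<phi> \<in> borel_measurable M" "grad \<phi> \<in> borel_measurable M" using C1c_lebesgue_on[OF Om \<phi>] by auto
    have [measurable]: "V \<in> borel_measurable M" using V by (simp add: Linf_loc_def)
    obtain b where b: "b \<ge> 0" "\<And>x. norm (\<phi> x) \<le> b" "\<And>x. norm (grad \<phi> x) \<le> b" using C1c_bounded[OF \<phi>] by metis
    have "\<exists>N. \<forall>k\<ge>N. \<forall>x\<in>tsupp \<phi>. \<zeta> k x > 0" using pos[rule_format, of "tsupp \<phi>"] C1cD(4,5)[OF \<phi>] by simp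
    then obtain N1 where N1: "\<forall>k\<ge>N1. \<forall>x\<in>tsupp \<phi>. \<zeta> k x > 0" ..
    obtain N2 where N2: "\<And>k. k \<ge> N2 \<Longrightarrow> \<delta> k \<le> 1"
      using order_tendstoD(2)[OF \<delta>(2), of 1] by (auto simp: eventually_sequentially intro: less_imp_le)
    define N where "N = max N1 N2"
    define Zk where "Zk k = \<zeta> (k + N)" for k
    \<comment> \<open>The step size balances the two errors: both the step and the quotient of
      \<open>\<delta>\<close> by the step equal \<open>t k\<close> and tend to zero.\<close>
    define t where "t k = sqrt (\<delta> (k + N))" for k
    have t: "t k > 0" "t k \<le> 1" for k using \<delta>(1) N2[of "k + N"] by (auto simp: t_def N_def)
    have t0: "t \<longlonglongrightarrow> 0" unfolding t_def
      using tendsto_real_sqrt[OF LIMSEQ_ignore_initial_segment[OF \<delta>(2), of N]] by simp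
    define H where "H k x = rgrad p (Zk k) x + t k *\<^sub>R grad \<phi> x" for k x
    define a1 where "a1 k x = norm (H k x) powr (p - 2) * (H k x \<bullet> grad \<phi> x)" for k x
    define u where "u k x = Zk k x powr (1/p)" for k x
    define b1 where "b1 k x = ((u k x + t k * \<phi> x) powr p - Zk k x) / t k" for k x
    have [measurable]: "Zk k \<in> borel_measurable M" "H k \<in> borel_measurable M" for k unfolding Zk_def H_def by measurable
    have [measurable]: "u k \<in> borel_measurable M" "a1 k \<in> borel_measurable M" "b1 k \<in> borel_measurable M" for k
      unfolding u_def a1_def b1_def by measurable
    have u0: "u k x \<ge> 0" for k x by (simp add: u_def)
    have upz: "u k x powr p = Zk k x" for k x using up[of "k + N" x] by (simp add: u_def Zk_def)
    have ulim: "AE x in M. (\<lambda>k. u k x) \<longlonglongrightarrow> \<psi> x"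
      using \<psi>lim unfolding u_def Zk_def by eventually_elim (rule LIMSEQ_ignore_initial_segment)
    have Hlim: "AE x in M. (\<lambda>k. H k x) \<longlonglongrightarrow> G x"
      using Glim
    proof eventually_elim
      case (elim x)
      have "(\<lambda>k. H k x) \<longlonglongrightarrow> G x + 0 *\<^sub>R grad \<phi> x" unfolding H_def Zk_def
        by (intro tendsto_intros t0 LIMSEQ_ignore_initial_segment[OF elim])
      then show ?case by simp
    qed
    have a1lim: "AE x in M. (\<lambda>k. a1 k x) \<longlonglongrightarrow> norm (G x) powr (p - 2) * (G x \<bullet> grad \<phi> x)"
      using Hlim unfolding a1_def by eventually_elim (rule pflux_tendsto[OF p])
    \<comment> \<open>Tangents at both ends enclose the difference quotient of the p-th power; this
      gives its limit and, below, its bound in \<open>L\<^sup>q\<close>.\<close>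
    have bb: "p * u k x powr (p - 1) * \<phi> x \<le> b1 k x" "b1 k x \<le> p * (u k x + t k * \<phi> x) powr (p - 1) * \<phi> x" for k x
    proof -
      have s: "u k x + t k * \<phi> x \<ge> 0" using u0[of k x] t(1)[of k] \<phi>0 by (intro add_nonneg_nonneg mult_nonneg_nonneg) auto
      have "u k x powr p + p * u k x powr (p - 1) * (u k x + t k * \<phi> x - u k x) \<le> (u k x + t k * \<phi> x) powr p"
        by (rule powr_tangent[OF p s u0])
      then show "p * u k x powr (p - 1) * \<phi> x \<le> b1 k x"
        unfolding b1_def upz using t(1)[of k] by (simp add: pos_le_divide_eq mult_ac)
      have "(u k x + t k * \<phi> x) powr p + p * (u k x + t k * \<phi> x) powr (p - 1) * (u k x - (u k x + t k * \<phi> x)) \<le> u k x powr p"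
        by (rule powr_tangent[OF p u0 s])
      then show "b1 k x \<le> p * (u k x + t k * \<phi> x) powr (p - 1) * \<phi> x"
        unfolding b1_def upz using t(1)[of k] by (simp add: pos_divide_le_eq mult_ac)
    qed
    have b1lim: "AE x in M. (\<lambda>k. b1 k x) \<longlonglongrightarrow> p * \<psi> x powr (p - 1) * \<phi> x"
      using ulim
    proof eventually_elim
      case (elim x)
      have \<psi>x: "\<psi> x \<noteq> 0" using \<psi>pos by (metis less_irrefl)
      have l1: "(\<lambda>k. p * u k x powr (p - 1) * \<phi> x) \<longlonglongrightarrow> p * \<psi> x powr (p - 1) * \<phi> x"
        using \<psi>x by (intro tendsto_intros elim) auto
      have "(\<lambda>k. p * (u k x + t k * \<phi> x) powr (p - 1) * \<phi> x) \<longlonglongrightarrow> p * (\<psi> x + 0 * \<phi> x) powr (p - 1) * \<phi> x"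
        using \<psi>x by (intro tendsto_intros elim t0) auto
      then have l2: "(\<lambda>k. p * (u k x + t k * \<phi> x) powr (p - 1) * \<phi> x) \<longlonglongrightarrow> p * \<psi> x powr (p - 1) * \<phi> x" by simp
      show ?case by (rule tendsto_sandwich[OF _ _ l1 l2]) (use bb in auto)
    qed
    have p1q: "(y powr (p - 1)) powr q = y powr p" for y by (simp add: powr_powr q(3))
    have a1q: "\<bar>a1 k x\<bar> powr q \<le> b powr q * (2 powr p * (en p (Zk k x) (grad (Zk k) x) + norm (grad \<phi> x) powr p))" for k x
    proof -
      have nH: "norm (H k x) \<le> norm (rgrad p (Zk k) x) + norm (grad \<phi> x)"
        unfolding H_def using norm_triangle_ineq[of "rgrad p (Zk k) x" "t k *\<^sub>R grad \<phi> x"] t[of k]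
          mult_right_mono[of "t k" 1 "norm (grad \<phi> x)"] by simp
      have "norm (H k x) powr p \<le> (norm (rgrad p (Zk k) x) + norm (grad \<phi> x)) powr p" using p nH by (intro powr_mono2) auto
      also have "\<dots> \<le> 2 powr p * (norm (rgrad p (Zk k) x) powr p + norm (grad \<phi> x) powr p)" using p by (intro powr_add_le) auto
      finally have hp: "norm (H k x) powr p \<le> 2 powr p * (en p (Zk k x) (grad (Zk k) x) + norm (grad \<phi> x) powr p)"
        unfolding Zk_def ge .
      have "\<bar>a1 k x\<bar> \<le> norm (H k x) powr (p - 1) * b"
        unfolding a1_def by (rule order_trans[OF pflux_bound]) (intro mult_left_mono b(3), simp)
      then have "\<bar>a1 k x\<bar> powr q \<le> (norm (H k x) powr (p - 1) * b) powr q" using q by (intro powr_mono2) auto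
      also have "\<dots> = b powr q * norm (H k x) powr p" using b(1) by (simp add: powr_mult p1q)
      also have "\<dots> \<le> b powr q * (2 powr p * (en p (Zk k x) (grad (Zk k) x) + norm (grad \<phi> x) powr p))"
        by (intro mult_left_mono hp) simp
      finally show ?thesis .
    qed
    have p0: "p > 0" using p by simp
    note gi = C1c_powr_integrable(2)[OF Om \<phi> p0] and fi = C1c_powr_integrable(1)[OF Om \<phi> p0]
    have zi: "integrable M (\<lambda>x. en p (Zk k x) (grad (Zk k) x))" "integrable M (Zk k)" for k unfolding Zk_def using a(1,3) by auto
    define A1 where "A1 = b powr q * (2 powr p * (B + integral\<^sup>L M (\<lambda>x. norm (grad \<phi> x) powr p)))"
    have a1d: "integrable M (\<lambda>x. b powr q * (2 powr p * (en p (Zk k x) (grad (Zk k) x) + norm (grad \<phi> x) powr p)))" for k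
      using zi gi by simp
    have a1i: "integrable M (\<lambda>x. \<bar>a1 k x\<bar> powr q)" for k
      by (rule Bochner_Integration.integrable_bound[OF a1d[of k]]) (use a1q[of k] in \<open>auto intro: order_trans[OF _ abs_ge_self]\<close>)
    have a1B: "integral\<^sup>L M (\<lambda>x. \<bar>a1 k x\<bar> powr q) \<le> A1" for k
    proof -
      have "integral\<^sup>L M (\<lambda>x. \<bar>a1 k x\<bar> powr q) \<le> integral\<^sup>L M (\<lambda>x. b powr q * (2 powr p * (en p (Zk k x) (grad (Zk k) x) + norm (grad \<phi> x) powr p)))"
        by (rule integral_mono[OF a1i a1d a1q])
      also have "\<dots> = b powr q * (2 powr p * (energy p \<Omega> (Zk k) + integral\<^sup>L M (\<lambda>x. norm (grad \<phi> x) powr p)))" using zi gi by simp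
      also have "\<dots> \<le> A1" unfolding A1_def Zk_def using B by (intro mult_left_mono add_right_mono) auto
      finally show ?thesis .
    qed
    have b1q: "\<bar>b1 k x\<bar> powr q \<le> (p * b) powr q * (2 powr p * (Zk k x + \<bar>\<phi> x\<bar> powr p))" for k x
    proof -
      have s0: "0 \<le> p * u k x powr (p - 1) * \<phi> x" using p \<phi>0 by simp
      have s: "u k x + t k * \<phi> x \<ge> 0" using u0[of k x] t(1)[of k] \<phi>0 by (intro add_nonneg_nonneg mult_nonneg_nonneg) auto
      have su: "u k x + t k * \<phi> x \<le> u k x + \<bar>\<phi> x\<bar>"
        using mult_right_mono[of "t k" 1 "\<phi> x"] t[of k] \<phi>0 by simp
      have "\<bar>b1 k x\<bar> \<le> p * (u k x + t k * \<phi> x) powr (p - 1) * \<phi> x" using bb[of k x] s0 by linarith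
      also have "\<dots> \<le> p * (u k x + t k * \<phi> x) powr (p - 1) * b" using b(2)[of x] p by (intro mult_left_mono) auto
      finally have "\<bar>b1 k x\<bar> powr q \<le> (p * b * (u k x + t k * \<phi> x) powr (p - 1)) powr q"
        using q by (intro powr_mono2) (auto simp: mult_ac)
      also have "\<dots> = (p * b) powr q * (u k x + t k * \<phi> x) powr p" using b(1) p by (simp add: powr_mult p1q)
      also have "\<dots> \<le> (p * b) powr q * (u k x + \<bar>\<phi> x\<bar>) powr p" using s su p by (intro mult_left_mono powr_mono2) auto
      also have "\<dots> \<le> (p * b) powr q * (2 powr p * (u k x powr p + \<bar>\<phi> x\<bar> powr p))"
        using u0[of k x] p by (intro mult_left_mono powr_add_le) auto
      finally show ?thesis unfolding upz .
    qed
    have b1d: "integrable M (\<lambda>x. (p * b) powr q * (2 powr p * (Zk k x + \<bar>\<phi> x\<bar> powr p)))" for k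
      using zi fi by simp
    define B1 where "B1 = (p * b) powr q * (2 powr p * (B + integral\<^sup>L M (\<lambda>x. \<bar>\<phi> x\<bar> powr p)))"
    have b1i: "integrable M (\<lambda>x. \<bar>b1 k x\<bar> powr q)" for k
      by (rule Bochner_Integration.integrable_bound[OF b1d[of k]]) (use b1q[of k] in \<open>auto intro: order_trans[OF _ abs_ge_self]\<close>)
    have b1B: "integral\<^sup>L M (\<lambda>x. \<bar>b1 k x\<bar> powr q) \<le> B1" for k
    proof -
      have "integral\<^sup>L M (\<lambda>x. \<bar>b1 k x\<bar> powr q) \<le> integral\<^sup>L M (\<lambda>x. (p * b) powr q * (2 powr p * (Zk k x + \<bar>\<phi> x\<bar> powr p)))"
        by (rule integral_mono[OF b1i b1d b1q])
      also have "\<dots> = (p * b) powr q * (2 powr p * (integral\<^sup>L M (Zk k) + integral\<^sup>L M (\<lambda>x. \<bar>\<phi> x\<bar> powr p)))" using zi fi by simp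
      also have "\<dots> \<le> B1" unfolding B1_def Zk_def using B by (intro mult_left_mono add_right_mono) auto
      finally show ?thesis .
    qed
    obtain CV where CV: "CV \<ge> 0" "AE x in M. x \<in> S \<longrightarrow> \<bar>V x\<bar> \<le> CV"
      using Linf_loc_bounded[OF V Om C1cD(4,5)[OF \<phi>]] unfolding S_def by blast
    have iS: "integrable M (\<lambda>x. indicator S x * c)" for c :: real
      unfolding S_def by (rule integrable_on_compact_lebesgue_on[OF Om C1cD(4,5)[OF \<phi>]]) simp
    \<comment> \<open>Cutting off at the support makes the potential bounded with compact support,
      hence an admissible dual function.\<close>
    define h where "h x = indicator S x * (V x - l)" for x
    have hi: "integrable M (\<lambda>x. \<bar>h x\<bar> powr p)"
    proof (rule Bochner_Integration.integrable_bound[OF iS[of "(CV + \<bar>l\<bar>) powr p"]])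
      show "AE x in M. norm (\<bar>h x\<bar> powr p) \<le> norm (indicator S x * (CV + \<bar>l\<bar>) powr p)"
        using CV(2)
      proof eventually_elim
        case (elim x)
        show ?case
        proof (cases "x \<in> S")
          case True
          then have "\<bar>V x - l\<bar> \<le> CV + \<bar>l\<bar>" using elim by auto
          then show ?thesis using True p by (auto simp: h_def intro!: powr_mono2)
        qed (simp add: h_def)
      qed
    qed (unfold h_def, measurable)
    have [measurable]: "h \<in> borel_measurable M" unfolding h_def by measurable
    have a1z: "indicator S x * a1 k x = a1 k x" for k x
      by (cases "x \<in> S") (auto simp: a1_def S_def grad_zero_off_tsupp)
    have Gz: "indicator S x * (norm (G x) powr (p - 2) * (G x \<bullet> grad \<phi> x)) = norm (G x) powr (p - 2) * (G x \<bullet> grad \<phi> x)" for x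
      by (cases "x \<in> S") (auto simp: S_def grad_zero_off_tsupp)
    \<comment> \<open>The factor \<open>grad \<phi>\<close> is already part of \<open>a1\<close>, so
      the dual function is just the indicator of the support.\<close>
    have L1: "(\<lambda>k. integral\<^sup>L M (a1 k)) \<longlonglongrightarrow> integral\<^sup>L M (\<lambda>x. norm (G x) powr (p - 2) * (G x \<bullet> grad \<phi> x))"
    proof -
      have "integrable M (\<lambda>x. \<bar>indicator S x\<bar> powr (q / (q - 1)))"
      proof -
        have "(\<lambda>x. \<bar>indicator S x :: real\<bar> powr (q / (q - 1))) = (\<lambda>x. indicator S x * 1)"
          by (rule ext) (auto simp: indicator_def)
        then show ?thesis using iS[of 1] by (simp only:)
      qed
      from weak_convergence_from_AE(4)[OF q(1) _ _ _ a1lim a1i a1B this]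
      show ?thesis unfolding a1z Gz by (auto simp: a1z Gz)
    qed
    have L2: "(\<lambda>k. integral\<^sup>L M (\<lambda>x. h x * b1 k x)) \<longlonglongrightarrow> integral\<^sup>L M (\<lambda>x. h x * (p * \<psi> x powr (p - 1) * \<phi> x))"
      by (rule weak_convergence_from_AE(4)[OF q(1) _ _ _ b1lim b1i b1B]) (use hi in \<open>auto simp: q(2)\<close>)
    have b1z: "h x * b1 k x = (V x - l) * b1 k x" for k x
    proof (cases "x \<in> S")
      case False
      then have "\<phi> x = 0" by (simp add: S_def zero_off_tsupp)
      then show ?thesis using upz[of k x] by (simp add: b1_def)
    qed (simp add: h_def)
    have main: "0 \<le> \<alpha> * p * integral\<^sup>L M (a1 k) + integral\<^sup>L M (\<lambda>x. h x * b1 k x) + t k" for k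
    proof -
      have "\<delta> (k + N) / t k = t k" using \<delta>(1) by (simp add: t_def real_div_sqrt less_imp_le)
      moreover have "\<forall>x\<in>tsupp \<phi>. \<zeta> (k + N) x > 0" using N1 by (simp add: N_def)
      note almost_Euler_Lagrange[OF z[rule_format, of "k + N"] Jz[rule_format] \<phi> \<phi>0[rule_format] t(1)[of k] this]
      ultimately have "0 \<le> \<alpha> * p * integral\<^sup>L M (a1 k) + integral\<^sup>L M (\<lambda>x. (V x - l) * b1 k x) + t k"
        unfolding a1_def H_def b1_def u_def Zk_def by simp
      then show ?thesis by (simp only: b1z)
    qed
    have "(\<lambda>k. \<alpha> * p * integral\<^sup>L M (a1 k) + integral\<^sup>L M (\<lambda>x. h x * b1 k x) + t k)
       \<longlonglongrightarrow> \<alpha> * p * integral\<^sup>L M (\<lambda>x. norm (G x) powr (p - 2) * (G x \<bullet> grad \<phi> x)) + integral\<^sup>L M (\<lambda>x. h x * (p * \<psi> x powr (p - 1) * \<phi> x)) + 0"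
      by (intro tendsto_intros L1 L2 t0)
    then have lim: "0 \<le> \<alpha> * p * integral\<^sup>L M (\<lambda>x. norm (G x) powr (p - 2) * (G x \<bullet> grad \<phi> x)) + integral\<^sup>L M (\<lambda>x. h x * (p * \<psi> x powr (p - 1) * \<phi> x))"
      using LIMSEQ_le_const[of _ _ 0] main by fastforce
    have \<psi>i: "integrable M (\<lambda>x. \<psi> x powr (p - 1) * \<phi> x)"
    proof (rule Bochner_Integration.integrable_bound)
      show "integrable M (\<lambda>x. b * (\<bar>\<psi> x\<bar> powr p) + \<phi> x)" using \<psi>p C1c_lebesgue_on(1)[OF Om \<phi>] by simp
      show "AE x in M. norm (\<psi> x powr (p - 1) * \<phi> x) \<le> norm (b * (\<bar>\<psi> x\<bar> powr p) + \<phi> x)"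
      proof (rule AE_I2)
        fix x
        have \<psi>x: "\<psi> x > 0" using \<psi>pos by blast
        have fx: "0 \<le> \<phi> x" "\<phi> x \<le> b" using \<phi>0 b(2)[of x] by auto
        have "\<psi> x powr (p - 1) * \<phi> x \<le> b * \<psi> x powr p + \<phi> x"
        proof (cases "\<psi> x \<le> 1")
          case True
          have "\<psi> x powr (p - 1) \<le> 1 powr (p - 1)" using True \<psi>x p by (intro powr_mono2) auto
          then have "\<psi> x powr (p - 1) * \<phi> x \<le> 1 * \<phi> x" using fx by (intro mult_right_mono) auto
          moreover have "0 \<le> b * \<psi> x powr p" using b(1) by simp
          ultimately show ?thesis by linarith
        next
          case False
          have "\<psi> x powr (p - 1) * \<phi> x \<le> \<psi> x powr p * b" using False fx by (intro mult_mono powr_mono) auto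
          then show ?thesis using fx by (simp add: mult.commute)
        qed
        then show "norm (\<psi> x powr (p - 1) * \<phi> x) \<le> norm (b * (\<bar>\<psi> x\<bar> powr p) + \<phi> x)"
          using fx \<psi>x b(1) by simp
      qed
    qed simp
    have \<psi>z: "\<psi> x powr (p - 1) * \<phi> x = 0" if "x \<notin> S" for x using that by (simp add: S_def zero_off_tsupp)
    have \<psi>V: "integrable M (\<lambda>x. V x * (\<psi> x powr (p - 1) * \<phi> x))"
      by (rule integrable_Linf_loc_mult[OF V Om _ _ \<psi>i \<psi>z]) (use C1cD(4,5)[OF \<phi>] in \<open>auto simp: S_def\<close>)
    have "integral\<^sup>L M (\<lambda>x. h x * (p * \<psi> x powr (p - 1) * \<phi> x))
       = integral\<^sup>L M (\<lambda>x. p * (V x * (\<psi> x powr (p - 1) * \<phi> x) - l * (\<psi> x powr (p - 1) * \<phi> x)))"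
    proof (rule Bochner_Integration.integral_cong[OF refl])
      fix x
      show "h x * (p * \<psi> x powr (p - 1) * \<phi> x) = p * (V x * (\<psi> x powr (p - 1) * \<phi> x) - l * (\<psi> x powr (p - 1) * \<phi> x))"
      proof (cases "x \<in> S")
        case True
        then show ?thesis by (simp add: h_def algebra_simps)
      next
        case False
        then have "\<phi> x = 0" by (simp add: S_def zero_off_tsupp)
        then show ?thesis by simp
      qed
    qed
    also have "\<dots> = p * (integral\<^sup>L M (\<lambda>x. V x * (\<psi> x powr (p - 1) * \<phi> x)) - l * integral\<^sup>L M (\<lambda>x. \<psi> x powr (p - 1) * \<phi> x))"
      using \<psi>i \<psi>V by simp
    finally have "0 \<le> p * (\<alpha> * integral\<^sup>L M (\<lambda>x. norm (G x) powr (p - 2) * (G x \<bullet> grad \<phi> x))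
        + (integral\<^sup>L M (\<lambda>x. V x * (\<psi> x powr (p - 1) * \<phi> x)) - l * integral\<^sup>L M (\<lambda>x. \<psi> x powr (p - 1) * \<phi> x)))"
      using lim by (simp add: algebra_simps)
    then show ?thesis using p by (simp add: zero_le_mult_iff mult.assoc)
  qed
  have "W1p_loc p \<Omega> \<psi> G" unfolding W1p_loc_def using Wp wg by simp
  then show ?thesis using \<psi>pos EL by (intro exI[of _ \<psi>] exI[of _ G]) blast
qed

end

section \<open>Picone's inequality\<close>


lemma Ck_reflect: "Ck k f \<Longrightarrow> Ck k (\<lambda>y. f (x - y))"
proof (induction k arbitrary: f)
  case 0
  then show ?case by (auto intro!: continuous_on_compose2[of UNIV f] continuous_intros)
next
  case (Suc k)
  have "((\<lambda>y. f (x - y)) has_derivative (\<lambda>v. (-1) * frechet_derivative f (at (x - y)) v)) (at y)" for y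
  proof -
    have "((\<lambda>y. x - y) has_derivative (\<lambda>v. - v)) (at y)" by (auto intro!: derivative_eq_intros)
    from has_derivative_compose[OF this Ck_deriv(1)[OF Suc.prems]]
    have "((\<lambda>y. f (x - y)) has_derivative (\<lambda>v. frechet_derivative f (at (x - y)) (- v))) (at y)" .
    moreover have "linear (frechet_derivative f (at (x - y)))"
      using Ck_deriv(1)[OF Suc.prems] by (rule has_derivative_linear)
    ultimately show ?thesis by (simp add: linear_neg)
  qed
  then show ?case
    by (rule Ck_SucI) (intro Ck_mult Ck_const Suc.IH Ck_deriv(2) Suc.prems)
qed

lemma integrable_lebesgue_on_indicator:
  fixes f :: "'a::euclidean_space \<Rightarrow> real"
  assumes f: "integrable (lebesgue_on K) f" and K: "K \<subseteq> S" "K \<in> sets lebesgue" "S \<in> sets lebesgue"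
  shows "integrable (lebesgue_on S) (\<lambda>x. indicator K x * f x)"
proof -
  have "integrable lebesgue (\<lambda>x. indicator K x *\<^sub>R f x)" using f K(2) integrable_restrict_space[of K lebesgue f] by simp
  moreover have "(\<lambda>x. indicator S x *\<^sub>R (indicator K x * f x)) = (\<lambda>x. indicator K x *\<^sub>R f x)"
    using K(1) by (auto intro!: ext simp: indicator_def)
  ultimately show ?thesis using K(3) integrable_restrict_space[of S lebesgue "\<lambda>x. indicator K x * f x"] by simp
qed

lemma compact_neighbourhood:
  fixes K :: "'a::euclidean_space set"
  assumes "open S" "compact K" "K \<subseteq> S"
  shows "\<exists>r>0. \<exists>K'. compact K' \<and> K' \<subseteq> S \<and> (\<forall>x\<in>K. \<forall>y. norm (y - x) \<le> r \<longrightarrow> y \<in> K')"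
proof -
  obtain e where e: "e > 0" "(\<Union>x\<in>K. cball x e) \<subseteq> S"
    using compact_subset_open_imp_cball_epsilon_subset[OF assms(2,1,3)] by blast
  define K' where "K' = {x + y | x y. x \<in> K \<and> y \<in> cball 0 e}"
  have "compact K'" unfolding K'_def by (intro compact_sums assms compact_cball)
  moreover have "y \<in> K'" if "x \<in> K" "norm (y - x) \<le> e" for x y
    unfolding K'_def mem_Collect_eq using that by (intro exI[of _ x] exI[of _ "y - x"]) auto
  moreover have "K' \<subseteq> S"
  proof
    fix z assume "z \<in> K'"
    then obtain x y where "x \<in> K" "z = x + y" "norm y \<le> e" unfolding K'_def by auto
    then have "z \<in> cball x e" by (simp add: dist_norm)
    then show "z \<in> S" using e(2) \<open>x \<in> K\<close> by blast
  qed
  ultimately show ?thesis using e(1) by blast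
qed

lemma conv_moll_support:
  assumes mr: "m > 0" "r > 0" and g: "\<And>x. x \<notin> K \<Longrightarrow> g x = 0" and x: "\<And>y. y \<in> K \<Longrightarrow> norm (x - y) \<ge> r"
  shows "conv g (moll m r) x = 0"
proof -
  have "g y * moll m r (x - y) = 0" for y
    using g[of y] moll(4)[OF mr x, of y] by (cases "y \<in> K") auto
  then show ?thesis unfolding conv_def by (simp only:) simp
qed

lemma conv_moll_bound:
  assumes mr: "m > 0" "r > 0" and g: "integrable lborel g" "\<And>x. \<bar>g x\<bar> \<le> b"
  shows "\<bar>conv g (moll m r) x\<bar> \<le> b"
proof -
  have "\<bar>conv g (moll m r) x\<bar> \<le> integral\<^sup>L lborel (\<lambda>y. b * moll m r (x - y))" unfolding conv_def
  proof (rule integral_abs_bound_integral)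
    show "integrable lborel (\<lambda>y. g y * moll m r (x - y))" by (rule integrable_moll_conv[OF mr g(1)])
    show "integrable lborel (\<lambda>y. b * moll m r (x - y))" using integral_moll_translate(2)[OF mr, of x] by simp
    fix y
    have "\<bar>g y\<bar> * moll m r (x - y) \<le> b * moll m r (x - y)" by (intro mult_right_mono g(2) moll(3)[OF mr])
    then show "\<bar>g y * moll m r (x - y)\<bar> \<le> b * moll m r (x - y)" by (simp add: abs_mult moll(3)[OF mr])
  qed
  also have "\<dots> = b" using integral_moll_translate(1)[OF mr, of x] by simp
  finally show ?thesis .
qed

lemma conv_moll_nonneg:
  assumes mr: "m > 0" "r > 0" and g: "\<And>x. g x \<ge> 0"
  shows "conv g (moll m r) x \<ge> 0"
  unfolding conv_def by (intro Bochner_Integration.integral_nonneg) (simp add: g moll(3)[OF mr])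

lemma conv_moll_grad:
  assumes mr: "m > 0" "r > 0" and \<phi>: "C1c S \<phi>"
  shows "grad (conv \<phi> (moll m r)) x \<bullet> v = conv (\<lambda>z. grad \<phi> z \<bullet> v) (moll m r) x"
proof -
  have [measurable]: "moll m r \<in> borel_measurable borel" by (rule C1c_measurable[OF moll(2)[OF mr]])
  have [measurable]: "\<phi> \<in> borel_measurable borel" "grad \<phi> \<in> borel_measurable borel" using C1c_measurable[OF \<phi>] by auto
  have "conv \<phi> (moll m r) = conv (moll m r) \<phi>" by (rule ext, rule conv_commute) auto
  then have "grad (conv \<phi> (moll m r)) x \<bullet> v = conv (moll m r) (\<lambda>z. grad \<phi> z \<bullet> v) x"
    using conv_grad(1)[OF moll(6)[OF mr] \<phi>] by simp
  also have "\<dots> = conv (\<lambda>z. grad \<phi> z \<bullet> v) (moll m r) x" by (rule conv_commute) auto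
  finally show ?thesis .
qed

lemma conv_moll_simultaneous:
  fixes F :: "('a::euclidean_space \<Rightarrow> real) set"
  assumes m: "m > 0" and F: "finite F" "\<And>g. g \<in> F \<Longrightarrow> integrable lborel g" and K: "compact K" and e: "e > 0"
  shows "\<exists>d>0. \<forall>r. 0 < r \<and> r < d \<longrightarrow> (\<forall>g\<in>F. integral\<^sup>L lborel (\<lambda>x. indicator K x * \<bar>conv g (moll m r) x - g x\<bar>) < e)"
  using F
proof (induction F rule: finite_induct)
  case empty
  then show ?case by (intro exI[of _ 1]) auto
next
  case (insert g F)
  obtain d1 where d1: "d1 > 0" "\<forall>r. 0 < r \<and> r < d1 \<longrightarrow> (\<forall>g\<in>F. integral\<^sup>L lborel (\<lambda>x. indicator K x * \<bar>conv g (moll m r) x - g x\<bar>) < e)"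
    using insert by auto
  obtain d2 where d2: "d2 > 0" "\<forall>r. 0 < r \<and> r < d2 \<longrightarrow> integral\<^sup>L lborel (\<lambda>x. indicator K x * \<bar>conv g (moll m r) x - g x\<bar>) < e"
    using conv_moll_L1[OF m _ K e, of g] insert.prems by auto
  show ?case using d1 d2 by (intro exI[of _ "min d1 d2"]) auto
qed

lemma AE_lborel_lebesgue_on:
  assumes "AE x in lborel. P x" "S \<in> sets lebesgue"
  shows "AE x in lebesgue_on S. P x"
  using AE_completion[OF assms(1)] by (subst AE_lebesgue_on_iff[OF assms(2)]) (auto elim: eventually_mono)

lemma integral_lebesgue_on_le:
  fixes f :: "'a::euclidean_space \<Rightarrow> real"
  assumes S: "open S" and f: "integrable lborel f" "\<And>x. f x \<ge> 0"
  shows "integrable (lebesgue_on S) f" "integral\<^sup>L (lebesgue_on S) f \<le> integral\<^sup>L lborel f"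
proof -
  have [measurable]: "f \<in> borel_measurable borel" using f(1) by simp
  have s: "S \<inter> space lebesgue \<in> sets lebesgue" "S \<in> sets lebesgue" using S by auto
  have i: "integrable lebesgue f" using f(1) by (subst integrable_completion) auto
  then have i2: "integrable lebesgue (\<lambda>x. indicator S x *\<^sub>R f x)" by (rule integrable_mult_indicator[OF s(2)])
  then show "integrable (lebesgue_on S) f" using integrable_restrict_space[OF s(1), of f] by simp
  have "integral\<^sup>L (lebesgue_on S) f = integral\<^sup>L lebesgue (\<lambda>x. indicator S x *\<^sub>R f x)" by (rule integral_restrict_space[OF s(1)])
  also have "\<dots> \<le> integral\<^sup>L lebesgue f" using i i2 f(2) by (intro integral_mono) (auto simp: indicator_def)
  also have "\<dots> = integral\<^sup>L lborel f" by (rule integral_completion) auto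
  finally show "integral\<^sup>L (lebesgue_on S) f \<le> integral\<^sup>L lborel f" .
qed

text \<open>A Lebesgue measurable function cut off at \<open>K\<close> agrees almost everywhere with
  a Borel function, to which convolution in \<open>lborel\<close> applies. Test functions vanishing
  off \<open>K\<close> do not see the difference.\<close>

lemma borel_version:
  fixes f :: "'a::euclidean_space \<Rightarrow> real"
  assumes S: "open S" and K: "K \<subseteq> S" and f: "integrable (lebesgue_on S) (\<lambda>x. indicator K x * f x)"
  shows "\<exists>g. integrable lborel g \<and> (AE x in lborel. g x = indicator K x * f x) \<and>
    (\<forall>h. h \<in> borel_measurable borel \<longrightarrow> (\<forall>x. x \<notin> K \<longrightarrow> h x = 0) \<longrightarrow>
       integral\<^sup>L (lebesgue_on S) (\<lambda>x. f x * h x) = integral\<^sup>L lborel (\<lambda>x. g x * h x))"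
proof -
  have s: "S \<inter> space lebesgue \<in> sets lebesgue" "S \<in> sets lebesgue" using S by auto
  have e: "indicator S x *\<^sub>R (indicator K x * f x) = indicator K x * f x" for x using K by (auto simp: indicator_def)
  have i: "integrable lebesgue (\<lambda>x. indicator K x * f x)"
    using f integrable_restrict_space[OF s(1), of "\<lambda>x. indicator K x * f x"] unfolding e by simp
  then have "(\<lambda>x. indicator K x * f x) \<in> borel_measurable lebesgue" by simp
  then obtain g where g: "g \<in> borel_measurable lborel" "AE x in lborel. indicator K x * f x = g x"
    using completion_ex_borel_measurable_real by blast
  have gm[measurable]: "g \<in> borel_measurable borel" using g(1) by simp
  have gl: "g \<in> borel_measurable lebesgue" using g(1) by (rule measurable_completion)
  have ae: "AE x in lebesgue. indicator K x * f x = g x" using g(2) by (rule AE_completion)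
  have "integrable lebesgue g" by (rule Bochner_Integration.integrable_cong_AE_imp[OF i gl]) (use ae in auto)
  then have ig: "integrable lborel g" by (subst (asm) integrable_completion) auto
  have "integral\<^sup>L (lebesgue_on S) (\<lambda>x. f x * h x) = integral\<^sup>L lborel (\<lambda>x. g x * h x)"
    if [measurable]: "h \<in> borel_measurable borel" and z: "\<And>x. x \<notin> K \<Longrightarrow> h x = 0" for h
  proof -
    have hl: "h \<in> borel_measurable lebesgue" by (rule measurable_completion) simp
    have "integral\<^sup>L (lebesgue_on S) (\<lambda>x. f x * h x) = integral\<^sup>L lebesgue (\<lambda>x. indicator S x *\<^sub>R (f x * h x))"
      by (rule integral_restrict_space[OF s(1)])
    also have "(\<lambda>x. indicator S x *\<^sub>R (f x * h x)) = (\<lambda>x. (indicator K x * f x) * h x)"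
    proof
      fix x
      show "indicator S x *\<^sub>R (f x * h x) = (indicator K x * f x) * h x"
        using z[of x] K by (cases "x \<in> K") (auto simp: indicator_def)
    qed
    also have "integral\<^sup>L lebesgue (\<lambda>x. (indicator K x * f x) * h x) = integral\<^sup>L lebesgue (\<lambda>x. g x * h x)"
    proof (rule integral_cong_AE)
      show "(\<lambda>x. indicator K x * f x * h x) \<in> borel_measurable lebesgue" 
        by (rule borel_measurable_times[OF borel_measurable_integrable[OF i] hl])
      show "(\<lambda>x. g x * h x) \<in> borel_measurable lebesgue" using gl hl by (intro borel_measurable_times)
      show "AE x in lebesgue. indicator K x * f x * h x = g x * h x" using ae by eventually_elim simp
    qed
    also have "\<dots> = integral\<^sup>L lborel (\<lambda>x. g x * h x)" by (rule integral_completion) simp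
    finally show ?thesis .
  qed
  then show ?thesis using ig g(2) by (intro exI[of _ g]) (auto elim: eventually_mono)
qed

locale supersolution =
  fixes p \<alpha> l :: real and \<Omega> :: "'a::euclidean_space set" and V \<psi> :: "'a \<Rightarrow> real" and G :: "'a \<Rightarrow> 'a"
  assumes p: "p > 1" and Om: "open \<Omega>" and V: "Linf_loc \<Omega> V" and al: "\<alpha> > 0"
    and W: "W1p_loc p \<Omega> \<psi> G" and pos: "\<And>x. x \<in> \<Omega> \<Longrightarrow> \<psi> x > 0"
    and super: "\<And>\<phi>. test_fun \<Omega> \<phi> \<Longrightarrow> (\<And>x. \<phi> x \<ge> 0) \<Longrightarrow>
         l * integral\<^sup>L (lebesgue_on \<Omega>) (\<lambda>x. \<psi> x powr (p - 1) * \<phi> x)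
         \<le> \<alpha> * integral\<^sup>L (lebesgue_on \<Omega>) (\<lambda>x. norm (G x) powr (p - 2) * (G x \<bullet> grad \<phi> x))
         + integral\<^sup>L (lebesgue_on \<Omega>) (\<lambda>x. V x * \<psi> x powr (p - 1) * \<phi> x)"
begin

abbreviation "M \<equiv> lebesgue_on \<Omega>"

lemma meas: "\<psi> \<in> borel_measurable M" "G \<in> borel_measurable M" "V \<in> borel_measurable M"
  using W V by (auto simp: W1p_loc_def Lp_loc_def Linf_loc_def)

lemma local_Lp:
  assumes K: "compact K" "K \<subseteq> \<Omega>"
  shows "integrable M (\<lambda>x. indicator K x * \<psi> x powr p)" "integrable M (\<lambda>x. indicator K x * norm (G x) powr p)"
    "integrable M (\<lambda>x. indicator K x * (1 + \<psi> x powr p))" "integrable M (\<lambda>x. indicator K x * (1 + norm (G x) powr p))"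
    "K \<in> sets M"
proof -
  have Ks: "K \<in> sets lebesgue" using K(1) by (auto simp: borel_compact)
  have Os: "\<Omega> \<in> sets lebesgue" using Om by auto
  have 1: "integrable (lebesgue_on K) (\<lambda>x. \<bar>\<psi> x\<bar> powr p)" "integrable (lebesgue_on K) (\<lambda>x. norm (G x) powr p)"
    using W K by (auto simp: W1p_loc_def Lp_loc_def)
  have "integrable M (\<lambda>x. indicator K x * \<bar>\<psi> x\<bar> powr p)"
    by (rule integrable_lebesgue_on_indicator[OF 1(1) K(2) Ks Os])
  then show 2: "integrable M (\<lambda>x. indicator K x * \<psi> x powr p)"
    by (rule Bochner_Integration.integrable_cong[THEN iffD1, rotated 2])
       (use pos in \<open>auto simp: abs_of_pos\<close>)
  show 3: "integrable M (\<lambda>x. indicator K x * norm (G x) powr p)"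
    by (rule integrable_lebesgue_on_indicator[OF 1(2) K(2) Ks Os])
  have "integrable M (\<lambda>x. indicator K x * 1 :: real)"
    by (rule integrable_on_compact_lebesgue_on[OF Om K]) simp
  then show "integrable M (\<lambda>x. indicator K x * (1 + \<psi> x powr p))" "integrable M (\<lambda>x. indicator K x * (1 + norm (G x) powr p))"
    using 2 3 by (auto simp: distrib_left)
  show "K \<in> sets M" using Ks K(2) Os by (subst sets_restrict_space_iff) auto
qed

text \<open>Lets local p-integrability dominate the power \<open>p - 1\<close> of the weak
  formulation; the constant 1 is integrable on compact sets.\<close>

lemma powr_le_one_add: "y \<ge> 0 \<Longrightarrow> y powr (p - 1) \<le> 1 + y powr p"
proof (cases "y \<le> 1")
  case True
  assume "y \<ge> 0"
  then have "y powr (p - 1) \<le> 1 powr (p - 1)" using True p by (intro powr_mono2) auto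
  then have "y powr (p - 1) \<le> 1" by simp
  then show ?thesis using powr_ge_zero[of y p] by linarith
next
  case False
  then have "y powr (p - 1) \<le> y powr p" by (intro powr_mono) auto
  then show ?thesis by simp
qed

text \<open>The weak form of the operator minus \<open>l\<close>. The gradient slot \<open>w\<close>
  is kept apart from \<open>\<phi>\<close> so that limits can be taken in the two slots
  separately.\<close>

definition functional :: "('a \<Rightarrow> 'a) \<Rightarrow> ('a \<Rightarrow> real) \<Rightarrow> real" where
  "functional w \<phi> = \<alpha> * integral\<^sup>L M (\<lambda>x. norm (G x) powr (p - 2) * (G x \<bullet> w x)) + integral\<^sup>L M (\<lambda>x. (V x - l) * (\<psi> x powr (p - 1) * \<phi> x))"

lemma integrable_flux:
  assumes K: "compact K" "K \<subseteq> \<Omega>" and [measurable]: "w \<in> borel_measurable M" and b: "\<And>x. norm (w x) \<le> b" "\<And>x. x \<notin> K \<Longrightarrow> w x = 0"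
  shows "integrable M (\<lambda>x. norm (G x) powr (p - 2) * (G x \<bullet> w x))"
    "\<bar>norm (G x) powr (p - 2) * (G x \<bullet> w x)\<bar> \<le> b * (indicator K x * (1 + norm (G x) powr p))"
proof -
  note [measurable] = meas
  show le: "\<bar>norm (G x) powr (p - 2) * (G x \<bullet> w x)\<bar> \<le> b * (indicator K x * (1 + norm (G x) powr p))" for x
  proof (cases "x \<in> K")
    case True
    have "\<bar>norm (G x) powr (p - 2) * (G x \<bullet> w x)\<bar> \<le> norm (G x) powr (p - 1) * norm (w x)" by (rule pflux_bound)
    also have "\<dots> \<le> (1 + norm (G x) powr p) * b" by (intro mult_mono b(1) powr_le_one_add) auto
    finally show ?thesis using True by (simp add: mult.commute)
  qed (simp add: b(2))
  have i: "integrable M (\<lambda>x. b * (indicator K x * (1 + norm (G x) powr p)))" using local_Lp(4)[OF K] by simp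
  show "integrable M (\<lambda>x. norm (G x) powr (p - 2) * (G x \<bullet> w x))"
    by (rule Bochner_Integration.integrable_bound[OF i]) (use le in \<open>auto intro: order_trans[OF _ abs_ge_self]\<close>)
qed

lemma integrable_mass:
  assumes K: "compact K" "K \<subseteq> \<Omega>" and [measurable]: "\<phi> \<in> borel_measurable M" and b: "\<And>x. \<bar>\<phi> x\<bar> \<le> b" "\<And>x. x \<notin> K \<Longrightarrow> \<phi> x = 0"
  shows "integrable M (\<lambda>x. \<psi> x powr (p - 1) * \<phi> x)" "integrable M (\<lambda>x. V x * (\<psi> x powr (p - 1) * \<phi> x))"
    "x \<in> \<Omega> \<Longrightarrow> \<bar>\<psi> x powr (p - 1) * \<phi> x\<bar> \<le> b * (indicator K x * (1 + \<psi> x powr p))"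
proof -
  note [measurable] = meas
  show le: "\<bar>\<psi> x powr (p - 1) * \<phi> x\<bar> \<le> b * (indicator K x * (1 + \<psi> x powr p))" if "x \<in> \<Omega>" for x
  proof (cases "x \<in> K")
    case True
    have "\<psi> x powr (p - 1) * \<bar>\<phi> x\<bar> \<le> (1 + \<psi> x powr p) * b"
      using pos[OF that] by (intro mult_mono b(1) powr_le_one_add) auto
    then show ?thesis using True by (simp add: abs_mult mult.commute)
  qed (simp add: b(2))
  have i: "integrable M (\<lambda>x. b * (indicator K x * (1 + \<psi> x powr p)))" using local_Lp(3)[OF K] by simp
  show i2: "integrable M (\<lambda>x. \<psi> x powr (p - 1) * \<phi> x)"
    by (rule Bochner_Integration.integrable_bound[OF i]) (use le in \<open>auto intro!: AE_I2 intro: order_trans[OF _ abs_ge_self]\<close>)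
  show "integrable M (\<lambda>x. V x * (\<psi> x powr (p - 1) * \<phi> x))"
    by (rule integrable_Linf_loc_mult[OF V Om K i2]) (simp add: b(2))
qed

lemma functional_limit:
  assumes K: "compact K" "K \<subseteq> \<Omega>"
    and m: "\<And>n. w n \<in> borel_measurable M" "\<And>n. \<phi> n \<in> borel_measurable M" "w' \<in> borel_measurable M" "\<phi>' \<in> borel_measurable M"
    and b: "\<And>n x. norm (w n x) \<le> b" "\<And>n x. x \<notin> K \<Longrightarrow> w n x = 0" "\<And>n x. \<bar>\<phi> n x\<bar> \<le> b" "\<And>n x. x \<notin> K \<Longrightarrow> \<phi> n x = 0"
    and lim: "AE x in M. (\<lambda>n. w n x) \<longlonglongrightarrow> w' x" "AE x in M. (\<lambda>n. \<phi> n x) \<longlonglongrightarrow> \<phi>' x"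
  shows "(\<lambda>n. integral\<^sup>L M (\<lambda>x. norm (G x) powr (p - 2) * (G x \<bullet> w n x))) \<longlonglongrightarrow> integral\<^sup>L M (\<lambda>x. norm (G x) powr (p - 2) * (G x \<bullet> w' x))"
    "(\<lambda>n. integral\<^sup>L M (\<lambda>x. (V x - l) * (\<psi> x powr (p - 1) * \<phi> n x))) \<longlonglongrightarrow> integral\<^sup>L M (\<lambda>x. (V x - l) * (\<psi> x powr (p - 1) * \<phi>' x))"
proof -
  note [measurable] = meas m
  obtain CV where CV: "CV \<ge> 0" "AE x in M. x \<in> K \<longrightarrow> \<bar>V x\<bar> \<le> CV" using Linf_loc_bounded[OF V Om K] by blast
  show "(\<lambda>n. integral\<^sup>L M (\<lambda>x. norm (G x) powr (p - 2) * (G x \<bullet> w n x))) \<longlonglongrightarrow> integral\<^sup>L M (\<lambda>x. norm (G x) powr (p - 2) * (G x \<bullet> w' x))"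
  proof (rule integral_dominated_convergence[where w="\<lambda>x. b * (indicator K x * (1 + norm (G x) powr p))"])
    show "integrable M (\<lambda>x. b * (indicator K x * (1 + norm (G x) powr p)))" using local_Lp(4)[OF K] by simp
    show "AE x in M. (\<lambda>n. norm (G x) powr (p - 2) * (G x \<bullet> w n x)) \<longlonglongrightarrow> norm (G x) powr (p - 2) * (G x \<bullet> w' x)"
      using lim(1) by eventually_elim (intro tendsto_mult tendsto_inner tendsto_const)
    show "AE x in M. norm (norm (G x) powr (p - 2) * (G x \<bullet> w n x)) \<le> b * (indicator K x * (1 + norm (G x) powr p))" for n
      using integrable_flux(2)[OF K m(1)[of n] b(1,2)] by simp
  qed measurable
  show "(\<lambda>n. integral\<^sup>L M (\<lambda>x. (V x - l) * (\<psi> x powr (p - 1) * \<phi> n x))) \<longlonglongrightarrow> integral\<^sup>L M (\<lambda>x. (V x - l) * (\<psi> x powr (p - 1) * \<phi>' x))"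
  proof (rule integral_dominated_convergence[where w="\<lambda>x. (CV + \<bar>l\<bar>) * (b * (indicator K x * (1 + \<psi> x powr p)))"])
    show "integrable M (\<lambda>x. (CV + \<bar>l\<bar>) * (b * (indicator K x * (1 + \<psi> x powr p))))" using local_Lp(3)[OF K] by simp
    show "AE x in M. (\<lambda>n. (V x - l) * (\<psi> x powr (p - 1) * \<phi> n x)) \<longlonglongrightarrow> (V x - l) * (\<psi> x powr (p - 1) * \<phi>' x)"
      using lim(2) by eventually_elim (intro tendsto_mult tendsto_const)
    show "AE x in M. norm ((V x - l) * (\<psi> x powr (p - 1) * \<phi> n x)) \<le> (CV + \<bar>l\<bar>) * (b * (indicator K x * (1 + \<psi> x powr p)))" for n
      using CV(2) AE_space
    proof eventually_elim
      case (elim x)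
      then have x: "x \<in> \<Omega>" by simp
      show ?case
      proof (cases "x \<in> K")
        case True
        then have "\<bar>V x - l\<bar> \<le> CV + \<bar>l\<bar>" using elim by auto
        then have "\<bar>V x - l\<bar> * \<bar>\<psi> x powr (p - 1) * \<phi> n x\<bar> \<le> (CV + \<bar>l\<bar>) * (b * (indicator K x * (1 + \<psi> x powr p)))"
          using integrable_mass(3)[OF K m(2)[of n] b(3,4) x] CV(1) by (intro mult_mono) auto
        then show ?thesis by (simp only: real_norm_def abs_mult)
      qed (simp add: b(4))
    qed
  qed measurable
qed

lemma super_functional:
  assumes \<phi>: "test_fun \<Omega> \<phi>" "\<And>x. \<phi> x \<ge> 0"
  shows "0 \<le> functional (grad \<phi>) \<phi>"
proof -
  note c = test_fun_C1c[OF \<phi>(1)]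
  obtain b where b: "b \<ge> 0" "\<And>x. norm (\<phi> x) \<le> b" using C1c_bounded[OF c] by metis
  have i: "integrable M (\<lambda>x. \<psi> x powr (p - 1) * \<phi> x)" "integrable M (\<lambda>x. V x * (\<psi> x powr (p - 1) * \<phi> x))"
    by (rule integrable_mass[OF C1cD(4,5)[OF c] C1c_lebesgue_on(3)[OF Om c], of b]; use b in \<open>auto simp: zero_off_tsupp\<close>)+
  have "integral\<^sup>L M (\<lambda>x. (V x - l) * (\<psi> x powr (p - 1) * \<phi> x))
    = integral\<^sup>L M (\<lambda>x. V x * (\<psi> x powr (p - 1) * \<phi> x)) - l * integral\<^sup>L M (\<lambda>x. \<psi> x powr (p - 1) * \<phi> x)"
    using i by (simp add: left_diff_distrib)
  then show ?thesis unfolding functional_def using super[OF \<phi>] by (simp add: mult.assoc)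
qed

text \<open>Mollifying a C1 test function gives smooth nonnegative ones with supports in a common
  compact set and uniform bounds on values and gradients, so dominated convergence transfers the
  inequality.\<close>

lemma super_C1c:
  assumes \<phi>: "C1c \<Omega> \<phi>" "\<And>x. \<phi> x \<ge> 0"
  shows "0 \<le> functional (grad \<phi>) \<phi>"
proof -
  obtain r K' where r: "r > 0" and K': "compact K'" "K' \<subseteq> \<Omega>" and nb: "\<And>x y. x \<in> tsupp \<phi> \<Longrightarrow> norm (y - x) \<le> r \<Longrightarrow> y \<in> K'"
    using compact_neighbourhood[OF Om C1cD(4,5)[OF \<phi>(1)]] by metis
  obtain b where b: "b \<ge> 0" "\<And>x. norm (\<phi> x) \<le> b" "\<And>x. norm (grad \<phi> x) \<le> b" using C1c_bounded[OF \<phi>(1)] by metis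
  \<comment> \<open>The shift by two keeps every radius strictly below \<open>r\<close>, so all
    mollified supports stay in \<open>K'\<close>.\<close>
  define s where "s n = r / real (Suc (Suc n))" for n
  have s: "s n > 0" "s n < r" for n using r by (auto simp: s_def field_simps intro!: add_pos_nonneg)
  have s0: "s \<longlonglongrightarrow> 0"
    unfolding s_def using LIMSEQ_Suc[OF LIMSEQ_Suc[OF lim_const_over_n[of r]]] by simp
  define \<phi>n where "\<phi>n n = conv \<phi> (moll 1 (s n))" for n
  have ip: "integrable lborel \<phi>" by (rule integrable_C1c[OF \<phi>(1)])
  have cg: "continuous_on UNIV (\<lambda>z. grad \<phi> z \<bullet> i)" for i by (intro continuous_intros C1cD(3)[OF \<phi>(1)])
  have ig: "integrable lborel (\<lambda>z. grad \<phi> z \<bullet> i)" for i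
    by (rule integrable_compact_support[OF C1cD(4)[OF \<phi>(1)]])
       (auto intro!: continuous_intros C1cD(3)[OF \<phi>(1)] simp: grad_zero_off_tsupp)
  have far: "norm (x - y) \<ge> s n" if "x \<notin> K'" "y \<in> tsupp \<phi>" for x y n
    using nb[OF that(2), of x] that(1) s(2)[of n] by linarith
  have z: "\<phi>n n x = 0" if "x \<notin> K'" for n x
    unfolding \<phi>n_def by (rule conv_moll_support[OF _ s(1), where K="tsupp \<phi>"]) (use far[OF that] in \<open>auto simp: zero_off_tsupp\<close>)
  have gn: "grad (\<phi>n n) x \<bullet> i = conv (\<lambda>z. grad \<phi> z \<bullet> i) (moll 1 (s n)) x" for n x i
    unfolding \<phi>n_def by (rule conv_moll_grad[OF _ s(1) \<phi>(1)]) simp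
  have tsK: "tsupp (\<phi>n n) \<subseteq> K'" for n
    using tsupp_subset[OF compact_imp_closed[OF K'(1)]] z by blast
  have tf: "test_fun \<Omega> (\<phi>n n)" for n
  proof -
    have "smooth_fun (\<phi>n n)"
      unfolding smooth_fun_def \<phi>n_def using moll(1)[OF zero_less_one s(1)[of n]] conv_Ck[OF ip]
      by (auto simp: test_fun_def)
    moreover have "compact (tsupp (\<phi>n n))"
      using tsK[of n] K'(1) closed_tsupp by (metis compact_Int_closed inf.absorb_iff2)
    ultimately show ?thesis using tsK[of n] K'(2) by (auto simp: test_fun_def)
  qed
  have nn: "\<phi>n n x \<ge> 0" for n x unfolding \<phi>n_def by (rule conv_moll_nonneg[OF _ s(1) \<phi>(2)]) simp
  note cn = test_fun_C1c[OF tf]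
  \<comment> \<open>Gradients are bounded by components only, each by \<open>b\<close>; their sum
    costs a factor \<open>DIM('a)\<close>, and the summand 1 covers the values of the
    function.\<close>
  define b' where "b' = b * (1 + real DIM('a))"
  have bb: "b \<le> b'" unfolding b'_def using b(1) by (simp add: mult_le_cancel_left1 distrib_left)
  have b1: "\<bar>\<phi>n n x\<bar> \<le> b'" for n x
    unfolding \<phi>n_def using conv_moll_bound[OF zero_less_one s(1)[of n] ip, of b x] b(2) bb by simp
  have b2: "norm (grad (\<phi>n n) x) \<le> b'" for n x
  proof -
    have "norm (grad (\<phi>n n) x) \<le> (\<Sum>i\<in>Basis. \<bar>grad (\<phi>n n) x \<bullet> i\<bar>)" by (rule norm_le_l1)
    also have "\<dots> \<le> (\<Sum>i\<in>(Basis::'a set). b)"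
    proof (rule sum_mono)
      fix i :: 'a assume "i \<in> Basis"
      then have "\<bar>grad \<phi> z \<bullet> i\<bar> \<le> b" for z using Basis_le_norm[of i "grad \<phi> z"] b(3)[of z] by linarith
      then show "\<bar>grad (\<phi>n n) x \<bullet> i\<bar> \<le> b" unfolding gn by (intro conv_moll_bound[OF _ s(1) ig]) auto
    qed
    also have "\<dots> = b * DIM('a)" by simp
    also have "\<dots> \<le> b'" unfolding b'_def using b(1) by (simp add: distrib_left)
    finally show ?thesis .
  qed
  have unif: "(\<lambda>n. conv h (moll 1 (s n)) x) \<longlonglongrightarrow> h x" if h: "continuous_on UNIV h" "integrable lborel h" for h :: "'a \<Rightarrow> real" and x
  proof (rule LIMSEQ_I)
    fix e :: real assume e: "e > 0"
    obtain d where d: "d > 0" "\<forall>r. 0 < r \<and> r < d \<longrightarrow> (\<forall>y\<in>{x}. \<bar>conv h (moll 1 r) y - h y\<bar> \<le> e/2)"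
      using conv_moll_uniform[OF zero_less_one h, of "{x}" "e/2"] e by auto
    obtain N where "\<forall>n\<ge>N. s n < d" using order_tendstoD(2)[OF s0 d(1)] by (auto simp: eventually_sequentially)
    then show "\<exists>no. \<forall>n\<ge>no. norm (conv h (moll 1 (s n)) x - h x) < e"
      using d(2) s(1) e by (intro exI[of _ N]) fastforce
  qed
  have l1: "(\<lambda>n. \<phi>n n x) \<longlonglongrightarrow> \<phi> x" for x unfolding \<phi>n_def by (rule unif[OF C1cD(2)[OF \<phi>(1)] ip])
  have l2: "(\<lambda>n. grad (\<phi>n n) x) \<longlonglongrightarrow> grad \<phi> x" for x
    unfolding tendsto_componentwise_iff[of _ "grad \<phi> x"] gn using unif[OF cg ig] by auto
  have off: "grad (\<phi>n n) x = 0" if "x \<notin> K'" for n x using that tsK[of n] grad_zero_off_tsupp by blast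
  have AE12: "AE x in M. (\<lambda>n. grad (\<phi>n n) x) \<longlonglongrightarrow> grad \<phi> x" "AE x in M. (\<lambda>n. \<phi>n n x) \<longlonglongrightarrow> \<phi> x"
    using l1 l2 by auto
  note L = functional_limit[OF K' C1c_lebesgue_on(4)[OF Om cn] C1c_lebesgue_on(3)[OF Om cn] C1c_lebesgue_on(4,3)[OF Om \<phi>(1)] b2 off b1 z AE12]
  have "(\<lambda>n. functional (grad (\<phi>n n)) (\<phi>n n)) \<longlonglongrightarrow> functional (grad \<phi>) \<phi>"
    unfolding functional_def by (intro tendsto_intros L)
  then show ?thesis by (rule LIMSEQ_le_const) (use super_functional[OF tf nn] in auto)
qed

text \<open>Test the weak gradient identity with the reflected kernel
  \<open>moll 1 r (x - y)\<close> as a function of \<open>y\<close>; differentiating the reflection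
  turns the minus sign of the identity into equality of convolutions. The kernel must fit into
  \<open>K'\<close>, where the Borel representatives are valid.\<close>

lemma mollified_weak_grad:
  fixes g h :: "'a \<Rightarrow> real"
  assumes r: "r > 0" and K': "compact K'" "K' \<subseteq> \<Omega>" and x: "\<And>y. norm (y - x) \<le> r \<Longrightarrow> y \<in> K'" and i: "i \<in> Basis"
    and g: "integrable lborel g" "\<And>h. h \<in> borel_measurable borel \<Longrightarrow> (\<And>x. x \<notin> K' \<Longrightarrow> h x = 0) \<Longrightarrow>
       integral\<^sup>L M (\<lambda>x. \<psi> x * h x) = integral\<^sup>L lborel (\<lambda>x. g x * h x)"
    and gi: "\<And>h. h \<in> borel_measurable borel \<Longrightarrow> (\<And>x. x \<notin> K' \<Longrightarrow> h x = 0) \<Longrightarrow>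
       integral\<^sup>L M (\<lambda>x. (G x \<bullet> i) * h x) = integral\<^sup>L lborel (\<lambda>x. gi x * h x)"
  shows "grad (conv g (moll 1 r)) x \<bullet> i = conv gi (moll 1 r) x"
proof -
  define \<eta> :: "'a \<Rightarrow> real" where "\<eta> = moll 1 r"
  have m: "test_fun UNIV \<eta>" "C1c UNIV \<eta>" "\<And>z. norm z \<ge> r \<Longrightarrow> \<eta> z = 0" unfolding \<eta>_def using moll[OF zero_less_one r] by auto
  have [measurable]: "\<eta> \<in> borel_measurable borel" "grad \<eta> \<in> borel_measurable borel" using C1c_measurable[OF m(2)] by auto
  define \<phi> where "\<phi> y = \<eta> (x + (-1) *\<^sub>R y)" for y
  have z: "\<phi> y = 0" if "y \<notin> K'" for y
  proof -
    have "\<not> norm (y - x) \<le> r" using x[of y] that by blast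
    then show ?thesis unfolding \<phi>_def by (intro m(3)) (simp add: norm_minus_commute)
  qed
  have ts: "tsupp \<phi> \<subseteq> K'" using tsupp_subset[OF compact_imp_closed[OF K'(1)]] z by blast
  have "Ck k \<phi>" for k using Ck_reflect[of k \<eta> x] m(1) by (auto simp: \<phi>_def[abs_def] test_fun_def smooth_fun_def)
  then have tf: "test_fun \<Omega> \<phi>"
    using ts K' closed_tsupp unfolding test_fun_def smooth_fun_def
    by (metis compact_Int_closed inf.absorb_iff2 order_trans)
  have gr: "grad \<phi> = (\<lambda>y. (-1) *\<^sub>R grad \<eta> (x + (-1) *\<^sub>R y))"
    unfolding \<phi>_def by (rule C1c_affine(2)[OF m(2), where S=UNIV]) auto
  have goff: "grad \<phi> y = 0" if "y \<notin> K'" for y using that ts grad_zero_off_tsupp by blast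
  have fr: "frechet_derivative \<phi> (at y) i = grad \<phi> y \<bullet> i" for y
    by (rule frechet_eq_grad[OF C1cD(6)[OF test_fun_C1c[OF tf]]])
  have [measurable]: "\<phi> \<in> borel_measurable borel" "grad \<phi> \<in> borel_measurable borel"
    using C1c_measurable[OF test_fun_C1c[OF tf]] by auto
  have "integral\<^sup>L M (\<lambda>y. \<psi> y * (grad \<phi> y \<bullet> i)) = - integral\<^sup>L M (\<lambda>y. (G y \<bullet> i) * \<phi> y)"
    using W tf i unfolding W1p_loc_def weak_grad_def fr[symmetric] by blast
  moreover have "integral\<^sup>L M (\<lambda>y. \<psi> y * (grad \<phi> y \<bullet> i)) = integral\<^sup>L lborel (\<lambda>y. g y * (grad \<phi> y \<bullet> i))"
    by (rule g(2)) (auto simp: goff)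
  moreover have "integral\<^sup>L M (\<lambda>y. (G y \<bullet> i) * \<phi> y) = integral\<^sup>L lborel (\<lambda>y. gi y * \<phi> y)"
    by (rule gi) (auto simp: z)
  ultimately have "integral\<^sup>L lborel (\<lambda>y. g y * (grad \<phi> y \<bullet> i)) = - integral\<^sup>L lborel (\<lambda>y. gi y * \<phi> y)" by simp
  then have "integral\<^sup>L lborel (\<lambda>y. g y * (grad \<eta> (x - y) \<bullet> i)) = integral\<^sup>L lborel (\<lambda>y. gi y * \<eta> (x - y))"
    unfolding gr \<phi>_def by simp
  then show ?thesis
    unfolding \<eta>_def[symmetric] conv_grad(1)[OF g(1) m(2)] by (simp add: conv_def)
qed

text \<open>The test function is \<open>\<zeta>\<close> times the power \<open>1 - p\<close> of the
  mollified \<open>\<psi>\<close> plus \<open>e\<close>; the shift by \<open>e\<close> keeps that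
  power bounded. After the mollification is removed, Young's inequality with the field
  \<open>G x /\<^sub>R (\<psi> x + e)\<close> bounds the flux terms by the energy density of
  \<open>\<zeta>\<close>.\<close>

lemma picone_regularised:
  assumes \<zeta>: "adm p \<Omega> \<zeta>" and e: "e > 0"
  shows "0 \<le> \<alpha> * energy p \<Omega> \<zeta> + integral\<^sup>L M (\<lambda>x. (V x - l) * (\<psi> x powr (p - 1) * ((\<psi> x + e) powr (1 - p) * \<zeta> x)))"
proof -
  note [measurable] = meas
  have c: "C1c \<Omega> \<zeta>" and \<zeta>0: "\<And>x. \<zeta> x \<ge> 0" using \<zeta> by (auto simp: adm_def)
  define K where "K = tsupp \<zeta>"
  have K: "compact K" "K \<subseteq> \<Omega>" unfolding K_def by (rule C1cD[OF c])+
  have [measurable]: "\<zeta> \<in> borel_measurable M" "grad \<zeta> \<in> borel_measurable M" using C1c_lebesgue_on[OF Om c] by auto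
  have [measurable]: "K \<in> sets M" by (rule local_Lp(5)[OF K])
  have Os: "\<Omega> \<in> sets lebesgue" using Om by auto
  obtain b where b: "b \<ge> 0" "\<And>x. norm (\<zeta> x) \<le> b" "\<And>x. norm (grad \<zeta> x) \<le> b" using C1c_bounded[OF c] by metis
  obtain r0 K' where r0: "r0 > 0" and K': "compact K'" "K' \<subseteq> \<Omega>" and nb: "\<And>x y. x \<in> K \<Longrightarrow> norm (y - x) \<le> r0 \<Longrightarrow> y \<in> K'"
    using compact_neighbourhood[OF Om K] by metis
  have KK': "K \<subseteq> K'" using nb[of x x for x] r0 by auto
  have [measurable]: "K' \<in> sets M" by (rule local_Lp(5)[OF K'])
  have le1: "y \<le> 1 + y powr p" if "y \<ge> 0" for y
  proof (cases "y \<le> 1")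
    case False
    then have "y powr 1 \<le> y powr p" using p by (intro powr_mono) auto
    then show ?thesis using False by simp
  qed (simp add: add_increasing2)
  have "integrable M (\<lambda>x. indicator K' x * \<psi> x)"
  proof (rule Bochner_Integration.integrable_bound[OF local_Lp(3)[OF K']])
    show "AE x in M. norm (indicator K' x * \<psi> x) \<le> norm (indicator K' x * (1 + \<psi> x powr p))"
    proof (rule AE_I2)
      fix x assume "x \<in> space M"
      then have "\<psi> x > 0" using pos by simp
      then show "norm (indicator K' x * \<psi> x) \<le> norm (indicator K' x * (1 + \<psi> x powr p))"
        using le1[of "\<psi> x"] by (auto simp: indicator_def abs_of_nonneg)
    qed
  qed measurable
  from borel_version[OF Om K'(2) this] obtain g0 where g0: "integrable lborel g0" "AE x in lborel. g0 x = indicator K' x * \<psi> x"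
    "\<And>h. h \<in> borel_measurable borel \<Longrightarrow> (\<And>x. x \<notin> K' \<Longrightarrow> h x = 0) \<Longrightarrow> integral\<^sup>L M (\<lambda>x. \<psi> x * h x) = integral\<^sup>L lborel (\<lambda>x. g0 x * h x)"
    by auto
  \<comment> \<open>An everywhere nonnegative representative keeps the mollifications nonnegative at
    every point, so the negative power of their shift by \<open>e\<close> is C1.\<close>
  define g where "g x = \<bar>g0 x\<bar>" for x
  have g0g: "AE x in lborel. g0 x = g x" using g0(2)
  proof eventually_elim
    case (elim x)
    have "0 \<le> indicator K' x * \<psi> x" using pos[of x] K'(2) by (auto simp: indicator_def less_imp_le)
    then show ?case unfolding g_def using elim by simp
  qed
  have [measurable]: "g0 \<in> borel_measurable borel" using g0(1) by simp
  have gm[measurable]: "g \<in> borel_measurable borel" unfolding g_def by measurable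
  have g1: "integrable lborel g" unfolding g_def using g0(1) by simp
  have g2: "integral\<^sup>L M (\<lambda>x. \<psi> x * h x) = integral\<^sup>L lborel (\<lambda>x. g x * h x)"
    if [measurable]: "h \<in> borel_measurable borel" and "\<And>x. x \<notin> K' \<Longrightarrow> h x = 0" for h
  proof -
    have "integral\<^sup>L lborel (\<lambda>x. g0 x * h x) = integral\<^sup>L lborel (\<lambda>x. g x * h x)"
      using g0g by (intro integral_cong_AE) (auto elim: eventually_mono)
    then show ?thesis using g0(3)[OF that] by simp
  qed
  have gi_ex: "\<exists>gi. integrable lborel gi \<and> (AE x in lborel. gi x = indicator K' x * (G x \<bullet> i)) \<and>
    (\<forall>h. h \<in> borel_measurable borel \<longrightarrow> (\<forall>x. x \<notin> K' \<longrightarrow> h x = 0) \<longrightarrow>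
       integral\<^sup>L M (\<lambda>x. (G x \<bullet> i) * h x) = integral\<^sup>L lborel (\<lambda>x. gi x * h x))" if i: "i \<in> Basis" for i
  proof (rule borel_version[OF Om K'(2)], rule Bochner_Integration.integrable_bound[OF local_Lp(4)[OF K']])
    show "AE x in M. norm (indicator K' x * (G x \<bullet> i)) \<le> norm (indicator K' x * (1 + norm (G x) powr p))"
    proof (rule AE_I2)
      fix x
      have "\<bar>G x \<bullet> i\<bar> \<le> 1 + norm (G x) powr p" using Basis_le_norm[OF i, of "G x"] le1[of "norm (G x)"] by simp
      then show "norm (indicator K' x * (G x \<bullet> i)) \<le> norm (indicator K' x * (1 + norm (G x) powr p))"
        by (auto simp: indicator_def abs_of_nonneg)
    qed
  qed measurable
  then have "\<forall>i\<in>Basis. \<exists>gi. integrable lborel gi \<and> (AE x in lborel. gi x = indicator K' x * (G x \<bullet> i)) \<and>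
    (\<forall>h. h \<in> borel_measurable borel \<longrightarrow> (\<forall>x. x \<notin> K' \<longrightarrow> h x = 0) \<longrightarrow>
       integral\<^sup>L M (\<lambda>x. (G x \<bullet> i) * h x) = integral\<^sup>L lborel (\<lambda>x. gi x * h x))" by blast
  from bchoice[OF this] obtain gG where gG: "\<And>i. i \<in> Basis \<Longrightarrow> integrable lborel (gG i)"
    "\<And>i. i \<in> Basis \<Longrightarrow> AE x in lborel. gG i x = indicator K' x * (G x \<bullet> i)"
    "\<And>i h. i \<in> Basis \<Longrightarrow> h \<in> borel_measurable borel \<Longrightarrow> (\<And>x. x \<notin> K' \<Longrightarrow> h x = 0) \<Longrightarrow>
       integral\<^sup>L M (\<lambda>x. (G x \<bullet> i) * h x) = integral\<^sup>L lborel (\<lambda>x. gG i x * h x)"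
    by auto
  have gGp: "integrable lborel (\<lambda>x. \<bar>gG i x\<bar> powr p)" if i: "i \<in> Basis" for i
  proof -
    have [measurable]: "gG i \<in> borel_measurable borel" using gG(1)[OF i] by simp
    have s: "\<Omega> \<inter> space lebesgue \<in> sets lebesgue" using Om by auto
    have e: "indicator \<Omega> x *\<^sub>R (indicator K' x * norm (G x) powr p) = indicator K' x * norm (G x) powr p" for x
      using K'(2) by (auto simp: indicator_def)
    have i1: "integrable lebesgue (\<lambda>x. indicator K' x * norm (G x) powr p)"
      using local_Lp(2)[OF K'] integrable_restrict_space[OF s, of "\<lambda>x. indicator K' x * norm (G x) powr p"] unfolding e by simp
    have "integrable lebesgue (\<lambda>x. \<bar>gG i x\<bar> powr p)"
    proof (rule Bochner_Integration.integrable_bound[OF i1])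
      show "(\<lambda>x. \<bar>gG i x\<bar> powr p) \<in> borel_measurable lebesgue" by (rule measurable_completion) simp
      show "AE x in lebesgue. norm (\<bar>gG i x\<bar> powr p) \<le> norm (indicator K' x * norm (G x) powr p)"
        using AE_completion[OF gG(2)[OF i]]
      proof eventually_elim
        case (elim x)
        show ?case
        proof (cases "x \<in> K'")
          case True
          then show ?thesis unfolding elim using Basis_le_norm[OF i, of "G x"] p by (auto intro!: powr_mono2)
        qed (simp add: elim)
      qed
    qed
    then show ?thesis by (subst (asm) integrable_completion) auto
  qed
  \<comment> \<open>One radius serves \<open>\<psi>\<close> and all components of its weak gradient;
    L1 errors below \<open>(1/2)^n\<close> upgrade L1 convergence to convergence almost
    everywhere.\<close>
  have "\<exists>r. 0 < r \<and> r < r0 \<and> (\<forall>h\<in>insert g (gG ` Basis). integral\<^sup>L lborel (\<lambda>x. indicator K x * \<bar>conv h (moll 1 r) x - h x\<bar>) < (1/2)^n)" for n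
  proof -
    obtain d where d: "d > 0" "\<forall>r. 0 < r \<and> r < d \<longrightarrow> (\<forall>h\<in>insert g (gG ` Basis). integral\<^sup>L lborel (\<lambda>x. indicator K x * \<bar>conv h (moll 1 r) x - h x\<bar>) < (1/2)^n)"
      using conv_moll_simultaneous[OF zero_less_one, of "insert g (gG ` Basis)" K "(1/2)^n"] g1 gG(1) K(1) by auto
    show ?thesis by (rule exI[of _ "min d r0 / 2"]) (use d r0 in auto)
  qed
  then obtain r where r: "\<And>n. r n > 0" "\<And>n. r n < r0"
    "\<And>n h. h \<in> insert g (gG ` Basis) \<Longrightarrow> integral\<^sup>L lborel (\<lambda>x. indicator K x * \<bar>conv h (moll 1 (r n)) x - h x\<bar>) < (1/2)^n"
    by metis
  have convAE: "AE x in M. x \<in> K \<longrightarrow> (\<lambda>n. conv h (moll 1 (r n)) x) \<longlonglongrightarrow> h x"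
    if h: "h \<in> insert g (gG ` Basis)" for h
  proof (rule AE_lborel_lebesgue_on[OF _ Os])
    have hi: "integrable lborel h" using h g1 gG(1) by auto
    have Kb: "K \<in> sets lborel" using K(1) by (simp add: borel_compact)
    have "AE x in lborel. (\<lambda>n. indicator K x * \<bar>conv h (moll 1 (r n)) x - h x\<bar>) \<longlonglongrightarrow> 0"
    proof (rule AE_tendsto_zero_geometric[where B=1])
      show "integrable lborel (\<lambda>x. indicator K x * \<bar>conv h (moll 1 (r n)) x - h x\<bar>)" for n
      proof -
        have "integrable lborel (\<lambda>x. \<bar>conv h (moll 1 (r n)) x - h x\<bar>)"
          using conv_moll_Tonelli(1)[OF zero_less_one r(1) hi] hi by auto
        from integrable_mult_indicator[OF Kb this] show ?thesis by simp
      qed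
      show "integral\<^sup>L lborel (\<lambda>x. indicator K x * \<bar>conv h (moll 1 (r n)) x - h x\<bar>) \<le> 1 * (1/2)^n" for n
        using r(3)[OF h, of n] by simp
    qed simp
    then show "AE x in lborel. x \<in> K \<longrightarrow> (\<lambda>n. conv h (moll 1 (r n)) x) \<longlonglongrightarrow> h x"
    proof eventually_elim
      case (elim x)
      show ?case
      proof
        assume "x \<in> K"
        then have "(\<lambda>n. \<bar>conv h (moll 1 (r n)) x - h x\<bar>) \<longlonglongrightarrow> 0" using elim by simp
        then have "(\<lambda>n. conv h (moll 1 (r n)) x - h x) \<longlonglongrightarrow> 0" by (simp add: tendsto_rabs_zero_iff)
        then show "(\<lambda>n. conv h (moll 1 (r n)) x) \<longlonglongrightarrow> h x" by (rule LIM_zero_cancel)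
      qed
    qed
  qed
  define \<psi>n where "\<psi>n n = conv g (moll 1 (r n))" for n
  define an where "an i n = conv (gG i) (moll 1 (r n))" for i n
  have \<psi>n0: "\<psi>n n x \<ge> 0" for n x unfolding \<psi>n_def by (rule conv_moll_nonneg[OF _ r(1)]) (auto simp: g_def)
  have \<psi>lim: "AE x in M. x \<in> K \<longrightarrow> (\<lambda>n. \<psi>n n x) \<longlonglongrightarrow> \<psi> x"
    using convAE[of g, OF insertI1] AE_lborel_lebesgue_on[OF g0g Os] AE_lborel_lebesgue_on[OF g0(2) Os]
  proof eventually_elim
    case (elim x)
    then show ?case using KK' by (auto simp: \<psi>n_def)
  qed
  have alim: "AE x in M. x \<in> K \<longrightarrow> (\<lambda>n. an i n x) \<longlonglongrightarrow> G x \<bullet> i" if i: "i \<in> Basis" for i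
  proof -
    have "gG i \<in> insert g (gG ` Basis)" using i by simp
    from convAE[OF this] AE_lborel_lebesgue_on[OF gG(2)[OF i] Os] show ?thesis
    proof eventually_elim
      case (elim x)
      then show ?case using KK' by (auto simp: an_def)
    qed
  qed
  have gradn: "grad (\<psi>n n) x \<bullet> i = an i n x" if "x \<in> K" "i \<in> Basis" for n x i
    unfolding \<psi>n_def an_def
  proof (rule mollified_weak_grad[OF r(1) K' _ that(2) g1 g2 gG(3)[OF that(2)]])
    fix y assume "norm (y - x) \<le> r n"
    then show "y \<in> K'" using nb[OF that(1), of y] r(2)[of n] by linarith
  qed auto
  have C1m: "C1c UNIV (moll 1 (r n) :: 'a \<Rightarrow> real)" for n by (rule moll(2)[OF zero_less_one r(1)])
  have d\<psi>: "\<psi>n n differentiable at x" for n x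
    unfolding \<psi>n_def differentiable_def using conv_has_derivative[OF g1 C1m] by blast
  have c\<psi>: "continuous_on UNIV (grad (\<psi>n n))" for n unfolding \<psi>n_def by (rule conv_grad(2)[OF g1 C1m])
  have c\<psi>': "continuous_on UNIV (\<psi>n n)" for n
    using d\<psi> by (meson continuous_at_imp_continuous_on differentiable_imp_continuous_within)
  define w where "w n x = (\<psi>n n x + e) powr (1 - p)" for n x
  define w' where "w' n x = ((1 - p) * (\<psi>n n x + e) powr (- p)) *\<^sub>R grad (\<psi>n n) x" for n x
  have pe: "\<psi>n n x + e > 0" for n x using \<psi>n0[of n x] e by simp
  have dw: "(w n has_derivative (\<lambda>h. w' n x \<bullet> h)) (at x)" for n x
  proof -
    have "((\<lambda>y. y powr (1 - p)) has_real_derivative (1 - p) * (\<psi>n n x + e) powr (1 - p - 1)) (at (\<psi>n n x + e))"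
      using pe[of n x] by (auto intro!: derivative_eq_intros)
    moreover have "((\<lambda>x. \<psi>n n x + e) has_derivative (\<lambda>h. grad (\<psi>n n) x \<bullet> h)) (at x)"
      using has_derivative_add_const[OF has_derivative_grad[OF d\<psi>]] .
    ultimately have "((\<lambda>x. (\<psi>n n x + e) powr (1 - p)) has_derivative (\<lambda>h. (grad (\<psi>n n) x \<bullet> h) * ((1 - p) * (\<psi>n n x + e) powr (1 - p - 1)))) (at x)"
      by (rule DERIV_compose_FDERIV)
    then show ?thesis unfolding w_def w'_def by (simp add: mult_ac)
  qed
  have cw: "continuous_on UNIV (w' n)" for n unfolding w'_def using pe
    by (intro continuous_intros c\<psi> c\<psi>') (auto simp: less_imp_neq[symmetric])
  define \<phi>n where "\<phi>n n = (\<lambda>x. w n x * \<zeta> x)" for n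
  have \<phi>n: "C1c \<Omega> (\<phi>n n)" "grad (\<phi>n n) x = w n x *\<^sub>R grad \<zeta> x + \<zeta> x *\<^sub>R w' n x" for n x
    using C1c_mult_local[OF c open_UNIV subset_UNIV dw[of n] cw[of n]] by (auto simp: \<phi>n_def)
  have w0: "0 \<le> w n x" "w n x \<le> e powr (1 - p)" for n x
  proof -
    show "0 \<le> w n x" by (simp add: w_def)
    show "w n x \<le> e powr (1 - p)" unfolding w_def using \<psi>n0[of n x] e p by (intro powr_mono2') auto
  qed
  have sup: "0 \<le> functional (grad (\<phi>n n)) (\<phi>n n)" for n
    by (rule super_C1c[OF \<phi>n(1)]) (simp add: \<phi>n_def w0 \<zeta>0)
  have [measurable]: "\<psi>n n \<in> borel_measurable M" "grad (\<psi>n n) \<in> borel_measurable M" for n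
    using c\<psi> c\<psi>' by (auto intro!: borel_measurable_lebesgue_on borel_measurable_continuous_onI)
  have [measurable]: "an i n \<in> borel_measurable M" if "i \<in> Basis" for i n
    using conv_moll_Tonelli(1)[OF zero_less_one r(1) gG(1)[OF that]] unfolding an_def
    by (intro borel_measurable_lebesgue_on) auto
  define B where "B = b * e powr (1 - p)"
  \<comment> \<open>The mollified gradient has no obvious dominating function, only a bound in
    \<open>L\<^sup>p\<close>. Its term is therefore split by components into the fixed function
    \<open>h i\<close>, which lies in the dual space, and \<open>a' i n\<close>, which converges
    almost everywhere.\<close>
  define h where "h i x = norm (G x) powr (p - 2) * (G x \<bullet> i) * \<zeta> x * (1 - p)" for i x
  define a' where "a' i n x = indicator K x * (\<psi>n n x + e) powr (- p) * an i n x" for i n x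
  define a'' where "a'' i x = indicator K x * (\<psi> x + e) powr (- p) * (G x \<bullet> i)" for i x
  have [measurable]: "h i \<in> borel_measurable M" "a'' i \<in> borel_measurable M" for i unfolding h_def a''_def by measurable
  have am[measurable]: "a' i n \<in> borel_measurable M" if [simp]: "i \<in> Basis" for i n unfolding a'_def by measurable
  define q where "q = p / (p - 1)"
  have q: "q > 1" "(p - 1) * q = p" using p by (auto simp: q_def field_simps)
  have a'lim: "AE x in M. (\<lambda>n. a' i n x) \<longlonglongrightarrow> a'' i x" if i: "i \<in> Basis" for i
    using \<psi>lim alim[OF i] AE_space
  proof eventually_elim
    case (elim x)
    show ?case
    proof (cases "x \<in> K")
      case True
      have "\<psi> x + e \<noteq> 0" using pos[of x] elim(3) e by (simp add: add_pos_pos)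
      then show ?thesis unfolding a'_def a''_def using elim(1,2) True by (intro tendsto_intros) auto
    qed (simp add: a'_def a''_def)
  qed
  define Ca where "Ca i = (e powr (- p)) powr p * integral\<^sup>L lborel (\<lambda>x. \<bar>gG i x\<bar> powr p)" for i
  have a'b: "integrable M (\<lambda>x. \<bar>a' i n x\<bar> powr p)" "integral\<^sup>L M (\<lambda>x. \<bar>a' i n x\<bar> powr p) \<le> Ca i" if i: "i \<in> Basis" for i n
  proof -
    note L = conv_moll_Lp[OF zero_less_one r(1)[of n] p gG(1)[OF i] gGp[OF i], folded an_def]
    note LM = integral_lebesgue_on_le[OF Om L(1)]
    have le: "\<bar>a' i n x\<bar> powr p \<le> (e powr (- p)) powr p * \<bar>an i n x\<bar> powr p" for x
    proof -
      have "(\<psi>n n x + e) powr (- p) \<le> e powr (- p)" using \<psi>n0[of n x] e p by (intro powr_mono2') auto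
      then have "\<bar>a' i n x\<bar> \<le> e powr (- p) * \<bar>an i n x\<bar>" unfolding a'_def
        by (auto simp: abs_mult indicator_def mult_right_mono)
      then have "\<bar>a' i n x\<bar> powr p \<le> (e powr (- p) * \<bar>an i n x\<bar>) powr p" using p by (intro powr_mono2) auto
      then show ?thesis by (simp add: powr_mult)
    qed
    have LMi: "integrable M (\<lambda>x. (e powr (- p)) powr p * \<bar>an i n x\<bar> powr p)" using LM(1) by simp
    show ai: "integrable M (\<lambda>x. \<bar>a' i n x\<bar> powr p)"
      by (rule Bochner_Integration.integrable_bound[OF LMi]) (use le am[OF i] in \<open>auto intro: order_trans[OF _ abs_ge_self]\<close>)
    have "integral\<^sup>L M (\<lambda>x. \<bar>a' i n x\<bar> powr p) \<le> integral\<^sup>L M (\<lambda>x. (e powr (- p)) powr p * \<bar>an i n x\<bar> powr p)"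
      by (rule integral_mono[OF ai LMi le])
    also have "\<dots> = (e powr (- p)) powr p * integral\<^sup>L M (\<lambda>x. \<bar>an i n x\<bar> powr p)" by simp
    also have "\<dots> \<le> Ca i" unfolding Ca_def using LM(2) L(2) by (intro mult_left_mono) auto
    finally show "integral\<^sup>L M (\<lambda>x. \<bar>a' i n x\<bar> powr p) \<le> Ca i" .
  qed
  have hq: "integrable M (\<lambda>x. \<bar>h i x\<bar> powr (p / (p - 1)))" if i: "i \<in> Basis" for i
  proof (rule Bochner_Integration.integrable_bound)
    show "integrable M (\<lambda>x. ((p - 1) * b) powr q * (indicator K x * norm (G x) powr p))" using local_Lp(2)[OF K] by simp
    show "AE x in M. norm (\<bar>h i x\<bar> powr (p / (p - 1))) \<le> norm (((p - 1) * b) powr q * (indicator K x * norm (G x) powr p))"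
    proof (rule AE_I2)
      fix x
      show "norm (\<bar>h i x\<bar> powr (p / (p - 1))) \<le> norm (((p - 1) * b) powr q * (indicator K x * norm (G x) powr p))"
      proof (cases "x \<in> K")
        case True
        have "\<bar>norm (G x) powr (p - 2) * (G x \<bullet> i)\<bar> \<le> norm (G x) powr (p - 1)"
          using pflux_bound[of "G x" p i] i by simp
        then have "\<bar>norm (G x) powr (p - 2) * (G x \<bullet> i)\<bar> * (\<bar>\<zeta> x\<bar> * \<bar>1 - p\<bar>) \<le> norm (G x) powr (p - 1) * (b * (p - 1))"
          using b(1) b(2)[of x] p by (intro mult_mono) auto
        then have "\<bar>h i x\<bar> \<le> ((p - 1) * b) * norm (G x) powr (p - 1)" unfolding h_def by (simp add: abs_mult mult_ac)
        then have "\<bar>h i x\<bar> powr q \<le> (((p - 1) * b) * norm (G x) powr (p - 1)) powr q" using q by (intro powr_mono2) auto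
        also have "\<dots> = ((p - 1) * b) powr q * norm (G x) powr p" using b(1) p by (simp add: powr_mult powr_powr q(2))
        finally show ?thesis using True by (simp add: q_def)
      next
        case False
        then have "\<zeta> x = 0" by (simp add: K_def zero_off_tsupp)
        then show ?thesis by (simp add: h_def)
      qed
    qed
  qed measurable
  have ha: "integrable M (\<lambda>x. h i x * a'' i x)" "\<And>n. integrable M (\<lambda>x. h i x * a' i n x)"
    "(\<lambda>n. integral\<^sup>L M (\<lambda>x. h i x * a' i n x)) \<longlonglongrightarrow> integral\<^sup>L M (\<lambda>x. h i x * a'' i x)" if i: "i \<in> Basis" for i
    by (rule weak_convergence_from_AE[OF p am[OF i] _ _ a'lim[OF i] a'b[OF i] hq[OF i]]; measurable)+
  define w2 where "w2 x = (\<psi> x + e) powr (1 - p)" for x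
  have wlim: "AE x in M. x \<in> K \<longrightarrow> (\<lambda>n. w n x) \<longlonglongrightarrow> w2 x"
    using \<psi>lim AE_space
  proof eventually_elim
    case (elim x)
    have "\<psi> x + e \<noteq> 0" using pos[of x] elim(2) e by (simp add: add_pos_pos)
    then show ?case unfolding w_def w2_def using elim(1) by (auto intro!: tendsto_intros)
  qed
  have [measurable]: "w n \<in> borel_measurable M" "w2 \<in> borel_measurable M" for n unfolding w_def w2_def by measurable
  have off: "\<zeta> x = 0" "grad \<zeta> x = 0" if "x \<notin> K" for x using that by (auto simp: K_def zero_off_tsupp grad_zero_off_tsupp)
  have wB: "norm (w n x *\<^sub>R grad \<zeta> x) \<le> B" "\<bar>\<phi>n n x\<bar> \<le> B" for n x
    unfolding B_def \<phi>n_def using w0[of n x] b(1) b(2)[of x] b(3)[of x]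
    by (auto simp: abs_mult mult.commute[of b] intro!: mult_mono)
  have FL: "(\<lambda>n. integral\<^sup>L M (\<lambda>x. norm (G x) powr (p - 2) * (G x \<bullet> (w n x *\<^sub>R grad \<zeta> x)))) \<longlonglongrightarrow> integral\<^sup>L M (\<lambda>x. norm (G x) powr (p - 2) * (G x \<bullet> (w2 x *\<^sub>R grad \<zeta> x)))"
    "(\<lambda>n. integral\<^sup>L M (\<lambda>x. (V x - l) * (\<psi> x powr (p - 1) * \<phi>n n x))) \<longlonglongrightarrow> integral\<^sup>L M (\<lambda>x. (V x - l) * (\<psi> x powr (p - 1) * (w2 x * \<zeta> x)))"
  proof -
    have l1: "AE x in M. (\<lambda>n. w n x *\<^sub>R grad \<zeta> x) \<longlonglongrightarrow> w2 x *\<^sub>R grad \<zeta> x" using wlim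
    proof eventually_elim
      case (elim x)
      then show ?case by (cases "x \<in> K") (auto simp: off intro!: tendsto_intros)
    qed
    have l2: "AE x in M. (\<lambda>n. \<phi>n n x) \<longlonglongrightarrow> w2 x * \<zeta> x" using wlim
    proof eventually_elim
      case (elim x)
      then show ?case unfolding \<phi>n_def by (cases "x \<in> K") (auto simp: off intro!: tendsto_intros)
    qed
    have m: "\<And>n. (\<lambda>x. w n x *\<^sub>R grad \<zeta> x) \<in> borel_measurable M" "\<And>n. \<phi>n n \<in> borel_measurable M"
      "(\<lambda>x. w2 x *\<^sub>R grad \<zeta> x) \<in> borel_measurable M" "(\<lambda>x. w2 x * \<zeta> x) \<in> borel_measurable M"
      unfolding \<phi>n_def by measurable
    have z: "\<And>n x. x \<notin> K \<Longrightarrow> w n x *\<^sub>R grad \<zeta> x = 0" "\<And>n x. x \<notin> K \<Longrightarrow> \<phi>n n x = 0" by (auto simp: off \<phi>n_def)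
    from functional_limit[OF K m wB(1) z(1) wB(2) z(2) l1 l2]
    show "(\<lambda>n. integral\<^sup>L M (\<lambda>x. norm (G x) powr (p - 2) * (G x \<bullet> (w n x *\<^sub>R grad \<zeta> x)))) \<longlonglongrightarrow> integral\<^sup>L M (\<lambda>x. norm (G x) powr (p - 2) * (G x \<bullet> (w2 x *\<^sub>R grad \<zeta> x)))"
      "(\<lambda>n. integral\<^sup>L M (\<lambda>x. (V x - l) * (\<psi> x powr (p - 1) * \<phi>n n x))) \<longlonglongrightarrow> integral\<^sup>L M (\<lambda>x. (V x - l) * (\<psi> x powr (p - 1) * (w2 x * \<zeta> x)))" by auto
  qed
  have mw: "(\<lambda>x. w n x *\<^sub>R grad \<zeta> x) \<in> borel_measurable M" for n by measurable
  have iw: "integrable M (\<lambda>x. norm (G x) powr (p - 2) * (G x \<bullet> (w n x *\<^sub>R grad \<zeta> x)))" for n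
    by (rule integrable_flux(1)[OF K mw wB(1)]) (simp add: off)
  have split: "integral\<^sup>L M (\<lambda>x. norm (G x) powr (p - 2) * (G x \<bullet> grad (\<phi>n n) x))
     = integral\<^sup>L M (\<lambda>x. norm (G x) powr (p - 2) * (G x \<bullet> (w n x *\<^sub>R grad \<zeta> x))) + (\<Sum>i\<in>Basis. integral\<^sup>L M (\<lambda>x. h i x * a' i n x))" for n
  proof -
    have "norm (G x) powr (p - 2) * (G x \<bullet> grad (\<phi>n n) x)
       = norm (G x) powr (p - 2) * (G x \<bullet> (w n x *\<^sub>R grad \<zeta> x)) + (\<Sum>i\<in>Basis. h i x * a' i n x)" for x
    proof (cases "x \<in> K")
      case True
      have "G x \<bullet> grad (\<psi>n n) x = (\<Sum>i\<in>Basis. (G x \<bullet> i) * an i n x)"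
        by (subst euclidean_inner) (intro sum.cong refl, simp add: gradn[OF True])
      then have "norm (G x) powr (p - 2) * (G x \<bullet> (\<zeta> x *\<^sub>R w' n x)) = (\<Sum>i\<in>Basis. h i x * a' i n x)"
        unfolding h_def a'_def w'_def using True by (simp add: sum_distrib_left mult_ac)
      then show ?thesis unfolding \<phi>n(2) by (simp only: inner_add_right distrib_left)
    qed (simp add: \<phi>n(2) off a'_def)
    then show ?thesis using iw[of n] ha(2)[of _ n]
      by (simp only:) (subst Bochner_Integration.integral_add, auto intro!: Bochner_Integration.integrable_sum simp: Bochner_Integration.integral_sum)
  qed
  have fl: "(\<lambda>n. functional (grad (\<phi>n n)) (\<phi>n n)) \<longlonglongrightarrow>
     \<alpha> * (integral\<^sup>L M (\<lambda>x. norm (G x) powr (p - 2) * (G x \<bullet> (w2 x *\<^sub>R grad \<zeta> x))) + (\<Sum>i\<in>Basis. integral\<^sup>L M (\<lambda>x. h i x * a'' i x)))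
      + integral\<^sup>L M (\<lambda>x. (V x - l) * (\<psi> x powr (p - 1) * (w2 x * \<zeta> x)))"
    unfolding functional_def split by (intro tendsto_intros FL ha(3))
  have lim0: "0 \<le> \<alpha> * (integral\<^sup>L M (\<lambda>x. norm (G x) powr (p - 2) * (G x \<bullet> (w2 x *\<^sub>R grad \<zeta> x))) + (\<Sum>i\<in>Basis. integral\<^sup>L M (\<lambda>x. h i x * a'' i x)))
      + integral\<^sup>L M (\<lambda>x. (V x - l) * (\<psi> x powr (p - 1) * (w2 x * \<zeta> x)))"
    by (rule LIMSEQ_le_const[OF fl]) (use sup in auto)
  \<comment> \<open>The bound on \<open>w2\<close> uses positivity of \<open>\<psi>\<close> and
    holds inside the domain; extension by zero yields the everywhere bound that
    \<open>integrable_flux\<close> asks for.\<close>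
  define w3 where "w3 x = (if x \<in> \<Omega> then w2 x *\<^sub>R grad \<zeta> x else 0)" for x
  have w3b: "norm (w3 x) \<le> B" for x
  proof (cases "x \<in> \<Omega>")
    case True
    have "w2 x \<le> e powr (1 - p)" unfolding w2_def using pos[OF True] e p by (intro powr_mono2') auto
    then show ?thesis unfolding w3_def B_def using True b(1) b(3)[of x]
      by (auto simp: w2_def mult.commute[of b] intro!: mult_mono)
  qed (use b(1) in \<open>simp add: w3_def B_def\<close>)
  have i3: "integrable M (\<lambda>x. norm (G x) powr (p - 2) * (G x \<bullet> w3 x))"
  proof (rule integrable_flux(1)[OF K _ w3b])
    show "w3 \<in> borel_measurable M"
      by (subst measurable_cong[where g="\<lambda>x. w2 x *\<^sub>R grad \<zeta> x"]) (auto simp: w3_def)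
  qed (auto simp: w3_def off)
  have i4: "integrable M (\<lambda>x. norm (G x) powr (p - 2) * (G x \<bullet> (w2 x *\<^sub>R grad \<zeta> x)))"
    by (rule Bochner_Integration.integrable_cong[THEN iffD1, OF refl _ i3]) (auto simp: w3_def)
  have "integral\<^sup>L M (\<lambda>x. norm (G x) powr (p - 2) * (G x \<bullet> (w2 x *\<^sub>R grad \<zeta> x))) + (\<Sum>i\<in>Basis. integral\<^sup>L M (\<lambda>x. h i x * a'' i x))
     = integral\<^sup>L M (\<lambda>x. norm (G x) powr (p - 2) * (G x \<bullet> (w2 x *\<^sub>R grad \<zeta> x)) + (\<Sum>i\<in>Basis. h i x * a'' i x))"
    using i4 ha(1) by (subst Bochner_Integration.integral_add) (auto intro!: Bochner_Integration.integrable_sum simp: Bochner_Integration.integral_sum)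
  also have "\<dots> \<le> energy p \<Omega> \<zeta>"
  proof (rule integral_mono)
    show "integrable M (\<lambda>x. norm (G x) powr (p - 2) * (G x \<bullet> (w2 x *\<^sub>R grad \<zeta> x)) + (\<Sum>i\<in>Basis. h i x * a'' i x))"
      using i4 ha(1) by (intro Bochner_Integration.integrable_add Bochner_Integration.integrable_sum) auto
    show "integrable M (\<lambda>x. en p (\<zeta> x) (grad \<zeta> x))" by (rule adm_lebesgue_on(1)[OF Om \<zeta>])
    fix x assume "x \<in> space M"
    then have s: "\<psi> x + e > 0" using pos[of x] e by simp
    \<comment> \<open>The regularised logarithmic gradient of \<open>\<psi>\<close>. Testing
      produced exactly the two terms of \<open>en_young\<close> for this field: the flux against
      \<open>grad \<zeta>\<close> and the penalty.\<close>
    define F where "F = G x /\<^sub>R (\<psi> x + e)"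
    have nF: "norm F = norm (G x) / (\<psi> x + e)" unfolding F_def using s by (simp add: divide_inverse)
    have F1: "norm F powr (p - 2) * (F \<bullet> grad \<zeta> x) = norm (G x) powr (p - 2) * (G x \<bullet> (w2 x *\<^sub>R grad \<zeta> x))"
    proof -
      have "(\<psi> x + e) powr (p - 2) * (\<psi> x + e) = (\<psi> x + e) powr (p - 1)"
        using s by (simp add: powr_mult_base mult.commute)
      moreover have "w2 x = 1 / (\<psi> x + e) powr (p - 1)" unfolding w2_def using powr_minus_divide[of "\<psi> x + e" "p - 1"] by simp
      moreover have "norm F powr (p - 2) = norm (G x) powr (p - 2) / (\<psi> x + e) powr (p - 2)" unfolding nF using s by (simp add: powr_divide)
      moreover have "F \<bullet> grad \<zeta> x = (G x \<bullet> grad \<zeta> x) / (\<psi> x + e)" unfolding F_def by (simp add: divide_inverse mult.commute)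
      ultimately show ?thesis by (simp add: times_divide_times_eq)
    qed
    have F2: "(p - 1) * norm F powr p * \<zeta> x = - (\<Sum>i\<in>Basis. h i x * a'' i x)"
    proof (cases "x \<in> K")
      case True
      have "(\<Sum>i\<in>Basis. h i x * a'' i x) = norm (G x) powr (p - 2) * (\<Sum>i\<in>Basis. (G x \<bullet> i) * (G x \<bullet> i)) * \<zeta> x * (1 - p) * (\<psi> x + e) powr (- p)"
        unfolding h_def a''_def using True by (simp add: sum_distrib_left sum_distrib_right mult_ac)
      also have "(\<Sum>i\<in>Basis. (G x \<bullet> i) * (G x \<bullet> i)) = G x \<bullet> G x" by (rule euclidean_inner[symmetric])
      also have "norm (G x) powr (p - 2) * (G x \<bullet> G x) = norm (G x) powr p" by (rule norm_powr_mult_inner)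
      finally have S: "(\<Sum>i\<in>Basis. h i x * a'' i x) = norm (G x) powr p * \<zeta> x * (1 - p) * (\<psi> x + e) powr (- p)" .
      have "norm F powr p = norm (G x) powr p * (\<psi> x + e) powr (- p)" unfolding nF using s by (simp add: powr_divide powr_minus_divide)
      then show ?thesis unfolding S by (simp add: algebra_simps)
    qed (simp add: off a''_def)
    show "norm (G x) powr (p - 2) * (G x \<bullet> (w2 x *\<^sub>R grad \<zeta> x)) + (\<Sum>i\<in>Basis. h i x * a'' i x) \<le> en p (\<zeta> x) (grad \<zeta> x)"
      using en_young[OF p \<zeta>0 adm_zero_grad[OF \<zeta>], of x x F] unfolding F1 F2 by simp
  qed
  finally have "\<alpha> * (integral\<^sup>L M (\<lambda>x. norm (G x) powr (p - 2) * (G x \<bullet> (w2 x *\<^sub>R grad \<zeta> x))) + (\<Sum>i\<in>Basis. integral\<^sup>L M (\<lambda>x. h i x * a'' i x)))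
     \<le> \<alpha> * energy p \<Omega> \<zeta>" using al by simp
  then show ?thesis using lim0 unfolding w2_def by linarith
qed

text \<open>Let \<open>e\<close> tend to zero: the factor
  \<open>\<psi> x powr (p - 1) * (\<psi> x + e) powr (1 - p)\<close> is at most 1 and tends to 1, so
  the potential term is dominated by the absolute value of its limit.\<close>

lemma picone:
  assumes \<zeta>: "adm p \<Omega> \<zeta>"
  shows "l * integral\<^sup>L M \<zeta> \<le> \<alpha> * energy p \<Omega> \<zeta> + integral\<^sup>L M (\<lambda>x. V x * \<zeta> x)"
proof -
  note [measurable] = meas
  note a = adm_lebesgue_on[OF Om \<zeta>]
  have [measurable]: "\<zeta> \<in> borel_measurable M" using a(3) by simp
  have i: "integrable M (\<lambda>x. (V x - l) * \<zeta> x)" using a(3) a(6)[OF V] by (simp add: left_diff_distrib)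
  define e where "e n = inverse (real (Suc n))" for n
  have e: "e n > 0" for n by (simp add: e_def)
  have e0: "e \<longlonglongrightarrow> 0" unfolding e_def by (rule LIMSEQ_inverse_real_of_nat)
  have "(\<lambda>n. integral\<^sup>L M (\<lambda>x. (V x - l) * (\<psi> x powr (p - 1) * ((\<psi> x + e n) powr (1 - p) * \<zeta> x)))) \<longlonglongrightarrow> integral\<^sup>L M (\<lambda>x. (V x - l) * \<zeta> x)"
  proof (rule integral_dominated_convergence[where w="\<lambda>x. \<bar>(V x - l) * \<zeta> x\<bar>"])
    show "integrable M (\<lambda>x. \<bar>(V x - l) * \<zeta> x\<bar>)" using i by simp
    show "AE x in M. (\<lambda>n. (V x - l) * (\<psi> x powr (p - 1) * ((\<psi> x + e n) powr (1 - p) * \<zeta> x))) \<longlonglongrightarrow> (V x - l) * \<zeta> x"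
    proof (rule AE_I2)
      fix x assume "x \<in> space M"
      then have px: "\<psi> x > 0" using pos by simp
      have "(\<lambda>n. (V x - l) * (\<psi> x powr (p - 1) * ((\<psi> x + e n) powr (1 - p) * \<zeta> x))) \<longlonglongrightarrow> (V x - l) * (\<psi> x powr (p - 1) * ((\<psi> x + 0) powr (1 - p) * \<zeta> x))"
        using px by (intro tendsto_intros e0) auto
      moreover have "\<psi> x powr (p - 1) * (\<psi> x powr (1 - p) * \<zeta> x) = \<zeta> x"
        using px by (simp add: mult.assoc[symmetric] powr_add[symmetric])
      ultimately show "(\<lambda>n. (V x - l) * (\<psi> x powr (p - 1) * ((\<psi> x + e n) powr (1 - p) * \<zeta> x))) \<longlonglongrightarrow> (V x - l) * \<zeta> x" by simp
    qed
    show "AE x in M. norm ((V x - l) * (\<psi> x powr (p - 1) * ((\<psi> x + e n) powr (1 - p) * \<zeta> x))) \<le> \<bar>(V x - l) * \<zeta> x\<bar>" for n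
    proof (rule AE_I2)
      fix x assume "x \<in> space M"
      then have px: "\<psi> x > 0" using pos by simp
      have "(\<psi> x + e n) powr (1 - p) \<le> \<psi> x powr (1 - p)" using px e[of n] p by (intro powr_mono2') auto
      then have "\<psi> x powr (p - 1) * (\<psi> x + e n) powr (1 - p) \<le> \<psi> x powr (p - 1) * \<psi> x powr (1 - p)" by (intro mult_left_mono) auto
      also have "\<dots> = 1" using px by (simp add: powr_add[symmetric])
      finally have "(\<psi> x powr (p - 1) * (\<psi> x + e n) powr (1 - p)) * \<bar>(V x - l) * \<zeta> x\<bar> \<le> 1 * \<bar>(V x - l) * \<zeta> x\<bar>" by (intro mult_right_mono) auto
      then show "norm ((V x - l) * (\<psi> x powr (p - 1) * ((\<psi> x + e n) powr (1 - p) * \<zeta> x))) \<le> \<bar>(V x - l) * \<zeta> x\<bar>"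
        by (simp add: abs_mult mult_ac)
    qed
  qed measurable
  then have "(\<lambda>n. \<alpha> * energy p \<Omega> \<zeta> + integral\<^sup>L M (\<lambda>x. (V x - l) * (\<psi> x powr (p - 1) * ((\<psi> x + e n) powr (1 - p) * \<zeta> x)))) \<longlonglongrightarrow> \<alpha> * energy p \<Omega> \<zeta> + integral\<^sup>L M (\<lambda>x. (V x - l) * \<zeta> x)"
    by (intro tendsto_intros)
  then have "0 \<le> \<alpha> * energy p \<Omega> \<zeta> + integral\<^sup>L M (\<lambda>x. (V x - l) * \<zeta> x)"
    by (rule LIMSEQ_le_const) (use picone_regularised[OF \<zeta> e] in auto)
  then show ?thesis using a(3) a(6)[OF V] by (simp add: left_diff_distrib)
qed

end

section \<open>The variational characterisation\<close>


text \<open>The kernel is a multiple of the m-th power of \<open>bump 1 s\<close>, so it has finite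
  energy when \<open>m\<close> is at least \<open>p\<close>.\<close>

lemma adm_moll:
  fixes x :: "'a::euclidean_space"
  assumes p: "p > 1" and m: "real m \<ge> p" and r: "r > 0" and S: "\<And>y. norm (y - x) \<le> r \<Longrightarrow> y \<in> S"
  shows "adm p S (\<lambda>y. moll m r (x - y))"
proof -
  define s where "s = r / (2 * DIM('a))"
  define I where "I = integral\<^sup>L lborel (bump m s :: 'a \<Rightarrow> real)"
  have I: "I \<ge> 0" unfolding I_def by (simp add: bump_nonneg)
  define B where "B y = bump 1 s (x + (-1) *\<^sub>R y)" for y
  have sD: "s * DIM('a) = r / 2" by (simp add: s_def)
  have sup: "tsupp (bump 1 s) \<subseteq> cball (0::'a) (r / 2)"
  proof (rule tsupp_subset)
    fix y :: 'a assume "y \<notin> cball 0 (r / 2)"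
    then show "bump 1 s y = 0" using bump_C1c(1)[of 1 s y] sD by auto
  qed simp
  have B: "C1c S B" unfolding B_def
  proof (rule C1c_affine(1)[OF bump_C1c(3)])
    fix y assume "x + (-1) *\<^sub>R y \<in> tsupp (bump 1 s)"
    then have "x + (-1) *\<^sub>R y \<in> cball 0 (r / 2)" using sup by blast
    then show "y \<in> S" using r by (intro S) (auto simp: norm_minus_commute)
  qed auto
  have 1: "adm p S (\<lambda>y. B y ^ m)" by (rule adm_power[OF p B _ m]) (simp add: B_def bump_nonneg)
  have "adm p S (\<lambda>y. (1 / I) * (B y ^ m) + 0 * 0)"
    by (rule adm_lincomb(1)[OF p 1 adm_zero[OF p]]) (use I in auto)
  moreover have "moll m r (x - y) = (1 / I) * (B y ^ m) + 0 * 0" for y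
    by (simp add: moll_def B_def bump_def I_def s_def)
  ultimately show ?thesis by simp
qed

text \<open>Kernels centred at the points of \<open>K\<close> are admissible, so the mollifications
  of \<open>V - c\<close> are nonnegative there; they converge to \<open>V - c\<close> in L1 on
  \<open>K\<close>. The exhaustion by compacts extends the conclusion to the domain.\<close>

lemma nonneg_if_tested_nonneg:
  fixes V :: "'a::euclidean_space \<Rightarrow> real"
  assumes p: "p > 1" and Om: "open \<Omega>" and V: "Linf_loc \<Omega> V"
    and test: "\<And>\<zeta>. adm p \<Omega> \<zeta> \<Longrightarrow> c * integral\<^sup>L (lebesgue_on \<Omega>) \<zeta> \<le> integral\<^sup>L (lebesgue_on \<Omega>) (\<lambda>x. V x * \<zeta> x)"
  shows "AE x in lebesgue. x \<in> \<Omega> \<longrightarrow> c \<le> V x"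
proof -
  define m where "m = nat \<lceil>p\<rceil>"
  have m: "real m \<ge> p" "m > 0" using p unfolding m_def by linarith+
  have Vm: "V \<in> borel_measurable (lebesgue_on \<Omega>)" using V by (simp add: Linf_loc_def)
  have loc: "AE x in lebesgue. x \<in> K \<longrightarrow> c \<le> V x" if K: "compact K" "K \<subseteq> \<Omega>" for K
  proof -
    obtain r0 K' where r0: "r0 > 0" and K': "compact K'" "K' \<subseteq> \<Omega>" and nb: "\<And>x y. x \<in> K \<Longrightarrow> norm (y - x) \<le> r0 \<Longrightarrow> y \<in> K'"
      using compact_neighbourhood[OF Om K] by metis
    have iK: "integrable (lebesgue_on \<Omega>) (\<lambda>x. indicator K' x * 1 :: real)"
      by (rule integrable_on_compact_lebesgue_on[OF Om K']) simp
    have "integrable (lebesgue_on \<Omega>) (\<lambda>x. V x * (indicator K' x * 1))"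
      by (rule integrable_Linf_loc_mult[OF V Om K' iK]) simp
    then have "integrable (lebesgue_on \<Omega>) (\<lambda>x. indicator K' x * (V x - c))"
      using iK by (simp add: right_diff_distrib mult.commute)
    from borel_version[OF Om K'(2) this] obtain g where g: "integrable lborel g" "AE x in lborel. g x = indicator K' x * (V x - c)"
      "\<And>h. h \<in> borel_measurable borel \<Longrightarrow> (\<And>x. x \<notin> K' \<Longrightarrow> h x = 0) \<Longrightarrow> integral\<^sup>L (lebesgue_on \<Omega>) (\<lambda>x. (V x - c) * h x) = integral\<^sup>L lborel (\<lambda>x. g x * h x)"
      by auto
    have cpos: "conv g (moll m r) x \<ge> 0" if r: "r > 0" "r < r0" and x: "x \<in> K" for r x
    proof -
      have a: "adm p \<Omega> (\<lambda>y. moll m r (x - y))"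
      proof (rule adm_moll[OF p m(1) r(1)])
        fix y assume "norm (y - x) \<le> r"
        then have "norm (y - x) \<le> r0" using r(2) by linarith
        then show "y \<in> \<Omega>" using nb[OF x] K'(2) by blast
      qed
      note A = adm_lebesgue_on[OF Om a]
      have z: "moll m r (x - y) = 0" if "y \<notin> K'" for y
      proof (rule moll(4)[OF m(2) r(1)])
        have "\<not> norm (y - x) \<le> r0" using nb[OF x] that by blast
        then show "r \<le> norm (x - y)" using r(2) norm_minus_commute[of x y] by linarith
      qed
      have "conv g (moll m r) x = integral\<^sup>L (lebesgue_on \<Omega>) (\<lambda>y. (V y - c) * moll m r (x - y))"
        unfolding conv_def by (rule g(3)[symmetric]) (use C1c_measurable(1)[OF A(4)] z in auto)
      also have "\<dots> = integral\<^sup>L (lebesgue_on \<Omega>) (\<lambda>y. V y * moll m r (x - y)) - c * integral\<^sup>L (lebesgue_on \<Omega>) (\<lambda>y. moll m r (x - y))"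
        using A(3) A(6)[OF V] by (simp add: left_diff_distrib)
      finally show ?thesis using test[OF a] by simp
    qed
    have Kb: "K \<in> sets lborel" using K(1) by (simp add: borel_compact)
    have [measurable]: "g \<in> borel_measurable borel" using g(1) by simp
    \<comment> \<open>The negative part on \<open>K\<close>. It is at most the distance to the
      mollification, which is nonnegative, so its integral is below every positive number.\<close>
    define N where "N x = indicator K x * max (- g x) 0" for x
    have Ni: "integrable lborel N"
    proof -
      have "integrable lborel (\<lambda>x. max (- g x) 0)" using g(1) by (intro integrable_max) auto
      from integrable_mult_indicator[OF Kb this] show ?thesis by (simp add: N_def[abs_def])
    qed
    have "integral\<^sup>L lborel N \<le> e" if e: "e > 0" for e
    proof -
      obtain d where d: "d > 0" "\<forall>r. 0 < r \<and> r < d \<longrightarrow> integral\<^sup>L lborel (\<lambda>x. indicator K x * \<bar>conv g (moll m r) x - g x\<bar>) < e"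
        using conv_moll_L1[OF m(2) g(1) K(1) e] by auto
      define r where "r = min d r0 / 2"
      have r: "r > 0" "r < r0" "r < d" using d(1) r0 by (auto simp: r_def)
      have "integrable lborel (\<lambda>x. \<bar>conv g (moll m r) x - g x\<bar>)"
        using conv_moll_Tonelli(1)[OF m(2) r(1) g(1)] g(1) by auto
      from integrable_mult_indicator[OF Kb this]
      have "integral\<^sup>L lborel N \<le> integral\<^sup>L lborel (\<lambda>x. indicator K x * \<bar>conv g (moll m r) x - g x\<bar>)"
      proof (intro integral_mono Ni)
        fix x
        show "N x \<le> indicator K x * \<bar>conv g (moll m r) x - g x\<bar>"
          using cpos[OF r(1,2), of x] unfolding N_def by (cases "x \<in> K") auto
      qed simp
      then show ?thesis using d(2)[rule_format, of r] r by linarith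
    qed
    then have "integral\<^sup>L lborel N \<le> 0" by (rule dense_ge)
    moreover have "integral\<^sup>L lborel N \<ge> 0" by (rule Bochner_Integration.integral_nonneg) (simp add: N_def)
    ultimately have "integral\<^sup>L lborel N = 0" by (rule order_antisym)
    moreover have "AE x in lborel. 0 \<le> N x" by (simp add: N_def)
    ultimately have "AE x in lborel. N x = 0"
      using integral_nonneg_eq_0_iff_AE[OF Ni] by blast
    then have "AE x in lborel. x \<in> K \<longrightarrow> c \<le> V x" using g(2)
    proof eventually_elim
      case (elim x)
      show ?case
      proof
        assume x: "x \<in> K"
        then have "x \<in> K'" using nb[OF x, of x] r0 by simp
        then have "g x = V x - c" using elim(2) by simp
        moreover have "max (- g x) 0 = 0" using elim(1) x by (simp add: N_def)
        ultimately show "c \<le> V x" by (simp add: max_def split: if_splits)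
      qed
    qed
    then show ?thesis by (rule AE_completion)
  qed
  obtain C :: "nat \<Rightarrow> 'a set" where C: "(\<forall>n. compact (C n)) \<and> (\<forall>n. C n \<subseteq> \<Omega>) \<and> \<Union>(range C) = \<Omega> \<and>
      (\<forall>K. compact K \<longrightarrow> K \<subseteq> \<Omega> \<longrightarrow> (\<exists>N. \<forall>n\<ge>N. K \<subseteq> C n))"
    using open_compact_exhaustion[OF Om] by blast
  have "AE x in lebesgue. x \<in> C n \<longrightarrow> c \<le> V x" for n using loc[of "C n"] C by simp
  then have "AE x in lebesgue. \<forall>n. x \<in> C n \<longrightarrow> c \<le> V x" by (subst AE_all_countable) blast
  then show ?thesis
  proof eventually_elim
    case (elim x)
    show ?case
    proof
      assume "x \<in> \<Omega>"
      then have "x \<in> \<Union>(range C)" using C by simp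
      then show "c \<le> V x" using elim by auto
    qed
  qed
qed

lemma adm_positive_integral:
  assumes p: "p > 1" and Om: "open \<Omega>" "\<Omega> \<noteq> {}"
  shows "\<exists>\<zeta>. adm p \<Omega> \<zeta> \<and> integral\<^sup>L (lebesgue_on \<Omega>) \<zeta> > 0"
proof -
  obtain x0 where "x0 \<in> \<Omega>" using Om by auto
  then obtain \<Phi> where P: "adm p \<Omega> \<Phi>" "\<Phi> x0 > 0" using adm_cover[OF p Om(1), of "{x0}"] by auto
  note a = adm_lebesgue_on[OF Om(1) P(1)]
  have "integral\<^sup>L lborel \<Phi> > 0"
    by (rule integral_pos_continuous[OF integrable_C1c[OF a(4)] C1cD(2)[OF a(4)] a(5) P(2)])
  then show ?thesis using P(1) C1c_lebesgue_on(2)[OF Om(1) a(4)] by auto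
qed

text \<open>Picone's inequality makes every competitor \<open>l\<close> of the supremum a Rayleigh
  constant; conversely the minimisation makes \<open>l - \<epsilon>\<close> a competitor for every
  Rayleigh constant \<open>l\<close>. Everything after this lemma uses only these two facts about
  the eigenvalue.\<close>

lemma gpe_variational:
  fixes V :: "'a::euclidean_space \<Rightarrow> real"
  assumes p: "p > 1" and Om: "open \<Omega>" "\<Omega> \<noteq> {}" and V: "Linf_loc \<Omega> V"
    and low: "AE x in lebesgue. x \<in> \<Omega> \<longrightarrow> c0 \<le> V x" and al: "\<alpha> > 0"
  shows "adm p \<Omega> \<zeta> \<Longrightarrow> gpe p \<alpha> V \<Omega> * integral\<^sup>L (lebesgue_on \<Omega>) \<zeta>
      \<le> \<alpha> * energy p \<Omega> \<zeta> + integral\<^sup>L (lebesgue_on \<Omega>) (\<lambda>x. V x * \<zeta> x)"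
    and "(\<And>\<zeta>. adm p \<Omega> \<zeta> \<Longrightarrow> l * integral\<^sup>L (lebesgue_on \<Omega>) \<zeta>
      \<le> \<alpha> * energy p \<Omega> \<zeta> + integral\<^sup>L (lebesgue_on \<Omega>) (\<lambda>x. V x * \<zeta> x)) \<Longrightarrow> l \<le> gpe p \<alpha> V \<Omega>"
proof -
  let ?M = "lebesgue_on \<Omega>"
  define S where "S = {l. \<exists>\<psi> G. W1p_loc p \<Omega> \<psi> G \<and> (\<forall>x\<in>\<Omega>. \<psi> x > 0) \<and>
      (\<forall>\<phi>. test_fun \<Omega> \<phi> \<and> (\<forall>x. \<phi> x \<ge> 0) \<longrightarrow>
         \<alpha> * integral\<^sup>L ?M (\<lambda>x. norm (G x) powr (p - 2) * (G x \<bullet> grad \<phi> x))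
         + integral\<^sup>L ?M (\<lambda>x. V x * \<psi> x powr (p - 1) * \<phi> x)
         \<ge> l * integral\<^sup>L ?M (\<lambda>x. \<psi> x powr (p - 1) * \<phi> x))}"
  have gS: "gpe p \<alpha> V \<Omega> = Sup S" by (simp add: gpe_def S_def)
  have SR: "l * integral\<^sup>L ?M \<zeta> \<le> \<alpha> * energy p \<Omega> \<zeta> + integral\<^sup>L ?M (\<lambda>x. V x * \<zeta> x)" if lS: "l \<in> S" and z: "adm p \<Omega> \<zeta>" for l \<zeta>
  proof -
    obtain \<psi> G where h: "W1p_loc p \<Omega> \<psi> G" "\<forall>x\<in>\<Omega>. \<psi> x > 0"
      "\<forall>\<phi>. test_fun \<Omega> \<phi> \<and> (\<forall>x. \<phi> x \<ge> 0) \<longrightarrow>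
         \<alpha> * integral\<^sup>L ?M (\<lambda>x. norm (G x) powr (p - 2) * (G x \<bullet> grad \<phi> x))
         + integral\<^sup>L ?M (\<lambda>x. V x * \<psi> x powr (p - 1) * \<phi> x)
         \<ge> l * integral\<^sup>L ?M (\<lambda>x. \<psi> x powr (p - 1) * \<phi> x)" using lS unfolding S_def by blast
    have "supersolution p \<alpha> l \<Omega> V \<psi> G"
      by unfold_locales (use p Om V al h in auto)
    from supersolution.picone[OF this z] show ?thesis .
  qed
  obtain f :: "'a \<Rightarrow> real" where f: "f \<in> borel_measurable ?M" "\<forall>x. f x > 0" "integrable ?M (\<lambda>x. (f x)\<^sup>2)"
    using ex_positive_L2[OF Om(1)] by blast
  have lowM: "AE x in ?M. c0 \<le> V x" using low Om(1) by (subst AE_lebesgue_on_iff) auto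
  have RS: "l - \<epsilon> \<in> S" if e: "\<epsilon> > 0" and R: "\<And>\<zeta>. adm p \<Omega> \<zeta> \<Longrightarrow> l * integral\<^sup>L ?M \<zeta> \<le> \<alpha> * energy p \<Omega> \<zeta> + integral\<^sup>L ?M (\<lambda>x. V x * \<zeta> x)" for l \<epsilon>
  proof -
    have "rayleigh_bound p \<alpha> (l - \<epsilon>) \<epsilon> (- c0) \<Omega> V f"
      by unfold_locales (use p Om V al e f lowM R in auto)
    from rayleigh_bound.supersolution_exists[OF this] show ?thesis unfolding S_def by blast
  qed
  obtain \<zeta>0 where z0: "adm p \<Omega> \<zeta>0" "integral\<^sup>L ?M \<zeta>0 > 0" using adm_positive_integral[OF p Om] by blast
  have bdd: "bdd_above S"
  \<comment> \<open>The Rayleigh quotient of one test function bounds all competitors. Without this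
    bound and nonemptiness the real supremum would carry no information.\<close>
  proof (rule bdd_aboveI)
    fix l assume "l \<in> S"
    then show "l \<le> (\<alpha> * energy p \<Omega> \<zeta>0 + integral\<^sup>L ?M (\<lambda>x. V x * \<zeta>0 x)) / integral\<^sup>L ?M \<zeta>0"
      using SR[OF _ z0(1)] z0(2) by (simp add: pos_le_divide_eq)
  qed
  have c0R: "c0 * integral\<^sup>L ?M \<zeta> \<le> \<alpha> * energy p \<Omega> \<zeta> + integral\<^sup>L ?M (\<lambda>x. V x * \<zeta> x)" if z: "adm p \<Omega> \<zeta>" for \<zeta>
  proof -
    note a = adm_lebesgue_on[OF Om(1) z]
    have "c0 * integral\<^sup>L ?M \<zeta> = integral\<^sup>L ?M (\<lambda>x. c0 * \<zeta> x)" by simp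
    also have "\<dots> \<le> integral\<^sup>L ?M (\<lambda>x. V x * \<zeta> x)"
    proof (rule integral_mono_AE)
      show "AE x in ?M. c0 * \<zeta> x \<le> V x * \<zeta> x" using lowM by eventually_elim (intro mult_right_mono a(5))
    qed (use a(3) a(6)[OF V] in auto)
    also have "\<dots> \<le> \<alpha> * energy p \<Omega> \<zeta> + integral\<^sup>L ?M (\<lambda>x. V x * \<zeta> x)"
      using al a(5) by (simp add: en_nonneg)
    finally show ?thesis .
  qed
  \<comment> \<open>The lower bound \<open>c0\<close> of the potential is a Rayleigh constant, so
    \<open>c0 - 1\<close> is a competitor.\<close>
  have ne: "S \<noteq> {}" using RS[OF zero_less_one c0R] by blast
  show "gpe p \<alpha> V \<Omega> * integral\<^sup>L ?M \<zeta> \<le> \<alpha> * energy p \<Omega> \<zeta> + integral\<^sup>L ?M (\<lambda>x. V x * \<zeta> x)" if z: "adm p \<Omega> \<zeta>"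
  proof (cases "integral\<^sup>L ?M \<zeta> = 0")
    case True
    then show ?thesis using c0R[OF z] by simp
  next
    case False
    moreover have "integral\<^sup>L ?M \<zeta> \<ge> 0" using adm_lebesgue_on(5)[OF Om(1) z] by simp
    ultimately have i: "integral\<^sup>L ?M \<zeta> > 0" by simp
    have "gpe p \<alpha> V \<Omega> \<le> (\<alpha> * energy p \<Omega> \<zeta> + integral\<^sup>L ?M (\<lambda>x. V x * \<zeta> x)) / integral\<^sup>L ?M \<zeta>"
      unfolding gS by (rule cSup_least[OF ne]) (use SR[OF _ z] i in \<open>simp add: pos_le_divide_eq\<close>)
    then show ?thesis using i by (simp add: pos_le_divide_eq)
  qed
  show "l \<le> gpe p \<alpha> V \<Omega>" if R: "\<And>\<zeta>. adm p \<Omega> \<zeta> \<Longrightarrow> l * integral\<^sup>L ?M \<zeta> \<le> \<alpha> * energy p \<Omega> \<zeta> + integral\<^sup>L ?M (\<lambda>x. V x * \<zeta> x)"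
  proof (rule field_le_epsilon)
    fix e :: real assume "e > 0"
    then have "l - e \<le> Sup S" by (intro cSup_upper RS R bdd)
    then show "l \<le> gpe p \<alpha> V \<Omega> + e" unfolding gS by simp
  qed
qed

section \<open>Explicit bounds for the energy\<close>

lemma en_young_dual:
  fixes X \<xi> :: "'a::euclidean_space"
  assumes p: "p > 1" and c: "c \<ge> 0" "c = 0 \<Longrightarrow> \<xi> = 0"
  shows "X \<bullet> \<xi> - (p - 1) * norm X powr (p / (p - 1)) * c \<le> en p c \<xi>"
proof (cases "X = 0")
  case True
  then show ?thesis using en_nonneg[OF c(1)] by simp
next
  case False
  define q where "q = p / (p - 1)"
  \<comment> \<open>Inverts the map from \<open>F\<close> to \<open>norm F powr (p - 2)\<close>
    times \<open>F\<close>, so that \<open>X\<close> itself becomes the flux.\<close>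
  define F where "F = (norm X powr (q - 2)) *\<^sub>R X"
  have nX: "norm X > 0" using False by simp
  have nF: "norm F = norm X powr (q - 1)"
  proof -
    have "norm F = norm X powr (q - 2) * norm X" by (simp add: F_def)
    also have "\<dots> = norm X powr (q - 1)" using nX by (simp add: powr_mult_base mult.commute)
    finally show ?thesis .
  qed
  have e1: "(q - 1) * (p - 2) + (q - 2) = 0" "(q - 1) * p = q" using p by (auto simp: q_def field_simps)
  have "norm F powr (p - 2) * (F \<bullet> \<xi>) = (norm X powr ((q - 1) * (p - 2)) * norm X powr (q - 2)) * (X \<bullet> \<xi>)"
    unfolding nF powr_powr by (simp add: F_def)
  also have "norm X powr ((q - 1) * (p - 2)) * norm X powr (q - 2) = norm X powr ((q - 1) * (p - 2) + (q - 2))"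
    by (rule powr_add[symmetric])
  also have "\<dots> = 1" using e1(1) nX by simp
  finally have 1: "norm F powr (p - 2) * (F \<bullet> \<xi>) = X \<bullet> \<xi>" by simp
  have 2: "norm F powr p = norm X powr q" unfolding nF powr_powr e1(2) ..
  show ?thesis using en_young[OF p c, of F] unfolding 1 2 q_def by simp
qed

text \<open>Young's inequality with a vector field, integrated by parts: minus the divergence of
  \<open>X\<close> acts as a potential \<open>d\<close> supplied by the energy, at the price of the
  dual power of its bound.\<close>

lemma energy_lower_bound:
  fixes X :: "'a::euclidean_space \<Rightarrow> 'a" and \<zeta> d :: "'a \<Rightarrow> real"
  assumes p: "p > 1" and Om: "open \<Omega>" and z: "adm p \<Omega> \<zeta>"
    and X: "\<And>x i. i \<in> Basis \<Longrightarrow> ((\<lambda>x. X x \<bullet> i) has_derivative (\<lambda>h. g i x \<bullet> h)) (at x)" "\<And>i. i \<in> Basis \<Longrightarrow> continuous_on UNIV (g i)"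
    and b: "\<And>x. x \<in> \<Omega> \<Longrightarrow> norm (X x) \<le> b"
    and d: "\<And>x. (\<Sum>i\<in>Basis. g i x \<bullet> i) = - d x"
  shows "integrable (lebesgue_on \<Omega>) (\<lambda>x. d x * \<zeta> x)"
    "integral\<^sup>L (lebesgue_on \<Omega>) (\<lambda>x. d x * \<zeta> x) - (p - 1) * b powr (p / (p - 1)) * integral\<^sup>L (lebesgue_on \<Omega>) \<zeta> \<le> energy p \<Omega> \<zeta>"
proof -
  note a = adm_lebesgue_on[OF Om z]
  note I = integration_by_parts_C1c[OF a(4) open_UNIV subset_UNIV X(1) X(2)]
  have deq: "d x * \<zeta> x = - (\<Sum>i\<in>Basis. \<zeta> x * (g i x \<bullet> i))" for x
    using d[of x] by (simp add: sum_distrib_left[symmetric])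
  have Xeq: "X x \<bullet> grad \<zeta> x = (\<Sum>i\<in>Basis. (X x \<bullet> i) * (grad \<zeta> x \<bullet> i))" for x by (rule euclidean_inner)
  have iX: "integrable lborel (\<lambda>x. X x \<bullet> grad \<zeta> x)" unfolding Xeq using I(1) by (intro Bochner_Integration.integrable_sum) auto
  have id: "integrable lborel (\<lambda>x. d x * \<zeta> x)" unfolding deq using I(2) by (intro integrable_minus Bochner_Integration.integrable_sum) auto
  have "integral\<^sup>L lborel (\<lambda>x. X x \<bullet> grad \<zeta> x) = (\<Sum>i\<in>Basis. integral\<^sup>L lborel (\<lambda>x. (X x \<bullet> i) * (grad \<zeta> x \<bullet> i)))"
    unfolding Xeq using I(1) by (intro Bochner_Integration.integral_sum) auto
  also have "\<dots> = (\<Sum>i\<in>Basis. - integral\<^sup>L lborel (\<lambda>x. \<zeta> x * (g i x \<bullet> i)))"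
    by (intro sum.cong refl I(3)) auto
  also have "\<dots> = integral\<^sup>L lborel (\<lambda>x. d x * \<zeta> x)"
    unfolding deq using I(2) by (simp add: sum_negf Bochner_Integration.integral_sum)
  finally have eq: "integral\<^sup>L lborel (\<lambda>x. X x \<bullet> grad \<zeta> x) = integral\<^sup>L lborel (\<lambda>x. d x * \<zeta> x)" .
  have off: "\<zeta> x = 0" "grad \<zeta> x = 0" if "x \<notin> \<Omega>" for x
    using that C1cD(5)[OF a(4)] by (auto intro: zero_off_tsupp grad_zero_off_tsupp)
  have "integrable (lebesgue_on \<Omega>) (\<lambda>x. X x \<bullet> grad \<zeta> x) \<longleftrightarrow> integrable lborel (\<lambda>x. X x \<bullet> grad \<zeta> x)"
    "integral\<^sup>L (lebesgue_on \<Omega>) (\<lambda>x. X x \<bullet> grad \<zeta> x) = integral\<^sup>L lborel (\<lambda>x. X x \<bullet> grad \<zeta> x)"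
    by (rule lebesgue_on_eq_lborel[OF Om]; use iX off in auto)+
  then have X1: "integrable (lebesgue_on \<Omega>) (\<lambda>x. X x \<bullet> grad \<zeta> x)"
    and X2: "integral\<^sup>L (lebesgue_on \<Omega>) (\<lambda>x. X x \<bullet> grad \<zeta> x) = integral\<^sup>L lborel (\<lambda>x. X x \<bullet> grad \<zeta> x)" using iX by auto
  have "integrable (lebesgue_on \<Omega>) (\<lambda>x. d x * \<zeta> x) \<longleftrightarrow> integrable lborel (\<lambda>x. d x * \<zeta> x)"
    "integral\<^sup>L (lebesgue_on \<Omega>) (\<lambda>x. d x * \<zeta> x) = integral\<^sup>L lborel (\<lambda>x. d x * \<zeta> x)"
    by (rule lebesgue_on_eq_lborel[OF Om]; use id off in auto)+
  then show D1: "integrable (lebesgue_on \<Omega>) (\<lambda>x. d x * \<zeta> x)" using id by auto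
  have D2: "integral\<^sup>L (lebesgue_on \<Omega>) (\<lambda>x. d x * \<zeta> x) = integral\<^sup>L lborel (\<lambda>x. d x * \<zeta> x)" by fact
  have "integral\<^sup>L (lebesgue_on \<Omega>) (\<lambda>x. d x * \<zeta> x) - (p - 1) * b powr (p / (p - 1)) * integral\<^sup>L (lebesgue_on \<Omega>) \<zeta>
    = integral\<^sup>L (lebesgue_on \<Omega>) (\<lambda>x. X x \<bullet> grad \<zeta> x - (p - 1) * b powr (p / (p - 1)) * \<zeta> x)"
    using X1 a(3) by (simp add: D2 X2 eq)
  also have "\<dots> \<le> energy p \<Omega> \<zeta>"
  proof (rule integral_mono)
    fix x assume "x \<in> space (lebesgue_on \<Omega>)"
    then have "norm (X x) powr (p / (p - 1)) \<le> b powr (p / (p - 1))" using b[of x] p by (intro powr_mono2) auto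
    then have "(p - 1) * norm (X x) powr (p / (p - 1)) * \<zeta> x \<le> (p - 1) * b powr (p / (p - 1)) * \<zeta> x"
      using p a(5)[of x] by (intro mult_right_mono mult_left_mono) auto
    then show "X x \<bullet> grad \<zeta> x - (p - 1) * b powr (p / (p - 1)) * \<zeta> x \<le> en p (\<zeta> x) (grad \<zeta> x)"
      using en_young_dual[OF p a(5) adm_zero_grad[OF z], of x x "X x"] by linarith
  qed (use X1 a(1,3) in auto)
  finally show "integral\<^sup>L (lebesgue_on \<Omega>) (\<lambda>x. d x * \<zeta> x) - (p - 1) * b powr (p / (p - 1)) * integral\<^sup>L (lebesgue_on \<Omega>) \<zeta> \<le> energy p \<Omega> \<zeta>" .
qed

text \<open>A Poincare inequality. The field points along one coordinate with slope
  \<open>- \<delta>\<close>, so the gain is linear in \<open>\<delta>\<close> while the penalty is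
  of order \<open>\<delta> powr q\<close> with \<open>q > 1\<close>; small \<open>\<delta>\<close>
  wins.\<close>

lemma energy_lower_bound_bounded:
  fixes \<Omega> :: "'a::euclidean_space set"
  assumes p: "p > 1" and Om: "open \<Omega>" "bounded \<Omega>"
  shows "\<exists>\<kappa>>0. \<forall>\<zeta>. adm p \<Omega> \<zeta> \<longrightarrow> \<kappa> * integral\<^sup>L (lebesgue_on \<Omega>) \<zeta> \<le> energy p \<Omega> \<zeta>"
proof -
  obtain i :: 'a where i: "i \<in> Basis" using nonempty_Basis by blast
  obtain R where R: "R > 0" "\<And>x. x \<in> \<Omega> \<Longrightarrow> norm x \<le> R" using Om(2) by (auto simp: bounded_pos)
  define q where "q = p / (p - 1)"
  have q: "q > 1" using p by (simp add: q_def)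
  \<comment> \<open>Solves \<open>(p - 1) * (\<delta> * R) powr q = \<delta> / 2\<close>, so that
    the penalty takes exactly half of the gain.\<close>
  define \<delta> where "\<delta> = (1 / (2 * (p - 1) * R powr q)) powr (1 / (q - 1))"
  have d0: "\<delta> > 0" using p R by (simp add: \<delta>_def)
  have dq: "\<delta> powr (q - 1) = 1 / (2 * (p - 1) * R powr q)" unfolding \<delta>_def powr_powr using q p R by simp
  have dR: "(p - 1) * (\<delta> * R) powr q = \<delta> / 2"
  proof -
    have "\<delta> powr q = \<delta> powr (q - 1) * \<delta>" using d0 by (simp add: powr_diff)
    then show ?thesis using d0 R p by (simp add: powr_mult dq field_simps)
  qed
  have "\<delta> / 2 * integral\<^sup>L (lebesgue_on \<Omega>) \<zeta> \<le> energy p \<Omega> \<zeta>" if z: "adm p \<Omega> \<zeta>" for \<zeta>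
  proof -
    have "integral\<^sup>L (lebesgue_on \<Omega>) (\<lambda>x. \<delta> * \<zeta> x) - (p - 1) * (\<delta> * R) powr (p / (p - 1)) * integral\<^sup>L (lebesgue_on \<Omega>) \<zeta> \<le> energy p \<Omega> \<zeta>"
    proof (rule energy_lower_bound(2)[OF p Om(1) z, where X="\<lambda>x. (- \<delta> * (x \<bullet> i)) *\<^sub>R i" and g="\<lambda>j x. (- \<delta> * (i \<bullet> j)) *\<^sub>R i" and d="\<lambda>_. \<delta>"])
      show "((\<lambda>x. ((- \<delta> * (x \<bullet> i)) *\<^sub>R i) \<bullet> j) has_derivative (\<lambda>h. ((- \<delta> * (i \<bullet> j)) *\<^sub>R i) \<bullet> h)) (at x)" for x j
        by (auto intro!: derivative_eq_intros simp: inner_commute mult_ac)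
      show "norm ((- \<delta> * (x \<bullet> i)) *\<^sub>R i) \<le> \<delta> * R" if "x \<in> \<Omega>" for x
      proof -
        have "\<bar>x \<bullet> i\<bar> \<le> R" using Basis_le_norm[OF i, of x] R(2)[OF that] by linarith
        then show ?thesis using d0 i by (simp add: abs_mult)
      qed
      have "(\<Sum>j\<in>Basis. ((- \<delta> * (i \<bullet> j)) *\<^sub>R i) \<bullet> j) = - \<delta> * (\<Sum>j\<in>Basis. (i \<bullet> j) * (i \<bullet> j))"
        by (simp add: sum_distrib_left mult.assoc sum_negf)
      also have "(\<Sum>j\<in>Basis. (i \<bullet> j) * (i \<bullet> j)) = 1" using euclidean_inner[of i i] i by (simp add: inner_Basis)
      finally show "(\<Sum>j\<in>Basis. ((- \<delta> * (i \<bullet> j)) *\<^sub>R i) \<bullet> j) = - \<delta>" by simp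
    qed auto
    then show ?thesis unfolding q_def[symmetric] dR by (simp add: algebra_simps)
  qed
  then show ?thesis using d0 by (intro exI[of _ "\<delta> / 2"]) auto
qed

text \<open>\<open>D\<close> is the negative divergence of the field \<open>- A x (1 + |x|\<^sup>2)\<^sup>-\<^sup>N\<^sup>/\<^sup>2\<close>, which is bounded by \<open>A\<close>.\<close>
lemma energy_lower_bound_UNIV:
  fixes \<zeta> :: "'a::euclidean_space \<Rightarrow> real"
  assumes p: "p > 1" and A: "A \<ge> 0" and z: "adm p UNIV \<zeta>"
  defines "D \<equiv> \<lambda>x::'a. A * (real DIM('a) * (1 + x \<bullet> x) powr (- real DIM('a) / 2 - 1))"
  shows "integrable (lebesgue_on UNIV) (\<lambda>x. D x * \<zeta> x)"
    "integral\<^sup>L (lebesgue_on UNIV) (\<lambda>x. D x * \<zeta> x) - (p - 1) * A powr (p / (p - 1)) * integral\<^sup>L (lebesgue_on UNIV) \<zeta> \<le> energy p UNIV \<zeta>"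
proof -
  define n where "n = real DIM('a)"
  have n: "n \<ge> 1" unfolding n_def using DIM_positive[where 'a='a] by linarith
  have s: "1 + x \<bullet> x > 0" for x :: 'a by (simp add: add_pos_nonneg)
  define X where "X x = (- A * (1 + x \<bullet> x) powr (- n / 2)) *\<^sub>R x" for x :: 'a
  define g where "g i x = (A * n * (1 + x \<bullet> x) powr (- n / 2 - 1) * (x \<bullet> i)) *\<^sub>R x - (A * (1 + x \<bullet> x) powr (- n / 2)) *\<^sub>R i" for i x :: 'a
  have D1: "((\<lambda>x. X x \<bullet> i) has_derivative (\<lambda>h. g i x \<bullet> h)) (at x)" for x i
  proof -
    have "((\<lambda>y. y powr (- n / 2)) has_real_derivative (- n / 2) * (1 + x \<bullet> x) powr (- n / 2 - 1)) (at (1 + x \<bullet> x))"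
      using s[of x] by (auto intro!: derivative_eq_intros)
    moreover have "((\<lambda>x. 1 + x \<bullet> x) has_derivative (\<lambda>h. 2 * (x \<bullet> h))) (at x)"
      by (auto intro!: derivative_eq_intros simp: inner_commute)
    ultimately have "((\<lambda>x. (1 + x \<bullet> x) powr (- n / 2)) has_derivative (\<lambda>h. 2 * (x \<bullet> h) * ((- n / 2) * (1 + x \<bullet> x) powr (- n / 2 - 1)))) (at x)"
      by (rule DERIV_compose_FDERIV)
    then have "((\<lambda>x. - A * (1 + x \<bullet> x) powr (- n / 2) * (x \<bullet> i)) has_derivative
       (\<lambda>h. - A * (1 + x \<bullet> x) powr (- n / 2) * (h \<bullet> i) + - A * (2 * (x \<bullet> h) * ((- n / 2) * (1 + x \<bullet> x) powr (- n / 2 - 1))) * (x \<bullet> i))) (at x)"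
      by (intro has_derivative_mult has_derivative_mult_right has_derivative_inner_left has_derivative_ident)
    then show ?thesis unfolding X_def g_def
      by (simp add: inner_diff_left inner_commute algebra_simps)
  qed
  have cg: "continuous_on UNIV (g i)" for i unfolding g_def using s
    by (intro continuous_intros) (auto simp: less_imp_neq[symmetric])
  have Xb: "norm (X x) \<le> A" for x
  proof -
    \<comment> \<open>The length is at most the power 1/2 of \<open>1 + x \<bullet> x\<close>, and
      passing to the power \<open>n / 2\<close> is allowed since the base and \<open>n\<close> are
      at least 1; hence the uniform bound \<open>A\<close>.\<close>
    have "norm x = (norm x ^ 2) powr (1/2)" by (simp add: powr_half_sqrt)
    also have "\<dots> \<le> (1 + x \<bullet> x) powr (1/2)" by (intro powr_mono2) (auto simp: power2_norm_eq_inner)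
    also have "\<dots> \<le> (1 + x \<bullet> x) powr (n / 2)" using n by (intro powr_mono) auto
    finally have "(1 + x \<bullet> x) powr (- n / 2) * norm x \<le> (1 + x \<bullet> x) powr (- n / 2) * (1 + x \<bullet> x) powr (n / 2)"
      by (intro mult_left_mono) auto
    also have "\<dots> = 1" using s[of x] by (simp add: powr_add[symmetric])
    finally have "A * ((1 + x \<bullet> x) powr (- n / 2) * norm x) \<le> A * 1" using A by (intro mult_left_mono) auto
    then show ?thesis unfolding X_def using A by (simp add: abs_mult)
  qed
  have dv: "(\<Sum>i\<in>Basis. g i x \<bullet> i) = - D x" for x
  proof -
    \<comment> \<open>The exponent \<open>n / 2\<close> is what cancels the quadratic terms:
      \<open>x \<bullet> x - (1 + x \<bullet> x)\<close> is the constant -1, so the divergence has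
      one sign everywhere.\<close>
    have "(\<Sum>i\<in>Basis. g i x \<bullet> i) = (\<Sum>i\<in>Basis. A * n * (1 + x \<bullet> x) powr (- n / 2 - 1) * ((x \<bullet> i) * (x \<bullet> i)) - A * (1 + x \<bullet> x) powr (- n / 2))"
      unfolding g_def by (intro sum.cong refl) (simp add: inner_diff_left)
    also have "\<dots> = A * n * (1 + x \<bullet> x) powr (- n / 2 - 1) * (x \<bullet> x) - n * (A * (1 + x \<bullet> x) powr (- n / 2))"
      by (simp add: sum_subtractf sum_distrib_left[symmetric] euclidean_inner[of x x, symmetric] n_def)
    also have "(1 + x \<bullet> x) powr (- n / 2) = (1 + x \<bullet> x) powr (- n / 2 - 1) * (1 + x \<bullet> x)"
      using s[of x] by (simp add: powr_diff)
    finally show ?thesis unfolding D_def n_def[symmetric] by (simp add: algebra_simps)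
  qed
  note E = energy_lower_bound[OF p open_UNIV z D1 cg Xb dv]
  show "integrable (lebesgue_on UNIV) (\<lambda>x. D x * \<zeta> x)"
    "integral\<^sup>L (lebesgue_on UNIV) (\<lambda>x. D x * \<zeta> x) - (p - 1) * A powr (p / (p - 1)) * integral\<^sup>L (lebesgue_on UNIV) \<zeta> \<le> energy p UNIV \<zeta>"
    using E by auto
qed

text \<open>Dilating a fixed test function by \<open>1 / \<kappa>\<close> multiplies the ratio of
  energy to mass by \<open>\<kappa> powr p\<close>, and a translation moves the dilated support out
  of the ball of radius \<open>R\<close>.\<close>

lemma adm_far_small_energy:
  fixes R e :: real
  assumes p: "p > 1" and e: "e > 0"
  shows "\<exists>\<zeta>::'a::euclidean_space \<Rightarrow> real. adm p UNIV \<zeta> \<and> integral\<^sup>L (lebesgue_on UNIV) \<zeta> > 0 \<and> (\<forall>x. norm x \<le> R \<longrightarrow> \<zeta> x = 0) \<and>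
     energy p UNIV \<zeta> \<le> e * integral\<^sup>L (lebesgue_on UNIV) \<zeta>"
proof -
  obtain B :: "'a \<Rightarrow> real" where B: "adm p UNIV B" "integral\<^sup>L (lebesgue_on UNIV) B > 0"
    using adm_positive_integral[OF p open_UNIV] by auto
  note a = adm_lebesgue_on[OF open_UNIV B(1)]
  have IB: "integral\<^sup>L lborel B > 0" using B(2) C1c_lebesgue_on(2)[OF open_UNIV a(4)] by simp
  define EB where "EB = integral\<^sup>L lborel (\<lambda>x. en p (B x) (grad B x))"
  have EB0: "EB \<ge> 0" unfolding EB_def using a(5) by (simp add: en_nonneg)
  obtain \<rho> where \<rho>: "\<rho> > 0" "\<And>y. y \<in> tsupp B \<Longrightarrow> norm y \<le> \<rho>"
    using compact_imp_bounded[OF C1cD(4)[OF a(4)]] by (auto simp: bounded_pos)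
  \<comment> \<open>Makes \<open>\<kappa> powr p * EB\<close> at most \<open>e\<close> times the
    mass of \<open>B\<close>; the summand 1 covers vanishing energy.\<close>
  define \<kappa> where "\<kappa> = (e * integral\<^sup>L lborel B / (EB + 1)) powr (1 / p)"
  have k: "\<kappa> > 0" using e IB EB0 by (simp add: \<kappa>_def)
  have kp: "\<kappa> powr p = e * integral\<^sup>L lborel B / (EB + 1)" unfolding \<kappa>_def powr_powr using p e IB EB0 by simp
  obtain i :: 'a where i: "i \<in> Basis" using nonempty_Basis by blast
  \<comment> \<open>If \<open>norm x\<close> is at most \<open>R\<close>, then
    \<open>t + \<kappa> *\<^sub>R x\<close> still has norm above \<open>\<rho>\<close>, outside the
    support of \<open>B\<close>.\<close>
  define t where "t = (\<rho> + \<kappa> * (\<bar>R\<bar> + 1)) *\<^sub>R i"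
  have nt: "norm t = \<rho> + \<kappa> * (\<bar>R\<bar> + 1)" unfolding t_def using i \<rho>(1) k by simp
  define \<zeta> where "\<zeta> x = B (t + \<kappa> *\<^sub>R x)" for x
  have z: "C1c UNIV \<zeta>" "grad \<zeta> = (\<lambda>x. \<kappa> *\<^sub>R grad B (t + \<kappa> *\<^sub>R x))"
    using C1c_affine[OF a(4), of \<kappa> t UNIV] k by (auto simp: \<zeta>_def[abs_def])
  have far: "\<zeta> x = 0" if "norm x \<le> R" for x
  proof -
    have "norm (\<kappa> *\<^sub>R x) \<le> \<kappa> * R" using that k by simp
    moreover have "\<kappa> * R \<le> \<kappa> * \<bar>R\<bar>" using k by simp
    moreover have "\<kappa> * (\<bar>R\<bar> + 1) = \<kappa> * \<bar>R\<bar> + \<kappa>" by (simp add: distrib_left)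
    ultimately have "norm (t + \<kappa> *\<^sub>R x) > \<rho>" using norm_diff_ineq[of t "\<kappa> *\<^sub>R x"] nt k by linarith
    then show ?thesis unfolding \<zeta>_def using \<rho>(2) by (metis zero_off_tsupp not_le)
  qed
  have en\<zeta>: "en p (\<zeta> x) (grad \<zeta> x) = \<kappa> powr p * en p (B (t + \<kappa> *\<^sub>R x)) (grad B (t + \<kappa> *\<^sub>R x))" for x
  proof -
    have "norm ((\<kappa> *\<^sub>R grad B (t + \<kappa> *\<^sub>R x)) /\<^sub>R (p * B (t + \<kappa> *\<^sub>R x))) = \<kappa> * norm (grad B (t + \<kappa> *\<^sub>R x) /\<^sub>R (p * B (t + \<kappa> *\<^sub>R x)))"
      using k by (simp add: abs_mult mult_ac)
    then show ?thesis unfolding en_def z(2) \<zeta>_def using k by (simp only: powr_mult) (simp add: mult_ac)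
  qed
  have mB: "B \<in> borel_measurable borel" "(\<lambda>x. en p (B x) (grad B x)) \<in> borel_measurable borel"
    using C1c_measurable[OF a(4)] by (auto intro!: en_measurable)
  have k0: "\<kappa> \<noteq> 0" using k by simp
  note A1 = integral_lborel_affine[OF mB(1) k0, of t] and A2 = integral_lborel_affine[OF mB(2) k0, of t]
  have iB: "integrable lborel (\<lambda>x. en p (B x) (grad B x))" using B(1) by (simp add: adm_def)
  have adm\<zeta>: "adm p UNIV \<zeta>" unfolding adm_def
    using z(1) a(5) A2(2) iB by (auto simp: en\<zeta>) (simp add: \<zeta>_def)
  define N where "N = DIM('a)"
  have E: "integral\<^sup>L lborel (\<lambda>x. en p (\<zeta> x) (grad \<zeta> x)) * \<kappa> ^ N = \<kappa> powr p * EB"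
    unfolding en\<zeta> EB_def using A2(1) k by (simp add: N_def)
  have I: "integral\<^sup>L lborel \<zeta> * \<kappa> ^ N = integral\<^sup>L lborel B"
    unfolding \<zeta>_def using A1(1) k by (simp add: N_def)
  have kN: "\<kappa> ^ N > 0" using k by simp
  have "integral\<^sup>L lborel \<zeta> > 0" using I IB kN by (metis zero_less_mult_pos2)
  moreover have "integral\<^sup>L lborel (\<lambda>x. en p (\<zeta> x) (grad \<zeta> x)) \<le> e * integral\<^sup>L lborel \<zeta>"
  proof -
    have "\<kappa> powr p * EB \<le> \<kappa> powr p * (EB + 1)" by (intro mult_left_mono) auto
    also have "\<dots> = e * integral\<^sup>L lborel B" unfolding kp using EB0 by simp
    finally have "integral\<^sup>L lborel (\<lambda>x. en p (\<zeta> x) (grad \<zeta> x)) * \<kappa> ^ N \<le> e * integral\<^sup>L lborel \<zeta> * \<kappa> ^ N"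
      unfolding E I[symmetric] by (simp add: mult.assoc)
    then show ?thesis using kN by simp
  qed
  ultimately show ?thesis using adm\<zeta> far C1c_lebesgue_on(2)[OF open_UNIV z(1)] adm_lebesgue_on(2)[OF open_UNIV adm\<zeta>]
    by (intro exI[of _ \<zeta>]) simp
qed

lemma integral_potential_ge:
  fixes V D \<zeta> :: "'a::euclidean_space \<Rightarrow> real"
  assumes Om: "open \<Omega>" and V: "Linf_loc \<Omega> V" and z: "adm p \<Omega> \<zeta>"
    and D: "integrable (lebesgue_on \<Omega>) (\<lambda>x. D x * \<zeta> x)" and le: "AE x in lebesgue. x \<in> \<Omega> \<longrightarrow> c \<le> D x + V x"
  shows "c * integral\<^sup>L (lebesgue_on \<Omega>) \<zeta> \<le> integral\<^sup>L (lebesgue_on \<Omega>) (\<lambda>x. D x * \<zeta> x) + integral\<^sup>L (lebesgue_on \<Omega>) (\<lambda>x. V x * \<zeta> x)"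
proof -
  note a = adm_lebesgue_on[OF Om z]
  have leM: "AE x in lebesgue_on \<Omega>. c \<le> D x + V x" using le Om by (subst AE_lebesgue_on_iff) auto
  have "c * integral\<^sup>L (lebesgue_on \<Omega>) \<zeta> = integral\<^sup>L (lebesgue_on \<Omega>) (\<lambda>x. c * \<zeta> x)" by simp
  also have "\<dots> \<le> integral\<^sup>L (lebesgue_on \<Omega>) (\<lambda>x. D x * \<zeta> x + V x * \<zeta> x)"
  proof (rule integral_mono_AE)
    show "AE x in lebesgue_on \<Omega>. c * \<zeta> x \<le> D x * \<zeta> x + V x * \<zeta> x"
      using leM unfolding distrib_right[symmetric] by eventually_elim (intro mult_right_mono a(5))
  qed (use a(3) a(6)[OF V] D in auto)
  finally show ?thesis using a(6)[OF V] D by simp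
qed

theorem theorem1p5:
  fixes p :: real and \<Omega> :: "'a::euclidean_space set" and V :: "'a \<Rightarrow> real"
  assumes p: "p > 1"
    and dom: "domain \<Omega>"
    and V_loc: "Linf_loc \<Omega> V"
    and V_bdd: "ess_inf_on \<Omega> V > -\<infinity>"
  shows "concave_on {0<..} (\<lambda>\<alpha>. gpe p \<alpha> V \<Omega>)
     \<and> mono_on {0<..} (\<lambda>\<alpha>. gpe p \<alpha> V \<Omega>)
     \<and> ((\<lambda>\<alpha>. ereal (gpe p \<alpha> V \<Omega>)) \<longlongrightarrow> ess_inf_on \<Omega> V) (at_right 0)
     \<and> (smooth_bounded_domain \<Omega> \<longrightarrow> filterlim (\<lambda>\<alpha>. gpe p \<alpha> V \<Omega>) at_top at_top)
     \<and> (\<Omega> = UNIV \<longrightarrow>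
          Limsup at_top (\<lambda>\<alpha>. ereal (gpe p \<alpha> V \<Omega>)) \<le> ess_limsup_inf V
        \<and> Liminf at_top (\<lambda>\<alpha>. ereal (gpe p \<alpha> V \<Omega>)) \<ge> ess_liminf_inf V)"
proof -
  have Om: "open \<Omega>" "\<Omega> \<noteq> {}" using dom by (auto simp: domain_def)
  obtain c0 where c0: "AE x in lebesgue. x \<in> \<Omega> \<longrightarrow> c0 \<le> V x"
    using V_bdd unfolding ess_inf_on_def less_Sup_iff by auto
  let ?I = "\<lambda>\<zeta>. integral\<^sup>L (lebesgue_on \<Omega>) \<zeta>" and ?V = "\<lambda>\<zeta>. integral\<^sup>L (lebesgue_on \<Omega>) (\<lambda>x. V x * \<zeta> x)"
  let ?g = "\<lambda>\<alpha>. gpe p \<alpha> V \<Omega>"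
  note upper = gpe_variational(1)[OF p Om V_loc c0] and lower = gpe_variational(2)[OF p Om V_loc c0]
  have I0: "?I \<zeta> \<ge> 0" and E0: "energy p \<Omega> \<zeta> \<ge> 0" if "adm p \<Omega> \<zeta>" for \<zeta>
    using adm_lebesgue_on(5)[OF Om(1) that] by (simp_all add: en_nonneg)
  have ge: "c * ?I \<zeta> \<le> ?V \<zeta>" if "AE x in lebesgue. x \<in> \<Omega> \<longrightarrow> c \<le> V x" "adm p \<Omega> \<zeta>" for c \<zeta>
    using integral_potential_ge[OF Om(1) V_loc that(2), of "\<lambda>_. 0" c] that(1) by simp

  \<comment> \<open>For fixed \<open>\<zeta>\<close> the Rayleigh bound is affine in
    \<open>\<alpha>\<close> with nonnegative slope, so the best constant is concave and, below,
    nondecreasing.\<close>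
  have conc: "concave_on {0<..} ?g"
    unfolding concave_on_iff
  proof (intro conjI ballI allI impI)
    show cv: "convex {0::real<..}" by (rule convex_real_interval)
    fix x y u v :: real assume xy: "x \<in> {0<..}" "y \<in> {0<..}" and uv: "0 \<le> u" "0 \<le> v" "u + v = 1"
    have pos: "u *\<^sub>R x + v *\<^sub>R y > 0" using convexD[OF cv xy uv] by simp
    show "u * ?g x + v * ?g y \<le> ?g (u *\<^sub>R x + v *\<^sub>R y)"
    proof (rule lower[OF pos])
      fix \<zeta> assume z: "adm p \<Omega> \<zeta>"
      have "u * (?g x * ?I \<zeta>) + v * (?g y * ?I \<zeta>) \<le> u * (x * energy p \<Omega> \<zeta> + ?V \<zeta>) + v * (y * energy p \<Omega> \<zeta> + ?V \<zeta>)"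
        using xy by (intro add_mono mult_left_mono uv upper z) auto
      also have "\<dots> = (u * x + v * y) * energy p \<Omega> \<zeta> + (u + v) * ?V \<zeta>" by (simp add: algebra_simps)
      finally show "(u * ?g x + v * ?g y) * ?I \<zeta> \<le> (u *\<^sub>R x + v *\<^sub>R y) * energy p \<Omega> \<zeta> + ?V \<zeta>"
        unfolding uv(3) by (simp add: algebra_simps)
    qed
  qed

  have mono: "mono_on {0<..} ?g"
  proof (rule mono_onI)
    fix x y :: real assume xy: "x \<in> {0<..}" "y \<in> {0<..}" "x \<le> y"
    show "?g x \<le> ?g y"
    proof (rule lower)
      fix \<zeta> assume z: "adm p \<Omega> \<zeta>"
      have "x * energy p \<Omega> \<zeta> \<le> y * energy p \<Omega> \<zeta>" using xy E0[OF z] by (intro mult_right_mono) auto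
      then show "?g x * ?I \<zeta> \<le> y * energy p \<Omega> \<zeta> + ?V \<zeta>" using upper[OF _ z, of x] xy by simp
    qed (use xy in simp)
  qed

  have lim0: "((\<lambda>\<alpha>. ereal (?g \<alpha>)) \<longlongrightarrow> ess_inf_on \<Omega> V) (at_right 0)"
  proof (rule order_tendstoI)
    fix a assume "a < ess_inf_on \<Omega> V"
    then obtain c where c: "a < ereal c" "AE x in lebesgue. x \<in> \<Omega> \<longrightarrow> c \<le> V x"
      unfolding ess_inf_on_def less_Sup_iff by auto
    have "a < ereal (?g \<alpha>)" if al: "\<alpha> > 0" for \<alpha>
    proof -
      have "c \<le> ?g \<alpha>"
      proof (rule lower[OF al])
        fix \<zeta> assume z: "adm p \<Omega> \<zeta>"
        show "c * ?I \<zeta> \<le> \<alpha> * energy p \<Omega> \<zeta> + ?V \<zeta>" using ge[OF c(2) z] al E0[OF z] by (simp add: add_increasing)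
      qed
      then show ?thesis using c(1) by (meson ereal_less_eq(3) less_le_trans)
    qed
    then show "eventually (\<lambda>\<alpha>. a < ereal (?g \<alpha>)) (at_right 0)" by (auto simp: eventually_at_filter)
  next
    fix a assume "ess_inf_on \<Omega> V < a"
    then obtain c where c: "ess_inf_on \<Omega> V < ereal c" "ereal c < a" using ereal_dense2 by blast
    have "\<not> (AE x in lebesgue. x \<in> \<Omega> \<longrightarrow> c \<le> V x)"
    proof
      assume "AE x in lebesgue. x \<in> \<Omega> \<longrightarrow> c \<le> V x"
      then have "ereal c \<le> ess_inf_on \<Omega> V" unfolding ess_inf_on_def by (intro Sup_upper) auto
      then show False using c(1) by simp
    qed
    \<comment> \<open>Since \<open>V\<close> falls below \<open>c\<close> on a set of positive
      measure, some test function has a weighted mean of \<open>V\<close> below \<open>c\<close>. It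
      stays fixed while \<open>\<alpha>\<close> tends to 0, so its energy, however large, stops
      mattering.\<close>
    then obtain \<zeta> where z: "adm p \<Omega> \<zeta>" "?V \<zeta> < c * ?I \<zeta>"
      using nonneg_if_tested_nonneg[OF p Om(1) V_loc, of c] by (meson not_le)
    have "?I \<zeta> \<noteq> 0"
    proof
      assume "?I \<zeta> = 0"
      then show False using z(2) ge[OF c0 z(1)] by simp
    qed
    then have I: "?I \<zeta> > 0" using I0[OF z(1)] by simp
    have "((\<lambda>\<alpha>. \<alpha> * energy p \<Omega> \<zeta> + ?V \<zeta>) \<longlongrightarrow> 0 * energy p \<Omega> \<zeta> + ?V \<zeta>) (at_right 0)"
      by (intro tendsto_intros)
    then have "eventually (\<lambda>\<alpha>. \<alpha> * energy p \<Omega> \<zeta> + ?V \<zeta> < c * ?I \<zeta>) (at_right 0)"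
      using z(2) by (intro order_tendstoD(2)) auto
    moreover have "eventually (\<lambda>\<alpha>. \<alpha> > 0) (at_right (0::real))" by (rule eventually_at_right_less)
    ultimately show "eventually (\<lambda>\<alpha>. ereal (?g \<alpha>) < a) (at_right 0)"
    proof eventually_elim
      case (elim \<alpha>)
      then have "?g \<alpha> * ?I \<zeta> < c * ?I \<zeta>" using upper[OF elim(2) z(1)] by linarith
      then have "ereal (?g \<alpha>) < ereal c" using I by simp
      then show ?case using c(2) by (rule less_trans)
    qed
  qed

  have bdd: "filterlim ?g at_top at_top" if sb: "smooth_bounded_domain \<Omega>"
  proof -
    have "bounded \<Omega>" using sb by (simp add: smooth_bounded_domain_def)
    from energy_lower_bound_bounded[OF p Om(1) this]
    obtain \<kappa> where k: "\<kappa> > 0" "\<forall>\<zeta>. adm p \<Omega> \<zeta> \<longrightarrow> \<kappa> * ?I \<zeta> \<le> energy p \<Omega> \<zeta>" by blast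
    have "c0 + \<kappa> * \<alpha> \<le> ?g \<alpha>" if al: "\<alpha> > 0" for \<alpha>
    proof (rule lower[OF al])
      fix \<zeta> assume z: "adm p \<Omega> \<zeta>"
      have "\<alpha> * (\<kappa> * ?I \<zeta>) \<le> \<alpha> * energy p \<Omega> \<zeta>" using k(2) z al by simp
      then show "(c0 + \<kappa> * \<alpha>) * ?I \<zeta> \<le> \<alpha> * energy p \<Omega> \<zeta> + ?V \<zeta>" using ge[OF c0 z] by (simp add: algebra_simps)
    qed
    then have ev: "eventually (\<lambda>\<alpha>. c0 + \<kappa> * \<alpha> \<le> ?g \<alpha>) at_top"
      by (rule eventually_mono[OF eventually_gt_at_top[of 0]])
    have "filterlim (\<lambda>\<alpha>. c0 + \<kappa> * \<alpha>) at_top at_top"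
      by (rule filterlim_tendsto_add_at_top[OF tendsto_const filterlim_tendsto_pos_mult_at_top[OF tendsto_const k(1) filterlim_ident]])
    then show ?thesis by (rule filterlim_at_top_mono[OF _ ev])
  qed

  have whole: "Limsup at_top (\<lambda>\<alpha>. ereal (?g \<alpha>)) \<le> ess_limsup_inf V \<and> Liminf at_top (\<lambda>\<alpha>. ereal (?g \<alpha>)) \<ge> ess_liminf_inf V"
    if U: "\<Omega> = UNIV"
  proof
    show "Limsup at_top (\<lambda>\<alpha>. ereal (?g \<alpha>)) \<le> ess_limsup_inf V"
      unfolding Limsup_le_iff
    proof (intro allI impI)
      fix y assume "ess_limsup_inf V < y"
      then obtain R c where c: "ereal c < y" "AE x in lebesgue. norm x > R \<longrightarrow> V x \<le> c"
        unfolding ess_limsup_inf_def ess_sup_on_def INF_less_iff by (auto simp: Inf_less_iff)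
      have "?g \<alpha> \<le> c" if al: "\<alpha> > 0" for \<alpha>
      proof (rule field_le_epsilon)
        fix e :: real assume e: "e > 0"
        then have "e / \<alpha> > 0" using al by simp
        \<comment> \<open>The test function depends on \<open>\<alpha>\<close>: its energy is at
          most \<open>e / \<alpha>\<close> times its mass, so multiplication by
          \<open>\<alpha>\<close> leaves only \<open>e\<close>. Its support avoids the ball where
          \<open>V\<close> may exceed \<open>c\<close>.\<close>
        then obtain \<zeta> :: "'a \<Rightarrow> real" where z: "adm p \<Omega> \<zeta>" "?I \<zeta> > 0" "\<forall>x. norm x \<le> R \<longrightarrow> \<zeta> x = 0"
           "energy p \<Omega> \<zeta> \<le> e / \<alpha> * ?I \<zeta>"
          using adm_far_small_energy[OF p, of "e / \<alpha>" R] unfolding U by blast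
        note a = adm_lebesgue_on[OF Om(1) z(1)]
        have "AE x in lebesgue_on \<Omega>. V x \<le> c \<or> norm x \<le> R"
          using c(2) U by (subst AE_lebesgue_on_iff) (auto elim!: eventually_mono)
        then have "AE x in lebesgue_on \<Omega>. V x * \<zeta> x \<le> c * \<zeta> x"
        proof eventually_elim
          case (elim x)
          then show ?case using z(3) a(5)[of x] by (auto intro: mult_right_mono)
        qed
        then have "?V \<zeta> \<le> integral\<^sup>L (lebesgue_on \<Omega>) (\<lambda>x. c * \<zeta> x)"
          using a(3) a(6)[OF V_loc] by (intro integral_mono_AE) auto
        then have "?V \<zeta> \<le> c * ?I \<zeta>" by simp
        moreover have "\<alpha> * energy p \<Omega> \<zeta> \<le> \<alpha> * (e / \<alpha> * ?I \<zeta>)" by (rule mult_left_mono[OF z(4)]) (use al in simp)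
        moreover have "\<alpha> * (e / \<alpha> * ?I \<zeta>) = e * ?I \<zeta>" using al by simp
        ultimately have "?g \<alpha> * ?I \<zeta> \<le> (c + e) * ?I \<zeta>"
          using upper[OF al z(1)] unfolding distrib_right by linarith
        then show "?g \<alpha> \<le> c + e" using z(2) by simp
      qed
      then have "ereal (?g \<alpha>) < y" if "\<alpha> > 0" for \<alpha> using that c(1) by (meson ereal_less_eq(3) le_less_trans)
      then show "eventually (\<lambda>\<alpha>. ereal (?g \<alpha>) < y) at_top"
        by (rule eventually_mono[OF eventually_gt_at_top[of 0]])
    qed
    show "Liminf at_top (\<lambda>\<alpha>. ereal (?g \<alpha>)) \<ge> ess_liminf_inf V"
      unfolding le_Liminf_iff
    proof (intro allI impI)
      fix y assume "y < ess_liminf_inf V"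
      then obtain R c where c: "y < ereal c" "AE x in lebesgue. norm x > R \<longrightarrow> c \<le> V x"
        unfolding ess_liminf_inf_def ess_inf_on_def less_SUP_iff by (auto simp: less_Sup_iff)
      \<comment> \<open>Room between \<open>y\<close> and \<open>c\<close> for the error that
        vanishes only as \<open>\<alpha>\<close> tends to infinity.\<close>
      obtain m where m: "y < ereal m" "ereal m < ereal c" using ereal_dense2[OF c(1)] by blast
      define q where "q = p / (p - 1)"
      have q: "q > 1" using p by (simp add: q_def)
      define \<gamma> where "\<gamma> = real DIM('a) / 2 + 1"
      have g0: "\<gamma> > 0" unfolding \<gamma>_def by simp
      \<comment> \<open>Inside the ball only \<open>c0 \<le> V x\<close> is known; the amplitude
        lets the artificial potential make up the difference \<open>c - c0\<close> there, where
        \<open>W\<close> is at least \<open>(1 + R\<^sup>2) powr (- \<gamma>)\<close>.\<close>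
      define A where "A = \<bar>c - c0\<bar> * (1 + R\<^sup>2) powr \<gamma>"
      have A: "A \<ge> 0" by (simp add: A_def)
      define W where "W x = real DIM('a) * (1 + x \<bullet> x) powr (- \<gamma>)" for x :: 'a
      have ge\<gamma>: "- real DIM('a) / 2 - 1 = - \<gamma>" by (simp add: \<gamma>_def)
      have AW: "c \<le> A * W x + V x" if "norm x > R \<longrightarrow> c \<le> V x" "c0 \<le> V x" for x
      proof (cases "norm x > R")
        case True
        have "0 \<le> A * W x" using A by (simp add: W_def)
        then show ?thesis using that True by simp
      next
        case False
        then have "x \<bullet> x \<le> R\<^sup>2" using power_mono[of "norm x" R 2] by (simp add: power2_norm_eq_inner)
        then have "(1 + R\<^sup>2) powr (- \<gamma>) \<le> (1 + x \<bullet> x) powr (- \<gamma>)" using g0 by (intro powr_mono2') (auto simp: add_pos_nonneg)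
        also have "\<dots> \<le> W x" unfolding W_def using DIM_positive[where 'a='a] by (simp add: mult_le_cancel_right1)
        finally have "A * (1 + R\<^sup>2) powr (- \<gamma>) \<le> A * W x" using A by (rule mult_left_mono)
        moreover have "A * (1 + R\<^sup>2) powr (- \<gamma>) = \<bar>c - c0\<bar>"
        proof -
          have "1 + R\<^sup>2 > 0" by (simp add: add_pos_nonneg)
          then show ?thesis unfolding A_def by (simp add: mult.assoc powr_add[symmetric])
        qed
        ultimately show ?thesis using that(2) by linarith
      qed
      have AWae: "AE x in lebesgue. x \<in> \<Omega> \<longrightarrow> c \<le> A * W x + V x"
        using c(2) c0
      proof eventually_elim
        case (elim x)
        then show ?case using AW[of x] U by simp
      qed
      \<comment> \<open>The field is used with amplitude \<open>A / \<alpha>\<close>: after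
        multiplication by \<open>\<alpha>\<close> the gained potential \<open>A * W x\<close> no
        longer depends on \<open>\<alpha>\<close>, while the penalty becomes a multiple of
        \<open>\<alpha> powr (1 - q)\<close> and tends to zero because \<open>q > 1\<close>.\<close>
      have step: "c - (p - 1) * A powr q * \<alpha> powr (1 - q) \<le> ?g \<alpha>" if al: "\<alpha> > 0" for \<alpha>
      proof (rule lower[OF al])
        fix \<zeta> assume z: "adm p \<Omega> \<zeta>"
        have Aa: "A / \<alpha> \<ge> 0" using A al by simp
        note E = energy_lower_bound_UNIV[OF p Aa z[unfolded U], unfolded ge\<gamma>, folded W_def q_def U]
        have f: "(\<lambda>x. A * W x * \<zeta> x) = (\<lambda>x. \<alpha> * (A / \<alpha> * W x * \<zeta> x))" by (rule ext) (use al in simp)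
        have Wi: "integrable (lebesgue_on \<Omega>) (\<lambda>x. A * W x * \<zeta> x)"
          unfolding f by (rule integrable_mult_right) (rule E(1))
        have We: "\<alpha> * integral\<^sup>L (lebesgue_on \<Omega>) (\<lambda>x. A / \<alpha> * W x * \<zeta> x) = integral\<^sup>L (lebesgue_on \<Omega>) (\<lambda>x. A * W x * \<zeta> x)"
          unfolding f by (rule integral_mult_right_zero[symmetric])
        have pw: "\<alpha> * ((p - 1) * (A / \<alpha>) powr q) = (p - 1) * A powr q * \<alpha> powr (1 - q)"
        proof -
          have "(A / \<alpha>) powr q = A powr q / \<alpha> powr q" "\<alpha> powr (1 - q) = \<alpha> / \<alpha> powr q"
            using A al by (simp_all add: powr_divide powr_diff)
          then show ?thesis by (simp only:) simp
        qed
        have "\<alpha> * (integral\<^sup>L (lebesgue_on \<Omega>) (\<lambda>x. A / \<alpha> * W x * \<zeta> x) - (p - 1) * (A / \<alpha>) powr q * ?I \<zeta>) \<le> \<alpha> * energy p \<Omega> \<zeta>"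
          by (rule mult_left_mono[OF E(2)]) (use al in simp)
        then have "integral\<^sup>L (lebesgue_on \<Omega>) (\<lambda>x. A * W x * \<zeta> x) - (p - 1) * A powr q * \<alpha> powr (1 - q) * ?I \<zeta> \<le> \<alpha> * energy p \<Omega> \<zeta>"
          unfolding right_diff_distrib We pw[symmetric] by (simp add: mult.assoc)
        moreover have "c * ?I \<zeta> \<le> integral\<^sup>L (lebesgue_on \<Omega>) (\<lambda>x. A * W x * \<zeta> x) + ?V \<zeta>"
          by (rule integral_potential_ge[OF Om(1) V_loc z Wi AWae])
        ultimately show "(c - (p - 1) * A powr q * \<alpha> powr (1 - q)) * ?I \<zeta> \<le> \<alpha> * energy p \<Omega> \<zeta> + ?V \<zeta>"
          unfolding left_diff_distrib by linarith
      qed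
      have "((\<lambda>\<alpha>. c - (p - 1) * A powr q * \<alpha> powr (1 - q)) \<longlongrightarrow> c - (p - 1) * A powr q * 0) at_top"
        using q by (intro tendsto_intros tendsto_neg_powr filterlim_ident) auto
      then have "eventually (\<lambda>\<alpha>. m < c - (p - 1) * A powr q * \<alpha> powr (1 - q)) at_top"
        using m(2) by (intro order_tendstoD(1)) auto
      then show "eventually (\<lambda>\<alpha>. y < ereal (?g \<alpha>)) at_top"
        using eventually_gt_at_top[of "0::real"]
      proof eventually_elim
        case (elim \<alpha>)
        then have "ereal m \<le> ereal (?g \<alpha>)" using step[OF elim(2)] by simp
        then show ?case using m(1) by (rule less_le_trans[rotated])
      qed
    qed
  qed
  show ?thesis using conc mono lim0 bdd whole by blast
qed

end
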